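(* Let $S=\bigoplus_{i,j\in\mathbb Z}S_{(i,j)}$ be a densely bigraded algebra such that $S_0:=\bigoplus_{j\in\mathbb Z}S_{(0,j)}$ is a noetherian algebra, and $S_i:=\bigoplus_{j\in\mathbb Z}S_{(i,j)}$ is finitely generated both as a graded left $S_0$-module and as a graded right $S_0$-module for every $i\in\mathbb Z$. Then the natural functor $(-)_0:\mathsf{BiGrMod}\,S\to\mathsf{GrMod}\,S_0$, $M\mapsto M_0$, induces the following equivalences of abelian categories: $$(-)_0:\mathsf{QBiGr}_{\mathsf L}\,S\xrightarrow{\ \cong\ }\mathsf{QGr}\,S_0\quad\text{and}\quad(-)_0:\mathsf{qlbigr}_{\mathsf l}\,S\xrightarrow{\ \cong\ }\mathsf{qgr}\,S_0.$$
   Context: Throughout, $k$ is an algebraically closed field of characteristic $0$; all algebras (associative, unital) are over $k$. Noetherian means right and left noetherian. For a $\mathbb Z\times\mathbb Z$-bigraded algebra $S=\bigoplus_{i,j}S_{(i,j)}$ put $S_i=\bigoplus_j S_{(i,j)}$, so $S=\bigoplus_i S_i$ is a $\mathbb Z$-graded algebra. $S$ is densely bigraded if this $\mathbb Z$-graded algebra is densely graded, i.e. $\dim_k(S_n/S_iS_{n-i})<\infty$ for all $n,i\in\mathbb Z$. $S_0$ is regarded as a $\mathbb Z$-graded algebra with degree $j$ component $S_{(0,j)}$. $\mathsf{BiGrMod}\,S$ is the category of bigraded right $S$-modules $M=\bigoplus_{i,j}M_{(i,j)}$ with morphisms the $S$-module homomorphisms preserving bidegree; $M_i:=\bigoplus_j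 M_{(i,j)}$, a graded right $S_0$-module. $\mathsf{lbigrmod}\,S$ is the full subcategory of those $M$ such that $M_i$ is a finitely generated graded right $S_0$-module for every $i$. A homogeneous element $x$ of $M$ is locally torsion if $xS_0$ is finite dimensional; $M$ is locally torsion if all its homogeneous elements are. $\mathsf{BiLTors}\,S$ (resp. $\mathsf{lbiltors}\,S$) is the full (Serre) subcategory of locally torsion objects of $\mathsf{BiGrMod}\,S$ (resp. $\mathsf{lbigrmod}\,S$). Put $\mathsf{QBiGr}_{\mathsf L}\,S:=\mathsf{BiGrMod}\,S/\mathsf{BiLTors}\,S$ and $\mathsf{qlbigr}_{\mathsf l}\,S:=\mathsf{lbigrmod}\,S/\mathsf{lbiltors}\,S$. For a noetherian $\mathbb Z$-graded algebra $R$, $\mathsf{GrMod}\,R$ (resp. $\mathsf{grmod}\,R$) is the category of (resp. finitely generated) graded right $R$-modules with degree zero homomorphisms; a graded module $M$ is torsion if $\dim_k xR<\infty$ for every homogeneous $x\in M$; $\mathsf{Tors}\,R$ and $\mathsf{tors}\,R$ are the full subcategories of torsion modules in $\mathsf{GrMod}\,R$ and $\mathsf{grmod}\,R$; $\mathsf{QGr}\,R=\mathsf{GrMod}\,R/\mathsf{Tors}\,R$ and $\mathsf{qgr}\,R=\mathsf{grmod}\,R/\mathsf{tors}\,R$. *)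

theory Defs
  imports "HOL-Algebra.Algebra" "HOL-Library.Product_Plus"
begin

section \<open>Categories\<close>

text \<open>\<open>Cmp C V Y Z g f\<close> is the composite of \<open>f : V \<rightarrow> Y\<close> and \<open>g : Y \<rightarrow> Z\<close>. Objects are passed
  explicitly because hom-sets of different pairs of objects need not be disjoint.\<close>

record ('o, 'f) category =
  Ob :: "'o set"
  Mor :: "'o \<Rightarrow> 'o \<Rightarrow> 'f set"
  Idn :: "'o \<Rightarrow> 'f"
  Cmp :: "'o \<Rightarrow> 'o \<Rightarrow> 'o \<Rightarrow> 'f \<Rightarrow> 'f \<Rightarrow> 'f"

definition is_category :: "('o, 'f) category \<Rightarrow> bool" where
  "is_category C \<longleftrightarrow>
     (\<forall>V\<in>Ob C. Idn C V \<in> Mor C V V) \<and>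
     (\<forall>V\<in>Ob C. \<forall>Y\<in>Ob C. \<forall>Z\<in>Ob C. \<forall>f\<in>Mor C V Y. \<forall>g\<in>Mor C Y Z. Cmp C V Y Z g f \<in> Mor C V Z) \<and>
     (\<forall>V\<in>Ob C. \<forall>Y\<in>Ob C. \<forall>f\<in>Mor C V Y.
        Cmp C V V Y f (Idn C V) = f \<and> Cmp C V Y Y (Idn C Y) f = f) \<and>
     (\<forall>W\<in>Ob C. \<forall>V\<in>Ob C. \<forall>Y\<in>Ob C. \<forall>Z\<in>Ob C.
        \<forall>f\<in>Mor C W V. \<forall>g\<in>Mor C V Y. \<forall>h\<in>Mor C Y Z.
          Cmp C W Y Z h (Cmp C W V Y g f) = Cmp C W V Z (Cmp C V Y Z h g) f)"

definition op_cat :: "('o, 'f) category \<Rightarrow> ('o, 'f) category" where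
  "op_cat C = \<lparr>Ob = Ob C, Mor = (\<lambda>V Y. Mor C Y V), Idn = Idn C,
     Cmp = (\<lambda>V Y Z g f. Cmp C Z Y V f g)\<rparr>"

definition is_zero_obj :: "('o, 'f) category \<Rightarrow> 'o \<Rightarrow> bool" where
  "is_zero_obj C Z \<longleftrightarrow> Z \<in> Ob C \<and>
     (\<forall>V\<in>Ob C. (\<exists>!f. f \<in> Mor C V Z) \<and> (\<exists>!f. f \<in> Mor C Z V))"

definition is_zero_mor :: "('o, 'f) category \<Rightarrow> 'o \<Rightarrow> 'o \<Rightarrow> 'f \<Rightarrow> bool" where
  "is_zero_mor C V Y f \<longleftrightarrow>
     (\<exists>Z. is_zero_obj C Z \<and> (\<exists>g\<in>Mor C V Z. \<exists>h\<in>Mor C Z Y. f = Cmp C V Z Y h g))"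

definition is_mono :: "('o, 'f) category \<Rightarrow> 'o \<Rightarrow> 'o \<Rightarrow> 'f \<Rightarrow> bool" where
  "is_mono C V Y f \<longleftrightarrow> f \<in> Mor C V Y \<and>
     (\<forall>W\<in>Ob C. \<forall>g\<in>Mor C W V. \<forall>h\<in>Mor C W V. Cmp C W V Y f g = Cmp C W V Y f h \<longrightarrow> g = h)"

definition is_kernel :: "('o, 'f) category \<Rightarrow> 'o \<Rightarrow> 'o \<Rightarrow> 'f \<Rightarrow> 'o \<Rightarrow> 'f \<Rightarrow> bool" where
  "is_kernel C V Y f N i \<longleftrightarrow> N \<in> Ob C \<and> i \<in> Mor C N V \<and> is_zero_mor C N Y (Cmp C N V Y f i) \<and>
     (\<forall>W\<in>Ob C. \<forall>h\<in>Mor C W V. is_zero_mor C W Y (Cmp C W V Y f h) \<longrightarrow>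
        (\<exists>!u. u \<in> Mor C W N \<and> Cmp C W N V i u = h))"

definition has_kernels :: "('o, 'f) category \<Rightarrow> bool" where
  "has_kernels C \<longleftrightarrow> (\<forall>V\<in>Ob C. \<forall>Y\<in>Ob C. \<forall>f\<in>Mor C V Y. \<exists>N i. is_kernel C V Y f N i)"

definition has_binary_products :: "('o, 'f) category \<Rightarrow> bool" where
  "has_binary_products C \<longleftrightarrow> (\<forall>V\<in>Ob C. \<forall>Y\<in>Ob C. \<exists>P\<in>Ob C. \<exists>p\<in>Mor C P V. \<exists>q\<in>Mor C P Y.
     \<forall>W\<in>Ob C. \<forall>f\<in>Mor C W V. \<forall>g\<in>Mor C W Y.
       \<exists>!u. u \<in> Mor C W P \<and> Cmp C W P V p u = f \<and> Cmp C W P Y q u = g)"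

definition monos_are_kernels :: "('o, 'f) category \<Rightarrow> bool" where
  "monos_are_kernels C \<longleftrightarrow> (\<forall>V\<in>Ob C. \<forall>Y\<in>Ob C. \<forall>i. is_mono C V Y i \<longrightarrow>
     (\<exists>Z\<in>Ob C. \<exists>f\<in>Mor C Y Z. is_kernel C Y Z f V i))"

text \<open>Abelian categories in Freyd's formulation. Cokernels, coproducts and epimorphisms are kernels,
  products and monomorphisms of the opposite category. The additive structure on the hom-sets is
  determined by the category, so being abelian is a property and equivalences automatically respect
  addition and exactness.\<close>

definition is_abelian :: "('o, 'f) category \<Rightarrow> bool" where
  "is_abelian C \<longleftrightarrow> is_category C \<and> (\<exists>Z. is_zero_obj C Z) \<and>
     has_binary_products C \<and> has_binary_products (op_cat C) \<and>
     has_kernels C \<and> has_kernels (op_cat C) \<and>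
     monos_are_kernels C \<and> monos_are_kernels (op_cat C)"

definition is_functor ::
  "('o, 'f) category \<Rightarrow> ('p, 'g) category \<Rightarrow> ('o \<Rightarrow> 'p) \<Rightarrow> ('o \<Rightarrow> 'o \<Rightarrow> 'f \<Rightarrow> 'g) \<Rightarrow> bool" where
  "is_functor C D Fo Fm \<longleftrightarrow> is_category C \<and> is_category D \<and>
     (\<forall>V\<in>Ob C. Fo V \<in> Ob D) \<and>
     (\<forall>V\<in>Ob C. \<forall>Y\<in>Ob C. \<forall>f\<in>Mor C V Y. Fm V Y f \<in> Mor D (Fo V) (Fo Y)) \<and>
     (\<forall>V\<in>Ob C. Fm V V (Idn C V) = Idn D (Fo V)) \<and>
     (\<forall>V\<in>Ob C. \<forall>Y\<in>Ob C. \<forall>Z\<in>Ob C. \<forall>f\<in>Mor C V Y. \<forall>g\<in>Mor C Y Z.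
        Fm V Z (Cmp C V Y Z g f) = Cmp D (Fo V) (Fo Y) (Fo Z) (Fm Y Z g) (Fm V Y f))"

definition is_iso :: "('o, 'f) category \<Rightarrow> 'o \<Rightarrow> 'o \<Rightarrow> 'f \<Rightarrow> bool" where
  "is_iso C V Y f \<longleftrightarrow> f \<in> Mor C V Y \<and>
     (\<exists>g\<in>Mor C Y V. Cmp C V Y V g f = Idn C V \<and> Cmp C Y V Y f g = Idn C Y)"

definition nat_isomorphic ::
  "('o, 'f) category \<Rightarrow> ('p, 'g) category \<Rightarrow> ('o \<Rightarrow> 'p) \<Rightarrow> ('o \<Rightarrow> 'o \<Rightarrow> 'f \<Rightarrow> 'g) \<Rightarrow>
     ('o \<Rightarrow> 'p) \<Rightarrow> ('o \<Rightarrow> 'o \<Rightarrow> 'f \<Rightarrow> 'g) \<Rightarrow> bool" where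
  "nat_isomorphic C D Fo Fm Go Gm \<longleftrightarrow> (\<exists>\<eta>.
     (\<forall>V\<in>Ob C. is_iso D (Fo V) (Go V) (\<eta> V)) \<and>
     (\<forall>V\<in>Ob C. \<forall>Y\<in>Ob C. \<forall>f\<in>Mor C V Y.
        Cmp D (Fo V) (Fo Y) (Go Y) (\<eta> Y) (Fm V Y f) = Cmp D (Fo V) (Go V) (Go Y) (Gm V Y f) (\<eta> V)))"

definition is_equivalence ::
  "('o, 'f) category \<Rightarrow> ('p, 'g) category \<Rightarrow> ('o \<Rightarrow> 'p) \<Rightarrow> ('o \<Rightarrow> 'o \<Rightarrow> 'f \<Rightarrow> 'g) \<Rightarrow> bool" where
  "is_equivalence C D Fo Fm \<longleftrightarrow> is_functor C D Fo Fm \<and>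
     (\<exists>Go Gm. is_functor D C Go Gm \<and>
        nat_isomorphic C C (\<lambda>V. Go (Fo V)) (\<lambda>V Y f. Gm (Fo V) (Fo Y) (Fm V Y f)) (\<lambda>V. V) (\<lambda>V Y f. f) \<and>
        nat_isomorphic D D (\<lambda>V. Fo (Go V)) (\<lambda>V Y f. Fm (Go V) (Go Y) (Gm V Y f)) (\<lambda>V. V) (\<lambda>V Y f. f))"

text \<open>\<open>QA\<close> and \<open>QB\<close> are quotients of \<open>A\<close> and \<open>B\<close> with the same objects; \<open>pA\<close> and \<open>pB\<close> are the
  morphism parts of the quotient functors.\<close>

definition induces_abelian_equivalence ::
  "('o, 'f) category \<Rightarrow> ('p, 'g) category \<Rightarrow> ('o \<Rightarrow> 'p) \<Rightarrow> ('o \<Rightarrow> 'o \<Rightarrow> 'f \<Rightarrow> 'g) \<Rightarrow>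
     ('o, 'u) category \<Rightarrow> ('o \<Rightarrow> 'o \<Rightarrow> 'f \<Rightarrow> 'u) \<Rightarrow>
     ('p, 'v) category \<Rightarrow> ('p \<Rightarrow> 'p \<Rightarrow> 'g \<Rightarrow> 'v) \<Rightarrow> bool" where
  "induces_abelian_equivalence A B Fo Fm QA pA QB pB \<longleftrightarrow>
     is_functor A B Fo Fm \<and> is_functor A QA (\<lambda>V. V) pA \<and> is_functor B QB (\<lambda>V. V) pB \<and>
     is_abelian QA \<and> is_abelian QB \<and>
     (\<exists>\<Phi>. is_equivalence QA QB Fo \<Phi> \<and>
        (\<forall>V\<in>Ob A. \<forall>Y\<in>Ob A. \<forall>f\<in>Mor A V Y. \<Phi> V Y (pA V Y f) = pB (Fo V) (Fo Y) (Fm V Y f)))"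


section \<open>Spans, finite generation and finite dimension\<close>

text \<open>The set of finite sums of elements \<open>sc c b\<close> with \<open>c \<in> C\<close> and \<open>b \<in> B\<close>, for \<open>C\<close> closed under
  addition and \<open>sc\<close> biadditive.\<close>

definition span_by :: "'c set \<Rightarrow> ('b, 'z) ring_scheme \<Rightarrow> ('c \<Rightarrow> 'b \<Rightarrow> 'b) \<Rightarrow> 'b set \<Rightarrow> 'b set" where
  "span_by C G sc B =
     {(\<Oplus>\<^bsub>G\<^esub>b\<in>T. sc (c b) b) | T c. finite T \<and> T \<subseteq> B \<and> c \<in> T \<rightarrow> C}"

definition fin_gen :: "'c set \<Rightarrow> ('b, 'z) ring_scheme \<Rightarrow> ('c \<Rightarrow> 'b \<Rightarrow> 'b) \<Rightarrow> 'b set \<Rightarrow> bool" where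
  "fin_gen C G sc V \<longleftrightarrow> (\<exists>B. finite B \<and> B \<subseteq> V \<and> V = span_by C G sc B)"

text \<open>The quotient of \<open>V\<close> by its subspace \<open>W\<close> is spanned by finitely many classes.\<close>

definition fin_codim ::
  "'c set \<Rightarrow> ('b, 'z) ring_scheme \<Rightarrow> ('c \<Rightarrow> 'b \<Rightarrow> 'b) \<Rightarrow> 'b set \<Rightarrow> 'b set \<Rightarrow> bool" where
  "fin_codim C G sc V W \<longleftrightarrow> (\<exists>B. finite B \<and> B \<subseteq> V \<and> V = W <+>\<^bsub>G\<^esub> span_by C G sc B)"

text \<open>The sum of a family of additive subgroups.\<close>

definition sum_of :: "('b, 'z) ring_scheme \<Rightarrow> ('j \<Rightarrow> 'b set) \<Rightarrow> 'b set" where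
  "sum_of G D = {(\<Oplus>\<^bsub>G\<^esub>j\<in>J. f j) | J f. finite J \<and> f \<in> Pi J D}"

definition direct_sum_decomp :: "('b, 'z) ring_scheme \<Rightarrow> ('g \<Rightarrow> 'b set) \<Rightarrow> bool" where
  "direct_sum_decomp G D \<longleftrightarrow> (\<forall>g. additive_subgroup (D g) G) \<and>
     (\<forall>x\<in>carrier G. \<exists>!f. (\<forall>g. f g \<in> D g) \<and> finite {g. f g \<noteq> \<zero>\<^bsub>G\<^esub>} \<and>
        x = (\<Oplus>\<^bsub>G\<^esub>g\<in>{g. f g \<noteq> \<zero>\<^bsub>G\<^esub>}. f g))"


section \<open>Graded algebras\<close>

text \<open>The scalar multiplication of the base field is the field \<open>smult\<close> of the record \<open>module\<close>.\<close>

record ('k, 'g, 'a) graded_alg = "('k, 'a) module" +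
  acomp :: "'g \<Rightarrow> 'a set"

definition graded_algebra ::
  "'k ring \<Rightarrow> ('k, 'g::ab_group_add, 'a) graded_alg \<Rightarrow> bool" where
  "graded_algebra K S \<longleftrightarrow> ring S \<and> Module.module K S \<and>
     (\<forall>c\<in>carrier K. \<forall>x\<in>carrier S. \<forall>y\<in>carrier S.
        c \<odot>\<^bsub>S\<^esub> (x \<otimes>\<^bsub>S\<^esub> y) = (c \<odot>\<^bsub>S\<^esub> x) \<otimes>\<^bsub>S\<^esub> y \<and> c \<odot>\<^bsub>S\<^esub> (x \<otimes>\<^bsub>S\<^esub> y) = x \<otimes>\<^bsub>S\<^esub> (c \<odot>\<^bsub>S\<^esub> y)) \<and>
     direct_sum_decomp S (acomp S) \<and>
     (\<forall>g. \<forall>c\<in>carrier K. \<forall>x\<in>acomp S g. c \<odot>\<^bsub>S\<^esub> x \<in> acomp S g) \<and>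
     \<one>\<^bsub>S\<^esub> \<in> acomp S 0 \<and>
     (\<forall>g h. \<forall>x\<in>acomp S g. \<forall>y\<in>acomp S h. x \<otimes>\<^bsub>S\<^esub> y \<in> acomp S (g + h))"

text \<open>\<open>row S i\<close> is \<open>S\<^sub>i\<close>, the sum of the components of bidegree \<open>(i, j)\<close> over all \<open>j\<close>;
  \<open>deg0_alg S\<close> is the graded algebra \<open>S\<^sub>0\<close>.\<close>

definition row :: "('k, int \<times> int, 'a) graded_alg \<Rightarrow> int \<Rightarrow> 'a set" where
  "row S i = sum_of S (\<lambda>j. acomp S (i, j))"

definition deg0_alg :: "('k, int \<times> int, 'a) graded_alg \<Rightarrow> ('k, int, 'a) graded_alg" where
  "deg0_alg S = \<lparr>carrier = row S 0, monoid.mult = monoid.mult S, one = one S, ring.zero = ring.zero S, add = add S,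
     smult = smult S, acomp = (\<lambda>j. acomp S (0, j))\<rparr>"

text \<open>For all integers \<open>n\<close> and \<open>i\<close>, the product of \<open>S\<^sub>i\<close> and \<open>S\<^sub>n\<^sub>-\<^sub>i\<close> (finite sums of
  products) has finite codimension in \<open>S\<^sub>n\<close>.\<close>

definition densely_bigraded :: "'k ring \<Rightarrow> ('k, int \<times> int, 'a) graded_alg \<Rightarrow> bool" where
  "densely_bigraded K S \<longleftrightarrow> (\<forall>n i. fin_codim (carrier K) S (\<lambda>c x. c \<odot>\<^bsub>S\<^esub> x)
     (row S n) (span_by (row S i) S (\<lambda>x y. x \<otimes>\<^bsub>S\<^esub> y) (row S (n - i))))"

text \<open>The library only has noetherianity for two-sided ideals. Here all one-sided ideals,
  homogeneous or not, are finitely generated.\<close>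

definition right_noetherian :: "('a, 'z) ring_scheme \<Rightarrow> bool" where
  "right_noetherian R \<longleftrightarrow> (\<forall>I. additive_subgroup I R \<and> (\<forall>x\<in>I. \<forall>r\<in>carrier R. x \<otimes>\<^bsub>R\<^esub> r \<in> I) \<longrightarrow>
     fin_gen (carrier R) R (\<lambda>r x. x \<otimes>\<^bsub>R\<^esub> r) I)"

definition left_noetherian :: "('a, 'z) ring_scheme \<Rightarrow> bool" where
  "left_noetherian R \<longleftrightarrow> (\<forall>I. additive_subgroup I R \<and> (\<forall>x\<in>I. \<forall>r\<in>carrier R. r \<otimes>\<^bsub>R\<^esub> x \<in> I) \<longrightarrow>
     fin_gen (carrier R) R (\<lambda>r x. r \<otimes>\<^bsub>R\<^esub> x) I)"


section \<open>Graded right modules\<close>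

text \<open>Only the additive structure of the underlying \<open>ring\<close> record is used; \<open>mult\<close> and \<open>one\<close> are
  irrelevant, as in the library's record \<open>module\<close>.\<close>

record ('g, 'a, 'm) graded_mod = "'m ring" +
  ract :: "'m \<Rightarrow> 'a \<Rightarrow> 'm" (infixl \<open>\<bullet>\<index>\<close> 70)
  mcomp :: "'g \<Rightarrow> 'm set"

definition graded_module ::
  "('k, 'g::ab_group_add, 'a) graded_alg \<Rightarrow> ('g, 'a, 'm) graded_mod \<Rightarrow> bool" where
  "graded_module S M \<longleftrightarrow> abelian_group M \<and>
     (\<forall>x\<in>carrier M. \<forall>s\<in>carrier S. x \<bullet>\<^bsub>M\<^esub> s \<in> carrier M) \<and>
     (\<forall>x\<in>carrier M. x \<bullet>\<^bsub>M\<^esub> \<one>\<^bsub>S\<^esub> = x) \<and>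
     (\<forall>x\<in>carrier M. \<forall>s\<in>carrier S. \<forall>t\<in>carrier S. x \<bullet>\<^bsub>M\<^esub> (s \<otimes>\<^bsub>S\<^esub> t) = x \<bullet>\<^bsub>M\<^esub> s \<bullet>\<^bsub>M\<^esub> t) \<and>
     (\<forall>x\<in>carrier M. \<forall>s\<in>carrier S. \<forall>t\<in>carrier S.
        x \<bullet>\<^bsub>M\<^esub> (s \<oplus>\<^bsub>S\<^esub> t) = x \<bullet>\<^bsub>M\<^esub> s \<oplus>\<^bsub>M\<^esub> x \<bullet>\<^bsub>M\<^esub> t) \<and>
     (\<forall>x\<in>carrier M. \<forall>y\<in>carrier M. \<forall>s\<in>carrier S.
        (x \<oplus>\<^bsub>M\<^esub> y) \<bullet>\<^bsub>M\<^esub> s = x \<bullet>\<^bsub>M\<^esub> s \<oplus>\<^bsub>M\<^esub> y \<bullet>\<^bsub>M\<^esub> s) \<and>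
     direct_sum_decomp M (mcomp M) \<and>
     (\<forall>g h. \<forall>x\<in>mcomp M g. \<forall>s\<in>acomp S h. x \<bullet>\<^bsub>M\<^esub> s \<in> mcomp M (g + h))"

text \<open>Homomorphisms are extensional functions, so that equality of functions is equality of
  morphisms. The carrier types of the two modules may differ.\<close>

definition graded_hom ::
  "('k, 'g, 'a) graded_alg \<Rightarrow> ('g, 'a, 'm) graded_mod \<Rightarrow> ('g, 'a, 'n) graded_mod \<Rightarrow> ('m \<Rightarrow> 'n) set" where
  "graded_hom S M N = {f \<in> carrier M \<rightarrow>\<^sub>E carrier N.
     (\<forall>x\<in>carrier M. \<forall>y\<in>carrier M. f (x \<oplus>\<^bsub>M\<^esub> y) = f x \<oplus>\<^bsub>N\<^esub> f y) \<and>
     (\<forall>x\<in>carrier M. \<forall>s\<in>carrier S. f (x \<bullet>\<^bsub>M\<^esub> s) = f x \<bullet>\<^bsub>N\<^esub> s) \<and>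
     (\<forall>g. f ` mcomp M g \<subseteq> mcomp N g)}"

definition graded_isomorphic ::
  "('k, 'g, 'a) graded_alg \<Rightarrow> ('g, 'a, 'm) graded_mod \<Rightarrow> ('g, 'a, 'n) graded_mod \<Rightarrow> bool" where
  "graded_isomorphic S M N \<longleftrightarrow> (\<exists>f\<in>graded_hom S M N. bij_betw f (carrier M) (carrier N))"

definition graded_submodule ::
  "('k, 'g, 'a) graded_alg \<Rightarrow> ('g, 'a, 'm) graded_mod \<Rightarrow> 'm set \<Rightarrow> bool" where
  "graded_submodule S M U \<longleftrightarrow> additive_subgroup U M \<and>
     (\<forall>x\<in>U. \<forall>s\<in>carrier S. x \<bullet>\<^bsub>M\<^esub> s \<in> U) \<and> U = sum_of M (\<lambda>g. U \<inter> mcomp M g)"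

definition sub_mod :: "('g, 'a, 'm) graded_mod \<Rightarrow> 'm set \<Rightarrow> ('g, 'a, 'm) graded_mod" where
  "sub_mod M U = M\<lparr>carrier := U, mcomp := (\<lambda>g. U \<inter> mcomp M g)\<rparr>"

definition quot_mod :: "('g, 'a, 'm) graded_mod \<Rightarrow> 'm set \<Rightarrow> ('g, 'a, 'm set) graded_mod" where
  "quot_mod M U = \<lparr>carrier = a_rcosets\<^bsub>M\<^esub> U, monoid.mult = undefined, one = undefined,
     ring.zero = U, add = (\<lambda>V Y. V <+>\<^bsub>M\<^esub> Y),
     ract = (\<lambda>V s. \<Union>x\<in>V. U +>\<^bsub>M\<^esub> (x \<bullet>\<^bsub>M\<^esub> s)),
     mcomp = (\<lambda>g. (\<lambda>x. U +>\<^bsub>M\<^esub> x) ` mcomp M g)\<rparr>"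

definition fg_module :: "('k, 'g, 'a) graded_alg \<Rightarrow> ('g, 'a, 'm) graded_mod \<Rightarrow> bool" where
  "fg_module S M \<longleftrightarrow> fin_gen (carrier S) M (\<lambda>s x. x \<bullet>\<^bsub>M\<^esub> s) (carrier M)"

text \<open>For every homogeneous \<open>x\<close> the set of all \<open>x s\<close> with \<open>s \<in> C\<close> is finite-dimensional; the base
  field acts on \<open>M\<close> through its image in \<open>S\<close>.\<close>

definition torsion_wrt ::
  "'k ring \<Rightarrow> ('k, 'g, 'a) graded_alg \<Rightarrow> 'a set \<Rightarrow> ('g, 'a, 'm) graded_mod \<Rightarrow> bool" where
  "torsion_wrt K S C M \<longleftrightarrow> (\<forall>g. \<forall>x\<in>mcomp M g.
     fin_gen (carrier K) M (\<lambda>c y. y \<bullet>\<^bsub>M\<^esub> (c \<odot>\<^bsub>S\<^esub> \<one>\<^bsub>S\<^esub>)) ((\<lambda>s. x \<bullet>\<^bsub>M\<^esub> s) ` C))"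

text \<open>\<open>mod_row M i\<close> is the graded right \<open>S\<^sub>0\<close>-module \<open>M\<^sub>i\<close>.\<close>

definition mod_row :: "(int \<times> int, 'a, 'm) graded_mod \<Rightarrow> int \<Rightarrow> (int, 'a, 'm) graded_mod" where
  "mod_row M i = \<lparr>carrier = sum_of M (\<lambda>j. mcomp M (i, j)), monoid.mult = monoid.mult M, one = one M,
     ring.zero = ring.zero M, add = add M, ract = ract M, mcomp = (\<lambda>j. mcomp M (i, j))\<rparr>"

text \<open>The functor \<open>M \<mapsto> M\<^sub>0\<close> on morphisms.\<close>

definition mor_row0 ::
  "(int \<times> int, 'a, 'm) graded_mod \<Rightarrow> (int \<times> int, 'a, 'm) graded_mod \<Rightarrow> ('m \<Rightarrow> 'm) \<Rightarrow> 'm \<Rightarrow> 'm" where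
  "mor_row0 M N f = restrict f (carrier (mod_row M 0))"


section \<open>Categories of graded modules and their Serre quotients\<close>

text \<open>The full subcategory, on a class \<open>\<A>\<close> of objects, of the category of graded right
  \<open>S\<close>-modules. The carriers of the objects are subsets of the type \<open>'m\<close>, which acts as the
  universe. If \<open>S\<close> embeds into \<open>'m\<close> and \<open>'m\<close> is infinite, these are, up to isomorphism, all modules
  of cardinality at most that of \<open>'m\<close>; they are closed under submodules, quotients and
  extensions.\<close>

definition mod_cat ::
  "('k, 'g, 'a) graded_alg \<Rightarrow> ('g, 'a, 'm) graded_mod set \<Rightarrow>
     (('g, 'a, 'm) graded_mod, 'm \<Rightarrow> 'm) category" where
  "mod_cat S \<A> = \<lparr>Ob = \<A>, Mor = graded_hom S, Idn = (\<lambda>M. \<lambda>x\<in>carrier M. x),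
     Cmp = (\<lambda>M N P g f. compose (carrier M) g f)\<rparr>"

text \<open>Gabriel's construction of the quotient of \<open>\<A>\<close> by a Serre subcategory \<open>\<T>\<close>:
  the objects are those of \<open>\<A>\<close>, and the morphisms \<open>M \<rightarrow> N\<close> are the elements of the directed colimit
  of \<open>Hom(U, N/W)\<close>, where \<open>U \<subseteq> M\<close> and \<open>W \<subseteq> N\<close> are subobjects with \<open>M/U\<close> and \<open>W\<close> in \<open>\<T>\<close>.
  Since \<open>M/U\<close> has carrier type \<open>'m set\<close>, it is required to be isomorphic to an object of \<open>\<T>\<close>.
  A triple \<open>(U, W, f)\<close> stands for \<open>f : U \<rightarrow> N/W\<close>.\<close>

definition cotorsion_sub ::
  "('k, 'g, 'a) graded_alg \<Rightarrow> ('g, 'a, 'm) graded_mod set \<Rightarrow> ('g, 'a, 'm) graded_mod set \<Rightarrow>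
     ('g, 'a, 'm) graded_mod \<Rightarrow> 'm set \<Rightarrow> bool" where
  "cotorsion_sub S \<A> \<T> M U \<longleftrightarrow> graded_submodule S M U \<and> sub_mod M U \<in> \<A> \<and>
     (\<exists>Q\<in>\<T>. graded_isomorphic S (quot_mod M U) Q)"

definition torsion_sub ::
  "('k, 'g, 'a) graded_alg \<Rightarrow> ('g, 'a, 'm) graded_mod set \<Rightarrow>
     ('g, 'a, 'm) graded_mod \<Rightarrow> 'm set \<Rightarrow> bool" where
  "torsion_sub S \<T> N W \<longleftrightarrow> graded_submodule S N W \<and> sub_mod N W \<in> \<T>"

type_synonym 'm partial_hom = "'m set \<times> 'm set \<times> ('m \<Rightarrow> 'm set)"

definition partial_homs ::
  "('k, 'g, 'a) graded_alg \<Rightarrow> ('g, 'a, 'm) graded_mod set \<Rightarrow> ('g, 'a, 'm) graded_mod set \<Rightarrow>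
     ('g, 'a, 'm) graded_mod \<Rightarrow> ('g, 'a, 'm) graded_mod \<Rightarrow> 'm partial_hom set" where
  "partial_homs S \<A> \<T> M N = {(U, W, f). cotorsion_sub S \<A> \<T> M U \<and> torsion_sub S \<T> N W \<and>
     f \<in> graded_hom S (sub_mod M U) (quot_mod N W)}"

text \<open>Two homomorphisms represent the same element of the colimit if they induce the same
  homomorphism \<open>U \<rightarrow> N/W\<close> for some smaller \<open>U\<close> and some larger \<open>W\<close>.\<close>

definition partial_hom_eq ::
  "('k, 'g, 'a) graded_alg \<Rightarrow> ('g, 'a, 'm) graded_mod set \<Rightarrow> ('g, 'a, 'm) graded_mod set \<Rightarrow>
     ('g, 'a, 'm) graded_mod \<Rightarrow> ('g, 'a, 'm) graded_mod \<Rightarrow> 'm partial_hom rel" where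
  "partial_hom_eq S \<A> \<T> M N = {((U\<^sub>1, W\<^sub>1, f\<^sub>1), (U\<^sub>2, W\<^sub>2, f\<^sub>2)).
     (U\<^sub>1, W\<^sub>1, f\<^sub>1) \<in> partial_homs S \<A> \<T> M N \<and> (U\<^sub>2, W\<^sub>2, f\<^sub>2) \<in> partial_homs S \<A> \<T> M N \<and>
     (\<exists>U W. cotorsion_sub S \<A> \<T> M U \<and> U \<subseteq> U\<^sub>1 \<inter> U\<^sub>2 \<and> torsion_sub S \<T> N W \<and> W\<^sub>1 \<union> W\<^sub>2 \<subseteq> W \<and>
        (\<forall>x\<in>U. W <+>\<^bsub>N\<^esub> f\<^sub>1 x = W <+>\<^bsub>N\<^esub> f\<^sub>2 x))}"

text \<open>The composite of \<open>f : U \<rightarrow> N/W\<close> and \<open>g : V \<rightarrow> P/Z\<close> (with \<open>V \<subseteq> N\<close>) is the homomorphism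
  \<open>U' \<rightarrow> (V + W)/W \<cong> V/(V \<inter> W) \<rightarrow> P/Z'\<close>, where \<open>U'\<close> is the preimage of \<open>(V + W)/W\<close> under \<open>f\<close> and
  \<open>Z'/Z\<close> is the image of \<open>V \<inter> W\<close> under \<open>g\<close>. As \<open>f x\<close> is a coset of \<open>W\<close>, it lies in \<open>(V + W)/W\<close> iff
  it meets \<open>V\<close>, and the union over \<open>f x \<inter> V\<close> of the cosets \<open>g n\<close> is a coset of \<open>Z'\<close>.\<close>

fun partial_hom_comp :: "'m partial_hom \<Rightarrow> 'm partial_hom \<Rightarrow> 'm partial_hom" where
  "partial_hom_comp (V, Z, g) (U, W, f) =
     ({x \<in> U. f x \<inter> V \<noteq> {}}, \<Union> (g ` (V \<inter> W)),
      (\<lambda>x\<in>{x \<in> U. f x \<inter> V \<noteq> {}}. \<Union> (g ` (f x \<inter> V))))"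

text \<open>The quotient functor, the identity on objects, sends \<open>f\<close> to the class of \<open>f : M \<rightarrow> N/0\<close>.\<close>

definition quot_functor ::
  "('k, 'g, 'a) graded_alg \<Rightarrow> ('g, 'a, 'm) graded_mod set \<Rightarrow> ('g, 'a, 'm) graded_mod set \<Rightarrow>
     ('g, 'a, 'm) graded_mod \<Rightarrow> ('g, 'a, 'm) graded_mod \<Rightarrow> ('m \<Rightarrow> 'm) \<Rightarrow> 'm partial_hom set" where
  "quot_functor S \<A> \<T> M N f =
     partial_hom_eq S \<A> \<T> M N `` {(carrier M, {\<zero>\<^bsub>N\<^esub>}, \<lambda>x\<in>carrier M. {f x})}"

definition quot_cat ::
  "('k, 'g, 'a) graded_alg \<Rightarrow> ('g, 'a, 'm) graded_mod set \<Rightarrow> ('g, 'a, 'm) graded_mod set \<Rightarrow>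
     (('g, 'a, 'm) graded_mod, 'm partial_hom set) category" where
  "quot_cat S \<A> \<T> = \<lparr>Ob = \<A>,
     Mor = (\<lambda>M N. partial_homs S \<A> \<T> M N // partial_hom_eq S \<A> \<T> M N),
     Idn = (\<lambda>M. quot_functor S \<A> \<T> M M (\<lambda>x\<in>carrier M. x)),
     Cmp = (\<lambda>M N P \<psi> \<phi>. partial_hom_eq S \<A> \<T> M P `` {partial_hom_comp q p | q p. q \<in> \<psi> \<and> p \<in> \<phi>})\<rparr>"


section \<open>The module categories of the theorem\<close>

definition GrMod :: "('k, 'g::ab_group_add, 'a) graded_alg \<Rightarrow> ('g, 'a, 'm) graded_mod set" where
  "GrMod R = {M. graded_module R M}"

definition grmod :: "('k, 'g::ab_group_add, 'a) graded_alg \<Rightarrow> ('g, 'a, 'm) graded_mod set" where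
  "grmod R = {M \<in> GrMod R. fg_module R M}"

definition Tors ::
  "'k ring \<Rightarrow> ('k, 'g::ab_group_add, 'a) graded_alg \<Rightarrow> ('g, 'a, 'm) graded_mod set" where
  "Tors K R = {M \<in> GrMod R. torsion_wrt K R (carrier R) M}"

definition tors ::
  "'k ring \<Rightarrow> ('k, 'g::ab_group_add, 'a) graded_alg \<Rightarrow> ('g, 'a, 'm) graded_mod set" where
  "tors K R = {M \<in> grmod R. torsion_wrt K R (carrier R) M}"

abbreviation BiGrMod ::
  "('k, int \<times> int, 'a) graded_alg \<Rightarrow> (int \<times> int, 'a, 'm) graded_mod set" where
  "BiGrMod S \<equiv> GrMod S"

definition lbigrmod ::
  "('k, int \<times> int, 'a) graded_alg \<Rightarrow> (int \<times> int, 'a, 'm) graded_mod set" where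
  "lbigrmod S = {M \<in> BiGrMod S. \<forall>i. fg_module (deg0_alg S) (mod_row M i)}"

definition BiLTors ::
  "'k ring \<Rightarrow> ('k, int \<times> int, 'a) graded_alg \<Rightarrow> (int \<times> int, 'a, 'm) graded_mod set" where
  "BiLTors K S = {M \<in> BiGrMod S. torsion_wrt K S (carrier (deg0_alg S)) M}"

definition lbiltors ::
  "'k ring \<Rightarrow> ('k, int \<times> int, 'a) graded_alg \<Rightarrow> (int \<times> int, 'a, 'm) graded_mod set" where
  "lbiltors K S = {M \<in> lbigrmod S. torsion_wrt K S (carrier (deg0_alg S)) M}"

end

theory Submission
 imports Defs
begin

text \<open>A module is torsion iff each of its elements is annihilated by an open right ideal, where a graded
  right ideal of \<open>S\<close> or of \<open>S\<^sub>0\<close> is called open if its intersection with \<open>S\<^sub>0\<close> has finite codimension in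
  \<open>S\<^sub>0\<close>. The open ideals form Gabriel topologies (\<open>cofinite_gabriel\<close>); for \<open>S\<close> this uses that the
  left \<open>S\<^sub>0\<close>-modules \<open>S\<^sub>i\<close> are finitely generated.

  A morphism of a quotient by torsion is a class of homomorphisms \<open>U \<rightarrow> N/W\<close> with \<open>M/U\<close> and \<open>W\<close> torsion.
  The graph of such a homomorphism is a graded submodule of \<open>M \<oplus> N\<close>, and two of them are equivalent iff
  their graphs have the same closure, the closure of \<open>U\<close> being the preimage of the torsion of the quotient
  by \<open>U\<close>. The Serre quotient is therefore isomorphic to the category whose morphisms are the
  closed correspondences, composed as relations up to closure (\<open>quot_cat_iso\<close>). An inclusion between
  closed correspondences is an equality (\<open>cl_eq_sat\<close>), so identities of morphisms are verified by
  relating elements, and factorisations through kernels and cokernels are composites with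
  converse relations. In this form the category is seen to be abelian (\<open>sat_abelian\<close>).

  Density enters as follows. The right ideal generated by \<open>S\<^sub>n\<close> contains \<open>S\<^sub>n S\<^sub>-\<^sub>n\<close>, which has finite
  codimension in \<open>S\<^sub>0\<close>, and hence is open (\<open>ideal_containing_row\<close>). Consequently an element \<open>z\<close> of a
  bigraded module lies in a closed submodule as soon as the row \<open>0\<close> parts of all multiples \<open>z t\<close> do. Closed
  submodules of \<open>M \<oplus> N\<close> are thus determined by their row \<open>0\<close>, and every closed submodule of
  \<open>M\<^sub>0 \<oplus> N\<^sub>0\<close> occurs. As the topologies of \<open>S\<close> and \<open>S\<^sub>0\<close> agree on row \<open>0\<close> (\<open>cl_row\<close>),
  taking rows is bijective on the closed correspondences (\<open>row_rel_bij\<close>), that is, fully faithful.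

  Every graded \<open>S\<^sub>0\<close>-module \<open>N\<close> is even isomorphic to a row \<open>0\<close> (\<open>row0_essentially_surjective\<close>), namely
  to that of the image of \<open>N \<otimes> S\<close> in \<open>Hom(S, N)\<close>, both over \<open>S\<^sub>0\<close>, under the map that takes \<open>n \<otimes> s\<close> to
  \<open>t \<mapsto> n (s t)\<^sub>0\<close>. If \<open>N\<close> is finitely generated, then so are the rows of this module, because the right
  \<open>S\<^sub>0\<close>-modules \<open>S\<^sub>i\<close> are finitely generated.

  All modules have carriers in one type \<open>'m\<close> into which \<open>S\<close> embeds. In characteristic \<open>0\<close> either
  \<open>S = 0\<close>, and all modules vanish, or \<open>'m\<close> is infinite. Then it codes pairs and finite sums of tensors,
  as needed for direct sums and for the modules just constructed.\<close>

section \<open>Modules, spans and finite dimension\<close>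

lemma (in abelian_group) zero_minus_zero [simp]: "\<ominus> \<zero> = \<zero>"
 by (rule minus_equality) simp_all

lemma (in abelian_group) minus_zero_right [simp]: "x \<in> carrier G ==> x \<ominus> \<zero> = x"
 by (simp add: minus_eq)

lemma (in abelian_group) eq_if_diff_zero: "x \<oplus> \<ominus> y = \<zero> ==> x \<in> carrier G ==> y \<in> carrier G ==> x = y"
 using minus_equality[of x "\<ominus> y"] by simp

lemma additive_subgroupI_closed:
 assumes "abelian_group G" "H \<subseteq> carrier G" "\<zero>\<^bsub>G\<^esub> \<in> H"
  "\<And>x y. x \<in> H ==> y \<in> H ==> x \<oplus>\<^bsub>G\<^esub> y \<in> H"
  "\<And>x. x \<in> H ==> \<ominus>\<^bsub>G\<^esub> x \<in> H"
 shows "additive_subgroup H G"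
proof -
 interpret abelian_group G by fact
 show ?thesis
  by (rule additive_subgroupI, rule add.subgroupI) (use assms in \<open>auto simp: a_inv_def[symmetric]\<close>)
qed

lemma additive_subgroupD:
 assumes "abelian_group G" "additive_subgroup H G"
 shows "H \<subseteq> carrier G" "\<zero>\<^bsub>G\<^esub> \<in> H"
  "\<And>x y. x \<in> H ==> y \<in> H ==> x \<oplus>\<^bsub>G\<^esub> y \<in> H"
  "\<And>x. x \<in> H ==> \<ominus>\<^bsub>G\<^esub> x \<in> H"
  "\<And>x y. x \<in> H ==> y \<in> H ==> x \<ominus>\<^bsub>G\<^esub> y \<in> H"
proof -
 interpret G: abelian_group G by fact
 interpret H: additive_subgroup H G by fact
 interpret H2: abelian_subgroup H G by (intro abelian_subgroupI3 assms)
 show "H \<subseteq> carrier G" "\<zero>\<^bsub>G\<^esub> \<in> H"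
  "\<And>x y. x \<in> H ==> y \<in> H ==> x \<oplus>\<^bsub>G\<^esub> y \<in> H"
  "\<And>x. x \<in> H ==> \<ominus>\<^bsub>G\<^esub> x \<in> H"
  using H.a_subset H.a_inv_closed G.abelian_group_axioms by auto
 then show "\<And>x y. x \<in> H ==> y \<in> H ==> x \<ominus>\<^bsub>G\<^esub> y \<in> H"
  by (simp add: a_minus_def)
qed

lemma finsum_in_additive_subgroup:
 assumes "abelian_group G" "additive_subgroup H G" "\<And>i. i \<in> A ==> f i \<in> H"
 shows "(\<Oplus>\<^bsub>G\<^esub>i\<in>A. f i) \<in> H"
proof (cases "finite A")
 case True
 interpret G: abelian_group G by fact
 note H = additive_subgroupD[OF assms(1,2)]
 from True show ?thesis using assms(3)
 proof (induction A)
  case (insert a A)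
  then have "f \<in> A \<rightarrow> carrier G" "f a \<in> carrier G" using H(1) by auto
  then show ?case using insert H by (simp add: G.finsum_insert)
 qed (simp add: H)
next
 case False
 interpret G: abelian_group G by fact
 show ?thesis using False by (simp add: G.finsum_infinite additive_subgroupD[OF assms(1,2)])
qed

lemma finsum_additive:
 assumes G: "abelian_group G" and H: "abelian_group H"
  and f: "\<And>x. x \<in> carrier G ==> h x \<in> carrier H"
   "\<And>x y. x \<in> carrier G ==> y \<in> carrier G ==> h (x \<oplus>\<^bsub>G\<^esub> y) = h x \<oplus>\<^bsub>H\<^esub> h y"
  and u: "u \<in> A \<rightarrow> carrier G"
 shows "h (\<Oplus>\<^bsub>G\<^esub>i\<in>A. u i) = (\<Oplus>\<^bsub>H\<^esub>i\<in>A. h (u i))"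
proof -
 interpret G: abelian_group G by fact
 interpret H: abelian_group H by fact
 have z: "h \<zero>\<^bsub>G\<^esub> = \<zero>\<^bsub>H\<^esub>"
  using f(2)[of "\<zero>\<^bsub>G\<^esub>" "\<zero>\<^bsub>G\<^esub>"] f(1)[of "\<zero>\<^bsub>G\<^esub>"] by simp
 show ?thesis
 proof (cases "finite A")
  case True
  then show ?thesis using u
   by (induction A) (auto simp: z G.finsum_insert H.finsum_insert f Pi_def)
 qed (simp add: G.finsum_infinite H.finsum_infinite z)
qed

text \<open>Submodules and rows are records of their own that share the addition of the ambient module.\<close>

lemma finsum_restricted_carrier:
 assumes "abelian_group G" "abelian_group H" "carrier H \<subseteq> carrier G" "add H = add G"
  "u \<in> A \<rightarrow> carrier H"
 shows "(\<Oplus>\<^bsub>H\<^esub>i\<in>A. u i) = (\<Oplus>\<^bsub>G\<^esub>i\<in>A. u i)"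
 using finsum_additive[OF assms(2,1), of "\<lambda>x. x" u A] assms by auto

lemma additive_map_zero:
 assumes "abelian_group G" "abelian_group H" "h \<zero>\<^bsub>G\<^esub> \<in> carrier H"
  "\<And>x y. x \<in> carrier G ==> y \<in> carrier G ==> h (x \<oplus>\<^bsub>G\<^esub> y) = h x \<oplus>\<^bsub>H\<^esub> h y"
 shows "h \<zero>\<^bsub>G\<^esub> = \<zero>\<^bsub>H\<^esub>"
proof -
 interpret G: abelian_group G by fact
 interpret H: abelian_group H by fact
 show ?thesis
  using assms(4)[of "\<zero>\<^bsub>G\<^esub>" "\<zero>\<^bsub>G\<^esub>"] assms(3) by simp
qed

lemma additive_map_minus:
 assumes "abelian_group G" "abelian_group H"
  and f: "\<And>x. x \<in> carrier G ==> h x \<in> carrier H"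
   "\<And>x y. x \<in> carrier G ==> y \<in> carrier G ==> h (x \<oplus>\<^bsub>G\<^esub> y) = h x \<oplus>\<^bsub>H\<^esub> h y"
  and x: "x \<in> carrier G"
 shows "h (\<ominus>\<^bsub>G\<^esub> x) = \<ominus>\<^bsub>H\<^esub> h x"
proof -
 interpret G: abelian_group G by fact
 interpret H: abelian_group H by fact
 have "h (\<ominus>\<^bsub>G\<^esub> x) \<oplus>\<^bsub>H\<^esub> h x = \<zero>\<^bsub>H\<^esub>"
  using f(2)[of "\<ominus>\<^bsub>G\<^esub> x" x] x additive_map_zero[OF assms(1,2), of h] f by (simp add: G.l_neg)
 then show ?thesis using f(1) x by (metis G.a_inv_closed H.minus_equality)
qed

lemma span_by_subset:
 assumes "abelian_group G" "additive_subgroup H G" "\<And>c b. c \<in> C ==> b \<in> B ==> sc c b \<in> H"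
 shows "span_by C G sc B \<subseteq> H"
 unfolding span_by_def
 by (auto intro!: finsum_in_additive_subgroup[OF assms(1,2)] assms(3))

text \<open>The action is a parameter because one record carries several: elements of a graded algebra are
  multiplied by ring elements as well as by scalars.\<close>

locale right_act = R: ring R + G: abelian_group G
 for R :: "('r, 'x) ring_scheme" and G :: "('b, 'y) ring_scheme" (structure) +
 fixes act :: "'b \<Rightarrow> 'r \<Rightarrow> 'b" (infixl \<open>\<cdot>\<close> 70)
 assumes act_closed [simp, intro]: "x \<in> carrier G ==> r \<in> carrier R ==> x \<cdot> r \<in> carrier G"
  and act_one [simp]: "x \<in> carrier G ==> x \<cdot> \<one>\<^bsub>R\<^esub> = x"
  and act_mult: "x \<in> carrier G ==> r \<in> carrier R ==> s \<in> carrier R ==> x \<cdot> (r \<otimes>\<^bsub>R\<^esub> s) = x \<cdot> r \<cdot> s"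
  and act_add_right: "x \<in> carrier G ==> r \<in> carrier R ==> s \<in> carrier R ==>
   x \<cdot> (r \<oplus>\<^bsub>R\<^esub> s) = x \<cdot> r \<oplus> x \<cdot> s"
  and act_add_left: "x \<in> carrier G ==> y \<in> carrier G ==> r \<in> carrier R ==>
   (x \<oplus> y) \<cdot> r = x \<cdot> r \<oplus> y \<cdot> r"
begin

definition submod :: "'b set \<Rightarrow> bool" where
 "submod V \<longleftrightarrow> V \<subseteq> carrier G \<and> \<zero> \<in> V \<and> (\<forall>x\<in>V. \<forall>y\<in>V. x \<oplus> y \<in> V) \<and>
   (\<forall>x\<in>V. \<forall>r\<in>carrier R. x \<cdot> r \<in> V)"

definition gen :: "'b set \<Rightarrow> 'b set" where
 "gen W = {x. \<forall>V. submod V \<and> W \<subseteq> V \<longrightarrow> x \<in> V}"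

lemma act_zero_right [simp]: "x \<in> carrier G ==> x \<cdot> \<zero>\<^bsub>R\<^esub> = \<zero>"
 using additive_map_zero[OF R.is_abelian_group G.abelian_group_axioms, of "\<lambda>r. x \<cdot> r"]
 by (simp add: act_add_right)

lemma act_zero_left [simp]: "r \<in> carrier R ==> \<zero> \<cdot> r = \<zero>"
 using additive_map_zero[OF G.abelian_group_axioms G.abelian_group_axioms, of "\<lambda>x. x \<cdot> r"]
 by (simp add: act_add_left)

lemma act_minus_right: "x \<in> carrier G ==> r \<in> carrier R ==> x \<cdot> (\<ominus>\<^bsub>R\<^esub> r) = \<ominus> (x \<cdot> r)"
 using additive_map_minus[OF R.is_abelian_group G.abelian_group_axioms, of "\<lambda>r. x \<cdot> r"]
 by (simp add: act_add_right)

lemma act_minus_left: "x \<in> carrier G ==> r \<in> carrier R ==> (\<ominus> x) \<cdot> r = \<ominus> (x \<cdot> r)"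
 using additive_map_minus[OF G.abelian_group_axioms G.abelian_group_axioms, of "\<lambda>x. x \<cdot> r"]
 by (simp add: act_add_left)

lemma submodD:
 assumes "submod V"
 shows "V \<subseteq> carrier G" "\<zero> \<in> V" "\<And>x y. x \<in> V ==> y \<in> V ==> x \<oplus> y \<in> V"
  "\<And>x r. x \<in> V ==> r \<in> carrier R ==> x \<cdot> r \<in> V"
  "\<And>x. x \<in> V ==> \<ominus> x \<in> V" "\<And>x y. x \<in> V ==> y \<in> V ==> x \<ominus> y \<in> V"
proof -
 show *: "V \<subseteq> carrier G" "\<zero> \<in> V" "\<And>x y. x \<in> V ==> y \<in> V ==> x \<oplus> y \<in> V"
  "\<And>x r. x \<in> V ==> r \<in> carrier R ==> x \<cdot> r \<in> V"
  using assms by (auto simp: submod_def)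
 show **: "\<ominus> x \<in> V" if "x \<in> V" for x
  using *(4)[OF that, of "\<ominus>\<^bsub>R\<^esub> \<one>\<^bsub>R\<^esub>"] that *(1) by (simp add: act_minus_right subset_iff)
 show "\<And>x y. x \<in> V ==> y \<in> V ==> x \<ominus> y \<in> V"
  using * ** by (simp add: a_minus_def)
qed

lemma submod_additive_subgroup: "submod V ==> additive_subgroup V G"
 by (rule additive_subgroupI_closed[OF G.abelian_group_axioms]) (simp_all add: submodD)

lemma submod_iff: "submod V \<longleftrightarrow> additive_subgroup V G \<and> (\<forall>x\<in>V. \<forall>r\<in>carrier R. x \<cdot> r \<in> V)"
proof
 assume "submod V"
 then show "additive_subgroup V G \<and> (\<forall>x\<in>V. \<forall>r\<in>carrier R. x \<cdot> r \<in> V)"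
  using submod_additive_subgroup submodD(4) by auto
next
 assume *: "additive_subgroup V G \<and> (\<forall>x\<in>V. \<forall>r\<in>carrier R. x \<cdot> r \<in> V)"
 note V = additive_subgroupD[OF G.abelian_group_axioms conjunct1[OF *]]
 show "submod V" unfolding submod_def using V(1-3) * by auto
qed

lemma submod_carrier: "submod (carrier G)"
 by (auto simp: submod_def)

lemma submod_zero: "submod {\<zero>}"
 by (auto simp: submod_def)

lemma submod_gen: assumes "W \<subseteq> carrier G" shows "submod (gen W)"
proof -
 have "gen W \<subseteq> carrier G" unfolding gen_def using submod_carrier assms by auto
 then show ?thesis by (auto simp: submod_def gen_def)
qed

lemma gen_superset: "W \<subseteq> gen W"
 by (auto simp: gen_def)

lemma gen_least: "submod V ==> W \<subseteq> V ==> gen W \<subseteq> V"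
 by (auto simp: gen_def)

lemma gen_mono: "W \<subseteq> W' ==> gen W \<subseteq> gen W'"
 by (auto simp: gen_def)

lemma gen_submod: "submod V ==> gen V = V"
 using gen_least gen_superset by blast

text \<open>With this description by submodules, inductions need not handle finite sums.\<close>

lemma span_by_eq_gen:
 assumes "finite B" "B \<subseteq> carrier G"
 shows "span_by (carrier R) G (\<lambda>r x. x \<cdot> r) B = gen B"
proof
 show "span_by (carrier R) G (\<lambda>r x. x \<cdot> r) B \<subseteq> gen B"
  by (rule span_by_subset[OF G.abelian_group_axioms submod_additive_subgroup[OF submod_gen[OF assms(2)]]])
    (use submodD[OF submod_gen[OF assms(2)]] gen_superset[of B] in auto)
next
 have eq: "span_by (carrier R) G (\<lambda>r x. x \<cdot> r) B = {(\<Oplus>b\<in>B. b \<cdot> c b) | c. c \<in> B \<rightarrow> carrier R}"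
  (is "_ = ?S")
 proof
  show "?S \<subseteq> span_by (carrier R) G (\<lambda>r x. x \<cdot> r) B"
   unfolding span_by_def using assms(1) by blast
  show "span_by (carrier R) G (\<lambda>r x. x \<cdot> r) B \<subseteq> ?S"
  proof
   fix x assume "x \<in> span_by (carrier R) G (\<lambda>r x. x \<cdot> r) B"
   then obtain T c where T: "x = (\<Oplus>b\<in>T. b \<cdot> c b)" "T \<subseteq> B" "c \<in> T \<rightarrow> carrier R"
    unfolding span_by_def by auto
   let ?c = "\<lambda>b. if b \<in> T then c b else \<zero>\<^bsub>R\<^esub>"
   have "x = (\<Oplus>b\<in>B. b \<cdot> ?c b)"
    unfolding T(1) by (rule G.add.finprod_mono_neutral_cong_left[folded finsum_def])
     (use T assms in \<open>auto simp: subset_iff Pi_iff\<close>)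
   moreover have "?c \<in> B \<rightarrow> carrier R" using T by auto
   ultimately show "x \<in> ?S"
    by (intro CollectI exI[of _ ?c] conjI)
  qed
 qed
 have "submod ?S"
  unfolding submod_def
 proof (intro conjI ballI)
  show "?S \<subseteq> carrier G" using assms(2) by (auto intro!: G.finsum_closed)
  have "\<zero> = (\<Oplus>b\<in>B. b \<cdot> \<zero>\<^bsub>R\<^esub>)"
   using assms(2) G.finsum_cong'[of B B "\<lambda>b. \<zero>" "\<lambda>b. b \<cdot> \<zero>\<^bsub>R\<^esub>"] by (auto simp: subset_iff)
  then show "\<zero> \<in> ?S" by (intro CollectI exI[of _ "\<lambda>_. \<zero>\<^bsub>R\<^esub>"]) simp
 next
  fix x y assume "x \<in> ?S" "y \<in> ?S"
  then obtain c d where *: "x = (\<Oplus>b\<in>B. b \<cdot> c b)" "y = (\<Oplus>b\<in>B. b \<cdot> d b)"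
   "c \<in> B \<rightarrow> carrier R" "d \<in> B \<rightarrow> carrier R" by auto
  have "x \<oplus> y = (\<Oplus>b\<in>B. b \<cdot> c b \<oplus> b \<cdot> d b)"
   unfolding * by (rule G.finsum_addf[symmetric]) (use * assms in auto)
  also have "\<dots> = (\<Oplus>b\<in>B. b \<cdot> (c b \<oplus>\<^bsub>R\<^esub> d b))"
   by (rule G.finsum_cong') (use * assms in \<open>auto simp: act_add_right Pi_iff subset_iff\<close>)
  finally show "x \<oplus> y \<in> ?S" using * by (auto intro!: exI[of _ "\<lambda>b. c b \<oplus>\<^bsub>R\<^esub> d b"])
 next
  fix x r assume "x \<in> ?S" and r: "r \<in> carrier R"
  then obtain c where *: "x = (\<Oplus>b\<in>B. b \<cdot> c b)" "c \<in> B \<rightarrow> carrier R" by auto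
  have "x \<cdot> r = (\<Oplus>b\<in>B. b \<cdot> c b \<cdot> r)"
   unfolding * by (rule finsum_additive[OF G.abelian_group_axioms G.abelian_group_axioms])
    (use * assms r in \<open>auto simp: act_add_left\<close>)
  also have "\<dots> = (\<Oplus>b\<in>B. b \<cdot> (c b \<otimes>\<^bsub>R\<^esub> r))"
   by (rule G.finsum_cong') (use * assms r in \<open>auto simp: act_mult Pi_iff subset_iff\<close>)
  finally show "x \<cdot> r \<in> ?S" using * r by (auto intro!: exI[of _ "\<lambda>b. c b \<otimes>\<^bsub>R\<^esub> r"])
 qed
 moreover have "B \<subseteq> ?S"
 proof
  fix b assume b: "b \<in> B"
  have "b = (\<Oplus>b\<in>{b}. b \<cdot> \<one>\<^bsub>R\<^esub>)" using b assms by (auto simp: G.finsum_insert)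
  then have "b \<in> span_by (carrier R) G (\<lambda>r x. x \<cdot> r) B"
   unfolding span_by_def using b by (intro CollectI exI[of _ "{b}"] exI[of _ "\<lambda>_. \<one>\<^bsub>R\<^esub>"]) auto
  then show "b \<in> ?S" unfolding eq .
 qed
 ultimately show "gen B \<subseteq> span_by (carrier R) G (\<lambda>r x. x \<cdot> r) B"
  unfolding eq by (rule gen_least)
qed

lemma fin_gen_iff:
 assumes "V \<subseteq> carrier G"
 shows "fin_gen (carrier R) G (\<lambda>r x. x \<cdot> r) V \<longleftrightarrow> (\<exists>B. finite B \<and> B \<subseteq> V \<and> V = gen B)"
 unfolding fin_gen_def using span_by_eq_gen assms by (metis subset_trans)

lemma set_add_gen:
 assumes "submod W" "B \<subseteq> carrier G"
 shows "W <+>\<^bsub>G\<^esub> gen B = gen (W \<union> B)"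
proof
 note W = submodD[OF assms(1)] and B = submodD[OF submod_gen[OF assms(2)]]
 have WB: "W \<union> B \<subseteq> carrier G" using W assms by auto
 show "W <+>\<^bsub>G\<^esub> gen B \<subseteq> gen (W \<union> B)"
  using gen_superset[of "W \<union> B"] gen_mono[of B "W \<union> B"] submodD(3)[OF submod_gen[OF WB]]
  by (auto simp: set_add_def' subset_iff)
 have "submod (W <+>\<^bsub>G\<^esub> gen B)"
  unfolding submod_iff
 proof (intro conjI ballI)
  show "additive_subgroup (W <+>\<^bsub>G\<^esub> gen B) G"
   by (intro G.add_additive_subgroups submod_additive_subgroup submod_gen assms)
  fix x r assume "x \<in> W <+>\<^bsub>G\<^esub> gen B" and r: "r \<in> carrier R"
  then obtain w b where *: "x = w \<oplus> b" "w \<in> W" "b \<in> gen B" by (auto simp: set_add_def')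
  then have "x \<cdot> r = w \<cdot> r \<oplus> b \<cdot> r" using W(1) B(1) r by (simp add: act_add_left subset_iff)
  then show "x \<cdot> r \<in> W <+>\<^bsub>G\<^esub> gen B" using W(4) B(4) r * by (auto simp: set_add_def' intro!: bexI)
 qed
 moreover have "W \<subseteq> W <+>\<^bsub>G\<^esub> gen B"
 proof
  fix w assume "w \<in> W"
  then have "w = w \<oplus> \<zero>" using W by auto
  then show "w \<in> W <+>\<^bsub>G\<^esub> gen B" using \<open>w \<in> W\<close> B(2) unfolding set_add_def' by blast
 qed
 moreover have "B \<subseteq> W <+>\<^bsub>G\<^esub> gen B"
 proof
  fix b assume "b \<in> B"
  then have "b = \<zero> \<oplus> b" using assms by auto
  then show "b \<in> W <+>\<^bsub>G\<^esub> gen B" using \<open>b \<in> B\<close> W(2) gen_superset[of B] unfolding set_add_def' by blast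
 qed
 ultimately show "gen (W \<union> B) \<subseteq> W <+>\<^bsub>G\<^esub> gen B"
  by (intro gen_least) auto
qed

lemma gen_insertE:
 assumes "b \<in> carrier G" "W \<subseteq> carrier G" "x \<in> gen (insert b W)"
 obtains r where "r \<in> carrier R" "x \<ominus> b \<cdot> r \<in> gen W"
proof -
 have "gen W <+>\<^bsub>G\<^esub> gen {b} = gen (gen W \<union> {b})" by (rule set_add_gen[OF submod_gen]) (use assms in auto)
 moreover have "gen (insert b W) \<subseteq> gen (gen W \<union> {b})" using gen_superset[of W] by (intro gen_mono) auto
 ultimately have "x \<in> gen W <+>\<^bsub>G\<^esub> gen {b}" using assms(3) by blast
 then obtain w y where x: "w \<in> gen W" "y \<in> gen {b}" "x = w \<oplus> y" unfolding set_add_def' by blast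
 have "gen {b} \<subseteq> (\<lambda>r. b \<cdot> r) ` carrier R"
 proof (rule gen_least)
  have "additive_subgroup ((\<lambda>r. b \<cdot> r) ` carrier R) G"
   by (rule additive_subgroupI_closed[OF G.abelian_group_axioms])
     (use assms(1) in \<open>auto simp: act_add_right[symmetric] act_minus_right[symmetric] image_iff intro: bexI[of _ "\<zero>\<^bsub>R\<^esub>"]\<close>)
  then show "submod ((\<lambda>r. b \<cdot> r) ` carrier R)" using assms(1) by (auto simp: submod_iff act_mult[symmetric])
  show "{b} \<subseteq> (\<lambda>r. b \<cdot> r) ` carrier R" using assms(1) by (auto intro!: image_eqI[of _ _ "\<one>\<^bsub>R\<^esub>"])
 qed
 then obtain r where r: "r \<in> carrier R" "y = b \<cdot> r" using x(2) by auto
 moreover have "w \<in> carrier G" using x(1) submodD(1)[OF submod_gen[OF assms(2)]] by auto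
 ultimately have "x \<ominus> b \<cdot> r = w" using x(3) assms(1) by (simp add: G.minus_eq G.a_assoc G.r_neg)
 then show ?thesis using that r(1) x(1) by simp
qed

text \<open>The leading coefficients at \<open>b\<close>, in the manner of the proof of the basis theorem.\<close>

lemma coefficient_ideal:
 assumes b: "b \<in> carrier G" and W: "W \<subseteq> carrier G" and N: "submod N"
 defines "I \<equiv> {r \<in> carrier R. \<exists>x\<in>N. x \<ominus> b \<cdot> r \<in> gen W}"
 shows "additive_subgroup I R" "\<And>r s. r \<in> I ==> s \<in> carrier R ==> r \<otimes>\<^bsub>R\<^esub> s \<in> I"
proof -
 note H = submodD[OF submod_gen[OF W]] and N = submodD[OF N]
 show m: "r \<otimes>\<^bsub>R\<^esub> s \<in> I" if "r \<in> I" and s: "s \<in> carrier R" for r s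
 proof -
  obtain x where *: "x \<in> N" "r \<in> carrier R" "x \<ominus> b \<cdot> r \<in> gen W" using \<open>r \<in> I\<close> by (auto simp: I_def)
  then have "x \<in> carrier G" using N(1) by auto
  then have "x \<cdot> s \<ominus> b \<cdot> (r \<otimes>\<^bsub>R\<^esub> s) = (x \<ominus> b \<cdot> r) \<cdot> s"
   using * s b by (simp add: act_mult G.minus_eq act_add_left act_minus_left)
  then show ?thesis using * H(4) N(4) s by (auto simp: I_def intro!: bexI[of _ "x \<cdot> s"])
 qed
 show "additive_subgroup I R"
 proof (rule additive_subgroupI_closed[OF R.is_abelian_group])
  show "\<zero>\<^bsub>R\<^esub> \<in> I" using N(2) H(2) b by (auto intro!: bexI[of _ \<zero>] simp: I_def G.minus_eq)
  show "\<ominus>\<^bsub>R\<^esub> r \<in> I" if "r \<in> I" for r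
   using m[OF that, of "\<ominus>\<^bsub>R\<^esub> \<one>\<^bsub>R\<^esub>"] that by (simp add: I_def R.r_minus)
  fix r s assume "r \<in> I" "s \<in> I"
  then obtain x y where *: "r \<in> carrier R" "s \<in> carrier R" "x \<in> N" "y \<in> N" "x \<ominus> b \<cdot> r \<in> gen W" "y \<ominus> b \<cdot> s \<in> gen W"
   by (auto simp: I_def)
  then have "x \<in> carrier G" "y \<in> carrier G" using N(1) by auto
  then have "(x \<oplus> y) \<ominus> b \<cdot> (r \<oplus>\<^bsub>R\<^esub> s) = (x \<ominus> b \<cdot> r) \<oplus> (y \<ominus> b \<cdot> s)"
   using * b by (simp add: act_add_right G.minus_eq G.minus_add G.a_ac)
  then show "r \<oplus>\<^bsub>R\<^esub> s \<in> I" using * H(3) N(3) by (auto simp: I_def intro!: bexI[of _ "x \<oplus> y"])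
 qed (auto simp: I_def)
qed

text \<open>Submodules of finitely generated modules over a right noetherian ring are finitely generated,
  in a form relative to a submodule \<open>gen W\<close> that need not be finitely generated. The induction
  is on the number of generators: the coefficients at the generator \<open>b\<close> of elements of \<open>N\<close> form a
  right ideal, and subtracting elements of \<open>N\<close> that realise its generators removes \<open>b\<close>.\<close>

lemma noetherian_fin_gen_relative:
 assumes "right_noetherian R" "finite B" "B \<subseteq> carrier G" "W \<subseteq> carrier G" "submod N" "N \<subseteq> gen (W \<union> B)"
 shows "\<exists>B'. finite B' \<and> B' \<subseteq> N \<and> N \<subseteq> gen (W \<union> B')"
 using assms(2,3,5,6)
proof (induction B arbitrary: N)
 case empty
 then show ?case by (intro exI[of _ "{}"]) simp
next
 case (insert b B)
 let ?H = "gen (W \<union> B)"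
 let ?I = "{r \<in> carrier R. \<exists>x\<in>N. x \<ominus> b \<cdot> r \<in> ?H}"
 have ZB: "W \<union> B \<subseteq> carrier G" and b: "b \<in> carrier G" using insert assms(4) by auto
 note H = submodD[OF submod_gen[OF ZB]] and N = submodD[OF insert.prems(2)]
 note I = coefficient_ideal[OF b ZB insert.prems(2)]
 have "fin_gen (carrier R) R (\<lambda>r x. x \<otimes>\<^bsub>R\<^esub> r) ?I"
  using assms(1) I unfolding right_noetherian_def by blast
 then obtain E where E: "finite E" "E \<subseteq> ?I" "?I = span_by (carrier R) R (\<lambda>r x. x \<otimes>\<^bsub>R\<^esub> r) E"
  unfolding fin_gen_def by blast
 define xi where "xi r = (SOME x. x \<in> N \<and> x \<ominus> b \<cdot> r \<in> ?H)" for r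
 have xi: "xi r \<in> N" "xi r \<ominus> b \<cdot> r \<in> ?H" if "r \<in> E" for r
  using someI_ex[of "\<lambda>x. x \<in> N \<and> x \<ominus> b \<cdot> r \<in> ?H"] E(2) that unfolding xi_def by blast+
 have xiX: "xi ` E \<subseteq> N" using xi by auto
 then have xiG: "xi ` E \<subseteq> carrier G" using N(1) by blast
 let ?Y = "gen (xi ` E)"
 note Y = submodD[OF submod_gen[OF xiG]]
 have YX: "?Y \<subseteq> N" by (rule gen_least[OF insert.prems(2) xiX])
 let ?I' = "{r \<in> carrier R. \<exists>x\<in>?Y. x \<ominus> b \<cdot> r \<in> ?H}"
 note I' = coefficient_ideal[OF b ZB submod_gen[OF xiG]]
 have "e \<in> ?I'" if "e \<in> E" for e
  using xi[OF that] that E(2) gen_superset[of "xi ` E"] by blast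
 then have II': "?I \<subseteq> ?I'"
  unfolding E(3) using I'(2) by (intro span_by_subset[OF R.is_abelian_group I'(1)]) auto
 have "submod (N \<inter> ?H)"
  using N H unfolding submod_def by auto
 from insert.IH[OF _ this] insert.prems obtain B' where
  B': "finite B'" "B' \<subseteq> N \<inter> ?H" "N \<inter> ?H \<subseteq> gen (W \<union> B')" by auto
 have "N \<subseteq> gen (W \<union> (B' \<union> xi ` E))"
 proof
  fix x assume x: "x \<in> N"
  have WB': "W \<union> (B' \<union> xi ` E) \<subseteq> carrier G" using B' xiG N(1) assms(4) by auto
  obtain r where r: "r \<in> carrier R" "x \<ominus> b \<cdot> r \<in> ?H"
   using gen_insertE[OF b ZB, of x] x insert.prems by auto
  then have "r \<in> ?I'" using x II' by blast
  then obtain y where y: "y \<in> ?Y" "y \<ominus> b \<cdot> r \<in> ?H" by auto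
  have G: "x \<in> carrier G" "y \<in> carrier G" using x y N(1) Y(1) by auto
  have "x \<ominus> y = (x \<ominus> b \<cdot> r) \<ominus> (y \<ominus> b \<cdot> r)"
   using G b r by (simp add: G.minus_eq G.minus_add G.a_ac G.r_neg1 G.r_neg2 G.r_neg)
  then have "x \<ominus> y \<in> ?H" using H(6)[OF r(2) y(2)] by simp
  then have "x \<ominus> y \<in> N \<inter> ?H" using N(6)[OF x, of y] y YX by blast
  then have "x \<ominus> y \<in> gen (W \<union> (B' \<union> xi ` E))"
   using B'(3) gen_mono[of "W \<union> B'" "W \<union> (B' \<union> xi ` E)"] by auto
  moreover have "y \<in> gen (W \<union> (B' \<union> xi ` E))"
   using y gen_mono[of "xi ` E" "W \<union> (B' \<union> xi ` E)"] by auto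
  ultimately have "(x \<ominus> y) \<oplus> y \<in> gen (W \<union> (B' \<union> xi ` E))"
   by (rule submodD(3)[OF submod_gen[OF WB']])
  then show "x \<in> gen (W \<union> (B' \<union> xi ` E))"
   using G by (simp add: G.minus_eq G.a_assoc G.l_neg)
 qed
 moreover have "finite (B' \<union> xi ` E)" "B' \<union> xi ` E \<subseteq> N" using B' E xiX by auto
 ultimately show ?case by blast
qed

lemma noetherian_submodule_fin_gen:
 assumes "right_noetherian R" "submod N" "submod V" "N \<subseteq> V" "fin_gen (carrier R) G (\<lambda>r x. x \<cdot> r) V"
 shows "fin_gen (carrier R) G (\<lambda>r x. x \<cdot> r) N"
proof -
 obtain B where B: "finite B" "B \<subseteq> V" "V = gen B"
  using fin_gen_iff[OF submodD(1)[OF assms(3)]] assms(5) by blast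
 then have "B \<subseteq> carrier G" using submodD(1)[OF assms(3)] by auto
 from noetherian_fin_gen_relative[OF assms(1) B(1) this _ assms(2), of "{}"]
 obtain B' where B': "finite B'" "B' \<subseteq> N" "N \<subseteq> gen B'" using B assms by auto
 then show ?thesis using gen_least[OF assms(2)] fin_gen_iff[OF submodD(1)[OF assms(2)]] by blast
qed

end

lemma field_right_noetherian:
 assumes "field K" shows "right_noetherian K"
 unfolding right_noetherian_def
proof (intro allI impI)
 interpret K: field K by fact
 interpret A: right_act K K "(\<otimes>\<^bsub>K\<^esub>)"
  by unfold_locales (auto simp: K.m_assoc K.r_distr K.l_distr)
 fix I assume I: "additive_subgroup I K \<and> (\<forall>x\<in>I. \<forall>r\<in>carrier K. x \<otimes>\<^bsub>K\<^esub> r \<in> I)"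
 then have sub: "A.submod I" by (simp add: A.submod_iff)
 note S = A.submodD[OF sub]
 have "\<exists>B. finite B \<and> B \<subseteq> I \<and> I = A.gen B"
 proof (cases "I = {\<zero>\<^bsub>K\<^esub>}")
  case True
  then show ?thesis using A.gen_submod[OF sub] by (intro exI[of _ "{\<zero>\<^bsub>K\<^esub>}"]) auto
 next
  case False
  then obtain a where a: "a \<in> I" "a \<noteq> \<zero>\<^bsub>K\<^esub>" "a \<in> carrier K" using S by auto
  have "I \<subseteq> A.gen {a}"
  proof
   fix x assume "x \<in> I"
   then have x: "x \<in> carrier K" using S by auto
   have ia: "inv\<^bsub>K\<^esub> a \<in> carrier K" "a \<otimes>\<^bsub>K\<^esub> inv\<^bsub>K\<^esub> a = \<one>\<^bsub>K\<^esub>"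
    using a K.field_Units by auto
   have "x = a \<otimes>\<^bsub>K\<^esub> (inv\<^bsub>K\<^esub> a \<otimes>\<^bsub>K\<^esub> x)"
    using x a ia by (simp add: K.m_assoc[symmetric])
   moreover have "a \<otimes>\<^bsub>K\<^esub> (inv\<^bsub>K\<^esub> a \<otimes>\<^bsub>K\<^esub> x) \<in> A.gen {a}"
    using A.submodD(4)[OF A.submod_gen] A.gen_superset[of "{a}"] a x ia by auto
   ultimately show "x \<in> A.gen {a}" by simp
  qed
  then show ?thesis using A.gen_least[OF sub, of "{a}"] a by (intro exI[of _ "{a}"]) auto
 qed
 then show "fin_gen (carrier K) K (\<lambda>r x. x \<otimes>\<^bsub>K\<^esub> r) I"
  using A.fin_gen_iff[OF S(1)] by simp
qed

locale vec_act = right_act R G act + K: field R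
 for R :: "('r, 'x) ring_scheme" and G :: "('b, 'y) ring_scheme" and act
begin

text \<open>Finite dimension of \<open>V\<close> modulo \<open>N\<close>, that is, of \<open>(V + N)/N\<close>.\<close>

definition fdm :: "'b set \<Rightarrow> 'b set \<Rightarrow> bool" where
 "fdm N V \<longleftrightarrow> (\<exists>B. finite B \<and> B \<subseteq> carrier G \<and> V \<subseteq> gen (N \<union> B))"

lemma fdm_mono: "fdm N V ==> N \<subseteq> N' ==> V' \<subseteq> V ==> fdm N' V'"
 unfolding fdm_def by (meson Un_mono gen_mono order_refl order_trans)

lemma fdm_refl: "fdm V V"
 unfolding fdm_def using gen_superset[of V] by (intro exI[of _ "{}"]) simp

lemma fdmE:
 assumes "fdm N V" "submod V" "N \<subseteq> carrier G"
 obtains B where "finite B" "B \<subseteq> V" "V \<subseteq> gen (N \<union> B)"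
proof -
 obtain B where B: "finite B" "B \<subseteq> carrier G" "V \<subseteq> gen (N \<union> B)"
  using assms(1) by (auto simp: fdm_def)
 show ?thesis
  using noetherian_fin_gen_relative[OF field_right_noetherian[OF K.field_axioms] B(1,2) assms(3,2) B(3)]
   that by auto
qed

lemma fdm_trans:
 assumes "fdm N Y" "fdm Y V" "N \<subseteq> carrier G"
 shows "fdm N V"
proof -
 obtain B B' where B: "finite B" "B \<subseteq> carrier G" "Y \<subseteq> gen (N \<union> B)"
  "finite B'" "B' \<subseteq> carrier G" "V \<subseteq> gen (Y \<union> B')" using assms by (auto simp: fdm_def)
 have "gen (Y \<union> B') \<subseteq> gen (N \<union> (B \<union> B'))"
 proof (rule gen_least)
  show "submod (gen (N \<union> (B \<union> B')))" using B assms by (intro submod_gen) auto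
  show "Y \<union> B' \<subseteq> gen (N \<union> (B \<union> B'))"
   using B(3) gen_mono[of "N \<union> B" "N \<union> (B \<union> B')"] gen_superset[of "N \<union> (B \<union> B')"] by auto
 qed
 then show ?thesis using B unfolding fdm_def by (intro exI[of _ "B \<union> B'"]) auto
qed

lemma fdm_Un:
 assumes "finite I" "\<And>i. i \<in> I ==> fdm N (V i)"
 shows "\<exists>B. finite B \<and> B \<subseteq> carrier G \<and> (\<forall>i\<in>I. V i \<subseteq> gen (N \<union> B))"
proof -
 obtain B where B: "\<And>i. i \<in> I ==> finite (B i) \<and> B i \<subseteq> carrier G \<and> V i \<subseteq> gen (N \<union> B i)"
  using assms(2) unfolding fdm_def by metis
 then show ?thesis using assms(1) gen_mono[of "N \<union> B i" "N \<union> (\<Union>i\<in>I. B i)" for i]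
  by (intro exI[of _ "\<Union>i\<in>I. B i"]) blast
qed

lemma fdm_inter_left:
 assumes "fdm Y N" "submod N" "submod Y"
 shows "fdm (N \<inter> Y) N"
proof -
 note N = submodD[OF assms(2)] and Y = submodD[OF assms(3)]
 obtain B where B: "finite B" "B \<subseteq> N" "N \<subseteq> gen (Y \<union> B)"
  using fdmE[OF assms(1,2)] Y by blast
 have BG: "B \<subseteq> carrier G" using B N by auto
 have "N \<subseteq> gen ((N \<inter> Y) \<union> B)"
 proof
  fix x assume x: "x \<in> N"
  then have "x \<in> Y <+>\<^bsub>G\<^esub> gen B" using B set_add_gen[OF assms(3) BG] by blast
  then obtain y b where yb: "x = y \<oplus>\<^bsub>G\<^esub> b" "y \<in> Y" "b \<in> gen B" by (auto simp: set_add_def')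
  have bX: "b \<in> N" using yb gen_least[OF assms(2) B(2)] by auto
  have "y = x \<ominus>\<^bsub>G\<^esub> b" using yb bX x N Y by (simp add: G.minus_eq G.a_assoc G.r_neg subset_iff)
  then have "y \<in> N \<inter> Y" using N(6)[OF x bX] yb by auto
  moreover have "submod (gen ((N \<inter> Y) \<union> B))" using N BG by (intro submod_gen) auto
  ultimately show "x \<in> gen ((N \<inter> Y) \<union> B)"
   using submodD(3) yb gen_superset[of "(N \<inter> Y) \<union> B"] gen_mono[of B "(N \<inter> Y) \<union> B"]
   by (auto simp: subset_iff)
 qed
 then show ?thesis using B BG unfolding fdm_def by blast
qed

lemma fdm_inter:
 assumes "fdm N V" "fdm Y V" "submod N" "submod Y" "N \<subseteq> V"
 shows "fdm (N \<inter> Y) V"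
 using fdm_trans[OF fdm_inter_left[OF fdm_mono[OF assms(2)]] assms(1)] assms submodD(1) by blast

end

locale linear_map = V: vec_act K V actV + W: vec_act K W actW
 for K :: "('r, 'x) ring_scheme" and V :: "('b, 'y) ring_scheme" and actV
  and W :: "('c, 'z) ring_scheme" and actW +
 fixes f :: "'b \<Rightarrow> 'c"
 assumes map_closed: "x \<in> carrier V ==> f x \<in> carrier W"
  and map_add: "x \<in> carrier V ==> y \<in> carrier V ==> f (x \<oplus>\<^bsub>V\<^esub> y) = f x \<oplus>\<^bsub>W\<^esub> f y"
  and map_act: "x \<in> carrier V ==> r \<in> carrier K ==> f (actV x r) = actW (f x) r"
begin

lemma map_zero: "f \<zero>\<^bsub>V\<^esub> = \<zero>\<^bsub>W\<^esub>"
 by (rule additive_map_zero[OF V.G.abelian_group_axioms W.G.abelian_group_axioms])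
   (auto intro: map_closed map_add)

lemma map_minus: "x \<in> carrier V ==> f (\<ominus>\<^bsub>V\<^esub> x) = \<ominus>\<^bsub>W\<^esub> f x"
 by (rule additive_map_minus[OF V.G.abelian_group_axioms W.G.abelian_group_axioms])
   (auto intro: map_closed map_add)

lemma submod_image: "V.submod N ==> W.submod (f ` N)"
 unfolding W.submod_def
proof (intro conjI ballI)
 assume "V.submod N"
 note N = V.submodD[OF this]
 show "f ` N \<subseteq> carrier W" using N map_closed by auto
 show "\<zero>\<^bsub>W\<^esub> \<in> f ` N" using N map_zero by (metis imageI)
 show "x \<oplus>\<^bsub>W\<^esub> y \<in> f ` N" if "x \<in> f ` N" "y \<in> f ` N" for x y
  using that N map_add by (auto simp: subset_iff image_iff) metis
 show "actW x r \<in> f ` N" if "x \<in> f ` N" "r \<in> carrier K" for x r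
  using that N map_act by (auto simp: subset_iff image_iff) metis
qed

lemma submod_vimage: "V.submod N ==> W.submod Y ==> V.submod {x \<in> N. f x \<in> Y}"
 using V.submodD[of N] W.submodD[of Y] map_zero map_add map_act
 unfolding V.submod_def by (auto simp: subset_iff)

lemma image_gen:
 assumes "N \<subseteq> carrier V" shows "f ` V.gen N \<subseteq> W.gen (f ` N)"
proof -
 have fX: "f ` N \<subseteq> carrier W" using assms map_closed by auto
 have "V.gen N \<subseteq> {x \<in> carrier V. f x \<in> W.gen (f ` N)}"
  by (intro V.gen_least submod_vimage V.submod_carrier W.submod_gen fX)
    (use assms W.gen_superset[of "f ` N"] in auto)
 then show ?thesis by auto
qed

lemma fdm_image: "V.fdm N Y ==> N \<subseteq> carrier V ==> W.fdm (f ` N) (f ` Y)"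
 unfolding V.fdm_def W.fdm_def
proof (elim exE conjE)
 fix B assume *: "finite B" "B \<subseteq> carrier V" "Y \<subseteq> V.gen (N \<union> B)" "N \<subseteq> carrier V"
 then have "f ` Y \<subseteq> W.gen (f ` N \<union> f ` B)"
  using image_gen[of "N \<union> B"] image_mono[of Y "V.gen (N \<union> B)" f] unfolding image_Un by simp
 then show "\<exists>B. finite B \<and> B \<subseteq> carrier W \<and> f ` Y \<subseteq> W.gen (f ` N \<union> B)"
  using * map_closed by (intro exI[of _ "f ` B"]) auto
qed

lemma fdm_vimage:
 assumes "W.fdm Y (f ` N)" "V.submod N" "W.submod Y"
 shows "V.fdm {x \<in> N. f x \<in> Y} N"
proof -
 note N = V.submodD[OF assms(2)] and Y = W.submodD[OF assms(3)]
 obtain B where B: "finite B" "B \<subseteq> f ` N" "f ` N \<subseteq> W.gen (Y \<union> B)"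
  using W.fdmE[OF assms(1) submod_image[OF assms(2)] Y(1)] by blast
 then obtain B' where B': "finite B'" "B' \<subseteq> N" "B = f ` B'"
  by (meson finite_subset_image)
 have B'V: "B' \<subseteq> carrier V" using B' N by auto
 let ?P = "{x \<in> N. f x \<in> Y}"
 have gen: "V.submod (V.gen (?P \<union> B'))" using B'V N by (intro V.submod_gen) auto
 have BW: "B \<subseteq> carrier W" using B'(3) B'V map_closed by auto
 have hB: "W.gen B \<subseteq> f ` V.gen B'"
  unfolding B'(3) by (intro W.gen_least submod_image V.submod_gen B'V image_mono V.gen_superset)
 have "N \<subseteq> V.gen (?P \<union> B')"
 proof
  fix x assume x: "x \<in> N"
  then have "f x \<in> Y <+>\<^bsub>W\<^esub> W.gen B" using B W.set_add_gen[OF assms(3) BW] by blast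
  then obtain y b where yb: "f x = y \<oplus>\<^bsub>W\<^esub> b" "y \<in> Y" "b \<in> W.gen B" by (auto simp: set_add_def')
  then obtain b' where b': "b = f b'" "b' \<in> V.gen B'" using hB by auto
  then have b'N: "b' \<in> N" using V.gen_least[OF assms(2) B'(2)] by auto
  have c: "x \<in> carrier V" "b' \<in> carrier V" "y \<in> carrier W" "b \<in> carrier W" using x b'N N yb Y b' map_closed by auto
  then have "f (x \<ominus>\<^bsub>V\<^esub> b') = y"
   using yb b' by (simp add: V.G.minus_eq map_add map_minus map_closed W.G.a_assoc W.G.r_neg)
  then have "x \<ominus>\<^bsub>V\<^esub> b' \<in> ?P" using yb N(6)[OF x b'N] by auto
  then have "(x \<ominus>\<^bsub>V\<^esub> b') \<oplus>\<^bsub>V\<^esub> b' \<in> V.gen (?P \<union> B')"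
   using V.submodD(3)[OF gen] V.gen_superset[of "?P \<union> B'"] b' V.gen_mono[of B' "?P \<union> B'"] by blast
  then show "x \<in> V.gen (?P \<union> B')" using c by (simp add: V.G.minus_eq V.G.a_assoc V.G.l_neg)
 qed
 then show ?thesis using B' B'V unfolding V.fdm_def by blast
qed

end

section \<open>Homogeneous components\<close>

lemma sum_of_subset:
 assumes "abelian_group G" "additive_subgroup V G" "\<And>j. D j \<subseteq> V" shows "sum_of G D \<subseteq> V"
proof
 fix x assume "x \<in> sum_of G D"
 then obtain J f where x: "x = (\<Oplus>\<^bsub>G\<^esub>j\<in>J. f j)" "f \<in> Pi J D" by (auto simp: sum_of_def)
 show "x \<in> V" unfolding x(1) by (rule finsum_in_additive_subgroup[OF assms(1,2)]) (use x(2) assms(3) in blast)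
qed

definition hcomp :: "('b, 'z) ring_scheme \<Rightarrow> ('g \<Rightarrow> 'b set) \<Rightarrow> 'g \<Rightarrow> 'b \<Rightarrow> 'b" where
 "hcomp G D g x = (THE f. (\<forall>g. f g \<in> D g) \<and> finite {g. f g \<noteq> \<zero>\<^bsub>G\<^esub>} \<and>
   x = (\<Oplus>\<^bsub>G\<^esub>g\<in>{g. f g \<noteq> \<zero>\<^bsub>G\<^esub>}. f g)) g"

definition part :: "('b, 'z) ring_scheme \<Rightarrow> ('g \<Rightarrow> 'b set) \<Rightarrow> 'g set \<Rightarrow> 'b \<Rightarrow> 'b" where
 "part G D H x = (\<Oplus>\<^bsub>G\<^esub>g\<in>{g \<in> H. hcomp G D g x \<noteq> \<zero>\<^bsub>G\<^esub>}. hcomp G D g x)"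

locale graded_group = abelian_group G for G :: "('b, 'z) ring_scheme" (structure) +
 fixes D :: "'g \<Rightarrow> 'b set"
 assumes decomp: "direct_sum_decomp G D"
begin

abbreviation "hc \<equiv> hcomp G D"

lemma D_subgroup: "additive_subgroup (D g) G"
 using decomp by (simp add: direct_sum_decomp_def)

lemmas D_closed = additive_subgroupD[OF abelian_group_axioms D_subgroup]

lemma D_carrier: "x \<in> D g ==> x \<in> carrier G"
 using D_closed(1) by blast

lemma hc_spec:
 assumes "x \<in> carrier G"
 shows "(\<forall>g. hc g x \<in> D g) \<and> finite {g. hc g x \<noteq> \<zero>} \<and> x = (\<Oplus>g\<in>{g. hc g x \<noteq> \<zero>}. hc g x)"
proof -
 have "\<exists>!f. (\<forall>g. f g \<in> D g) \<and> finite {g. f g \<noteq> \<zero>} \<and> x = (\<Oplus>g\<in>{g. f g \<noteq> \<zero>}. f g)"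
  using decomp assms by (simp add: direct_sum_decomp_def)
 from theI'[OF this] show ?thesis unfolding hcomp_def .
qed

lemma hc_in: "x \<in> carrier G ==> hc g x \<in> D g"
 and finite_support: "x \<in> carrier G ==> finite {g. hc g x \<noteq> \<zero>}"
 and sum_hc: "x \<in> carrier G ==> (\<Oplus>g\<in>{g. hc g x \<noteq> \<zero>}. hc g x) = x"
 using hc_spec by auto

lemma hc_closed [simp, intro]: "x \<in> carrier G ==> hc g x \<in> carrier G"
 using hc_in D_carrier by blast

lemma hc_unique:
 assumes f: "\<And>g. f g \<in> D g" "finite J" "\<And>g. g \<notin> J ==> f g = \<zero>" "x = (\<Oplus>g\<in>J. f g)"
 shows "hc g x = f g"
proof -
 have fc: "\<And>g. f g \<in> carrier G" using f D_carrier by blast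
 then have x: "x \<in> carrier G" using f by (auto intro!: finsum_closed)
 have sub: "{g. f g \<noteq> \<zero>} \<subseteq> J" using f by auto
 have "(\<Oplus>g\<in>{g. f g \<noteq> \<zero>}. f g) = (\<Oplus>g\<in>J. f g)"
  by (rule add.finprod_mono_neutral_cong_left[folded finsum_def]) (use f fc sub in auto)
 then have *: "(\<forall>g. f g \<in> D g) \<and> finite {g. f g \<noteq> \<zero>} \<and> x = (\<Oplus>g\<in>{g. f g \<noteq> \<zero>}. f g)"
  using f finite_subset[OF sub] by auto
 have "\<exists>!f. (\<forall>g. f g \<in> D g) \<and> finite {g. f g \<noteq> \<zero>} \<and> x = (\<Oplus>g\<in>{g. f g \<noteq> \<zero>}. f g)"
  using decomp x by (simp add: direct_sum_decomp_def)
 then obtain f0 where "\<And>h. (\<forall>g. h g \<in> D g) \<and> finite {g. h g \<noteq> \<zero>} \<and>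
   x = (\<Oplus>g\<in>{g. h g \<noteq> \<zero>}. h g) ==> h = f0"
  by (elim ex1E) (metis (no_types))
 from this[OF *] this[OF hc_spec[OF x]] have "f = (\<lambda>g. hc g x)" by simp
 then show ?thesis by simp
qed

lemma hc_homog: "x \<in> D h ==> hc g x = (if g = h then x else \<zero>)"
 by (rule hc_unique[of "\<lambda>g. if g = h then x else \<zero>" "{h}"])
   (auto simp: finsum_insert D_carrier D_closed(2))

lemma hc_zero [simp]: "hc g \<zero> = \<zero>"
 by (rule hc_unique[of "\<lambda>g. \<zero>" "{}"]) (auto simp: D_closed(2))

lemma sum_hc_superset:
 assumes "x \<in> carrier G" "finite J" "{g. hc g x \<noteq> \<zero>} \<subseteq> J"
 shows "x = (\<Oplus>g\<in>J. hc g x)"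
proof -
 have "(\<Oplus>g\<in>{g. hc g x \<noteq> \<zero>}. hc g x) = (\<Oplus>g\<in>J. hc g x)"
  by (rule add.finprod_mono_neutral_cong_left[folded finsum_def]) (use assms in auto)
 then show ?thesis by (simp add: sum_hc assms(1))
qed

lemma hc_add:
 assumes "x \<in> carrier G" "y \<in> carrier G"
 shows "hc g (x \<oplus> y) = hc g x \<oplus> hc g y"
proof -
 let ?J = "{g. hc g x \<noteq> \<zero>} \<union> {g. hc g y \<noteq> \<zero>}"
 have fin: "finite ?J" using finite_support assms by simp
 have "x \<oplus> y = (\<Oplus>g\<in>?J. hc g x) \<oplus> (\<Oplus>g\<in>?J. hc g y)"
  using sum_hc_superset[OF assms(1) fin] sum_hc_superset[OF assms(2) fin] by auto
 also have "\<dots> = (\<Oplus>g\<in>?J. hc g x \<oplus> hc g y)"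
  by (rule finsum_addf[symmetric]) (use assms in auto)
 finally show ?thesis
  by (intro hc_unique[OF _ fin]) (auto simp: D_closed(3) hc_in assms)
qed

lemma hc_minus: "x \<in> carrier G ==> hc g (\<ominus> x) = \<ominus> hc g x"
 by (rule additive_map_minus[OF abelian_group_axioms abelian_group_axioms]) (auto simp: hc_add)

lemma hc_diff: "x \<in> carrier G ==> y \<in> carrier G ==> hc g (x \<ominus> y) = hc g x \<ominus> hc g y"
 by (simp add: minus_eq hc_add hc_minus)

lemma mem_of_hc:
 assumes "x \<in> carrier G" "additive_subgroup H G" "\<And>g. hc g x \<in> H"
 shows "x \<in> H"
 using finsum_in_additive_subgroup[OF abelian_group_axioms assms(2), of "{g. hc g x \<noteq> \<zero>}" "\<lambda>g. hc g x"]
  assms by (simp add: sum_hc)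

lemma hc_ext:
 assumes "x \<in> carrier G" "y \<in> carrier G" "\<And>g. hc g x = hc g y"
 shows "x = y"
proof -
 have "(\<lambda>g. hc g x) = (\<lambda>g. hc g y)" using assms(3) by auto
 then have "(\<Oplus>g\<in>{g. hc g x \<noteq> \<zero>}. hc g x) = (\<Oplus>g\<in>{g. hc g y \<noteq> \<zero>}. hc g y)"
  by (rule arg_cong[where f = "\<lambda>u. \<Oplus>g\<in>{g. u g \<noteq> \<zero>}. u g"])
 then show ?thesis unfolding sum_hc[OF assms(1)] sum_hc[OF assms(2)] .
qed

lemma homogeneous_induct [consumes 1, case_names zero homog add]:
 assumes "x \<in> carrier G" "P \<zero>" "\<And>g y. y \<in> D g ==> P y"
  "\<And>y z. y \<in> carrier G ==> z \<in> carrier G ==> P y ==> P z ==> P (y \<oplus> z)"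
 shows "P x"
proof -
 have "P (\<Oplus>g\<in>J. hc g x)" if "finite J" for J
  using that
 proof (induction J)
  case (insert g J)
  then show ?case
   using assms(1) assms(3)[OF hc_in[OF assms(1)]]
   by (auto simp: finsum_insert Pi_def intro!: assms(4) finsum_closed)
 qed (simp add: assms)
 from this[OF finite_support[OF assms(1)]] show ?thesis by (simp add: sum_hc assms)
qed

lemma part_closed [simp, intro]: "x \<in> carrier G ==> part G D H x \<in> carrier G"
 unfolding part_def by (auto intro!: finsum_closed)

lemma hc_part:
 assumes "x \<in> carrier G"
 shows "hc g (part G D H x) = (if g \<in> H then hc g x else \<zero>)"
proof (rule hc_unique[of "\<lambda>g. if g \<in> H then hc g x else \<zero>" "{g \<in> H. hc g x \<noteq> \<zero>}"])
 show "finite {g \<in> H. hc g x \<noteq> \<zero>}" using finite_support[OF assms] by auto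
 show "part G D H x = (\<Oplus>g\<in>{g \<in> H. hc g x \<noteq> \<zero>}. if g \<in> H then hc g x else \<zero>)"
  unfolding part_def by (rule finsum_cong') (use assms in auto)
qed (auto simp: D_closed(2) hc_in assms)

lemma part_add: "x \<in> carrier G ==> y \<in> carrier G ==> part G D H (x \<oplus> y) = part G D H x \<oplus> part G D H y"
 by (rule hc_ext) (auto simp: hc_part hc_add)

lemma part_zero [simp]: "part G D H \<zero> = \<zero>"
 by (rule hc_ext) (auto simp: hc_part)

lemma part_homog: "x \<in> D g ==> part G D H x = (if g \<in> H then x else \<zero>)"
 by (rule hc_ext) (auto simp: hc_part hc_homog D_carrier)

lemma part_mem:
 assumes "x \<in> carrier G" "additive_subgroup V G" "\<And>g. g \<in> H ==> hc g x \<in> V"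
 shows "part G D H x \<in> V"
 by (rule mem_of_hc) (use assms additive_subgroupD[OF abelian_group_axioms assms(2)] in \<open>auto simp: hc_part\<close>)

lemma part_eq_self: "x \<in> carrier G ==> (\<And>g. g \<notin> H ==> hc g x = \<zero>) ==> part G D H x = x"
 by (rule hc_ext) (auto simp: hc_part)

lemma sum_of_components:
 "sum_of G (\<lambda>j. D (\<iota> j)) = {x \<in> carrier G. \<forall>g. g \<notin> range \<iota> \<longrightarrow> hc g x = \<zero>}" if "inj \<iota>"
proof
 show "sum_of G (\<lambda>j. D (\<iota> j)) \<subseteq> {x \<in> carrier G. \<forall>g. g \<notin> range \<iota> \<longrightarrow> hc g x = \<zero>}"
  by (rule sum_of_subset[OF abelian_group_axioms additive_subgroupI_closed[OF abelian_group_axioms]])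
    (auto simp: hc_add hc_minus hc_homog D_carrier)
next
 show "{x \<in> carrier G. \<forall>g. g \<notin> range \<iota> \<longrightarrow> hc g x = \<zero>} \<subseteq> sum_of G (\<lambda>j. D (\<iota> j))"
 proof (intro subsetI, elim CollectE conjE)
  fix x assume x: "x \<in> carrier G" "\<forall>g. g \<notin> range \<iota> \<longrightarrow> hc g x = \<zero>"
  let ?J = "{j. hc (\<iota> j) x \<noteq> \<zero>}"
  have im: "\<iota> ` ?J = {g. hc g x \<noteq> \<zero>}" using x(2) by force
  then have fin: "finite ?J"
   using finite_support[OF x(1)] finite_imageD[of \<iota> ?J] that by (simp add: inj_on_def)
  have "(\<Oplus>g\<in>\<iota> ` ?J. hc g x) = (\<Oplus>j\<in>?J. hc (\<iota> j) x)"
   by (rule finsum_reindex) (use x that in \<open>auto simp: inj_on_def\<close>)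
  then have "x = (\<Oplus>j\<in>?J. hc (\<iota> j) x)" using sum_hc[OF x(1)] im by simp
  then show "x \<in> sum_of G (\<lambda>j. D (\<iota> j))"
   unfolding sum_of_def using fin hc_in[OF x(1)] by blast
 qed
qed

end

text \<open>The difference of two decompositions of an element is a decomposition of \<open>0\<close>.\<close>

lemma direct_sum_decompI_independent:
 assumes G: "abelian_group G" and sub: "\<And>g. additive_subgroup (D g) G"
  and sum: "\<And>x. x \<in> carrier G ==> \<exists>J f. finite J \<and> f \<in> Pi J D \<and> x = (\<Oplus>\<^bsub>G\<^esub>g\<in>J. f g)"
  and ind: "\<And>J f g. finite J ==> (\<And>g. f g \<in> D g) ==> (\<Oplus>\<^bsub>G\<^esub>g\<in>J. f g) = \<zero>\<^bsub>G\<^esub> ==> g \<in> J ==> f g = \<zero>\<^bsub>G\<^esub>"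
 shows "direct_sum_decomp G D"
proof -
 interpret abelian_group G by fact
 note D = additive_subgroupD[OF G sub]
 show ?thesis
  unfolding direct_sum_decomp_def
 proof (intro conjI allI ballI sub)
  fix x assume "x \<in> carrier G"
  then obtain J f where f: "finite J" "f \<in> Pi J D" "x = (\<Oplus>\<^bsub>G\<^esub>g\<in>J. f g)" using sum by blast
  let ?f = "\<lambda>g. if g \<in> J then f g else \<zero>\<^bsub>G\<^esub>"
  have fc: "\<And>g. ?f g \<in> D g" using f D by auto
  then have fcc: "\<And>g. ?f g \<in> carrier G" using D by blast
  have "(\<Oplus>\<^bsub>G\<^esub>g\<in>{g. ?f g \<noteq> \<zero>\<^bsub>G\<^esub>}. ?f g) = (\<Oplus>\<^bsub>G\<^esub>g\<in>J. ?f g)"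
   by (rule add.finprod_mono_neutral_cong_left[folded finsum_def]) (use f fcc in auto)
  also have "\<dots> = x" unfolding f(3) by (rule finsum_cong') (use f fcc in \<open>auto dest: D(1)[THEN subsetD]\<close>)
  finally have fx: "x = (\<Oplus>\<^bsub>G\<^esub>g\<in>{g. ?f g \<noteq> \<zero>\<^bsub>G\<^esub>}. ?f g)" by simp
  show "\<exists>!f. (\<forall>g. f g \<in> D g) \<and> finite {g. f g \<noteq> \<zero>\<^bsub>G\<^esub>} \<and> x = (\<Oplus>\<^bsub>G\<^esub>g\<in>{g. f g \<noteq> \<zero>\<^bsub>G\<^esub>}. f g)"
  proof (rule ex1I[of _ ?f])
   show "(\<forall>g. ?f g \<in> D g) \<and> finite {g. ?f g \<noteq> \<zero>\<^bsub>G\<^esub>} \<and> x = (\<Oplus>\<^bsub>G\<^esub>g\<in>{g. ?f g \<noteq> \<zero>\<^bsub>G\<^esub>}. ?f g)"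
    using fx fc f(1) by (auto intro: finite_subset[of _ J])
  next
   fix h assume h: "(\<forall>g. h g \<in> D g) \<and> finite {g. h g \<noteq> \<zero>\<^bsub>G\<^esub>} \<and> x = (\<Oplus>\<^bsub>G\<^esub>g\<in>{g. h g \<noteq> \<zero>\<^bsub>G\<^esub>}. h g)"
   then have hc: "\<And>g. h g \<in> carrier G" using D(1) by blast
   let ?K = "J \<union> {g. h g \<noteq> \<zero>\<^bsub>G\<^esub>}"
   have K: "finite ?K" using f h by auto
   have "(\<Oplus>\<^bsub>G\<^esub>g\<in>?K. ?f g) = (\<Oplus>\<^bsub>G\<^esub>g\<in>J. ?f g)"
    by (rule add.finprod_mono_neutral_cong_right[folded finsum_def]) (use K fcc in auto)
   also have "\<dots> = x" by fact
   also have "x = (\<Oplus>\<^bsub>G\<^esub>g\<in>{g. h g \<noteq> \<zero>\<^bsub>G\<^esub>}. h g)" using h by auto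
   also have "\<dots> = (\<Oplus>\<^bsub>G\<^esub>g\<in>?K. h g)"
    by (rule add.finprod_mono_neutral_cong_left[folded finsum_def]) (use K hc in auto)
   finally have eq: "(\<Oplus>\<^bsub>G\<^esub>g\<in>?K. ?f g) = (\<Oplus>\<^bsub>G\<^esub>g\<in>?K. h g)" .
   have mm: "(\<Oplus>\<^bsub>G\<^esub>g\<in>?K. \<ominus>\<^bsub>G\<^esub> h g) = \<ominus>\<^bsub>G\<^esub> (\<Oplus>\<^bsub>G\<^esub>g\<in>?K. h g)"
    by (rule finsum_additive[OF G G, symmetric]) (use hc in \<open>auto simp: minus_add\<close>)
   have "(\<Oplus>\<^bsub>G\<^esub>g\<in>?K. ?f g \<oplus>\<^bsub>G\<^esub> \<ominus>\<^bsub>G\<^esub> h g) = (\<Oplus>\<^bsub>G\<^esub>g\<in>?K. ?f g) \<oplus>\<^bsub>G\<^esub> (\<Oplus>\<^bsub>G\<^esub>g\<in>?K. \<ominus>\<^bsub>G\<^esub> h g)"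
    by (rule finsum_addf) (use fcc hc in auto)
   also have "\<dots> = \<zero>\<^bsub>G\<^esub>" unfolding eq mm using hc by (auto intro!: r_neg finsum_closed)
   finally have z: "(\<Oplus>\<^bsub>G\<^esub>g\<in>?K. ?f g \<oplus>\<^bsub>G\<^esub> \<ominus>\<^bsub>G\<^esub> h g) = \<zero>\<^bsub>G\<^esub>" .
   have "?f g = h g" for g
   proof (cases "g \<in> ?K")
    case True
    have "?f g \<oplus>\<^bsub>G\<^esub> \<ominus>\<^bsub>G\<^esub> h g = \<zero>\<^bsub>G\<^esub>"
     by (rule ind[OF K _ z True]) (intro D(3) D(4) fc h[THEN conjunct1, rule_format])
    then show ?thesis by (rule eq_if_diff_zero[OF _ fcc hc])
   next
    case False
    then show ?thesis by auto
   qed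
   then show "h = ?f" by auto
  qed
 qed
qed

lemma direct_sum_decompI_projections:
 assumes G: "abelian_group G" and sub: "\<And>g. additive_subgroup (D g) G"
  and p: "\<And>g x. x \<in> carrier G ==> p g x \<in> D g"
   "\<And>g x y. x \<in> carrier G ==> y \<in> carrier G ==> p g (x \<oplus>\<^bsub>G\<^esub> y) = p g x \<oplus>\<^bsub>G\<^esub> p g y"
   "\<And>g h x. x \<in> D h ==> p g x = (if g = h then x else \<zero>\<^bsub>G\<^esub>)"
   "\<And>x. x \<in> carrier G ==> finite {g. p g x \<noteq> \<zero>\<^bsub>G\<^esub>}"
   "\<And>x. x \<in> carrier G ==> (\<And>g. p g x = \<zero>\<^bsub>G\<^esub>) ==> x = \<zero>\<^bsub>G\<^esub>"
 shows "direct_sum_decomp G D"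
proof (rule direct_sum_decompI_independent[OF G sub])
 interpret abelian_group G by fact
 note D = additive_subgroupD[OF G sub]
 have pc: "p g x \<in> carrier G" if "x \<in> carrier G" for g x using p(1)[OF that] D(1) by blast
 have psum: "p h (\<Oplus>\<^bsub>G\<^esub>g\<in>J. f g) = (if h \<in> J then f h else \<zero>\<^bsub>G\<^esub>)"
  if "finite J" "\<And>g. g \<in> J ==> f g \<in> D g" for J f h
 proof -
  have fc: "\<And>g. g \<in> J ==> f g \<in> carrier G" using that D(1) by blast
  have "p h (\<Oplus>\<^bsub>G\<^esub>g\<in>J. f g) = (\<Oplus>\<^bsub>G\<^esub>g\<in>J. p h (f g))"
   by (rule finsum_additive[OF G G]) (use fc p(2) pc in auto)
  also have "\<dots> = (\<Oplus>\<^bsub>G\<^esub>g\<in>J. if h = g then f g else \<zero>\<^bsub>G\<^esub>)"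
   by (rule finsum_cong') (use that fc p(3) in auto)
  also have "\<dots> = (if h \<in> J then f h else \<zero>\<^bsub>G\<^esub>)"
   using that(1) fc
  proof (induction J)
   case (insert a J)
   then show ?case by (subst finsum_insert) auto
  qed simp
  finally show ?thesis .
 qed
 show "f g = \<zero>\<^bsub>G\<^esub>" if "finite J" "\<And>g. f g \<in> D g" "(\<Oplus>\<^bsub>G\<^esub>g\<in>J. f g) = \<zero>\<^bsub>G\<^esub>" "g \<in> J" for J f g
  using psum[OF that(1), of f g] that p(3)[OF D(2), of g] by auto
 show "\<exists>J f. finite J \<and> f \<in> Pi J D \<and> x = (\<Oplus>\<^bsub>G\<^esub>g\<in>J. f g)" if x: "x \<in> carrier G" for x
 proof (intro exI conjI)
  let ?J = "{g. p g x \<noteq> \<zero>\<^bsub>G\<^esub>}" let ?y = "\<Oplus>\<^bsub>G\<^esub>g\<in>?J. p g x"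
  show fin: "finite ?J" using p(4) x .
  show "(\<lambda>g. p g x) \<in> Pi ?J D" using p(1) x by auto
  have y: "?y \<in> carrier G" using pc x by (auto intro!: finsum_closed)
  have py: "p h ?y = p h x" for h using psum[OF fin, of "\<lambda>g. p g x" h] p(1)[OF x] by auto
  have pm: "p h (\<ominus>\<^bsub>G\<^esub> ?y) = \<ominus>\<^bsub>G\<^esub> p h ?y" for h
   by (rule additive_map_minus[OF G G]) (use pc p(2) y in auto)
  have "x \<ominus>\<^bsub>G\<^esub> ?y = \<zero>\<^bsub>G\<^esub>"
   by (rule p(5)) (use x y p(2) pm py pc in \<open>auto simp: minus_eq r_neg\<close>)
  then show "x = ?y" using eq_if_diff_zero[OF _ x y] by (simp only: minus_eq)
 qed
qed

section \<open>Graded modules over a graded ring\<close>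

locale graded_ring = ring R for R :: "('k, 'g::ab_group_add, 'a) graded_alg" (structure) +
 assumes decomp_ring: "direct_sum_decomp R (acomp R)"
  and one_homog: "\<one> \<in> acomp R 0"
  and mult_homog: "x \<in> acomp R g ==> y \<in> acomp R h ==> x \<otimes> y \<in> acomp R (g + h)"

sublocale graded_ring \<subseteq> graded_group R "acomp R"
 by unfold_locales (rule decomp_ring)

locale gmod = R: graded_ring R + graded_group M "mcomp M"
 for R :: "('k, 'g::ab_group_add, 'a) graded_alg" and M :: "('g, 'a, 'm) graded_mod" (structure) +
 assumes gm: "graded_module R M"

lemma (in graded_ring) gmodI: "graded_module R M ==> gmod R M"
 by (intro gmod.intro graded_ring_axioms graded_group.intro graded_group_axioms.intro gmod_axioms.intro)
   (auto simp: graded_module_def)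

sublocale gmod \<subseteq> right_act R M "ract M"
 using gm unfolding graded_module_def by unfold_locales blast+

context gmod
begin

lemma act_homog: "x \<in> mcomp M g ==> s \<in> acomp R h ==> x \<bullet> s \<in> mcomp M (g + h)"
 using gm unfolding graded_module_def by blast

lemma hc_act:
 assumes "x \<in> carrier M" "s \<in> acomp R h"
 shows "hc (g + h) (x \<bullet> s) = hc g x \<bullet> s"
 using assms(1)
proof (induction rule: homogeneous_induct)
 case zero
 then show ?case using assms R.D_carrier by simp
next
 case (homog g' x)
 then show ?case using act_homog[OF homog assms(2)] R.D_carrier[OF assms(2)] by (simp add: hc_homog)
next
 case (add y z)
 then show ?case using R.D_carrier[OF assms(2)] by (simp add: act_add_left hc_add)
qed

abbreviation "gs U \<equiv> graded_submodule R M U"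

lemma gsI:
 assumes "U \<subseteq> carrier M" "\<zero> \<in> U" "\<And>x y. x \<in> U ==> y \<in> U ==> x \<oplus> y \<in> U"
  "\<And>x r. x \<in> U ==> r \<in> carrier R ==> x \<bullet> r \<in> U" "\<And>x g. x \<in> U ==> hc g x \<in> U"
 shows "gs U"
 unfolding graded_submodule_def
proof (intro conjI)
 have "submod U" using assms by (auto simp: submod_def)
 then show U: "additive_subgroup U M" "\<forall>x\<in>U. \<forall>s\<in>carrier R. x \<bullet> s \<in> U"
  using submod_iff by auto
 show "U = sum_of M (\<lambda>g. U \<inter> mcomp M g)"
 proof
  show "U \<subseteq> sum_of M (\<lambda>g. U \<inter> mcomp M g)"
  proof
   fix x assume x: "x \<in> U"
   then have xc: "x \<in> carrier M" using assms by auto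
   show "x \<in> sum_of M (\<lambda>g. U \<inter> mcomp M g)"
    unfolding sum_of_def
    by (intro CollectI exI[of _ "{g. hc g x \<noteq> \<zero>}"] exI[of _ "\<lambda>g. hc g x"] conjI)
      (use assms(5)[OF x] hc_in[OF xc] finite_support[OF xc] in \<open>auto simp: sum_hc[OF xc]\<close>)
  qed
  show "sum_of M (\<lambda>g. U \<inter> mcomp M g) \<subseteq> U"
   unfolding sum_of_def by (auto intro!: finsum_in_additive_subgroup[OF abelian_group_axioms U(1)])
 qed
qed

lemma gsD:
 assumes "gs U"
 shows "additive_subgroup U M" "U \<subseteq> carrier M" "\<zero> \<in> U" "\<And>x y. x \<in> U ==> y \<in> U ==> x \<oplus> y \<in> U"
  "\<And>x y. x \<in> U ==> y \<in> U ==> x \<ominus> y \<in> U" "\<And>x. x \<in> U ==> \<ominus> x \<in> U"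
  "\<And>x r. x \<in> U ==> r \<in> carrier R ==> x \<bullet> r \<in> U" "\<And>x g. x \<in> U ==> hc g x \<in> U"
  "\<And>x. x \<in> U ==> x \<in> carrier M" "submod U"
proof -
 show U: "additive_subgroup U M" and act: "\<And>x r. x \<in> U ==> r \<in> carrier R ==> x \<bullet> r \<in> U"
  using assms by (auto simp: graded_submodule_def)
 note * = additive_subgroupD[OF abelian_group_axioms U]
 show "U \<subseteq> carrier M" "\<zero> \<in> U" "\<And>x y. x \<in> U ==> y \<in> U ==> x \<oplus> y \<in> U"
  "\<And>x. x \<in> U ==> \<ominus> x \<in> U" "\<And>x y. x \<in> U ==> y \<in> U ==> x \<ominus> y \<in> U" by (rule *; assumption)+
 show "submod U" using submod_iff U act by auto
 show c: "\<And>x. x \<in> U ==> x \<in> carrier M" using * by auto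
 have V: "additive_subgroup {x \<in> carrier M. \<forall>g. hc g x \<in> U} M"
  by (rule additive_subgroupI_closed[OF abelian_group_axioms]) (auto simp: hc_add hc_minus *)
 have "sum_of M (\<lambda>g. U \<inter> mcomp M g) \<subseteq> {x \<in> carrier M. \<forall>g. hc g x \<in> U}"
  by (rule sum_of_subset[OF abelian_group_axioms V]) (auto simp: hc_homog * c)
 then show "\<And>x g. x \<in> U ==> hc g x \<in> U"
  using assms by (auto simp: graded_submodule_def)
qed

lemma gs_part: "gs U ==> x \<in> U ==> part M (mcomp M) H x \<in> U"
 by (rule part_mem) (auto simp: gsD)

lemma gs_carrier: "gs (carrier M)"
 by (rule gsI) auto

lemma gs_zero: "gs {\<zero>}"
 by (rule gsI) auto

lemma gs_inter: "gs U ==> gs V ==> gs (U \<inter> V)"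
 by (rule gsI) (auto simp: gsD)

lemma act_diff_left: "x \<in> carrier M ==> y \<in> carrier M ==> r \<in> carrier R ==> (x \<ominus> y) \<bullet> r = x \<bullet> r \<ominus> y \<bullet> r"
 by (simp add: minus_eq act_add_left act_minus_left)

lemma minus_swap: "x \<in> carrier M ==> y \<in> carrier M ==> \<ominus> (x \<ominus> y) = y \<ominus> x"
 by (simp add: minus_eq minus_add a_comm)

lemma diff_telescope: "x \<in> carrier M ==> y \<in> carrier M ==> z \<in> carrier M ==> (x \<ominus> y) \<oplus> (y \<ominus> z) = x \<ominus> z"
 by (simp add: minus_eq a_assoc r_neg1)

lemma diff_add_diff: "x \<in> carrier M ==> y \<in> carrier M ==> z \<in> carrier M ==> w \<in> carrier M ==>
  (x \<oplus> y) \<ominus> (z \<oplus> w) = (x \<ominus> z) \<oplus> (y \<ominus> w)"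
 by (simp add: minus_eq minus_add a_ac)

lemma diff_add_cancel: "x \<in> carrier M ==> y \<in> carrier M ==> (x \<ominus> y) \<oplus> y = x"
 by (simp add: minus_eq a_assoc l_neg)

lemma add_diff_cancel: "x \<in> carrier M ==> y \<in> carrier M ==> (x \<oplus> y) \<ominus> y = x"
 by (simp add: minus_eq a_assoc r_neg)

lemma diff_self [simp]: "x \<in> carrier M ==> x \<ominus> x = \<zero>"
 by (simp add: minus_eq r_neg)

lemma diff_eq_zero: "x \<in> carrier M ==> y \<in> carrier M ==> x \<ominus> y = \<zero> \<longleftrightarrow> x = y"
 using eq_if_diff_zero[of x y] by (auto simp: minus_eq r_neg)

lemma gs_diff_sym: "gs U ==> x \<ominus> y \<in> U ==> x \<in> carrier M ==> y \<in> carrier M ==> y \<ominus> x \<in> U"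
 using gsD(6)[of U "x \<ominus> y"] by (simp add: minus_swap)

lemma gs_diff_trans: "gs U ==> x \<ominus> y \<in> U ==> y \<ominus> z \<in> U ==> x \<in> carrier M ==> y \<in> carrier M ==>
  z \<in> carrier M ==> x \<ominus> z \<in> U"
 using gsD(4)[of U "x \<ominus> y" "y \<ominus> z"] by (simp add: diff_telescope)

subsection \<open>Cosets\<close>

lemma mem_coset_iff:
 assumes "gs U" "x \<in> carrier M"
 shows "y \<in> U +>\<^bsub>M\<^esub> x \<longleftrightarrow> y \<in> carrier M \<and> y \<ominus> x \<in> U"
proof
 assume "y \<in> U +>\<^bsub>M\<^esub> x"
 then obtain u where "u \<in> U" "y = u \<oplus> x" by (auto simp: a_r_coset_def')
 then show "y \<in> carrier M \<and> y \<ominus> x \<in> U" using gsD(9)[OF assms(1)] assms by (auto simp: add_diff_cancel)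
next
 assume "y \<in> carrier M \<and> y \<ominus> x \<in> U"
 then have "y = (y \<ominus> x) \<oplus> x" "y \<ominus> x \<in> U" using assms by (auto simp: diff_add_cancel)
 then show "y \<in> U +>\<^bsub>M\<^esub> x" unfolding a_r_coset_def' by blast
qed

lemma mem_own_coset: "gs U ==> x \<in> carrier M ==> x \<in> U +>\<^bsub>M\<^esub> x"
 by (simp add: mem_coset_iff gsD)

lemma coset_eq_iff:
 assumes "gs U" "x \<in> carrier M" "y \<in> carrier M"
 shows "U +>\<^bsub>M\<^esub> x = U +>\<^bsub>M\<^esub> y \<longleftrightarrow> x \<ominus> y \<in> U"
proof
 assume "U +>\<^bsub>M\<^esub> x = U +>\<^bsub>M\<^esub> y"
 then show "x \<ominus> y \<in> U" using mem_own_coset[OF assms(1,2)] mem_coset_iff[OF assms(1,3)] by simp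
next
 assume *: "x \<ominus> y \<in> U"
 show "U +>\<^bsub>M\<^esub> x = U +>\<^bsub>M\<^esub> y"
  using gs_diff_trans[OF assms(1) _ *] gs_diff_trans[OF assms(1) _ gs_diff_sym[OF assms(1) *]] assms
  by (auto simp: mem_coset_iff)
qed

lemma coset_zero: "gs U ==> U +>\<^bsub>M\<^esub> \<zero> = U"
 by (auto simp: mem_coset_iff gsD)

lemma coset_add:
 assumes "gs U" "x \<in> carrier M" "y \<in> carrier M"
 shows "(U +>\<^bsub>M\<^esub> x) <+>\<^bsub>M\<^esub> (U +>\<^bsub>M\<^esub> y) = U +>\<^bsub>M\<^esub> (x \<oplus> y)"
proof
 show "(U +>\<^bsub>M\<^esub> x) <+>\<^bsub>M\<^esub> (U +>\<^bsub>M\<^esub> y) \<subseteq> U +>\<^bsub>M\<^esub> (x \<oplus> y)"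
  using assms by (auto simp: set_add_def' mem_coset_iff diff_add_diff gsD)
 show "U +>\<^bsub>M\<^esub> (x \<oplus> y) \<subseteq> (U +>\<^bsub>M\<^esub> x) <+>\<^bsub>M\<^esub> (U +>\<^bsub>M\<^esub> y)"
 proof
  fix z assume "z \<in> U +>\<^bsub>M\<^esub> (x \<oplus> y)"
  then have z: "z \<in> carrier M" "z \<ominus> (x \<oplus> y) \<in> U" using assms by (auto simp: mem_coset_iff)
  have "z \<ominus> y \<ominus> x = z \<ominus> (x \<oplus> y)" using z assms by (simp add: minus_eq minus_add a_ac)
  then have "z \<ominus> y \<in> U +>\<^bsub>M\<^esub> x" using z assms by (simp add: mem_coset_iff)
  moreover have "z = (z \<ominus> y) \<oplus> y" using z assms by (simp add: diff_add_cancel)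
  ultimately show "z \<in> (U +>\<^bsub>M\<^esub> x) <+>\<^bsub>M\<^esub> (U +>\<^bsub>M\<^esub> y)"
   unfolding set_add_def' using mem_own_coset[OF assms(1,3)] by blast
 qed
qed

lemma coset_act:
 assumes "gs U" "x \<in> carrier M" "s \<in> carrier R"
 shows "(\<Union>z\<in>U +>\<^bsub>M\<^esub> x. U +>\<^bsub>M\<^esub> (z \<bullet> s)) = U +>\<^bsub>M\<^esub> (x \<bullet> s)"
proof -
 have "U +>\<^bsub>M\<^esub> (z \<bullet> s) = U +>\<^bsub>M\<^esub> (x \<bullet> s)" if "z \<in> U +>\<^bsub>M\<^esub> x" for z
  using that assms by (auto simp: mem_coset_iff coset_eq_iff act_diff_left[symmetric] gsD)
 then show ?thesis using mem_own_coset[OF assms(1,2)] by blast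
qed

lemma carrier_quot_mod: "carrier (quot_mod M U) = (\<lambda>x. U +>\<^bsub>M\<^esub> x) ` carrier M"
 by (auto simp: quot_mod_def A_RCOSETS_def' )

end

subsection \<open>Homomorphisms\<close>

lemma graded_homD:
 assumes "f \<in> graded_hom R M N"
 shows "\<And>x. x \<in> carrier M ==> f x \<in> carrier N"
  "\<And>x y. x \<in> carrier M ==> y \<in> carrier M ==> f (x \<oplus>\<^bsub>M\<^esub> y) = f x \<oplus>\<^bsub>N\<^esub> f y"
  "\<And>x s. x \<in> carrier M ==> s \<in> carrier R ==> f (x \<bullet>\<^bsub>M\<^esub> s) = f x \<bullet>\<^bsub>N\<^esub> s"
  "\<And>g x. x \<in> mcomp M g ==> f x \<in> mcomp N g"
  "f \<in> extensional (carrier M)"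
 using assms unfolding graded_hom_def by (auto simp: PiE_def image_subset_iff)

lemma graded_homI:
 assumes "\<And>x. x \<in> carrier M ==> f x \<in> carrier N"
  "\<And>x y. x \<in> carrier M ==> y \<in> carrier M ==> f (x \<oplus>\<^bsub>M\<^esub> y) = f x \<oplus>\<^bsub>N\<^esub> f y"
  "\<And>x s. x \<in> carrier M ==> s \<in> carrier R ==> f (x \<bullet>\<^bsub>M\<^esub> s) = f x \<bullet>\<^bsub>N\<^esub> s"
  "\<And>g x. x \<in> mcomp M g ==> f x \<in> mcomp N g"
  "f \<in> extensional (carrier M)"
 shows "f \<in> graded_hom R M N"
 using assms unfolding graded_hom_def by (auto simp: PiE_def)

locale ghom = M: gmod R M + N: gmod R N
 for R :: "('k, 'g::ab_group_add, 'a) graded_alg" and M :: "('g, 'a, 'm) graded_mod"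
  and N :: "('g, 'a, 'n) graded_mod" +
 fixes f :: "'m \<Rightarrow> 'n"
 assumes f: "f \<in> graded_hom R M N"
begin

lemmas hom_closed = graded_homD(1)[OF f]
 and hom_add = graded_homD(2)[OF f]
 and hom_act = graded_homD(3)[OF f]
 and hom_homog = graded_homD(4)[OF f]
 and hom_extensional = graded_homD(5)[OF f]

lemma hom_zero: "f \<zero>\<^bsub>M\<^esub> = \<zero>\<^bsub>N\<^esub>"
 by (rule additive_map_zero[OF M.abelian_group_axioms N.abelian_group_axioms]) (auto intro: hom_closed hom_add)

lemma hom_minus: "x \<in> carrier M ==> f (\<ominus>\<^bsub>M\<^esub> x) = \<ominus>\<^bsub>N\<^esub> f x"
 by (rule additive_map_minus[OF M.abelian_group_axioms N.abelian_group_axioms]) (auto intro: hom_closed hom_add)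

lemma hom_diff: "x \<in> carrier M ==> y \<in> carrier M ==> f (x \<ominus>\<^bsub>M\<^esub> y) = f x \<ominus>\<^bsub>N\<^esub> f y"
 by (simp add: M.minus_eq N.minus_eq hom_add hom_minus)

lemma hom_hc:
 assumes "x \<in> carrier M" shows "f (M.hc g x) = N.hc g (f x)"
 using assms
proof (induction rule: M.homogeneous_induct)
 case zero
 then show ?case by (simp add: hom_zero)
next
 case (homog h y)
 then show ?case using hom_homog[OF homog] by (simp add: M.hc_homog N.hc_homog hom_zero)
next
 case (add y z)
 then show ?case by (simp add: M.hc_add N.hc_add hom_add hom_closed)
qed

lemma hom_part: "x \<in> carrier M ==> f (part M (mcomp M) H x) = part N (mcomp N) H (f x)"
 by (rule N.hc_ext) (auto simp: hom_hc[symmetric] hom_closed M.hc_part N.hc_part hom_zero)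

end

lemma (in graded_ring) ghomI:
 "graded_module R M ==> graded_module R N ==> f \<in> graded_hom R M N ==> ghom R M N f"
 by (intro ghom.intro gmodI ghom_axioms.intro)

subsection \<open>Constructions of modules\<close>

text \<open>The image of \<open>M\<close> under a map \<open>q\<close>, whose fibres are to be the cosets of a graded submodule. For
  an injective \<open>q\<close> this is a copy of \<open>M\<close> in another type; if \<open>q\<close> selects representatives of cosets
  it is a copy of a quotient module.\<close>

definition img_mod :: "('m \<Rightarrow> 'n) \<Rightarrow> ('g, 'a, 'm) graded_mod \<Rightarrow> ('g, 'a, 'n) graded_mod" where
 "img_mod q M = \<lparr>carrier = q ` carrier M, monoid.mult = undefined, one = undefined,
   ring.zero = q \<zero>\<^bsub>M\<^esub>,
   add = (\<lambda>a b. q (inv_into (carrier M) q a \<oplus>\<^bsub>M\<^esub> inv_into (carrier M) q b)),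
   ract = (\<lambda>a s. q (inv_into (carrier M) q a \<bullet>\<^bsub>M\<^esub> s)),
   mcomp = (\<lambda>g. q ` mcomp M g)\<rparr>"

lemma sub_mod_simps [simp]:
 "carrier (sub_mod M U) = U" "add (sub_mod M U) = add M" "ring.zero (sub_mod M U) = ring.zero M"
 "ract (sub_mod M U) = ract M" "mcomp (sub_mod M U) g = U \<inter> mcomp M g"
 by (auto simp: sub_mod_def)

context gmod
begin

lemma img_mod:
 assumes U: "gs U" and q: "\<And>x y. x \<in> carrier M ==> y \<in> carrier M ==> q x = q y \<longleftrightarrow> x \<ominus> y \<in> U"
 shows "graded_module R (img_mod q M)" "restrict q (carrier M) \<in> graded_hom R M (img_mod q M)"
  "restrict q (carrier M) ` carrier M = carrier (img_mod q M)"
proof -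
 let ?Q = "img_mod q M" let ?r = "inv_into (carrier M) q"
 note G = gsD[OF U]
 have r: "?r (q x) \<in> carrier M" "q (?r (q x)) = q x" if "x \<in> carrier M" for x
  using that by (auto intro: inv_into_into f_inv_into_f)
 then have r': "?r (q x) \<ominus> x \<in> U" if "x \<in> carrier M" for x
  using that q[OF r(1)[OF that] that] by simp
 have Qadd: "q x \<oplus>\<^bsub>?Q\<^esub> q y = q (x \<oplus> y)" if "x \<in> carrier M" "y \<in> carrier M" for x y
  using that r' r G(4) by (auto simp: img_mod_def q diff_add_diff)
 have Qact: "q x \<bullet>\<^bsub>?Q\<^esub> s = q (x \<bullet> s)" if "x \<in> carrier M" "s \<in> carrier R" for x s
  using that r' r G(7) by (auto simp: img_mod_def q act_diff_left[symmetric])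
 have Qc: "carrier ?Q = q ` carrier M" and Qz: "\<zero>\<^bsub>?Q\<^esub> = q \<zero>" and Qm: "mcomp ?Q g = q ` mcomp M g" for g
  by (auto simp: img_mod_def)
 have Q: "abelian_group ?Q"
 proof (rule abelian_groupI)
  show "\<exists>y\<in>carrier ?Q. y \<oplus>\<^bsub>?Q\<^esub> x = \<zero>\<^bsub>?Q\<^esub>" if "x \<in> carrier ?Q" for x
   using that unfolding Qc Qz by (auto simp: Qadd l_neg intro!: bexI[of _ "\<ominus> _"])
 qed (auto simp: Qc Qz Qadd a_ac)
 then interpret Q: abelian_group ?Q .
 have Qneg: "\<ominus>\<^bsub>?Q\<^esub> q x = q (\<ominus> x)" if "x \<in> carrier M" for x
  by (rule Q.minus_equality) (use that in \<open>auto simp: Qadd Qz l_neg Qc\<close>)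
 have pq: "q (hc g (?r (q x))) = q (hc g x)" if "x \<in> carrier M" for g x
  using that r r' G(8) by (simp add: q hc_diff[symmetric])
 have dec: "direct_sum_decomp ?Q (mcomp ?Q)"
 proof (rule direct_sum_decompI_projections[OF Q, where p = "\<lambda>g a. q (hc g (?r a))"])
  show "additive_subgroup (mcomp ?Q g) ?Q" for g
  proof (rule additive_subgroupI_closed[OF Q])
   show "mcomp ?Q g \<subseteq> carrier ?Q" unfolding Qc Qm using D_closed(1) by auto
   show "\<zero>\<^bsub>?Q\<^esub> \<in> mcomp ?Q g" unfolding Qz Qm using D_closed(2) by auto
   show "x \<oplus>\<^bsub>?Q\<^esub> y \<in> mcomp ?Q g" if "x \<in> mcomp ?Q g" "y \<in> mcomp ?Q g" for x y
    using that unfolding Qm by (auto simp: Qadd D_carrier D_closed)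
   show "\<ominus>\<^bsub>?Q\<^esub> x \<in> mcomp ?Q g" if "x \<in> mcomp ?Q g" for x
    using that unfolding Qm by (auto simp: Qneg D_carrier D_closed)
  qed
  show "q (hc g (?r x)) \<in> mcomp ?Q g" if "x \<in> carrier ?Q" for g x
   using that unfolding Qc Qm by (auto simp: pq hc_in)
  show "q (hc g (?r (x \<oplus>\<^bsub>?Q\<^esub> y))) = q (hc g (?r x)) \<oplus>\<^bsub>?Q\<^esub> q (hc g (?r y))"
   if "x \<in> carrier ?Q" "y \<in> carrier ?Q" for g x y
   using that unfolding Qc by (auto simp: Qadd pq hc_add r)
  show "q (hc g (?r x)) = (if g = h then x else \<zero>\<^bsub>?Q\<^esub>)" if "x \<in> mcomp ?Q h" for g h x
   using that unfolding Qm Qz by (auto simp: pq hc_homog D_carrier)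
  show "finite {g. q (hc g (?r x)) \<noteq> \<zero>\<^bsub>?Q\<^esub>}" if "x \<in> carrier ?Q" for x
   using that unfolding Qc Qz
   by (auto simp: pq intro!: finite_subset[OF _ finite_support])
  show "x = \<zero>\<^bsub>?Q\<^esub>" if "x \<in> carrier ?Q" "\<And>g. q (hc g (?r x)) = \<zero>\<^bsub>?Q\<^esub>" for x
  proof -
   obtain y where y: "x = q y" "y \<in> carrier M" using \<open>x \<in> carrier ?Q\<close> unfolding Qc by blast
   then have "hc g y \<in> U" for g using that(2)[of g] by (simp add: Qz pq q)
   then have "y \<in> U" by (rule mem_of_hc[OF y(2) G(1)])
   then show ?thesis using y by (simp add: Qz q)
  qed
 qed
 show "graded_module R ?Q"
  unfolding graded_module_def
  by (intro conjI Q dec ballI allI)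
    (auto simp: Qc Qact Qadd Qm act_mult act_add_left act_add_right D_carrier R.D_carrier act_homog)
 show "restrict q (carrier M) \<in> graded_hom R M ?Q"
  by (rule graded_homI) (auto simp: Qc Qadd Qact Qm D_carrier)
 show "restrict q (carrier M) ` carrier M = carrier ?Q" by (auto simp: Qc)
qed

lemma sub_mod:
 assumes U: "gs U"
 shows "graded_module R (sub_mod M U)" "restrict (\<lambda>x. x) U \<in> graded_hom R (sub_mod M U) M"
proof -
 let ?Q = "sub_mod M U"
 note G = gsD[OF U]
 have Q: "abelian_group ?Q"
 proof (rule abelian_groupI)
  show "\<exists>y\<in>carrier ?Q. y \<oplus>\<^bsub>?Q\<^esub> x = \<zero>\<^bsub>?Q\<^esub>" if "x \<in> carrier ?Q" for x
   using that G(6,9) by (intro bexI[of _ "\<ominus> x"]) (auto simp: l_neg)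
 qed (auto simp: G a_ac)
 then interpret Q: abelian_group ?Q .
 have Qneg: "\<ominus>\<^bsub>?Q\<^esub> x = (\<ominus> x)" if "x \<in> U" for x
  by (rule Q.minus_equality) (use that G(6,9) in \<open>auto simp: l_neg\<close>)
 have dec: "direct_sum_decomp ?Q (mcomp ?Q)"
 proof (rule direct_sum_decompI_projections[OF Q, where p = "hc"])
  show "additive_subgroup (mcomp ?Q g) ?Q" for g
   by (rule additive_subgroupI_closed[OF Q]) (auto simp: G D_closed Qneg)
  show "finite {g. hc g x \<noteq> \<zero>\<^bsub>?Q\<^esub>}" if "x \<in> carrier ?Q" for x
   using that finite_support G by simp
  show "x = \<zero>\<^bsub>?Q\<^esub>" if "x \<in> carrier ?Q" "\<And>g. hc g x = \<zero>\<^bsub>?Q\<^esub>" for x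
   by (rule hc_ext) (use that G in simp_all)
 qed (use G in \<open>auto simp: hc_in hc_add hc_homog\<close>)
 show "graded_module R ?Q"
  unfolding graded_module_def
  by (intro conjI Q dec ballI allI)
    (auto simp: G act_mult act_add_left act_add_right D_carrier R.D_carrier act_homog)
 show "restrict (\<lambda>x. x) U \<in> graded_hom R ?Q M"
  by (rule graded_homI) (auto simp: G)
qed

end

text \<open>Partial homomorphisms from \<open>M\<close> to \<open>N\<close> are going to be submodules of the direct sum, so its
  elements are kept as pairs.\<close>

definition dsum :: "('g, 'a, 'm) graded_mod \<Rightarrow> ('g, 'a, 'n) graded_mod \<Rightarrow> ('g, 'a, 'm \<times> 'n) graded_mod" where
 "dsum M N = \<lparr>carrier = carrier M \<times> carrier N, monoid.mult = undefined, one = undefined,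
   ring.zero = (\<zero>\<^bsub>M\<^esub>, \<zero>\<^bsub>N\<^esub>),
   add = (\<lambda>p q. (fst p \<oplus>\<^bsub>M\<^esub> fst q, snd p \<oplus>\<^bsub>N\<^esub> snd q)),
   ract = (\<lambda>p s. (fst p \<bullet>\<^bsub>M\<^esub> s, snd p \<bullet>\<^bsub>N\<^esub> s)),
   mcomp = (\<lambda>g. mcomp M g \<times> mcomp N g)\<rparr>"

lemma dsum_simps [simp]:
 "carrier (dsum M N) = carrier M \<times> carrier N" "\<zero>\<^bsub>dsum M N\<^esub> = (\<zero>\<^bsub>M\<^esub>, \<zero>\<^bsub>N\<^esub>)"
 "p \<oplus>\<^bsub>dsum M N\<^esub> q = (fst p \<oplus>\<^bsub>M\<^esub> fst q, snd p \<oplus>\<^bsub>N\<^esub> snd q)"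
 "p \<bullet>\<^bsub>dsum M N\<^esub> s = (fst p \<bullet>\<^bsub>M\<^esub> s, snd p \<bullet>\<^bsub>N\<^esub> s)"
 "mcomp (dsum M N) g = mcomp M g \<times> mcomp N g"
 by (auto simp: dsum_def)

locale gmod2 = M: gmod R M + N: gmod R N
 for R :: "('k, 'g::ab_group_add, 'a) graded_alg" and M :: "('g, 'a, 'm) graded_mod"
  and N :: "('g, 'a, 'n) graded_mod"
begin

lemma dsum_graded_module: "graded_module R (dsum M N)"
proof -
 let ?Q = "dsum M N"
 have Q: "abelian_group ?Q"
 proof (rule abelian_groupI)
  show "\<exists>y\<in>carrier ?Q. y \<oplus>\<^bsub>?Q\<^esub> x = \<zero>\<^bsub>?Q\<^esub>" if "x \<in> carrier ?Q" for x
   using that by (auto simp: M.l_neg N.l_neg intro!: bexI[of _ "(\<ominus>\<^bsub>M\<^esub> fst x, \<ominus>\<^bsub>N\<^esub> snd x)"])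
 qed (auto simp: M.a_ac N.a_ac)
 then interpret Q: abelian_group ?Q .
 have Qneg: "\<ominus>\<^bsub>?Q\<^esub> p = (\<ominus>\<^bsub>M\<^esub> fst p, \<ominus>\<^bsub>N\<^esub> snd p)" if "p \<in> carrier ?Q" for p
  by (rule Q.minus_equality) (use that in \<open>auto simp: M.l_neg N.l_neg\<close>)
 have dec: "direct_sum_decomp ?Q (mcomp ?Q)"
 proof (rule direct_sum_decompI_projections[OF Q, where p = "\<lambda>g p. (M.hc g (fst p), N.hc g (snd p))"])
  show "additive_subgroup (mcomp ?Q g) ?Q" for g
  proof (rule additive_subgroupI_closed[OF Q])
   show s: "mcomp ?Q g \<subseteq> carrier ?Q" using M.D_closed(1) N.D_closed(1) by auto
   show "\<ominus>\<^bsub>?Q\<^esub> x \<in> mcomp ?Q g" if "x \<in> mcomp ?Q g" for x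
    using that s by (auto simp: Qneg M.D_closed(4) N.D_closed(4) M.D_carrier N.D_carrier)
  qed (auto simp: M.D_closed(2,3) N.D_closed(2,3))
  show "finite {g. (M.hc g (fst x), N.hc g (snd x)) \<noteq> \<zero>\<^bsub>?Q\<^esub>}" if "x \<in> carrier ?Q" for x
   by (rule finite_subset[of _ "{g. M.hc g (fst x) \<noteq> \<zero>\<^bsub>M\<^esub>} \<union> {g. N.hc g (snd x) \<noteq> \<zero>\<^bsub>N\<^esub>}"])
     (use that M.finite_support N.finite_support in auto)
  show "x = \<zero>\<^bsub>?Q\<^esub>" if x: "x \<in> carrier ?Q" "\<And>g. (M.hc g (fst x), N.hc g (snd x)) = \<zero>\<^bsub>?Q\<^esub>" for x
  proof -
   have "fst x = \<zero>\<^bsub>M\<^esub>" by (rule M.hc_ext) (use x in auto)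
   moreover have "snd x = \<zero>\<^bsub>N\<^esub>" by (rule N.hc_ext) (use x in auto)
   ultimately show ?thesis by (cases x) simp
  qed
 qed (auto simp: M.hc_in N.hc_in M.hc_add N.hc_add M.hc_homog N.hc_homog)
 show ?thesis
  unfolding graded_module_def
  by (intro conjI Q dec ballI allI)
    (auto simp: M.act_mult M.act_add_left M.act_add_right M.act_homog
     N.act_mult N.act_add_left N.act_add_right N.act_homog)
qed

lemma fst_hom: "restrict fst (carrier (dsum M N)) \<in> graded_hom R (dsum M N) M"
 by (rule graded_homI) (auto simp: M.D_carrier N.D_carrier)

lemma snd_hom: "restrict snd (carrier (dsum M N)) \<in> graded_hom R (dsum M N) N"
 by (rule graded_homI) (auto simp: M.D_carrier N.D_carrier)

end

sublocale gmod2 \<subseteq> P: gmod R "dsum M N"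
 by (rule M.R.gmodI[OF dsum_graded_module])

context gmod2
begin

lemma hc_dsum:
 assumes "p \<in> carrier (dsum M N)"
 shows "P.hc g p = (M.hc g (fst p), N.hc g (snd p))"
proof -
 interpret f: ghom R "dsum M N" M "restrict fst (carrier (dsum M N))"
  by (rule M.R.ghomI[OF P.gm M.gm fst_hom])
 interpret s: ghom R "dsum M N" N "restrict snd (carrier (dsum M N))"
  by (rule M.R.ghomI[OF P.gm N.gm snd_hom])
 have "P.hc g p \<in> carrier (dsum M N)" using P.hc_closed[OF assms] .
 then have "fst (P.hc g p) = M.hc g (fst p)" "snd (P.hc g p) = N.hc g (snd p)"
  using f.hom_hc[OF assms, of g] s.hom_hc[OF assms, of g] assms by auto
 then show ?thesis by (simp add: prod_eq_iff)
qed

lemma minus_dsum: "p \<in> carrier (dsum M N) ==> q \<in> carrier (dsum M N) ==>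
  p \<ominus>\<^bsub>dsum M N\<^esub> q = (fst p \<ominus>\<^bsub>M\<^esub> fst q, snd p \<ominus>\<^bsub>N\<^esub> snd q)"
proof -
 have "\<ominus>\<^bsub>dsum M N\<^esub> q = (\<ominus>\<^bsub>M\<^esub> fst q, \<ominus>\<^bsub>N\<^esub> snd q)" if "q \<in> carrier (dsum M N)" for q
  by (rule P.minus_equality) (use that in \<open>auto simp: M.l_neg N.l_neg\<close>)
 then show "q \<in> carrier (dsum M N) ==> ?thesis" by (simp add: P.minus_eq M.minus_eq N.minus_eq)
qed

end

text \<open>The ring as a module over itself; its graded submodules are the graded right ideals.\<close>

definition reg :: "('k, 'g, 'a) graded_alg \<Rightarrow> ('g, 'a, 'a) graded_mod" where
 "reg R = \<lparr>carrier = carrier R, monoid.mult = monoid.mult R, one = one R, ring.zero = ring.zero R,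
   add = add R, ract = monoid.mult R, mcomp = acomp R\<rparr>"

lemma reg_simps [simp]:
 "carrier (reg R) = carrier R" "add (reg R) = add R" "ring.zero (reg R) = ring.zero R"
 "ract (reg R) = monoid.mult R" "mcomp (reg R) = acomp R"
 by (auto simp: reg_def)

lemma finsum_reg: "finsum (reg R) = finsum R"
 by (intro ext) (simp add: finsum_def finprod_def reg_def)

lemma (in graded_ring) reg_graded_module: "graded_module R (reg R)"
proof -
 have Q: "abelian_group (reg R)"
 proof (rule abelian_groupI)
  show "\<exists>y\<in>carrier (reg R). y \<oplus>\<^bsub>reg R\<^esub> x = \<zero>\<^bsub>reg R\<^esub>" if "x \<in> carrier (reg R)" for x
   using that by (auto simp: l_neg intro!: bexI[of _ "\<ominus> x"])
 qed (auto simp: a_ac)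
 then interpret Q: abelian_group "reg R" .
 have neg: "\<ominus>\<^bsub>reg R\<^esub> x = \<ominus> x" if "x \<in> carrier R" for x
  by (rule Q.minus_equality) (use that in \<open>auto simp: l_neg\<close>)
 have "additive_subgroup (acomp R g) (reg R)" for g
  by (rule additive_subgroupI_closed[OF Q])
    (use D_closed(1) in \<open>auto simp: D_closed(2,3,4) neg D_carrier\<close>)
 then have "direct_sum_decomp (reg R) (mcomp (reg R))"
  using decomp_ring by (simp add: direct_sum_decomp_def finsum_reg)
 then show ?thesis
  unfolding graded_module_def
  by (intro conjI Q ballI allI) (auto simp: m_assoc l_distr r_distr mult_homog)
qed

sublocale graded_ring \<subseteq> reg: gmod R "reg R"
 by (rule gmodI[OF reg_graded_module])

lemma hcomp_reg: "hcomp (reg R) (acomp R) = hcomp R (acomp R)"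
 by (intro ext) (simp add: hcomp_def finsum_reg)

context gmod
begin

lemma act_hom_homog: "x \<in> mcomp M g ==> r \<in> carrier R ==> hc (g + h) (x \<bullet> r) = x \<bullet> R.hc h r"
proof (rotate_tac, induction r rule: R.homogeneous_induct)
 case zero
 then show ?case by (simp add: D_carrier)
next
 case (homog h' r)
 then show ?case using act_homog[OF homog(2,1)] by (simp add: hc_homog R.hc_homog D_carrier)
next
 case (add y z)
 then show ?case by (simp add: D_carrier act_add_right hc_add R.hc_add)
qed

text \<open>The class of \<open>x\<close> modulo \<open>U\<close> is torsion iff this right ideal is open.\<close>

lemma gs_conductor:
 assumes "gs U" "x \<in> mcomp M g"
 shows "R.reg.gs {r \<in> carrier R. x \<bullet> r \<in> U}"
proof (rule R.reg.gsI)
 note G = gsD[OF assms(1)] and x = D_carrier[OF assms(2)]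
 show "R.reg.hc h r \<in> {r \<in> carrier R. x \<bullet> r \<in> U}" if "r \<in> {r \<in> carrier R. x \<bullet> r \<in> U}" for r h
  using that G(8)[of "x \<bullet> r" "g + h"] act_hom_homog[OF assms(2), of r h] by (auto simp: hcomp_reg)
qed (use gsD[OF assms(1)] D_carrier[OF assms(2)] in \<open>auto simp: act_add_right act_mult\<close>)

end

lemma (in graded_ring) compose_hom:
 assumes M: "graded_module R M" and f: "f \<in> graded_hom R M N" and g: "g \<in> graded_hom R N P"
 shows "compose (carrier M) g f \<in> graded_hom R M P"
proof -
 interpret M: gmod R M by (rule gmodI[OF M])
 show ?thesis
  by (rule graded_homI)
    (auto simp: compose_def graded_homD(1,2,3,4)[OF f] graded_homD(1,2,3,4)[OF g] M.D_carrier)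
qed

section \<open>Gabriel topologies and saturated correspondences\<close>

text \<open>A Gabriel topology is used like a filter: a property holds for almost all ring elements if it
  holds on an open right ideal. The closure of \<open>U\<close> is the preimage of the torsion of \<open>M/U\<close>, so the
  closure of \<open>0\<close> is the torsion submodule.\<close>

definition almost :: "'a set set \<Rightarrow> ('a \<Rightarrow> bool) \<Rightarrow> bool" where
 "almost GG P \<longleftrightarrow> (\<exists>J\<in>GG. \<forall>s\<in>J. P s)"

definition cl :: "'a set set \<Rightarrow> ('g, 'a, 'm) graded_mod \<Rightarrow> 'm set \<Rightarrow> 'm set" where
 "cl GG M U = {x \<in> carrier M. almost GG (\<lambda>s. x \<bullet>\<^bsub>M\<^esub> s \<in> U)}"

abbreviation tor :: "'a set set \<Rightarrow> ('g, 'a, 'm) graded_mod \<Rightarrow> 'm set" where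
 "tor GG M \<equiv> cl GG M {\<zero>\<^bsub>M\<^esub>}"

text \<open>By the axiom on shifts, multiples of torsion elements are torsion. The last axiom makes extensions
  of torsion modules by torsion modules torsion.\<close>

locale gabriel = graded_ring R for R :: "('k, 'g::ab_group_add, 'a) graded_alg" (structure) +
 fixes GG :: "'a set set"
 assumes GG_ideal: "J \<in> GG ==> graded_submodule R (reg R) J"
  and GG_top: "carrier R \<in> GG"
  and GG_up: "J \<in> GG ==> graded_submodule R (reg R) J' ==> J \<subseteq> J' ==> J' \<in> GG"
  and GG_inter: "J \<in> GG ==> J' \<in> GG ==> J \<inter> J' \<in> GG"
  and GG_shift: "J \<in> GG ==> r \<in> acomp R h ==> {s \<in> carrier R. r \<otimes> s \<in> J} \<in> GG"
  and GG_trans: "J \<in> GG ==> graded_submodule R (reg R) J' ==>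
   (\<And>h a. a \<in> J ==> a \<in> acomp R h ==> {s \<in> carrier R. a \<otimes> s \<in> J'} \<in> GG) ==> J' \<in> GG"
begin

lemma GG_carrier: "J \<in> GG ==> J \<subseteq> carrier R"
 using reg.gsD(2)[OF GG_ideal] by simp

lemma almost_elim: "almost GG P ==> (\<And>s. s \<in> carrier R ==> P s ==> Q s) ==> almost GG Q"
 unfolding almost_def by (meson GG_carrier subsetD)

lemma almost_conj: "almost GG P ==> almost GG Q ==> almost GG (\<lambda>s. P s \<and> Q s)"
proof -
 assume "almost GG P" "almost GG Q"
 then obtain J J' where "J \<in> GG" "J' \<in> GG" "\<forall>s\<in>J. P s" "\<forall>s\<in>J'. Q s" unfolding almost_def by blast
 then show ?thesis unfolding almost_def by (intro bexI[OF _ GG_inter[of J J']]) auto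
qed

lemma almost_elim2: "almost GG P ==> almost GG Q ==>
  (\<And>s. s \<in> carrier R ==> P s ==> Q s ==> T s) ==> almost GG T"
 by (drule (1) almost_conj) (erule almost_elim, simp)

lemma almost_always: "(\<And>s. s \<in> carrier R ==> P s) ==> almost GG P"
 unfolding almost_def using GG_top by blast

lemma almost_True [simp]: "almost GG (\<lambda>s. True)"
 by (rule almost_always) simp

lemma almost_finite: "finite I ==> (\<And>i. i \<in> I ==> almost GG (P i)) ==> almost GG (\<lambda>s. \<forall>i\<in>I. P i s)"
 by (induction I rule: finite_induct) (auto intro: almost_conj)

end

locale gabriel_mod = G: gabriel R GG + gmod R M
 for R :: "('k, 'g::ab_group_add, 'a) graded_alg" and GG
  and M :: "('g, 'a, 'm) graded_mod" (structure)
begin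

lemma cl_mono: "U \<subseteq> V ==> cl GG M U \<subseteq> cl GG M V"
 unfolding cl_def by (auto elim: G.almost_elim)

lemma cl_superset: "gs U ==> U \<subseteq> cl GG M U"
 unfolding cl_def by (auto simp: gsD intro!: G.almost_always)

lemma cl_carrier: "x \<in> cl GG M U ==> x \<in> carrier M"
 by (simp add: cl_def)

text \<open>For homogeneous elements a single right ideal decides, as it is graded.\<close>

lemma almost_iff_conductor:
 assumes "gs U" "x \<in> mcomp M g"
 shows "almost GG (\<lambda>s. x \<bullet> s \<in> U) \<longleftrightarrow> {r \<in> carrier R. x \<bullet> r \<in> U} \<in> GG"
proof
 assume "almost GG (\<lambda>s. x \<bullet> s \<in> U)"
 then obtain J where J: "J \<in> GG" "\<forall>s\<in>J. x \<bullet> s \<in> U" by (auto simp: almost_def)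
 then show "{r \<in> carrier R. x \<bullet> r \<in> U} \<in> GG"
  by (intro G.GG_up[OF J(1) gs_conductor[OF assms]]) (use G.GG_carrier[OF J(1)] in auto)
next
 assume "{r \<in> carrier R. x \<bullet> r \<in> U} \<in> GG"
 then show "almost GG (\<lambda>s. x \<bullet> s \<in> U)"
  unfolding almost_def by (rule bexI[rotated]) simp
qed

lemma cl_add: "gs U ==> x \<in> cl GG M U ==> y \<in> cl GG M U ==> x \<oplus> y \<in> cl GG M U"
 unfolding cl_def by (auto simp: act_add_left gsD intro: G.almost_elim2[of "\<lambda>s. x \<bullet> s \<in> U" "\<lambda>s. y \<bullet> s \<in> U"])

lemma cl_hc:
 assumes U: "gs U" and x: "x \<in> cl GG M U" shows "hc g x \<in> cl GG M U"
proof -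
 obtain J where J: "J \<in> GG" "\<And>s. s \<in> J ==> x \<bullet> s \<in> U" and xc: "x \<in> carrier M"
  using x by (auto simp: almost_def cl_def)
 note gJ = G.reg.gsD[OF G.GG_ideal[OF J(1)]]
 have "hc g x \<bullet> s \<in> U" if s: "s \<in> J" for s
 proof -
  have sc: "s \<in> carrier R" using s gJ by auto
  have V: "additive_subgroup {s \<in> carrier R. hc g x \<bullet> s \<in> U} R"
   by (rule additive_subgroupI_closed[OF G.is_abelian_group])
     (auto simp: xc act_add_right act_minus_right gsD[OF U])
  have "G.hc h s \<in> {s \<in> carrier R. hc g x \<bullet> s \<in> U}" for h
  proof -
   have "x \<bullet> G.hc h s \<in> U" using J(2) gJ(8)[OF s, of h] by (simp add: hcomp_reg)
   from gsD(8)[OF U this, of "g + h"] show ?thesis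
    using sc by (simp add: hc_act[OF xc G.hc_in[OF sc]])
  qed
  from G.mem_of_hc[OF sc V this] show ?thesis by simp
 qed
 then show ?thesis using J(1) xc by (auto simp: cl_def almost_def)
qed

lemma cl_of_hc:
 assumes U: "gs U" and x: "x \<in> carrier M" "\<And>g. hc g x \<in> cl GG M U"
 shows "x \<in> cl GG M U"
proof -
 have "almost GG (\<lambda>s. \<forall>g\<in>{g. hc g x \<noteq> \<zero>}. hc g x \<bullet> s \<in> U)"
  by (rule G.almost_finite) (use x finite_support in \<open>auto simp: cl_def\<close>)
 moreover have "x \<bullet> s \<in> U" if s: "s \<in> carrier R" and *: "\<forall>g\<in>{g. hc g x \<noteq> \<zero>}. hc g x \<bullet> s \<in> U" for s
 proof -
  have V: "additive_subgroup {z \<in> carrier M. z \<bullet> s \<in> U} M"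
   by (rule additive_subgroupI_closed[OF abelian_group_axioms])
     (auto simp: s act_add_left act_minus_left gsD[OF U])
  have "hc g x \<in> {z \<in> carrier M. z \<bullet> s \<in> U}" for g
   using * x(1) s gsD(3)[OF U] by (cases "hc g x = \<zero>") auto
  from mem_of_hc[OF x(1) V this] show ?thesis by simp
 qed
 ultimately show ?thesis using x by (auto simp: cl_def elim: G.almost_elim)
qed

lemma cl_act:
 assumes U: "gs U" and x: "x \<in> cl GG M U" and r: "r \<in> carrier R" shows "x \<bullet> r \<in> cl GG M U"
proof -
 have xc: "x \<in> carrier M" using x by (simp add: cl_def)
 have hh: "hc g x \<bullet> a \<in> cl GG M U" if a: "a \<in> acomp R h" for g a h
 proof -
  have x': "hc g x \<in> mcomp M g" using hc_in[OF xc] .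
  have "{r \<in> carrier R. hc g x \<bullet> r \<in> U} \<in> GG"
   using cl_hc[OF U x, of g] almost_iff_conductor[OF U x'] by (simp add: cl_def)
  from G.GG_shift[OF this a] show ?thesis
   unfolding cl_def almost_def using xc a G.D_carrier[OF a]
   by (auto simp: act_mult intro!: bexI[of _ "{s \<in> carrier R. a \<otimes>\<^bsub>R\<^esub> s \<in> {r \<in> carrier R. hc g x \<bullet> r \<in> U}}"])
 qed
 have z: "\<zero> \<in> cl GG M U" using cl_superset[OF U] gsD(3)[OF U] by auto
 have hr: "hc g x \<bullet> r \<in> cl GG M U" for g
  using r
 proof (induction r rule: G.homogeneous_induct)
  case zero
  then show ?case using xc z by simp
 next
  case (homog h a)
  then show ?case by (rule hh)
 next
  case (add a b)
  then show ?case using xc by (simp add: act_add_right cl_add[OF U])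
 qed
 have "x \<in> {y \<in> carrier M. y \<bullet> r \<in> cl GG M U}"
 proof (rule mem_of_hc[OF xc])
  have m: "\<ominus> y \<in> cl GG M U" if "y \<in> cl GG M U" for y
   using that unfolding cl_def by (auto simp: act_minus_left gsD[OF U] elim!: G.almost_elim)
  show "additive_subgroup {y \<in> carrier M. y \<bullet> r \<in> cl GG M U} M"
   by (rule additive_subgroupI_closed[OF abelian_group_axioms])
     (auto simp: r act_add_left act_minus_left cl_add[OF U] z m)
 qed (use hr xc in auto)
 then show ?thesis by simp
qed

lemma gs_cl: "gs U ==> gs (cl GG M U)"
 using cl_superset[of U] gsD(3)[of U]
 by (intro gsI) (auto simp: cl_add cl_act cl_hc cl_carrier)

lemmas gs_tor = gs_cl[OF gs_zero]

lemma cl_part: "gs U ==> x \<in> cl GG M U ==> part M (mcomp M) H x \<in> cl GG M U"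
 by (rule gs_part[OF gs_cl])

text \<open>Transitivity of the topology: closures are closed, even if membership in the closure is only
  required after multiplication with almost all ring elements.\<close>

lemma almost_cl:
 assumes U: "gs U" and x: "x \<in> carrier M" and ax: "almost GG (\<lambda>s. x \<bullet> s \<in> cl GG M U)"
 shows "x \<in> cl GG M U"
proof (rule cl_of_hc[OF U x])
 fix g
 note C = gs_cl[OF U] and x' = hc_in[OF x, of g]
 have "x \<in> cl GG M (cl GG M U)" using x ax by (simp add: cl_def)
 from cl_hc[OF C this, of g] have "almost GG (\<lambda>s. hc g x \<bullet> s \<in> cl GG M U)" by (simp add: cl_def)
 then have J: "{r \<in> carrier R. hc g x \<bullet> r \<in> cl GG M U} \<in> GG" (is "?J \<in> GG")
  using almost_iff_conductor[OF C x'] by simp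
 have "{r \<in> carrier R. hc g x \<bullet> r \<in> U} \<in> GG"
 proof (rule G.GG_trans[OF J gs_conductor[OF U x']])
  fix h a assume a: "a \<in> ?J" "a \<in> acomp R h"
  then have "{r \<in> carrier R. hc g x \<bullet> a \<bullet> r \<in> U} \<in> GG"
   using almost_iff_conductor[OF U act_homog[OF x' a(2)]] by (simp add: cl_def)
  moreover have "{s \<in> carrier R. a \<otimes>\<^bsub>R\<^esub> s \<in> {r \<in> carrier R. hc g x \<bullet> r \<in> U}} = {r \<in> carrier R. hc g x \<bullet> a \<bullet> r \<in> U}"
   using x a(1) by (auto simp: act_mult)
  ultimately show "{s \<in> carrier R. a \<otimes>\<^bsub>R\<^esub> s \<in> {r \<in> carrier R. hc g x \<bullet> r \<in> U}} \<in> GG" by simp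
 qed
 then show "hc g x \<in> cl GG M U" using almost_iff_conductor[OF U x'] x by (simp add: cl_def)
qed

lemma cl_cl: "gs U ==> cl GG M (cl GG M U) = cl GG M U"
 using almost_cl cl_superset[OF gs_cl] by (auto simp: cl_def)

end

lemma (in gabriel) gabriel_modI: "graded_module R M ==> gabriel_mod R GG M"
 by (intro gabriel_mod.intro gabriel_axioms gmodI)

locale gabriel_mod2 = M: gabriel_mod R GG M + N: gabriel_mod R GG N
 for R :: "('k, 'g::ab_group_add, 'a) graded_alg" and GG
  and M :: "('g, 'a, 'm) graded_mod" and N :: "('g, 'a, 'n) graded_mod"

sublocale gabriel_mod2 \<subseteq> gmod2 R M N ..

sublocale gabriel_mod2 \<subseteq> P: gabriel_mod R GG "dsum M N"
 by (rule M.G.gabriel_modI[OF dsum_graded_module])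

lemma (in gabriel) gabriel_mod2I: "graded_module R M ==> graded_module R N ==> gabriel_mod2 R GG M N"
 by (intro gabriel_mod2.intro gabriel_modI)

lemma (in gabriel) hom_tor:
 assumes "graded_module R M" "graded_module R N" "f \<in> graded_hom R M N" "x \<in> tor GG M"
 shows "f x \<in> tor GG N"
proof -
 interpret ghom R M N f by (rule ghomI[OF assms(1-3)])
 show ?thesis using assms(4) unfolding cl_def
  by (auto simp: hom_closed hom_act[symmetric] hom_zero elim!: almost_elim)
qed

text \<open>A correspondence is the graph of a homomorphism \<open>U \<rightarrow> N/W\<close> with \<open>M/U\<close> and \<open>W\<close> torsion, seen as
  a submodule of \<open>M \<oplus> N\<close>. Every class of partial homomorphisms contains exactly one correspondence
  that is closed for the topology; it represents the morphism of the quotient category. Equalities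
  of morphisms thereby become inclusions of relations.\<close>

definition corr ::
 "('k, 'g, 'a) graded_alg \<Rightarrow> 'a set set \<Rightarrow> ('g, 'a, 'm) graded_mod \<Rightarrow> ('g, 'a, 'n) graded_mod \<Rightarrow>
   ('m \<times> 'n) set \<Rightarrow> bool" where
 "corr R GG M N \<Gamma> \<longleftrightarrow> graded_submodule R (dsum M N) \<Gamma> \<and> carrier M \<subseteq> cl GG M (Domain \<Gamma>) \<and>
   (\<forall>y. (\<zero>\<^bsub>M\<^esub>, y) \<in> \<Gamma> \<longrightarrow> y \<in> tor GG N)"

definition sat ::
 "('k, 'g, 'a) graded_alg \<Rightarrow> 'a set set \<Rightarrow> ('g, 'a, 'm) graded_mod \<Rightarrow> ('g, 'a, 'n) graded_mod \<Rightarrow>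
   ('m \<times> 'n) set set" where
 "sat R GG M N = {\<Gamma>. corr R GG M N \<Gamma> \<and> cl GG (dsum M N) \<Gamma> \<subseteq> \<Gamma>}"

context gabriel
begin

lemma relI:
 assumes "graded_module R M" "graded_module R N"
  and "\<And>x y. (x, y) \<in> \<Gamma> ==> x \<in> carrier M \<and> y \<in> carrier N" "(\<zero>\<^bsub>M\<^esub>, \<zero>\<^bsub>N\<^esub>) \<in> \<Gamma>"
  "\<And>x y x' y'. (x, y) \<in> \<Gamma> ==> (x', y') \<in> \<Gamma> ==> (x \<oplus>\<^bsub>M\<^esub> x', y \<oplus>\<^bsub>N\<^esub> y') \<in> \<Gamma>"
  "\<And>x y r. (x, y) \<in> \<Gamma> ==> r \<in> carrier R ==> (x \<bullet>\<^bsub>M\<^esub> r, y \<bullet>\<^bsub>N\<^esub> r) \<in> \<Gamma>"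
  "\<And>x y g. (x, y) \<in> \<Gamma> ==> (hcomp M (mcomp M) g x, hcomp N (mcomp N) g y) \<in> \<Gamma>"
 shows "graded_submodule R (dsum M N) \<Gamma>"
proof -
 interpret gabriel_mod2 R GG M N by (intro gabriel_mod2I assms)
 show ?thesis
 proof (rule P.gsI)
  show sub: "\<Gamma> \<subseteq> carrier (dsum M N)" using assms(3) by auto
  fix p g assume p: "p \<in> \<Gamma>"
  then show "P.hc g p \<in> \<Gamma>" using hc_dsum[of p g] sub assms(7)[of "fst p" "snd p" g] by auto
 qed (use assms in auto)
qed

lemma relD:
 assumes "graded_module R M" "graded_module R N" "graded_submodule R (dsum M N) \<Gamma>"
 shows "\<And>x y. (x, y) \<in> \<Gamma> ==> x \<in> carrier M" "\<And>x y. (x, y) \<in> \<Gamma> ==> y \<in> carrier N"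
  "(\<zero>\<^bsub>M\<^esub>, \<zero>\<^bsub>N\<^esub>) \<in> \<Gamma>"
  "\<And>x y x' y'. (x, y) \<in> \<Gamma> ==> (x', y') \<in> \<Gamma> ==> (x \<oplus>\<^bsub>M\<^esub> x', y \<oplus>\<^bsub>N\<^esub> y') \<in> \<Gamma>"
  "\<And>x y r. (x, y) \<in> \<Gamma> ==> r \<in> carrier R ==> (x \<bullet>\<^bsub>M\<^esub> r, y \<bullet>\<^bsub>N\<^esub> r) \<in> \<Gamma>"
  "\<And>x y g. (x, y) \<in> \<Gamma> ==> (hcomp M (mcomp M) g x, hcomp N (mcomp N) g y) \<in> \<Gamma>"
  "\<And>x y x' y'. (x, y) \<in> \<Gamma> ==> (x', y') \<in> \<Gamma> ==> (x \<ominus>\<^bsub>M\<^esub> x', y \<ominus>\<^bsub>N\<^esub> y') \<in> \<Gamma>"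
  "graded_submodule R M (Domain \<Gamma>)" "graded_submodule R N (Range \<Gamma>)"
  "graded_submodule R M {x. (x, \<zero>\<^bsub>N\<^esub>) \<in> \<Gamma>}" "graded_submodule R N {y. (\<zero>\<^bsub>M\<^esub>, y) \<in> \<Gamma>}"
proof -
 interpret gabriel_mod2 R GG M N by (intro gabriel_mod2I assms)
 note G = P.gsD[OF assms(3)]
 show c: "\<And>x y. (x, y) \<in> \<Gamma> ==> x \<in> carrier M" "\<And>x y. (x, y) \<in> \<Gamma> ==> y \<in> carrier N" using G(2) by auto
 show z: "(\<zero>\<^bsub>M\<^esub>, \<zero>\<^bsub>N\<^esub>) \<in> \<Gamma>" using G(3) by simp
 show add: "(x \<oplus>\<^bsub>M\<^esub> x', y \<oplus>\<^bsub>N\<^esub> y') \<in> \<Gamma>" if "(x, y) \<in> \<Gamma>" "(x', y') \<in> \<Gamma>" for x y x' y'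
  using G(4)[OF that] by simp
 show act: "(x \<bullet>\<^bsub>M\<^esub> r, y \<bullet>\<^bsub>N\<^esub> r) \<in> \<Gamma>" if "(x, y) \<in> \<Gamma>" "r \<in> carrier R" for x y r
  using G(7)[OF that] by simp
 show hc: "(M.hc g x, N.hc g y) \<in> \<Gamma>" if "(x, y) \<in> \<Gamma>" for x y g
  using G(8)[OF that, of g] hc_dsum[OF G(9)[OF that]] by simp
 show "(x \<ominus>\<^bsub>M\<^esub> x', y \<ominus>\<^bsub>N\<^esub> y') \<in> \<Gamma>" if "(x, y) \<in> \<Gamma>" "(x', y') \<in> \<Gamma>" for x y x' y'
  using G(5)[OF that] minus_dsum[OF G(9)[OF that(1)] G(9)[OF that(2)]] by simp
 show "M.gs (Domain \<Gamma>)"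
  by (rule M.gsI) (use c in blast, use z in blast, use add in blast, use act in blast, use hc in blast)
 show "N.gs (Range \<Gamma>)"
  by (rule N.gsI) (use c in blast, use z in blast, use add in blast, use act in blast, use hc in blast)
 show "M.gs {x. (x, \<zero>\<^bsub>N\<^esub>) \<in> \<Gamma>}"
  by (rule M.gsI) (use c z add[of _ "\<zero>\<^bsub>N\<^esub>" _ "\<zero>\<^bsub>N\<^esub>"] act[of _ "\<zero>\<^bsub>N\<^esub>"] hc[of _ "\<zero>\<^bsub>N\<^esub>"] in auto)
 show "N.gs {y. (\<zero>\<^bsub>M\<^esub>, y) \<in> \<Gamma>}"
  by (rule N.gsI) (use c z add[of "\<zero>\<^bsub>M\<^esub>" _ "\<zero>\<^bsub>M\<^esub>"] act[of "\<zero>\<^bsub>M\<^esub>"] hc[of "\<zero>\<^bsub>M\<^esub>"] in auto)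
qed

lemma corrD:
 assumes "graded_module R M" "graded_module R N" "corr R GG M N \<Gamma>"
 shows "graded_submodule R (dsum M N) \<Gamma>"
  "\<And>x. x \<in> carrier M ==> almost GG (\<lambda>s. \<exists>y\<in>carrier N. (x \<bullet>\<^bsub>M\<^esub> s, y) \<in> \<Gamma>)"
  "\<And>y. (\<zero>\<^bsub>M\<^esub>, y) \<in> \<Gamma> ==> y \<in> tor GG N"
  "\<And>x y y'. (x, y) \<in> \<Gamma> ==> (x, y') \<in> \<Gamma> ==> y \<ominus>\<^bsub>N\<^esub> y' \<in> tor GG N"
proof -
 interpret gabriel_mod2 R GG M N by (intro gabriel_mod2I assms)
 show g: "graded_submodule R (dsum M N) \<Gamma>" and t: "\<And>y. (\<zero>\<^bsub>M\<^esub>, y) \<in> \<Gamma> ==> y \<in> tor GG N"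
  using assms(3) by (auto simp: corr_def)
 note \<Gamma> = relD[OF assms(1,2) g]
 show "almost GG (\<lambda>s. \<exists>y\<in>carrier N. (x \<bullet>\<^bsub>M\<^esub> s, y) \<in> \<Gamma>)" if "x \<in> carrier M" for x
 proof -
  have "almost GG (\<lambda>s. x \<bullet>\<^bsub>M\<^esub> s \<in> Domain \<Gamma>)" using assms(3) that by (auto simp: corr_def cl_def)
  then show ?thesis by (rule almost_elim) (use \<Gamma>(2) in blast)
 qed
 show "y \<ominus>\<^bsub>N\<^esub> y' \<in> tor GG N" if "(x, y) \<in> \<Gamma>" "(x, y') \<in> \<Gamma>" for x y y'
  using \<Gamma>(7)[OF that] t \<Gamma>(1)[OF that(1)] by simp
qed

lemma corrI:
 assumes "graded_module R M" "graded_module R N" "graded_submodule R (dsum M N) \<Gamma>"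
  and "\<And>x. x \<in> carrier M ==> x \<in> cl GG M (Domain \<Gamma>)"
  and "\<And>y. (\<zero>\<^bsub>M\<^esub>, y) \<in> \<Gamma> ==> y \<in> carrier N ==> y \<in> tor GG N"
 shows "corr R GG M N \<Gamma>"
 using assms relD(2)[OF assms(1-3)] by (auto simp: corr_def)

lemma cl_in_sat:
 assumes "graded_module R M" "graded_module R N" "corr R GG M N \<Gamma>"
 shows "cl GG (dsum M N) \<Gamma> \<in> sat R GG M N" "\<Gamma> \<subseteq> cl GG (dsum M N) \<Gamma>"
proof -
 interpret gabriel_mod2 R GG M N by (intro gabriel_mod2I assms)
 note D = corrD[OF assms] and rD = relD[OF assms(1,2) corrD(1)[OF assms]]
 show sub: "\<Gamma> \<subseteq> cl GG (dsum M N) \<Gamma>" by (rule P.cl_superset[OF D(1)])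
 have "corr R GG M N (cl GG (dsum M N) \<Gamma>)"
 proof (rule corrI[OF assms(1,2) P.gs_cl[OF D(1)]])
  show "x \<in> cl GG M (Domain (cl GG (dsum M N) \<Gamma>))" if "x \<in> carrier M" for x
   using assms(3) that M.cl_mono[OF Domain_mono[OF sub]] by (auto simp: corr_def)
  fix y assume "(\<zero>\<^bsub>M\<^esub>, y) \<in> cl GG (dsum M N) \<Gamma>" "y \<in> carrier N"
  then have "almost GG (\<lambda>s. y \<bullet>\<^bsub>N\<^esub> s \<in> tor GG N)"
   using D(3) by (auto simp: cl_def elim!: almost_elim)
  then show "y \<in> tor GG N" using \<open>y \<in> carrier N\<close> N.almost_cl[OF N.gs_zero] by simp
 qed
 then show "cl GG (dsum M N) \<Gamma> \<in> sat R GG M N"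
  using P.cl_cl[OF D(1)] by (simp add: sat_def)
qed

lemma satD:
 assumes "graded_module R M" "graded_module R N" "\<Gamma> \<in> sat R GG M N"
 shows "corr R GG M N \<Gamma>" "graded_submodule R (dsum M N) \<Gamma>"
  "\<And>x y. x \<in> carrier M ==> y \<in> carrier N ==> almost GG (\<lambda>s. (x \<bullet>\<^bsub>M\<^esub> s, y \<bullet>\<^bsub>N\<^esub> s) \<in> \<Gamma>) ==> (x, y) \<in> \<Gamma>"
  "\<And>y. y \<in> tor GG N ==> (\<zero>\<^bsub>M\<^esub>, y) \<in> \<Gamma>"
  "\<And>x y y'. (x, y) \<in> \<Gamma> ==> y' \<in> carrier N ==> y' \<ominus>\<^bsub>N\<^esub> y \<in> tor GG N ==> (x, y') \<in> \<Gamma>"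
  "\<And>x y. x \<in> tor GG M ==> (x, y) \<in> \<Gamma> ==> y \<in> tor GG N"
  "\<And>x. x \<in> tor GG M ==> (x, \<zero>\<^bsub>N\<^esub>) \<in> \<Gamma>"
proof -
 interpret gabriel_mod2 R GG M N by (intro gabriel_mod2I assms)
 show c: "corr R GG M N \<Gamma>" using assms(3) by (simp add: sat_def)
 note D = corrD[OF assms(1,2) c]
 show "graded_submodule R (dsum M N) \<Gamma>" by (rule D(1))
 note rD = relD[OF assms(1,2) D(1)]
 show s: "(x, y) \<in> \<Gamma>" if "x \<in> carrier M" "y \<in> carrier N" "almost GG (\<lambda>s. (x \<bullet>\<^bsub>M\<^esub> s, y \<bullet>\<^bsub>N\<^esub> s) \<in> \<Gamma>)" for x y
 proof -
  have "(x, y) \<in> cl GG (dsum M N) \<Gamma>" using that by (simp add: cl_def)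
  then show ?thesis using assms(3) by (auto simp: sat_def)
 qed
 show z: "(\<zero>\<^bsub>M\<^esub>, y) \<in> \<Gamma>" if "y \<in> tor GG N" for y
  by (rule s) (use that rD(3) in \<open>auto simp: cl_def elim!: almost_elim\<close>)
 show "(x, y') \<in> \<Gamma>" if "(x, y) \<in> \<Gamma>" "y' \<in> carrier N" "y' \<ominus>\<^bsub>N\<^esub> y \<in> tor GG N" for x y y'
  using rD(4)[OF z[OF that(3)] that(1)] rD(1,2)[OF that(1)] that(2) by (simp add: N.diff_add_cancel)
 show "y \<in> tor GG N" if "x \<in> tor GG M" "(x, y) \<in> \<Gamma>" for x y
 proof (rule N.almost_cl[OF N.gs_zero rD(2)[OF that(2)]])
  have "almost GG (\<lambda>s. x \<bullet>\<^bsub>M\<^esub> s = \<zero>\<^bsub>M\<^esub>)" using that by (simp add: cl_def)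
  then show "almost GG (\<lambda>s. y \<bullet>\<^bsub>N\<^esub> s \<in> tor GG N)"
   by (rule almost_elim) (use rD(5)[OF that(2)] D(3) in metis)
 qed
 show "(x, \<zero>\<^bsub>N\<^esub>) \<in> \<Gamma>" if "x \<in> tor GG M" for x
  by (rule s) (use that rD(3) in \<open>auto simp: cl_def elim!: almost_elim\<close>)
qed

lemma satI:
 assumes "graded_module R M" "graded_module R N" "graded_submodule R (dsum M N) \<Gamma>"
  and "\<And>x. x \<in> carrier M ==> x \<in> cl GG M (Domain \<Gamma>)"
  and "\<And>y. (\<zero>\<^bsub>M\<^esub>, y) \<in> \<Gamma> ==> y \<in> carrier N ==> y \<in> tor GG N"
  and "\<And>x y. x \<in> carrier M ==> y \<in> carrier N ==> almost GG (\<lambda>s. (x \<bullet>\<^bsub>M\<^esub> s, y \<bullet>\<^bsub>N\<^esub> s) \<in> \<Gamma>) ==> (x, y) \<in> \<Gamma>"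
 shows "\<Gamma> \<in> sat R GG M N"
 using corrI[OF assms(1-5)] assms(6) by (auto simp: sat_def cl_def)

text \<open>Two elements of \<open>N\<close> that correspond to the same element of \<open>M\<close> differ by torsion. Hence a closed
  correspondence is determined by any correspondence that it contains.\<close>

lemma cl_eq_sat:
 assumes "graded_module R M" "graded_module R N" "corr R GG M N \<Gamma>" "\<Gamma>' \<in> sat R GG M N" "\<Gamma> \<subseteq> \<Gamma>'"
 shows "cl GG (dsum M N) \<Gamma> = \<Gamma>'"
proof
 interpret gabriel_mod2 R GG M N by (intro gabriel_mod2I assms)
 show "cl GG (dsum M N) \<Gamma> \<subseteq> \<Gamma>'" using P.cl_mono[OF assms(5)] assms(4) by (auto simp: sat_def)
 note C = cl_in_sat[OF assms(1-3)]
 note S = satD[OF assms(1,2) C(1)] and S' = satD[OF assms(1,2,4)]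
 note r' = relD[OF assms(1,2) S'(2)]
 show "\<Gamma>' \<subseteq> cl GG (dsum M N) \<Gamma>"
 proof (intro subrelI S(3))
  fix x y assume xy: "(x, y) \<in> \<Gamma>'"
  show x: "x \<in> carrier M" and y: "y \<in> carrier N" using r'(1,2)[OF xy] .
  from corrD(2)[OF assms(1-3) x]
  show "almost GG (\<lambda>s. (x \<bullet>\<^bsub>M\<^esub> s, y \<bullet>\<^bsub>N\<^esub> s) \<in> cl GG (dsum M N) \<Gamma>)"
  proof (rule almost_elim)
   fix s assume s: "s \<in> carrier R" and "\<exists>y'\<in>carrier N. (x \<bullet>\<^bsub>M\<^esub> s, y') \<in> \<Gamma>"
   then obtain y' where y': "(x \<bullet>\<^bsub>M\<^esub> s, y') \<in> \<Gamma>" by auto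
   show "(x \<bullet>\<^bsub>M\<^esub> s, y \<bullet>\<^bsub>N\<^esub> s) \<in> cl GG (dsum M N) \<Gamma>"
    by (rule S(5)[of _ y'])
      (use C(2) y' y s corrD(4)[OF assms(1,2) S'(1) r'(5)[OF xy s]] assms(5) in auto)
  qed
 qed
qed

lemma sat_eqI:
 assumes "graded_module R M" "graded_module R N" "\<Gamma> \<in> sat R GG M N" "\<Gamma>' \<in> sat R GG M N" "\<Gamma> \<subseteq> \<Gamma>'"
 shows "\<Gamma> = \<Gamma>'"
 using cl_eq_sat[OF assms(1,2) _ assms(4,5)] cl_eq_sat[OF assms(1,2) _ assms(3), of \<Gamma>] satD(1)[OF assms(1-3)]
 by blast

lemma rel_comp:
 assumes "graded_module R M" "graded_module R N" "graded_module R P"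
  and "graded_submodule R (dsum M N) \<Gamma>" "graded_submodule R (dsum N P) \<Delta>"
 shows "graded_submodule R (dsum M P) (\<Gamma> O \<Delta>)"
proof (rule relI[OF assms(1,3)])
 note rC = relD[OF assms(1,2,4)] and rD = relD[OF assms(2,3,5)]
 show "x \<in> carrier M \<and> y \<in> carrier P" if "(x, y) \<in> \<Gamma> O \<Delta>" for x y
  using that rC(1) rD(2) by auto
 show "(\<zero>\<^bsub>M\<^esub>, \<zero>\<^bsub>P\<^esub>) \<in> \<Gamma> O \<Delta>" using rC(3) rD(3) by auto
 show "(x \<oplus>\<^bsub>M\<^esub> x', y \<oplus>\<^bsub>P\<^esub> y') \<in> \<Gamma> O \<Delta>" if "(x, y) \<in> \<Gamma> O \<Delta>" "(x', y') \<in> \<Gamma> O \<Delta>" for x y x' y'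
  using that rC(4) rD(4) by (elim relcompE) (auto intro!: relcompI)
 show "(x \<bullet>\<^bsub>M\<^esub> r, y \<bullet>\<^bsub>P\<^esub> r) \<in> \<Gamma> O \<Delta>" if "(x, y) \<in> \<Gamma> O \<Delta>" "r \<in> carrier R" for x y r
  using that rC(5) rD(5) by (elim relcompE) (auto intro!: relcompI)
 show "(hcomp M (mcomp M) g x, hcomp P (mcomp P) g y) \<in> \<Gamma> O \<Delta>" if "(x, y) \<in> \<Gamma> O \<Delta>" for x y g
  using that rC(6) rD(6) by (elim relcompE) (auto intro!: relcompI)
qed

lemma rel_converse:
 assumes "graded_module R V" "graded_module R Y" "graded_submodule R (dsum V Y) i"
 shows "graded_submodule R (dsum Y V) (i\<inverse>)"
 by (rule relI[OF assms(2,1)]) (auto simp: relD[OF assms])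

lemma corr_comp:
 assumes "graded_module R M" "graded_module R N" "graded_module R P"
  and "corr R GG M N \<Gamma>" "corr R GG N P \<Delta>"
 shows "corr R GG M P (\<Gamma> O \<Delta>)"
proof -
 interpret GM: gabriel_mod R GG M by (rule gabriel_modI[OF assms(1)])
 interpret GP: gabriel_mod R GG P by (rule gabriel_modI[OF assms(3)])
 note C = corrD[OF assms(1,2,4)] and D = corrD[OF assms(2,3,5)]
 note rC = relD[OF assms(1,2) C(1)] and rD = relD[OF assms(2,3) D(1)]
 note g = rel_comp[OF assms(1-3) C(1) D(1)]
 show ?thesis
 proof (rule corrI[OF assms(1,3) g])
  note gD = relD(8)[OF assms(1,3) g]
  show "x \<in> cl GG M (Domain (\<Gamma> O \<Delta>))" if x: "x \<in> carrier M" for x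
  proof (rule GM.almost_cl[OF gD x])
   show "almost GG (\<lambda>s. x \<bullet>\<^bsub>M\<^esub> s \<in> cl GG M (Domain (\<Gamma> O \<Delta>)))"
    using C(2)[OF x]
   proof (rule almost_elim)
    fix s assume s: "s \<in> carrier R" and "\<exists>y\<in>carrier N. (x \<bullet>\<^bsub>M\<^esub> s, y) \<in> \<Gamma>"
    then obtain y where y: "y \<in> carrier N" "(x \<bullet>\<^bsub>M\<^esub> s, y) \<in> \<Gamma>" by auto
    from D(2)[OF y(1)] have "almost GG (\<lambda>t. x \<bullet>\<^bsub>M\<^esub> s \<bullet>\<^bsub>M\<^esub> t \<in> Domain (\<Gamma> O \<Delta>))"
     by (rule almost_elim) (use rC(5)[OF y(2)] in blast)
    then show "x \<bullet>\<^bsub>M\<^esub> s \<in> cl GG M (Domain (\<Gamma> O \<Delta>))" using x s by (simp add: cl_def)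
   qed
  qed
  fix z assume "(\<zero>\<^bsub>M\<^esub>, z) \<in> \<Gamma> O \<Delta>" and z: "z \<in> carrier P"
  then obtain y where y: "(\<zero>\<^bsub>M\<^esub>, y) \<in> \<Gamma>" "(y, z) \<in> \<Delta>" by auto
  show "z \<in> tor GG P"
  proof (rule GP.almost_cl[OF GP.gs_zero z])
   have "almost GG (\<lambda>s. y \<bullet>\<^bsub>N\<^esub> s = \<zero>\<^bsub>N\<^esub>)" using C(3)[OF y(1)] by (simp add: cl_def)
   then show "almost GG (\<lambda>s. z \<bullet>\<^bsub>P\<^esub> s \<in> tor GG P)"
    by (rule almost_elim) (use D(3) rD(5)[OF y(2)] in metis)
  qed
 qed
qed

text \<open>Composites up to closure may be computed from arbitrary correspondences with the given closures. In
  particular composition up to closure is associative.\<close>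

lemma cl_corr_comp_cl:
 assumes "graded_module R M" "graded_module R N" "graded_module R P"
  and "corr R GG M N \<Gamma>" "corr R GG N P \<Delta>"
 shows "cl GG (dsum M P) (\<Gamma> O \<Delta>) = cl GG (dsum M P) (cl GG (dsum M N) \<Gamma> O cl GG (dsum N P) \<Delta>)"
proof (rule cl_eq_sat[OF assms(1,3) corr_comp[OF assms]])
 let ?\<Gamma> = "cl GG (dsum M N) \<Gamma>" let ?\<Delta> = "cl GG (dsum N P) \<Delta>"
 note C = cl_in_sat[OF assms(1,2,4)] and D = cl_in_sat[OF assms(2,3,5)]
 note CD = cl_in_sat[OF assms(1,3) corr_comp[OF assms(1-3) satD(1)[OF assms(1,2) C(1)] satD(1)[OF assms(2,3) D(1)]]]
 show "cl GG (dsum M P) (?\<Gamma> O ?\<Delta>) \<in> sat R GG M P" using CD(1) .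
 show "\<Gamma> O \<Delta> \<subseteq> cl GG (dsum M P) (?\<Gamma> O ?\<Delta>)" using CD(2) relcomp_mono[OF C(2) D(2)] by (rule order_trans[rotated])
qed

lemma comp_eq_iff:
 assumes "graded_module R M" "graded_module R N" "graded_module R P"
  and "\<Gamma> \<in> sat R GG M N" "\<Delta> \<in> sat R GG N P" "\<Lambda> \<in> sat R GG M P"
 shows "cl GG (dsum M P) (\<Gamma> O \<Delta>) = \<Lambda> \<longleftrightarrow> \<Gamma> O \<Delta> \<subseteq> \<Lambda>"
proof -
 note c = corr_comp[OF assms(1-3) satD(1)[OF assms(1,2,4)] satD(1)[OF assms(2,3,5)]]
 show ?thesis using cl_in_sat(2)[OF assms(1,3) c] cl_eq_sat[OF assms(1,3) c assms(6)] by auto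
qed

lemma comp_in_sat:
 assumes "graded_module R M" "graded_module R N" "graded_module R P"
  and "\<Gamma> \<in> sat R GG M N" "\<Delta> \<in> sat R GG N P"
 shows "cl GG (dsum M P) (\<Gamma> O \<Delta>) \<in> sat R GG M P" "\<Gamma> O \<Delta> \<subseteq> cl GG (dsum M P) (\<Gamma> O \<Delta>)"
proof -
 note c = corr_comp[OF assms(1-3) satD(1)[OF assms(1,2,4)] satD(1)[OF assms(2,3,5)]]
 show "cl GG (dsum M P) (\<Gamma> O \<Delta>) \<in> sat R GG M P" "\<Gamma> O \<Delta> \<subseteq> cl GG (dsum M P) (\<Gamma> O \<Delta>)"
  using cl_in_sat[OF assms(1,3) c] by auto
qed

end

text \<open>The morphism of the quotient category that \<open>f\<close> induces is the closure of its graph.\<close>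

definition sat_of_hom :: "'a set set \<Rightarrow> ('g, 'a, 'm) graded_mod \<Rightarrow> ('g, 'a, 'n) graded_mod \<Rightarrow> ('m \<Rightarrow> 'n) \<Rightarrow>
  ('m \<times> 'n) set" where
 "sat_of_hom GG M N f = {(x, y). x \<in> carrier M \<and> y \<in> carrier N \<and> y \<ominus>\<^bsub>N\<^esub> f x \<in> tor GG N}"

lemma (in gabriel) sat_of_hom:
 assumes "graded_module R M" "graded_module R N" "f \<in> graded_hom R M N"
 shows "sat_of_hom GG M N f \<in> sat R GG M N"
proof -
 interpret gabriel_mod2 R GG M N by (intro gabriel_mod2I assms)
 interpret ghom R M N f by (rule ghomI[OF assms])
 note T = N.gsD[OF N.gs_tor]
 show ?thesis
 proof (rule satI[OF assms(1,2)])
  show g: "graded_submodule R (dsum M N) (sat_of_hom GG M N f)"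
  proof (rule relI[OF assms(1,2)])
   show "(x \<bullet>\<^bsub>M\<^esub> r, y \<bullet>\<^bsub>N\<^esub> r) \<in> sat_of_hom GG M N f"
    if "(x, y) \<in> sat_of_hom GG M N f" "r \<in> carrier R" for x y r
    using that T(7)[of "y \<ominus>\<^bsub>N\<^esub> f x" r]
    by (auto simp: sat_of_hom_def hom_act N.act_diff_left hom_closed)
   show "(M.hc g x, N.hc g y) \<in> sat_of_hom GG M N f" if "(x, y) \<in> sat_of_hom GG M N f" for x y g
    using that T(8)[of "y \<ominus>\<^bsub>N\<^esub> f x" g]
    by (auto simp: sat_of_hom_def hom_hc N.hc_diff hom_closed)
  qed (auto simp: sat_of_hom_def hom_zero hom_add T(3,4) N.diff_add_diff hom_closed)
  have "(x, f x) \<in> sat_of_hom GG M N f" if "x \<in> carrier M" for x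
   using that by (auto simp: sat_of_hom_def hom_closed T(3))
  then have "carrier M \<subseteq> Domain (sat_of_hom GG M N f)" by auto
  then show "x \<in> cl GG M (Domain (sat_of_hom GG M N f))" if "x \<in> carrier M" for x
   using that M.cl_superset[OF relD(8)[OF assms(1,2) g]] by auto
  show "y \<in> tor GG N" if "(\<zero>\<^bsub>M\<^esub>, y) \<in> sat_of_hom GG M N f" "y \<in> carrier N" for y
   using that by (auto simp: sat_of_hom_def hom_zero)
  fix x y assume *: "x \<in> carrier M" "y \<in> carrier N"
   "almost GG (\<lambda>s. (x \<bullet>\<^bsub>M\<^esub> s, y \<bullet>\<^bsub>N\<^esub> s) \<in> sat_of_hom GG M N f)"
  have "y \<ominus>\<^bsub>N\<^esub> f x \<in> tor GG N"
  proof (rule N.almost_cl[OF N.gs_zero])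
   show "almost GG (\<lambda>s. (y \<ominus>\<^bsub>N\<^esub> f x) \<bullet>\<^bsub>N\<^esub> s \<in> tor GG N)"
    using *(3) by (rule almost_elim) (use * in \<open>auto simp: sat_of_hom_def hom_act N.act_diff_left hom_closed\<close>)
  qed (use * hom_closed in auto)
  then show "(x, y) \<in> sat_of_hom GG M N f" using * by (simp add: sat_of_hom_def)
 qed
qed

section \<open>The category of saturated correspondences is abelian\<close>

text \<open>Relations compose from left to right, hence the order of the factors.\<close>

definition sat_cat ::
 "('k, 'g, 'a) graded_alg \<Rightarrow> 'a set set \<Rightarrow> ('g, 'a, 'm) graded_mod set \<Rightarrow>
   (('g, 'a, 'm) graded_mod, ('m \<times> 'm) set) category" where
 "sat_cat R GG A = \<lparr>Ob = A, Mor = sat R GG, Idn = (\<lambda>M. sat_of_hom GG M M (\<lambda>x\<in>carrier M. x)),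
   Cmp = (\<lambda>M N P g f. cl GG (dsum M P) (f O g))\<rparr>"

lemma sat_cat_simps [simp]:
 "Ob (sat_cat R GG A) = A" "Mor (sat_cat R GG A) = sat R GG"
 "Idn (sat_cat R GG A) M = sat_of_hom GG M M (\<lambda>x\<in>carrier M. x)"
 "Cmp (sat_cat R GG A) M N P g f = cl GG (dsum M P) (f O g)"
 by (auto simp: sat_cat_def)

lemma op_cat_simps [simp]:
 "Ob (op_cat C) = Ob C" "Mor (op_cat C) V Y = Mor C Y V" "Idn (op_cat C) = Idn C"
 "Cmp (op_cat C) V Y Z g f = Cmp C Z Y V f g"
 by (auto simp: op_cat_def)

lemma is_zero_obj_op: "is_zero_obj (op_cat C) = is_zero_obj C"
 by (auto simp: is_zero_obj_def fun_eq_iff)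

lemma is_zero_mor_op: "is_zero_mor (op_cat C) V Y f = is_zero_mor C Y V f"
 by (auto simp: is_zero_mor_def is_zero_obj_op)

text \<open>A class of modules that is closed under the constructions needed for an abelian category.\<close>

locale module_class = gabriel R GG
 for R :: "('k, 'g::ab_group_add, 'a) graded_alg" and GG +
 fixes A :: "('g, 'a, 'm) graded_mod set"
 assumes A_gm: "M \<in> A ==> graded_module R M"
  and A_nonempty: "A \<noteq> {}"
  and A_sub: "M \<in> A ==> graded_submodule R M U ==> sub_mod M U \<in> A"
  and A_image: "M \<in> A ==> graded_module R N ==> f \<in> graded_hom R M N ==>
   f ` carrier M = carrier N ==> N \<in> A"
  and A_sum: "M \<in> A ==> N \<in> A ==>
   \<exists>j :: 'm \<times> 'm \<Rightarrow> 'm. inj_on j (carrier M \<times> carrier N) \<and> img_mod j (dsum M N) \<in> A"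
begin

text \<open>A quotient of a module is presented by a surjection with a given kernel, since cosets are of the
  wrong type to be elements of a module in the class.\<close>

definition quotient_data where
 "quotient_data M U Q q \<longleftrightarrow> Q \<in> A \<and> q \<in> graded_hom R M Q \<and> q ` carrier M = carrier Q \<and>
   (\<forall>x\<in>carrier M. q x = \<zero>\<^bsub>Q\<^esub> \<longleftrightarrow> x \<in> U)"

lemma quotient_exists:
 assumes "M \<in> A" "graded_submodule R M U"
 shows "\<exists>Q q. quotient_data M U Q q"
proof -
 interpret M: gmod R M by (rule gmodI[OF A_gm[OF assms(1)]])
 define rep where "rep x = (SOME y. y \<in> U +>\<^bsub>M\<^esub> x)" for x
 have rep: "rep x \<in> U +>\<^bsub>M\<^esub> x" if "x \<in> carrier M" for x
  unfolding rep_def using M.mem_own_coset[OF assms(2) that] by (rule someI)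
 have eq: "rep x = rep y \<longleftrightarrow> x \<ominus>\<^bsub>M\<^esub> y \<in> U" if xy: "x \<in> carrier M" "y \<in> carrier M" for x y
 proof
  assume "x \<ominus>\<^bsub>M\<^esub> y \<in> U"
  then have "U +>\<^bsub>M\<^esub> x = U +>\<^bsub>M\<^esub> y" using M.coset_eq_iff[OF assms(2) xy] by simp
  then show "rep x = rep y" unfolding rep_def by simp
 next
  assume e: "rep x = rep y"
  have rx: "rep x \<in> carrier M" "rep x \<ominus>\<^bsub>M\<^esub> x \<in> U" "rep x \<ominus>\<^bsub>M\<^esub> y \<in> U"
   using rep[OF xy(1)] rep[OF xy(2)] e M.mem_coset_iff[OF assms(2)] xy by auto
  show "x \<ominus>\<^bsub>M\<^esub> y \<in> U"
   by (rule M.gs_diff_trans[OF assms(2) M.gs_diff_sym[OF assms(2) rx(2)] rx(3)]) (use rx xy in auto)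
 qed
 note I = M.img_mod[OF assms(2), of rep, OF eq]
 have "img_mod rep M \<in> A" by (rule A_image[OF assms(1) I])
 moreover have "restrict rep (carrier M) x = \<zero>\<^bsub>img_mod rep M\<^esub> \<longleftrightarrow> x \<in> U" if "x \<in> carrier M" for x
  using that eq[OF that, of "\<zero>\<^bsub>M\<^esub>"] by (simp add: img_mod_def)
 ultimately have "quotient_data M U (img_mod rep M) (restrict rep (carrier M))"
  using I(2,3) unfolding quotient_data_def by blast
 then show ?thesis by blast
qed

definition product_data where
 "product_data V Y P p q \<longleftrightarrow> P \<in> A \<and> p \<in> graded_hom R P V \<and> q \<in> graded_hom R P Y \<and>
   (\<forall>a\<in>carrier V. \<forall>b\<in>carrier Y. \<exists>z\<in>carrier P. p z = a \<and> q z = b) \<and>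
   (\<forall>z\<in>carrier P. p z = \<zero>\<^bsub>V\<^esub> \<longrightarrow> q z = \<zero>\<^bsub>Y\<^esub> \<longrightarrow> z = \<zero>\<^bsub>P\<^esub>)"

lemma product_exists:
 assumes "V \<in> A" "Y \<in> A"
 shows "\<exists>P p q. product_data V Y P p q"
proof -
 interpret gmod2 R V Y by (intro gmod2.intro gmodI A_gm assms)
 obtain j :: "'m \<times> 'm \<Rightarrow> 'm" where j: "inj_on j (carrier V \<times> carrier Y)" "img_mod j (dsum V Y) \<in> A"
  using A_sum[OF assms] by blast
 let ?P = "img_mod j (dsum V Y)" and ?C = "carrier V \<times> carrier Y"
 have "j x = j y \<longleftrightarrow> x \<ominus>\<^bsub>dsum V Y\<^esub> y \<in> {\<zero>\<^bsub>dsum V Y\<^esub>}" if "x \<in> carrier (dsum V Y)" "y \<in> carrier (dsum V Y)" for x y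
  using P.diff_eq_zero[OF that] inj_on_eq_iff[OF j(1)] that by simp
 note I = P.img_mod[OF P.gs_zero this]
 note h = graded_homD[OF I(2)]
 have Pc: "carrier ?P = j ` ?C" and Pz: "\<zero>\<^bsub>?P\<^esub> = j (\<zero>\<^bsub>V\<^esub>, \<zero>\<^bsub>Y\<^esub>)" and Pm: "mcomp ?P g = j ` mcomp (dsum V Y) g" for g
  by (simp_all add: img_mod_def)
 have Padd: "j x \<oplus>\<^bsub>?P\<^esub> j y = j (fst x \<oplus>\<^bsub>V\<^esub> fst y, snd x \<oplus>\<^bsub>Y\<^esub> snd y)" if "x \<in> ?C" "y \<in> ?C" for x y
  using h(2)[of x y] that by auto
 have Pact: "j x \<bullet>\<^bsub>?P\<^esub> s = j (fst x \<bullet>\<^bsub>V\<^esub> s, snd x \<bullet>\<^bsub>Y\<^esub> s)" if "x \<in> ?C" "s \<in> carrier R" for x s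
  using h(3)[of x s] that by auto
 define p where "p = restrict (fst \<circ> inv_into ?C j) (carrier ?P)"
 define q where "q = restrict (snd \<circ> inv_into ?C j) (carrier ?P)"
 have pj: "p (j x) = fst x" "q (j x) = snd x" if "x \<in> ?C" for x
  using that j(1) by (auto simp: p_def q_def Pc)
 have mc: "x \<in> ?C" if "x \<in> mcomp (dsum V Y) g" for x g
  using P.D_carrier[of x g] that by simp
 have pe: "p \<in> extensional (carrier ?P)" "q \<in> extensional (carrier ?P)" by (simp_all add: p_def q_def)
 have "p \<in> graded_hom R ?P V"
 proof (rule graded_homI)
  show "p x \<in> mcomp V g" if "x \<in> mcomp ?P g" for g x
   using that mc unfolding Pm by (auto simp: pj)
 qed (use pe in \<open>auto simp: Pc Padd Pact pj\<close>)
 moreover have "q \<in> graded_hom R ?P Y"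
 proof (rule graded_homI)
  show "q x \<in> mcomp Y g" if "x \<in> mcomp ?P g" for g x
   using that mc unfolding Pm by (auto simp: pj)
 qed (use pe in \<open>auto simp: Pc Padd Pact pj\<close>)
 moreover have "\<exists>z\<in>carrier ?P. p z = a \<and> q z = b" if "a \<in> carrier V" "b \<in> carrier Y" for a b
  by (rule bexI[of _ "j (a, b)"]) (use that pj[of "(a, b)"] in \<open>auto simp: Pc\<close>)
 moreover have "z = \<zero>\<^bsub>?P\<^esub>" if "z \<in> carrier ?P" "p z = \<zero>\<^bsub>V\<^esub>" "q z = \<zero>\<^bsub>Y\<^esub>" for z
  using that by (auto simp: Pc Pz pj)
 ultimately have "product_data V Y ?P p q"
  using j(2) unfolding product_data_def by blast
 then show ?thesis by blast
qed

end

context gabriel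
begin

text \<open>The relation \<open>\<Gamma>\<close> is defined at almost all multiples \<open>x s\<close>, and its values there determine it.\<close>

lemma sat_memI:
 assumes "graded_module R M" "graded_module R N" "\<Gamma> \<in> sat R GG M N" "x \<in> carrier M" "y \<in> carrier N"
  and "\<And>s y'. s \<in> carrier R ==> (x \<bullet>\<^bsub>M\<^esub> s, y') \<in> \<Gamma> ==> y' \<in> carrier N ==>
   y \<bullet>\<^bsub>N\<^esub> s \<ominus>\<^bsub>N\<^esub> y' \<in> tor GG N"
 shows "(x, y) \<in> \<Gamma>"
proof (rule satD(3)[OF assms(1-5)])
 interpret N: gmod R N by (rule gmodI[OF assms(2)])
 note S = satD[OF assms(1-3)]
 from corrD(2)[OF assms(1,2) S(1) assms(4)]
 show "almost GG (\<lambda>s. (x \<bullet>\<^bsub>M\<^esub> s, y \<bullet>\<^bsub>N\<^esub> s) \<in> \<Gamma>)"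
 proof (rule almost_elim)
  fix s assume s: "s \<in> carrier R" "\<exists>y'\<in>carrier N. (x \<bullet>\<^bsub>M\<^esub> s, y') \<in> \<Gamma>"
  then obtain y' where y': "y' \<in> carrier N" "(x \<bullet>\<^bsub>M\<^esub> s, y') \<in> \<Gamma>" by auto
  show "(x \<bullet>\<^bsub>M\<^esub> s, y \<bullet>\<^bsub>N\<^esub> s) \<in> \<Gamma>"
   by (rule S(5)[OF y'(2)]) (use assms(5) assms(6)[OF s(1) y'(2,1)] s in auto)
 qed
qed

lemma sat_shift_left:
 assumes "graded_module R M" "graded_module R N" "\<Gamma> \<in> sat R GG M N" "(x', y) \<in> \<Gamma>" "x \<in> carrier M"
  "x \<ominus>\<^bsub>M\<^esub> x' \<in> tor GG M"
 shows "(x, y) \<in> \<Gamma>"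
proof -
 interpret gabriel_mod2 R GG M N by (intro gabriel_mod2I assms)
 note r = relD[OF assms(1,2) satD(2)[OF assms(1-3)]]
 show ?thesis using r(4)[OF satD(7)[OF assms(1-3,6)] assms(4)] r(1,2)[OF assms(4)] assms(5)
  by (simp add: M.diff_add_cancel)
qed

lemma cl_sat: "\<Gamma> \<in> sat R GG M N ==> graded_module R M ==> graded_module R N ==> cl GG (dsum M N) \<Gamma> = \<Gamma>"
 by (rule cl_eq_sat) (auto simp: sat_def)

lemma comp_cl_right_eq:
 assumes "graded_module R M" "graded_module R N" "graded_module R P"
  and "\<Gamma> \<in> sat R GG M N" "corr R GG N P \<Delta>" "\<Lambda> \<in> sat R GG M P" "\<Gamma> O \<Delta> \<subseteq> \<Lambda>"
 shows "cl GG (dsum M P) (\<Gamma> O cl GG (dsum N P) \<Delta>) = \<Lambda>"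
 using cl_corr_comp_cl[OF assms(1-3) satD(1)[OF assms(1,2,4)] assms(5)] cl_sat[OF assms(4,1,2)]
  cl_eq_sat[OF assms(1,3) corr_comp[OF assms(1-3) satD(1)[OF assms(1,2,4)] assms(5)] assms(6,7)]
 by simp

lemma comp_cl_left_eq:
 assumes "graded_module R M" "graded_module R N" "graded_module R P"
  and "corr R GG M N \<Gamma>" "\<Delta> \<in> sat R GG N P" "\<Lambda> \<in> sat R GG M P" "\<Gamma> O \<Delta> \<subseteq> \<Lambda>"
 shows "cl GG (dsum M P) (cl GG (dsum M N) \<Gamma> O \<Delta>) = \<Lambda>"
 using cl_corr_comp_cl[OF assms(1-4) satD(1)[OF assms(2,3,5)]] cl_sat[OF assms(5,2,3)]
  cl_eq_sat[OF assms(1,3) corr_comp[OF assms(1-4) satD(1)[OF assms(2,3,5)]] assms(6,7)]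
 by simp

text \<open>The closure of the graph of the zero map.\<close>

abbreviation zrel :: "('g, 'a, 'm) graded_mod \<Rightarrow> ('g, 'a, 'n) graded_mod \<Rightarrow> ('m \<times> 'n) set" where
 "zrel M N \<equiv> carrier M \<times> tor GG N"

lemma zrel_sat:
 assumes "graded_module R M" "graded_module R N"
 shows "zrel M N \<in> sat R GG M N"
proof -
 interpret gabriel_mod2 R GG M N by (intro gabriel_mod2I assms)
 let ?z = "\<lambda>x\<in>carrier M. \<zero>\<^bsub>N\<^esub>"
 have "?z \<in> graded_hom R M N"
  by (rule graded_homI) (auto simp: M.D_carrier N.D_closed(2))
 moreover have "sat_of_hom GG M N ?z = zrel M N"
  by (auto simp: sat_of_hom_def N.cl_carrier)
 ultimately show ?thesis using sat_of_hom[OF assms] by metis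
qed

lemma id_hom: "graded_module R M ==> (\<lambda>x\<in>carrier M. x) \<in> graded_hom R M M"
proof -
 assume "graded_module R M"
 then interpret M: gmod R M by (rule gmodI)
 show ?thesis by (rule graded_homI) (auto simp: M.D_carrier)
qed

lemma hom_mem_sat:
 assumes "graded_module R M" "graded_module R N" "f \<in> graded_hom R M N" "x \<in> carrier M"
 shows "(x, f x) \<in> sat_of_hom GG M N f"
proof -
 interpret gabriel_mod2 R GG M N by (intro gabriel_mod2I assms)
 show ?thesis using assms graded_homD(1)[OF assms(3)] N.gsD(3)[OF N.gs_tor] by (simp add: sat_of_hom_def)
qed

lemma tor_sub_mod:
 assumes "graded_module R M" "graded_submodule R M U"
 shows "cl GG (sub_mod M U) {\<zero>\<^bsub>M\<^esub>} = {x \<in> tor GG M. x \<in> U}"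
proof -
 interpret M: gmod R M by (rule gmodI[OF assms(1)])
 show ?thesis using M.gsD(9)[OF assms(2)] by (auto simp: cl_def)
qed

end

context module_class
begin

abbreviation "D \<equiv> sat_cat R GG A"

lemma Cmp_eq_iff: "V \<in> A ==> Y \<in> A ==> Z \<in> A ==> f \<in> sat R GG V Y ==> g \<in> sat R GG Y Z ==>
  h \<in> sat R GG V Z ==> Cmp D V Y Z g f = h \<longleftrightarrow> f O g \<subseteq> h"
 using comp_eq_iff[OF A_gm A_gm A_gm] by simp

lemma Cmp_in: "V \<in> A ==> Y \<in> A ==> Z \<in> A ==> f \<in> sat R GG V Y ==> g \<in> sat R GG Y Z ==>
  Cmp D V Y Z g f \<in> sat R GG V Z"
 using comp_in_sat[OF A_gm A_gm A_gm] by simp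

lemma Cmp_superset: "V \<in> A ==> Y \<in> A ==> Z \<in> A ==> f \<in> sat R GG V Y ==> g \<in> sat R GG Y Z ==>
  f O g \<subseteq> Cmp D V Y Z g f"
 using comp_in_sat[OF A_gm A_gm A_gm] by simp

lemma sat_category: "is_category D"
 unfolding is_category_def
proof (intro conjI ballI)
 fix V assume "V \<in> Ob D" then show "Idn D V \<in> Mor D V V"
  using sat_of_hom[OF A_gm A_gm id_hom[OF A_gm], of V] by simp
next
 fix V Y Z f g assume "V \<in> Ob D" "Y \<in> Ob D" "Z \<in> Ob D" "f \<in> Mor D V Y" "g \<in> Mor D Y Z"
 then show "Cmp D V Y Z g f \<in> Mor D V Z" using Cmp_in by simp
next
 fix V Y f assume *: "V \<in> Ob D" "Y \<in> Ob D" "f \<in> Mor D V Y"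
 then have V: "V \<in> A" and Y: "Y \<in> A" and f: "f \<in> sat R GG V Y" by auto
 note gV = A_gm[OF V] and gY = A_gm[OF Y]
 interpret gabriel_mod2 R GG V Y by (intro gabriel_mod2I gV gY)
 note r = relD[OF gV gY satD(2)[OF gV gY f]]
 have iV: "sat_of_hom GG V V (\<lambda>x\<in>carrier V. x) \<in> sat R GG V V" by (rule sat_of_hom[OF gV gV id_hom[OF gV]])
 have iY: "sat_of_hom GG Y Y (\<lambda>x\<in>carrier Y. x) \<in> sat R GG Y Y" by (rule sat_of_hom[OF gY gY id_hom[OF gY]])
 have "sat_of_hom GG V V (\<lambda>x\<in>carrier V. x) O f \<subseteq> f"
 proof (intro subrelI, elim relcompE)
  fix x z x' y z' assume "(x, z) = (x', z')" "(x', y) \<in> sat_of_hom GG V V (\<lambda>x\<in>carrier V. x)" "(y, z') \<in> f"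
  then have *: "x \<in> carrier V" "y \<in> carrier V" "y \<ominus>\<^bsub>V\<^esub> x \<in> tor GG V" "(y, z) \<in> f"
   by (auto simp: sat_of_hom_def)
  then show "(x, z) \<in> f"
   using sat_shift_left[OF gV gY f *(4,1)] M.gs_diff_sym[OF M.gs_tor *(3,2,1)] by simp
 qed
 then show "Cmp D V V Y f (Idn D V) = f"
  using Cmp_eq_iff[OF V V Y iV f f] by simp
 have "f O sat_of_hom GG Y Y (\<lambda>x\<in>carrier Y. x) \<subseteq> f"
  by (auto simp: sat_of_hom_def intro: satD(5)[OF gV gY f])
 then show "Cmp D V Y Y (Idn D Y) f = f"
  using Cmp_eq_iff[OF V Y Y f iY f] by simp
next
 fix W V Y Z f g h assume "W \<in> Ob D" "V \<in> Ob D" "Y \<in> Ob D" "Z \<in> Ob D" "f \<in> Mor D W V" "g \<in> Mor D V Y" "h \<in> Mor D Y Z"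
 then have o: "W \<in> A" "V \<in> A" "Y \<in> A" "Z \<in> A" and m: "f \<in> sat R GG W V" "g \<in> sat R GG V Y" "h \<in> sat R GG Y Z" by auto
 note gm = o[THEN A_gm]
 note cf = satD(1)[OF gm(1,2) m(1)] and cg = satD(1)[OF gm(2,3) m(2)] and ch = satD(1)[OF gm(3,4) m(3)]
 have "cl GG (dsum W Z) ((f O g) O h) = cl GG (dsum W Z) (cl GG (dsum W Y) (f O g) O h)"
  using cl_corr_comp_cl[OF gm(1,3,4) corr_comp[OF gm(1,2,3) cf cg] ch] cl_sat[OF m(3) gm(3,4)] by simp
 moreover have "cl GG (dsum W Z) (f O (g O h)) = cl GG (dsum W Z) (f O cl GG (dsum V Z) (g O h))"
  using cl_corr_comp_cl[OF gm(1,2,4) cf corr_comp[OF gm(2,3,4) cg ch]] cl_sat[OF m(1) gm(1,2)] by simp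
 ultimately show "Cmp D W Y Z h (Cmp D W V Y g f) = Cmp D W V Z (Cmp D V Y Z h g) f"
  by (simp add: O_assoc)
qed

text \<open>The zero objects are the torsion modules: only for these does the zero map have the same closure
  as the identity.\<close>

lemma torsion_zero_obj:
 assumes Z: "Z \<in> A" "carrier Z \<subseteq> tor GG Z"
 shows "is_zero_obj D Z"
 unfolding is_zero_obj_def
proof (intro conjI ballI)
 show "Z \<in> Ob D" using Z by simp
 fix V assume "V \<in> Ob D"
 then have V: "V \<in> A" by simp
 note gV = A_gm[OF V] and gZ = A_gm[OF Z(1)]
 have "f = zrel V Z" if f: "f \<in> sat R GG V Z" for f
  by (rule sat_eqI[OF gV gZ f zrel_sat[OF gV gZ]])
    (use relD(1,2)[OF gV gZ satD(2)[OF gV gZ f]] Z in auto)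
 then show "\<exists>!f. f \<in> Mor D V Z" using zrel_sat[OF gV gZ] by auto
 have "f = zrel Z V" if f: "f \<in> sat R GG Z V" for f
 proof (rule sat_eqI[OF gZ gV f zrel_sat[OF gZ gV]])
  show "f \<subseteq> zrel Z V"
   using relD(1)[OF gZ gV satD(2)[OF gZ gV f]] satD(6)[OF gZ gV f subsetD[OF Z(2)]] by auto
 qed
 then show "\<exists>!f. f \<in> Mor D Z V" using zrel_sat[OF gZ gV] by auto
qed

lemma zero_obj_torsion:
 assumes "is_zero_obj D Z"
 shows "Z \<in> A" "carrier Z \<subseteq> tor GG Z"
proof -
 show Z: "Z \<in> A" using assms by (simp add: is_zero_obj_def)
 note gZ = A_gm[OF Z]
 have u: "\<exists>!f. f \<in> sat R GG Z Z" using assms Z by (simp add: is_zero_obj_def)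
 have "sat_of_hom GG Z Z (\<lambda>x\<in>carrier Z. x) = zrel Z Z"
  using u sat_of_hom[OF gZ gZ id_hom[OF gZ]] zrel_sat[OF gZ gZ] by blast
 then show "carrier Z \<subseteq> tor GG Z" using hom_mem_sat[OF gZ gZ id_hom[OF gZ]] by fastforce
qed

lemma zero_obj_exists: "\<exists>Z. is_zero_obj D Z"
proof -
 obtain M where M: "M \<in> A" using A_nonempty by auto
 interpret M: gabriel_mod R GG M by (rule gabriel_modI[OF A_gm[OF M]])
 have "carrier (sub_mod M {\<zero>\<^bsub>M\<^esub>}) \<subseteq> tor GG (sub_mod M {\<zero>\<^bsub>M\<^esub>})"
  using M.gsD(3)[OF M.gs_tor] by (simp add: tor_sub_mod[OF A_gm[OF M] M.gs_zero])
 then show ?thesis using torsion_zero_obj[OF A_sub[OF M M.gs_zero]] by blast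
qed

lemma zero_mor_iff:
 assumes V: "V \<in> A" and Y: "Y \<in> A" and f: "f \<in> sat R GG V Y"
 shows "is_zero_mor D V Y f \<longleftrightarrow> f \<subseteq> zrel V Y"
proof
 note gV = A_gm[OF V] and gY = A_gm[OF Y]
 {
  assume "is_zero_mor D V Y f"
  then obtain Z g h where Z: "is_zero_obj D Z" and g: "g \<in> sat R GG V Z" and h: "h \<in> sat R GG Z Y"
   and fe: "f = Cmp D V Z Y h g" by (auto simp: is_zero_mor_def)
  note Z' = zero_obj_torsion[OF Z]
  note gZ = A_gm[OF Z'(1)]
  have "g O h \<subseteq> zrel V Y"
   using relD(1,2)[OF gV gZ satD(2)[OF gV gZ g]] satD(6)[OF gZ gY h subsetD[OF Z'(2)]] by blast
  then show "f \<subseteq> zrel V Y"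
   using Cmp_eq_iff[OF V Z'(1) Y g h zrel_sat[OF gV gY]] fe by simp
 }
 assume "f \<subseteq> zrel V Y"
 then have fe: "f = zrel V Y" by (rule sat_eqI[OF gV gY f zrel_sat[OF gV gY]])
 obtain Z where Z: "is_zero_obj D Z" using zero_obj_exists by blast
 note Z' = zero_obj_torsion[OF Z]
 note gZ = A_gm[OF Z'(1)]
 have "zrel V Z O zrel Z Y \<subseteq> zrel V Y" by auto
 then have "f = Cmp D V Z Y (zrel Z Y) (zrel V Z)"
  using Cmp_eq_iff[OF V Z'(1) Y zrel_sat[OF gV gZ] zrel_sat[OF gZ gY] zrel_sat[OF gV gY]] fe by simp
 then show "is_zero_mor D V Y f"
  unfolding is_zero_mor_def using Z zrel_sat[OF gV gZ] zrel_sat[OF gZ gY] by auto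
qed

lemma zero_comp_iff:
 assumes "V \<in> A" "Y \<in> A" "Z \<in> A" "f \<in> sat R GG V Y" "g \<in> sat R GG Y Z"
 shows "is_zero_mor D V Z (Cmp D V Y Z g f) \<longleftrightarrow> f O g \<subseteq> zrel V Z"
proof -
 note gV = A_gm[OF assms(1)] and gZ = A_gm[OF assms(3)]
 have "is_zero_mor D V Z (Cmp D V Y Z g f) \<longleftrightarrow> Cmp D V Y Z g f \<subseteq> zrel V Z"
  by (rule zero_mor_iff[OF assms(1,3) Cmp_in[OF assms]])
 also have "\<dots> \<longleftrightarrow> f O g \<subseteq> zrel V Z"
  using Cmp_superset[OF assms] Cmp_eq_iff[OF assms zrel_sat[OF gV gZ]] by auto
 finally show ?thesis .
qed

subsection \<open>Products and coproducts\<close>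

text \<open>As relations between elements, morphisms into a product are pairs of relations.\<close>

lemma product_lift:
 assumes P: "W \<in> A" "V \<in> A" "Y \<in> A" "P \<in> A" and p: "p \<in> graded_hom R P V" and q: "q \<in> graded_hom R P Y"
  and ex: "\<And>a b. a \<in> carrier V ==> b \<in> carrier Y ==> \<exists>z\<in>carrier P. p z = a \<and> q z = b"
  and inj: "\<And>z. z \<in> carrier P ==> p z = \<zero>\<^bsub>V\<^esub> ==> q z = \<zero>\<^bsub>Y\<^esub> ==> z = \<zero>\<^bsub>P\<^esub>"
  and f: "f \<in> sat R GG W V" and g: "g \<in> sat R GG W Y"
 shows "{(w, z). z \<in> carrier P \<and> (w, p z) \<in> f \<and> (w, q z) \<in> g} \<in> sat R GG W P" (is "?u \<in> _")
proof -
 note gm = P[THEN A_gm]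
 interpret p: ghom R P V p by (rule ghomI[OF gm(4,2) p])
 interpret q: ghom R P Y q by (rule ghomI[OF gm(4,3) q])
 interpret W: gabriel_mod R GG W by (rule gabriel_modI[OF gm(1)])
 note F = satD[OF gm(1,2) f] and G = satD[OF gm(1,3) g]
 note rF = relD[OF gm(1,2) F(2)] and rG = relD[OF gm(1,3) G(2)]
 show ?thesis
 proof (rule satI[OF gm(1,4)])
  show gs: "graded_submodule R (dsum W P) ?u"
   by (rule relI[OF gm(1,4)])
     (auto simp: p.hom_zero q.hom_zero p.hom_add q.hom_add p.hom_act q.hom_act p.hom_hc q.hom_hc
      rF(1,3,4,5,6) rG(3,4,5,6))
  show "w \<in> cl GG W (Domain ?u)" if w: "w \<in> carrier W" for w
   unfolding cl_def
  proof (intro CollectI conjI w almost_elim2[OF corrD(2)[OF gm(1,2) F(1) w] corrD(2)[OF gm(1,3) G(1) w]])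
   fix s assume "\<exists>y\<in>carrier V. (w \<bullet>\<^bsub>W\<^esub> s, y) \<in> f" "\<exists>y\<in>carrier Y. (w \<bullet>\<^bsub>W\<^esub> s, y) \<in> g"
   then obtain a b where ab: "a \<in> carrier V" "(w \<bullet>\<^bsub>W\<^esub> s, a) \<in> f" "b \<in> carrier Y" "(w \<bullet>\<^bsub>W\<^esub> s, b) \<in> g" by auto
   with ex[of a b] show "w \<bullet>\<^bsub>W\<^esub> s \<in> Domain ?u" by auto
  qed
  show "z \<in> tor GG P" if "(\<zero>\<^bsub>W\<^esub>, z) \<in> ?u" for z
  proof -
   have z: "z \<in> carrier P" "p z \<in> tor GG V" "q z \<in> tor GG Y"
    using that corrD(3)[OF gm(1,2) F(1)] corrD(3)[OF gm(1,3) G(1)] by auto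
   have "almost GG (\<lambda>s. p z \<bullet>\<^bsub>V\<^esub> s = \<zero>\<^bsub>V\<^esub>)" "almost GG (\<lambda>s. q z \<bullet>\<^bsub>Y\<^esub> s = \<zero>\<^bsub>Y\<^esub>)"
    using z by (auto simp: cl_def)
   then have "almost GG (\<lambda>s. z \<bullet>\<^bsub>P\<^esub> s = \<zero>\<^bsub>P\<^esub>)"
    by (rule almost_elim2) (use z(1) in \<open>auto simp: p.hom_act q.hom_act intro!: inj\<close>)
   then show ?thesis using z by (simp add: cl_def)
  qed
  show "(w, z) \<in> ?u" if "w \<in> carrier W" "z \<in> carrier P" "almost GG (\<lambda>s. (w \<bullet>\<^bsub>W\<^esub> s, z \<bullet>\<^bsub>P\<^esub> s) \<in> ?u)" for w z
  proof -
   have "(w, p z) \<in> f"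
    by (rule F(3)) (use that in \<open>auto simp: p.hom_closed p.hom_act[symmetric] elim!: almost_elim\<close>)
   moreover have "(w, q z) \<in> g"
    by (rule G(3)) (use that in \<open>auto simp: q.hom_closed q.hom_act[symmetric] elim!: almost_elim\<close>)
   ultimately show ?thesis using that by auto
  qed
 qed
qed

lemma sat_binary_products: "has_binary_products D"
 unfolding has_binary_products_def
proof (intro ballI)
 fix V Y assume "V \<in> Ob D" "Y \<in> Ob D"
 then have V: "V \<in> A" and Y: "Y \<in> A" by auto
 obtain P p q where "product_data V Y P p q" using product_exists[OF V Y] by blast
 then have P: "P \<in> A" and p: "p \<in> graded_hom R P V" and q: "q \<in> graded_hom R P Y"
  and ex: "\<And>a b. a \<in> carrier V ==> b \<in> carrier Y ==> \<exists>z\<in>carrier P. p z = a \<and> q z = b"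
  and inj: "\<And>z. z \<in> carrier P ==> p z = \<zero>\<^bsub>V\<^esub> ==> q z = \<zero>\<^bsub>Y\<^esub> ==> z = \<zero>\<^bsub>P\<^esub>"
  by (auto simp: product_data_def)
 note gV = A_gm[OF V] and gY = A_gm[OF Y] and gP = A_gm[OF P]
 let ?p = "sat_of_hom GG P V p" and ?q = "sat_of_hom GG P Y q"
 note p' = sat_of_hom[OF gP gV p] and q' = sat_of_hom[OF gP gY q]
 show "\<exists>P\<in>Ob D. \<exists>p\<in>Mor D P V. \<exists>q\<in>Mor D P Y. \<forall>W\<in>Ob D. \<forall>f\<in>Mor D W V. \<forall>g\<in>Mor D W Y.
   \<exists>!u. u \<in> Mor D W P \<and> Cmp D W P V p u = f \<and> Cmp D W P Y q u = g"
 proof (rule bexI[of _ P], rule bexI[of _ ?p], rule bexI[of _ ?q], intro ballI)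
  fix W f g assume "W \<in> Ob D" "f \<in> Mor D W V" "g \<in> Mor D W Y"
  then have W: "W \<in> A" and f: "f \<in> sat R GG W V" and g: "g \<in> sat R GG W Y" by auto
  note gW = A_gm[OF W]
  let ?u = "{(w, z). z \<in> carrier P \<and> (w, p z) \<in> f \<and> (w, q z) \<in> g}"
  note u = product_lift[OF W V Y P p q ex inj f g]
  show "\<exists>!u. u \<in> Mor D W P \<and> Cmp D W P V ?p u = f \<and> Cmp D W P Y ?q u = g"
  proof (rule ex1I[of _ ?u])
   have c: "?u O ?p \<subseteq> f" "?u O ?q \<subseteq> g"
    using satD(5)[OF gW gV f] satD(5)[OF gW gY g] by (auto simp: sat_of_hom_def)
   then show "?u \<in> Mor D W P \<and> Cmp D W P V ?p ?u = f \<and> Cmp D W P Y ?q ?u = g"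
    unfolding sat_cat_simps(2)
    by (intro conjI u iffD2[OF Cmp_eq_iff[OF W P V u p' f] c(1)] iffD2[OF Cmp_eq_iff[OF W P Y u q' g] c(2)])
  next
   fix u' assume *: "u' \<in> Mor D W P \<and> Cmp D W P V ?p u' = f \<and> Cmp D W P Y ?q u' = g"
   then have u': "u' \<in> sat R GG W P" by simp
   have "u' O ?p \<subseteq> f" "u' O ?q \<subseteq> g"
    using Cmp_superset[OF W P V u' p'] Cmp_superset[OF W P Y u' q'] * by auto
   then have "u' \<subseteq> ?u"
    using hom_mem_sat[OF gP gV p] hom_mem_sat[OF gP gY q] relD(2)[OF gW gP satD(2)[OF gW gP u']]
    by (auto intro!: relcompI)
   then show "u' = ?u" by (intro sat_eqI[OF gW gP u' u])
  qed
 qed (use P p' q' in auto)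
qed

text \<open>A closed form of the graph of \<open>v \<mapsto> (v, 0)\<close>. The product \<open>P\<close> is presented symmetrically, so
  \<open>coproj Y V P q p\<close> is the other coprojection.\<close>

definition coproj where
 "coproj V Y P p q = {(v, z). z \<in> carrier P \<and> (v, p z) \<in> sat_of_hom GG V V (\<lambda>x\<in>carrier V. x) \<and> q z \<in> tor GG Y}"

lemma coproj_sat:
 assumes "V \<in> A" "Y \<in> A" "product_data V Y P p q"
 shows "coproj V Y P p q \<in> sat R GG V P"
proof -
 note gV = A_gm[OF assms(1)] and gY = A_gm[OF assms(2)]
 have "coproj V Y P p q = {(v, z). z \<in> carrier P \<and> (v, p z) \<in> sat_of_hom GG V V (\<lambda>x\<in>carrier V. x) \<and> (v, q z) \<in> zrel V Y}"
  by (auto simp: coproj_def sat_of_hom_def)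
 moreover have "\<dots> \<in> sat R GG V P"
  by (rule product_lift[OF assms(1,1,2) _ _ _ _ _ sat_of_hom[OF gV gV id_hom[OF gV]] zrel_sat[OF gV gY]])
    (use assms(3) in \<open>auto simp: product_data_def\<close>)
 ultimately show ?thesis by simp
qed

text \<open>A morphism out of the product is the sum of its restrictions along the coprojections, and it is
  determined on elements of the form \<open>(v, 0)\<close> by the first of them.\<close>

lemma coproj_factor:
 assumes o: "V \<in> A" "Y \<in> A" "W \<in> A" and d: "product_data V Y P p q" and f: "f \<in> sat R GG V W"
 shows "\<And>v z a b g. (v, z) \<in> coproj V Y P p q ==> (p z, a) \<in> f ==> g \<in> sat R GG Y W ==> (q z, b) \<in> g ==>
   (v, a \<oplus>\<^bsub>W\<^esub> b) \<in> f"
  "\<And>u z a. u \<in> sat R GG P W ==> coproj V Y P p q O u \<subseteq> f ==> z \<in> carrier P ==> q z = \<zero>\<^bsub>Y\<^esub> ==>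
   (p z, a) \<in> f ==> (z, a) \<in> u"
proof -
 have P: "P \<in> A" and p: "p \<in> graded_hom R P V" and q: "q \<in> graded_hom R P Y"
  using d by (auto simp: product_data_def)
 note gV = A_gm[OF o(1)] and gY = A_gm[OF o(2)] and gW = A_gm[OF o(3)] and gP = A_gm[OF P]
 interpret GV: gabriel_mod R GG V by (rule gabriel_modI[OF gV])
 interpret GY: gabriel_mod R GG Y by (rule gabriel_modI[OF gY])
 interpret GW: gabriel_mod R GG W by (rule gabriel_modI[OF gW])
 interpret p: ghom R P V p by (rule ghomI[OF gP gV p])
 interpret q: ghom R P Y q by (rule ghomI[OF gP gY q])
 note F = satD[OF gV gW f] and rF = relD[OF gV gW satD(2)[OF gV gW f]]
 show "(v, a \<oplus>\<^bsub>W\<^esub> b) \<in> f"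
  if i: "(v, z) \<in> coproj V Y P p q" and a: "(p z, a) \<in> f" and g: "g \<in> sat R GG Y W" and b: "(q z, b) \<in> g" for v z a b g
 proof -
  have v: "v \<in> carrier V" "p z \<ominus>\<^bsub>V\<^esub> v \<in> tor GG V" "q z \<in> tor GG Y" "z \<in> carrier P"
   using i by (auto simp: coproj_def sat_of_hom_def)
  have va: "(v, a) \<in> f"
   by (rule sat_shift_left[OF gV gW f a v(1)]) (use v p.hom_closed GV.gs_diff_sym[OF GV.gs_tor] in auto)
  have t: "b \<in> tor GG W" by (rule satD(6)[OF gY gW g v(3) b])
  then have ab: "a \<in> carrier W" "b \<in> carrier W" using rF(2)[OF va] by (auto simp: cl_def)
  then have "(a \<oplus>\<^bsub>W\<^esub> b) \<ominus>\<^bsub>W\<^esub> a = b" using GW.add_diff_cancel[of b a] by (simp add: GW.a_comm)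
  then show ?thesis using t ab by (intro F(5)[OF va]) auto
 qed
 show "(z, a) \<in> u"
  if u: "u \<in> sat R GG P W" "coproj V Y P p q O u \<subseteq> f" and z: "z \<in> carrier P" "q z = \<zero>\<^bsub>Y\<^esub>" and a: "(p z, a) \<in> f" for u z a
 proof (rule sat_memI[OF gP gW u(1) z(1) rF(2)[OF a]])
  fix s y assume s: "s \<in> carrier R" and y: "(z \<bullet>\<^bsub>P\<^esub> s, y) \<in> u"
  have "(p z \<bullet>\<^bsub>V\<^esub> s, z \<bullet>\<^bsub>P\<^esub> s) \<in> coproj V Y P p q"
   using hom_mem_sat[OF gV gV id_hom[OF gV], of "p z \<bullet>\<^bsub>V\<^esub> s"] GY.gsD(3)[OF GY.gs_tor] z s
   by (simp add: coproj_def p.hom_act q.hom_act p.hom_closed)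
  then have "(p z \<bullet>\<^bsub>V\<^esub> s, y) \<in> f" using u(2) y by auto
  then show "a \<bullet>\<^bsub>W\<^esub> s \<ominus>\<^bsub>W\<^esub> y \<in> tor GG W" by (rule corrD(4)[OF gV gW F(1) rF(5)[OF a s]])
 qed
qed

lemma sat_binary_coproducts: "has_binary_products (op_cat D)"
 unfolding has_binary_products_def
proof (intro ballI)
 fix V Y assume "V \<in> Ob (op_cat D)" "Y \<in> Ob (op_cat D)"
 then have V: "V \<in> A" and Y: "Y \<in> A" by auto
 obtain P p q where d: "product_data V Y P p q" using product_exists[OF V Y] by blast
 then have d': "product_data Y V P q p" unfolding product_data_def by blast
 from d have P: "P \<in> A" and p: "p \<in> graded_hom R P V" and q: "q \<in> graded_hom R P Y"
  and ex: "\<And>a b. a \<in> carrier V ==> b \<in> carrier Y ==> \<exists>z\<in>carrier P. p z = a \<and> q z = b"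
  and inj: "\<And>z. z \<in> carrier P ==> p z = \<zero>\<^bsub>V\<^esub> ==> q z = \<zero>\<^bsub>Y\<^esub> ==> z = \<zero>\<^bsub>P\<^esub>"
  by (auto simp: product_data_def)
 note gV = A_gm[OF V] and gY = A_gm[OF Y] and gP = A_gm[OF P]
 interpret GP: gabriel_mod R GG P by (rule gabriel_modI[OF gP])
 interpret GV: gabriel_mod R GG V by (rule gabriel_modI[OF gV])
 interpret GY: gabriel_mod R GG Y by (rule gabriel_modI[OF gY])
 interpret p: ghom R P V p by (rule ghomI[OF gP gV p])
 interpret q: ghom R P Y q by (rule ghomI[OF gP gY q])
 have inj': "z = z'" if "z \<in> carrier P" "z' \<in> carrier P" "p z = p z'" "q z = q z'" for z z'
  using inj[of "z \<ominus>\<^bsub>P\<^esub> z'"] that GP.diff_eq_zero[OF that(1,2)]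
  by (simp add: p.hom_diff q.hom_diff p.hom_closed q.hom_closed)
 let ?i = "coproj V Y P p q" and ?j = "coproj Y V P q p"
 note i = coproj_sat[OF V Y d] and j = coproj_sat[OF Y V d']
 show "\<exists>P\<in>Ob (op_cat D). \<exists>p\<in>Mor (op_cat D) P V. \<exists>q\<in>Mor (op_cat D) P Y.
   \<forall>W\<in>Ob (op_cat D). \<forall>f\<in>Mor (op_cat D) W V. \<forall>g\<in>Mor (op_cat D) W Y.
   \<exists>!u. u \<in> Mor (op_cat D) W P \<and> Cmp (op_cat D) W P V p u = f \<and> Cmp (op_cat D) W P Y q u = g"
 proof (rule bexI[of _ P], rule bexI[of _ ?i], rule bexI[of _ ?j], intro ballI)
  fix W f g assume "W \<in> Ob (op_cat D)" "f \<in> Mor (op_cat D) W V" "g \<in> Mor (op_cat D) W Y"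
  then have W: "W \<in> A" and f: "f \<in> sat R GG V W" and g: "g \<in> sat R GG Y W" by auto
  note gW = A_gm[OF W] and I = coproj_factor[OF V Y W d f] and J = coproj_factor[OF Y V W d' g]
  interpret GW: gabriel_mod R GG W by (rule gabriel_modI[OF gW])
  note T = GW.gsD[OF GW.gs_tor]
  note F = satD[OF gV gW f] and G = satD[OF gY gW g]
  note rF = relD[OF gV gW F(2)] and rG = relD[OF gY gW G(2)]
  let ?u = "{(z, w). z \<in> carrier P \<and> (\<exists>a b. (p z, a) \<in> f \<and> (q z, b) \<in> g \<and> w = a \<oplus>\<^bsub>W\<^esub> b)}"
  have gs: "graded_submodule R (dsum P W) ?u"
  proof (rule relI[OF gP gW])
   show "(\<zero>\<^bsub>P\<^esub>, \<zero>\<^bsub>W\<^esub>) \<in> ?u" using rF(3) rG(3)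
    by (auto simp: p.hom_zero q.hom_zero intro!: exI[of _ "\<zero>\<^bsub>W\<^esub>"])
   show "(z \<oplus>\<^bsub>P\<^esub> z', w \<oplus>\<^bsub>W\<^esub> w') \<in> ?u" if zw: "(z, w) \<in> ?u" "(z', w') \<in> ?u" for z w z' w'
   proof -
    obtain a b a' b' where *: "(p z, a) \<in> f" "(q z, b) \<in> g" "w = a \<oplus>\<^bsub>W\<^esub> b" "z \<in> carrier P" "z' \<in> carrier P"
     "(p z', a') \<in> f" "(q z', b') \<in> g" "w' = a' \<oplus>\<^bsub>W\<^esub> b'" using zw by auto
    have "w \<oplus>\<^bsub>W\<^esub> w' = (a \<oplus>\<^bsub>W\<^esub> a') \<oplus>\<^bsub>W\<^esub> (b \<oplus>\<^bsub>W\<^esub> b')"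
     using * rF(2) rG(2) by (simp add: GW.a_ac)
    then show ?thesis using rF(4)[OF *(1,6)] rG(4)[OF *(2,7)] *
     by (auto simp: p.hom_add q.hom_add)
   qed
   show "(z \<bullet>\<^bsub>P\<^esub> r, w \<bullet>\<^bsub>W\<^esub> r) \<in> ?u" if zw: "(z, w) \<in> ?u" and r: "r \<in> carrier R" for z w r
   proof -
    obtain a b where *: "(p z, a) \<in> f" "(q z, b) \<in> g" "w = a \<oplus>\<^bsub>W\<^esub> b" "z \<in> carrier P" using zw by auto
    then have "w \<bullet>\<^bsub>W\<^esub> r = a \<bullet>\<^bsub>W\<^esub> r \<oplus>\<^bsub>W\<^esub> b \<bullet>\<^bsub>W\<^esub> r" using rF(2) rG(2) r by (simp add: GW.act_add_left)
    then show ?thesis using rF(5)[OF *(1) r] rG(5)[OF *(2) r] * r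
     by (auto simp: p.hom_act q.hom_act)
   qed
   show "(GP.hc k z, GW.hc k w) \<in> ?u" if zw: "(z, w) \<in> ?u" for z w k
   proof -
    obtain a b where *: "(p z, a) \<in> f" "(q z, b) \<in> g" "w = a \<oplus>\<^bsub>W\<^esub> b" "z \<in> carrier P" using zw by auto
    then have "GW.hc k w = GW.hc k a \<oplus>\<^bsub>W\<^esub> GW.hc k b" using rF(2) rG(2) by (simp add: GW.hc_add)
    then show ?thesis using rF(6)[OF *(1), of k] rG(6)[OF *(2), of k] *
     by (auto simp: p.hom_hc q.hom_hc)
   qed
  qed (use rF(2) rG(2) in auto)
  have u0: "corr R GG P W ?u"
  proof (rule corrI[OF gP gW gs])
   show "z \<in> cl GG P (Domain ?u)" if z: "z \<in> carrier P" for z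
    unfolding cl_def
   proof (intro CollectI conjI z almost_elim2[OF corrD(2)[OF gV gW F(1) p.hom_closed[OF z]]
       corrD(2)[OF gY gW G(1) q.hom_closed[OF z]]])
    fix s assume "s \<in> carrier R" "\<exists>y\<in>carrier W. (p z \<bullet>\<^bsub>V\<^esub> s, y) \<in> f" "\<exists>y\<in>carrier W. (q z \<bullet>\<^bsub>Y\<^esub> s, y) \<in> g"
    then show "z \<bullet>\<^bsub>P\<^esub> s \<in> Domain ?u" using z by (auto simp: p.hom_act q.hom_act Domain_iff)
   qed
   show "w \<in> tor GG W" if "(\<zero>\<^bsub>P\<^esub>, w) \<in> ?u" for w
    using that corrD(3)[OF gV gW F(1)] corrD(3)[OF gY gW G(1)]
    by (auto simp: p.hom_zero q.hom_zero intro!: T(4))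
  qed
  note u = cl_in_sat[OF gP gW u0]
  have iu: "?i O ?u \<subseteq> f" using I(1)[OF _ _ g] by (intro subrelI) auto
  have ju: "?j O ?u \<subseteq> g"
  proof (intro subrelI)
   fix v w assume "(v, w) \<in> ?j O ?u"
   then obtain z a b where *: "(v, z) \<in> ?j" "(p z, a) \<in> f" "(q z, b) \<in> g" "w = a \<oplus>\<^bsub>W\<^esub> b" by auto
   then show "(v, w) \<in> g" using J(1)[OF *(1,3) f *(2)] rF(2) rG(2) by (simp add: GW.a_comm)
  qed
  show "\<exists>!u. u \<in> Mor (op_cat D) W P \<and> Cmp (op_cat D) W P V ?i u = f \<and> Cmp (op_cat D) W P Y ?j u = g"
  proof (rule ex1I[of _ "cl GG (dsum P W) ?u"])
   show "cl GG (dsum P W) ?u \<in> Mor (op_cat D) W P \<and> Cmp (op_cat D) W P V ?i (cl GG (dsum P W) ?u) = f \<and>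
     Cmp (op_cat D) W P Y ?j (cl GG (dsum P W) ?u) = g"
    unfolding op_cat_simps sat_cat_simps
    by (intro conjI u comp_cl_right_eq[OF gV gP gW i u0 f iu] comp_cl_right_eq[OF gY gP gW j u0 g ju])
  next
   fix u' assume *: "u' \<in> Mor (op_cat D) W P \<and> Cmp (op_cat D) W P V ?i u' = f \<and> Cmp (op_cat D) W P Y ?j u' = g"
   then have u': "u' \<in> sat R GG P W" by simp
   have iu': "?i O u' \<subseteq> f" and ju': "?j O u' \<subseteq> g"
    using Cmp_superset[OF V P W i u'] Cmp_superset[OF Y P W j u'] * by auto
   note rS = relD[OF gP gW satD(2)[OF gP gW u']]
   have "?u \<subseteq> u'"
   proof (intro subrelI)
    fix z w assume "(z, w) \<in> ?u"
    then obtain a b where *: "(p z, a) \<in> f" "(q z, b) \<in> g" "w = a \<oplus>\<^bsub>W\<^esub> b" "z \<in> carrier P" by auto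
    obtain z1 where z1: "z1 \<in> carrier P" "p z1 = p z" "q z1 = \<zero>\<^bsub>Y\<^esub>"
     using ex[of "p z" "\<zero>\<^bsub>Y\<^esub>"] * p.hom_closed by auto
    obtain z2 where z2: "z2 \<in> carrier P" "p z2 = \<zero>\<^bsub>V\<^esub>" "q z2 = q z"
     using ex[of "\<zero>\<^bsub>V\<^esub>" "q z"] * q.hom_closed by auto
    have z: "z = z1 \<oplus>\<^bsub>P\<^esub> z2"
     by (rule inj') (use * z1 z2 in \<open>auto simp: p.hom_add q.hom_add p.hom_closed q.hom_closed\<close>)
    show "(z, w) \<in> u'"
     unfolding z *(3) by (rule rS(4)[OF I(2)[OF u' iu' z1(1,3)] J(2)[OF u' ju' z2(1,2)]]) (use * z1 z2 in auto)
   qed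
   then show "u' = cl GG (dsum P W) ?u" by (rule cl_eq_sat[OF gP gW u0 u', symmetric])
  qed
 qed (use P i j in auto)
qed

end

subsection \<open>Kernels and cokernels\<close>

context gabriel
begin

lemma hcomp_sub_mod:
 assumes "graded_module R M" "graded_submodule R M U" "x \<in> U"
 shows "hcomp (sub_mod M U) (\<lambda>g. U \<inter> mcomp M g) g x = hcomp M (mcomp M) g x"
proof -
 interpret M: gmod R M by (rule gmodI[OF assms(1)])
 interpret i: ghom R "sub_mod M U" M "\<lambda>x\<in>U. x"
  by (rule ghomI[OF M.sub_mod(1)[OF assms(2)] assms(1) M.sub_mod(2)[OF assms(2)]])
 have "mcomp (sub_mod M U) = (\<lambda>g. U \<inter> mcomp M g)" by auto
 then show ?thesis using i.hom_hc[of x g] i.M.hc_closed[of x g] assms(3) by simp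
qed

lemma mcomp_sub_mod: "mcomp (sub_mod M U) = (\<lambda>g. U \<inter> mcomp M g)"
 by auto

lemma kernel_gs:
 assumes "graded_module R V" "graded_module R Y" "f \<in> sat R GG V Y"
 shows "graded_submodule R V {x. (x, \<zero>\<^bsub>Y\<^esub>) \<in> f}"
 by (rule relD(10)[OF assms(1,2) satD(2)[OF assms]])

end

context module_class
begin

text \<open>The kernel of \<open>f\<close> is the inclusion of the submodule of all \<open>x\<close> that correspond to \<open>0\<close>.\<close>

lemma kernel_incl:
 assumes "V \<in> A" "Y \<in> A" "f \<in> sat R GG V Y"
 defines "U \<equiv> {x. (x, \<zero>\<^bsub>Y\<^esub>) \<in> f}"
 defines "i \<equiv> sat_of_hom GG (sub_mod V U) V (\<lambda>x\<in>U. x)"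
 shows "sub_mod V U \<in> A" "i \<in> sat R GG (sub_mod V U) V" "\<And>x. x \<in> U ==> (x, x) \<in> i" "i O f \<subseteq> zrel (sub_mod V U) Y"
proof -
 note gV = A_gm[OF assms(1)] and gY = A_gm[OF assms(2)]
 interpret GV: gabriel_mod R GG V by (rule gabriel_modI[OF gV])
 have gU: "graded_submodule R V U" unfolding U_def by (rule kernel_gs[OF gV gY assms(3)])
 show "sub_mod V U \<in> A" by (rule A_sub[OF assms(1) gU])
 note h = GV.sub_mod[OF gU]
 show "i \<in> sat R GG (sub_mod V U) V" unfolding i_def by (rule sat_of_hom[OF h(1) gV h(2)])
 show "(x, x) \<in> i" if "x \<in> U" for x
  using hom_mem_sat[OF h(1) gV h(2), of x] that by (simp add: i_def)
 show "i O f \<subseteq> zrel (sub_mod V U) Y"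
 proof (intro subrelI, elim relcompE)
  fix x y x' v y' assume "(x, y) = (x', y')" "(x', v) \<in> i" "(v, y') \<in> f"
  then have *: "x \<in> U" "v \<in> carrier V" "v \<ominus>\<^bsub>V\<^esub> x \<in> tor GG V" "(v, y) \<in> f"
   by (auto simp: i_def sat_of_hom_def)
  have xf: "(x, \<zero>\<^bsub>Y\<^esub>) \<in> f" using * U_def by simp
  interpret Y: gmod R Y by (rule gmodI[OF gY])
  have "(v \<ominus>\<^bsub>V\<^esub> x, y \<ominus>\<^bsub>Y\<^esub> \<zero>\<^bsub>Y\<^esub>) \<in> f" by (rule relD(7)[OF gV gY satD(2)[OF gV gY assms(3)] *(4) xf])
  moreover have "y \<in> carrier Y" using relD(2)[OF gV gY satD(2)[OF gV gY assms(3)] *(4)] .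
  ultimately show "(x, y) \<in> zrel (sub_mod V U) Y" using satD(6)[OF gV gY assms(3) *(3)] * by simp
 qed
qed

text \<open>The factorisation of \<open>h\<close> through a monomorphism \<open>i\<close> is the composite of \<open>h\<close> with the converse
  relation of \<open>i\<close>.\<close>

lemma mono_factor:
 assumes o: "W \<in> A" "V \<in> A" "Y \<in> A" and i: "i \<in> sat R GG V Y" and h: "h \<in> sat R GG W Y"
  and inj: "\<And>x. (x, \<zero>\<^bsub>Y\<^esub>) \<in> i ==> x \<in> tor GG V"
  and im: "\<And>w y. (w, y) \<in> h ==> almost GG (\<lambda>t. y \<bullet>\<^bsub>Y\<^esub> t \<in> Range i)"
 shows "\<exists>!u. u \<in> sat R GG W V \<and> cl GG (dsum W Y) (u O i) = h"
proof -
 note W = o(1) and V = o(2) and Y = o(3)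
 note gW = A_gm[OF W] and gV = A_gm[OF V] and gY = A_gm[OF Y]
 interpret GW: gabriel_mod R GG W by (rule gabriel_modI[OF gW])
 interpret GV: gabriel_mod R GG V by (rule gabriel_modI[OF gV])
 interpret GY: gabriel_mod R GG Y by (rule gabriel_modI[OF gY])
 note I = satD[OF gV gY i] and ri = relD[OF gV gY satD(2)[OF gV gY i]]
 note H = satD[OF gW gY h] and rh = relD[OF gW gY satD(2)[OF gW gY h]]
 let ?u = "h O i\<inverse>"
 have gs: "graded_submodule R (dsum W V) ?u" by (rule rel_comp[OF gW gY gV H(2) rel_converse[OF gV gY I(2)]])
 have u0: "corr R GG W V ?u"
 proof (rule corrI[OF gW gV gs])
  note gD = relD(8)[OF gW gV gs]
  show "w \<in> cl GG W (Domain ?u)" if w: "w \<in> carrier W" for w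
  proof (rule GW.almost_cl[OF gD w almost_elim[OF corrD(2)[OF gW gY H(1) w]]])
   fix s assume s: "s \<in> carrier R" "\<exists>y\<in>carrier Y. (w \<bullet>\<^bsub>W\<^esub> s, y) \<in> h"
   then obtain y where y: "(w \<bullet>\<^bsub>W\<^esub> s, y) \<in> h" by auto
   have "almost GG (\<lambda>t. w \<bullet>\<^bsub>W\<^esub> s \<bullet>\<^bsub>W\<^esub> t \<in> Domain ?u)"
    by (rule almost_elim[OF im[OF y]]) (use rh(5)[OF y] in blast)
   then show "w \<bullet>\<^bsub>W\<^esub> s \<in> cl GG W (Domain ?u)" using w s by (simp add: cl_def)
  qed
  show "v \<in> tor GG V" if v: "(\<zero>\<^bsub>W\<^esub>, v) \<in> ?u" for v
  proof -
   obtain y where y: "(\<zero>\<^bsub>W\<^esub>, y) \<in> h" "(v, y) \<in> i" using v by auto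
   have t: "y \<in> tor GG Y" by (rule corrD(3)[OF gW gY H(1) y(1)])
   have "(v, \<zero>\<^bsub>Y\<^esub>) \<in> i"
    by (rule I(5)[OF y(2)]) (use t GY.gsD(3,5)[OF GY.gs_tor] in auto)
   then show ?thesis by (rule inj)
  qed
 qed
 note u = cl_in_sat[OF gW gV u0]
 have ui: "?u O i \<subseteq> h"
 proof (intro subrelI, elim relcompE)
  fix w y w1 v y1 w2 y2 v2
  assume "(w, y) = (w1, y1)" "(w1, v) = (w2, v2)" "(v, y1) \<in> i" "(w2, y2) \<in> h" "(y2, v2) \<in> i\<inverse>"
  then have *: "(v, y) \<in> i" "(w, y2) \<in> h" "(v, y2) \<in> i" by auto
  show "(w, y) \<in> h" by (rule H(5)[OF *(2) ri(2)[OF *(1)] corrD(4)[OF gV gY I(1) *(1,3)]])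
 qed
 show ?thesis
 proof (rule ex1I[of _ "cl GG (dsum W V) ?u"])
  show "cl GG (dsum W V) ?u \<in> sat R GG W V \<and> cl GG (dsum W Y) (cl GG (dsum W V) ?u O i) = h"
   by (intro conjI u comp_cl_left_eq[OF gW gV gY u0 i h ui])
 next
  fix u' assume *: "u' \<in> sat R GG W V \<and> cl GG (dsum W Y) (u' O i) = h"
  then have u': "u' \<in> sat R GG W V" by simp
  have ui': "u' O i \<subseteq> h" using Cmp_superset[OF W V Y u' i] * by auto
  note ru = relD[OF gW gV satD(2)[OF gW gV u']]
  have "u' \<subseteq> cl GG (dsum W V) ?u"
  proof (intro subrelI satD(3)[OF gW gV u(1)])
   fix w v assume wv: "(w, v) \<in> u'"
   show "w \<in> carrier W" "v \<in> carrier V" using ru(1,2)[OF wv] by auto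
   show "almost GG (\<lambda>s. (w \<bullet>\<^bsub>W\<^esub> s, v \<bullet>\<^bsub>V\<^esub> s) \<in> cl GG (dsum W V) ?u)"
   proof (rule almost_elim[OF corrD(2)[OF gV gY I(1) ru(2)[OF wv]]])
    fix s assume s: "s \<in> carrier R" "\<exists>y\<in>carrier Y. (v \<bullet>\<^bsub>V\<^esub> s, y) \<in> i"
    then show "(w \<bullet>\<^bsub>W\<^esub> s, v \<bullet>\<^bsub>V\<^esub> s) \<in> cl GG (dsum W V) ?u"
     using ru(5)[OF wv s(1)] ui' u(2) by blast
   qed
  qed
  then show "u' = cl GG (dsum W V) ?u" by (intro sat_eqI[OF gW gV u' u(1)])
 qed
qed

lemma sat_kernels: "has_kernels D"
 unfolding has_kernels_def
proof (intro ballI)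
 fix V Y f assume "V \<in> Ob D" "Y \<in> Ob D" "f \<in> Mor D V Y"
 then have V: "V \<in> A" and Y: "Y \<in> A" and f: "f \<in> sat R GG V Y" by auto
 note gV = A_gm[OF V] and gY = A_gm[OF Y]
 interpret GV: gabriel_mod R GG V by (rule gabriel_modI[OF gV])
 interpret GY: gabriel_mod R GG Y by (rule gabriel_modI[OF gY])
 let ?U = "{x. (x, \<zero>\<^bsub>Y\<^esub>) \<in> f}"
 let ?i = "sat_of_hom GG (sub_mod V ?U) V (\<lambda>x\<in>?U. x)"
 note K = kernel_incl[OF V Y f]
 note gU = A_gm[OF K(1)] and sU = kernel_gs[OF gV gY f]
 have "is_kernel D V Y f (sub_mod V ?U) ?i"
  unfolding is_kernel_def
 proof (intro conjI ballI impI)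
  show "sub_mod V ?U \<in> Ob D" "?i \<in> Mor D (sub_mod V ?U) V" using K by auto
  show "is_zero_mor D (sub_mod V ?U) Y (Cmp D (sub_mod V ?U) V Y f ?i)"
   using zero_comp_iff[OF K(1) V Y K(2) f] K(4) by blast
  fix W h assume "W \<in> Ob D" "h \<in> Mor D W V" and z: "is_zero_mor D W Y (Cmp D W V Y f h)"
  then have W: "W \<in> A" and h: "h \<in> sat R GG W V" by auto
  note rh = relD[OF A_gm[OF W] gV satD(2)[OF A_gm[OF W] gV h]]
  have hf: "h O f \<subseteq> zrel W Y" using zero_comp_iff[OF W V Y h f] z by blast
  show "\<exists>!u. u \<in> Mor D W (sub_mod V ?U) \<and> Cmp D W (sub_mod V ?U) V ?i u = h"
   unfolding sat_cat_simps
  proof (rule mono_factor[OF W K(1) V K(2) h])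
   show "x \<in> tor GG (sub_mod V ?U)" if x: "(x, \<zero>\<^bsub>V\<^esub>) \<in> ?i" for x
   proof -
    have xU: "x \<in> ?U" using relD(1)[OF gU gV satD(2)[OF gU gV K(2)] x] by simp
    have "x \<ominus>\<^bsub>V\<^esub> \<zero>\<^bsub>V\<^esub> \<in> tor GG V" by (rule corrD(4)[OF gU gV satD(1)[OF gU gV K(2)] K(3)[OF xU] x])
    then show ?thesis using xU GV.gsD(9)[OF sU xU] by (simp add: tor_sub_mod[OF gV sU])
   qed
   fix w v assume w: "(w, v) \<in> h"
   have v: "v \<in> carrier V" using rh(2)[OF w] .
   have "(v, \<zero>\<^bsub>Y\<^esub>) \<in> f"
   proof (rule sat_memI[OF gV gY f v])
    fix s y assume s: "s \<in> carrier R" "(v \<bullet>\<^bsub>V\<^esub> s, y) \<in> f" "y \<in> carrier Y"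
    then have "y \<in> tor GG Y" using rh(5)[OF w s(1)] hf by blast
    then show "\<zero>\<^bsub>Y\<^esub> \<bullet>\<^bsub>Y\<^esub> s \<ominus>\<^bsub>Y\<^esub> y \<in> tor GG Y"
     using s GY.gsD(3,5)[OF GY.gs_tor] by simp
   qed simp
   then show "almost GG (\<lambda>t. v \<bullet>\<^bsub>V\<^esub> t \<in> Range ?i)"
    using GV.gsD(7)[OF sU] K(3) by (intro almost_always) blast
  qed
 qed
 then show "\<exists>N i. is_kernel D V Y f N i" by blast
qed

text \<open>The cokernel of \<open>f\<close> is the quotient by the range of the relation \<open>f\<close>.\<close>

lemma quotient_exists_Range:
 assumes "Y \<in> A" "V \<in> A" "f \<in> sat R GG Y V"
 shows "\<exists>Q q. quotient_data V (Range f) Q q"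
 by (rule quotient_exists[OF assms(2) relD(9)[OF A_gm[OF assms(1)] A_gm[OF assms(2)]
  satD(2)[OF A_gm[OF assms(1)] A_gm[OF assms(2)] assms(3)]]])

lemma quotient_sat:
 assumes "Y \<in> A" "V \<in> A" "f \<in> sat R GG Y V" and d: "quotient_data V (Range f) Q q"
 shows "Q \<in> A" "q \<in> graded_hom R V Q" "q ` carrier V = carrier Q"
  "\<And>v. v \<in> carrier V ==> q v = \<zero>\<^bsub>Q\<^esub> \<longleftrightarrow> v \<in> Range f" "sat_of_hom GG V Q q \<in> sat R GG V Q"
  "f O sat_of_hom GG V Q q \<subseteq> zrel Y Q"
proof -
 note gY = A_gm[OF assms(1)] and gV = A_gm[OF assms(2)]
 note rf = relD[OF gY gV satD(2)[OF gY gV assms(3)]]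
 show Q: "Q \<in> A" "q \<in> graded_hom R V Q" "q ` carrier V = carrier Q"
  "\<And>v. v \<in> carrier V ==> q v = \<zero>\<^bsub>Q\<^esub> \<longleftrightarrow> v \<in> Range f"
  using d by (auto simp: quotient_data_def)
 note gQ = A_gm[OF Q(1)]
 interpret Q: gmod R Q by (rule gmodI[OF gQ])
 show "f O sat_of_hom GG V Q q \<subseteq> zrel Y Q"
 proof (intro subrelI, elim relcompE)
  fix y z y' v z' assume "(y, z) = (y', z')" "(y', v) \<in> f" "(v, z') \<in> sat_of_hom GG V Q q"
  then have *: "(y, v) \<in> f" "v \<in> carrier V" "z \<in> carrier Q" "z \<ominus>\<^bsub>Q\<^esub> q v \<in> tor GG Q"
   by (auto simp: sat_of_hom_def)
  have "q v = \<zero>\<^bsub>Q\<^esub>" using Q(4)[OF *(2)] *(1) by auto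
  then show "(y, z) \<in> zrel Y Q" using * rf(1) by auto
 qed
 show "sat_of_hom GG V Q q \<in> sat R GG V Q" by (rule sat_of_hom[OF gV gQ Q(2)])
qed

lemma quotient_torsion_mem:
 assumes "Y \<in> A" "V \<in> A" "W \<in> A" and f: "f \<in> sat R GG Y V" and d: "quotient_data V (Range f) Q q"
  and h: "h \<in> sat R GG V W" and z: "f O h \<subseteq> zrel Y W"
  and x: "(x, w) \<in> h" "q x \<in> tor GG Q"
 shows "w \<in> tor GG W"
proof -
 note gm = assms(1-3)[THEN A_gm]
 have q: "q \<in> graded_hom R V Q" and k: "\<And>v. v \<in> carrier V ==> q v = \<zero>\<^bsub>Q\<^esub> \<longleftrightarrow> v \<in> Range f"
  using d by (auto simp: quotient_data_def)
 interpret GW: gabriel_mod R GG W by (rule gabriel_modI[OF gm(3)])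
 note rh = relD[OF gm(2,3) satD(2)[OF gm(2,3) h]]
 show ?thesis
 proof (rule GW.almost_cl[OF GW.gs_zero rh(2)[OF x(1)]])
  have "almost GG (\<lambda>s. q x \<bullet>\<^bsub>Q\<^esub> s = \<zero>\<^bsub>Q\<^esub>)" using x(2) by (simp add: cl_def)
  then show "almost GG (\<lambda>s. w \<bullet>\<^bsub>W\<^esub> s \<in> tor GG W)"
  proof (rule almost_elim)
   fix s assume s: "s \<in> carrier R" "q x \<bullet>\<^bsub>Q\<^esub> s = \<zero>\<^bsub>Q\<^esub>"
   have xs: "(x \<bullet>\<^bsub>V\<^esub> s, w \<bullet>\<^bsub>W\<^esub> s) \<in> h" by (rule rh(5)[OF x(1) s(1)])
   have "q (x \<bullet>\<^bsub>V\<^esub> s) = \<zero>\<^bsub>Q\<^esub>" using graded_homD(3)[OF q rh(1)[OF x(1)] s(1)] s(2) by simp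
   then have "x \<bullet>\<^bsub>V\<^esub> s \<in> Range f" using k[OF rh(1)[OF xs]] by simp
   then show "w \<bullet>\<^bsub>W\<^esub> s \<in> tor GG W" using xs z by auto
  qed
 qed
qed

text \<open>Dually, a factorisation through an epimorphism \<open>i\<close> is a composite with the converse of \<open>i\<close>.\<close>

lemma epi_factor:
 assumes o: "Y \<in> A" "V \<in> A" "W \<in> A" and i: "i \<in> sat R GG Y V" and h: "h \<in> sat R GG Y W"
  and dense: "\<And>v. v \<in> carrier V ==> almost GG (\<lambda>s. v \<bullet>\<^bsub>V\<^esub> s \<in> Range i)"
  and kt: "\<And>y w. (y, w) \<in> h ==> (y, \<zero>\<^bsub>V\<^esub>) \<in> i ==> w \<in> tor GG W"
 shows "\<exists>!u. u \<in> sat R GG V W \<and> cl GG (dsum Y W) (i O u) = h"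
proof -
 note Y = o(1) and V = o(2) and W = o(3)
 note gW = A_gm[OF W] and gV = A_gm[OF V] and gY = A_gm[OF Y]
 interpret GW: gabriel_mod R GG W by (rule gabriel_modI[OF gW])
 interpret GV: gabriel_mod R GG V by (rule gabriel_modI[OF gV])
 interpret GY: gabriel_mod R GG Y by (rule gabriel_modI[OF gY])
 note I = satD[OF gY gV i] and ri = relD[OF gY gV satD(2)[OF gY gV i]]
 note H = satD[OF gY gW h] and rh = relD[OF gY gW satD(2)[OF gY gW h]]
 let ?u = "i\<inverse> O h"
 have gs: "graded_submodule R (dsum V W) ?u"
  by (rule rel_comp[OF gV gY gW rel_converse[OF gY gV I(2)] H(2)])
 have u0: "corr R GG V W ?u"
 proof (rule corrI[OF gV gW gs])
  note gD = relD(8)[OF gV gW gs]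
  show "v \<in> cl GG V (Domain ?u)" if v: "v \<in> carrier V" for v
  proof (rule GV.almost_cl[OF gD v almost_elim[OF dense[OF v]]])
   fix s assume s: "s \<in> carrier R" "v \<bullet>\<^bsub>V\<^esub> s \<in> Range i"
   then obtain y where y: "(y, v \<bullet>\<^bsub>V\<^esub> s) \<in> i" by auto
   have "almost GG (\<lambda>t. v \<bullet>\<^bsub>V\<^esub> s \<bullet>\<^bsub>V\<^esub> t \<in> Domain ?u)"
    by (rule almost_elim[OF corrD(2)[OF gY gW H(1) ri(1)[OF y]]]) (use ri(5)[OF y] in blast)
   then show "v \<bullet>\<^bsub>V\<^esub> s \<in> cl GG V (Domain ?u)" using v s by (simp add: cl_def)
  qed
  show "w \<in> tor GG W" if "(\<zero>\<^bsub>V\<^esub>, w) \<in> ?u" for w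
   using that kt by auto
 qed
 note u = cl_in_sat[OF gV gW u0]
 have iu: "i O ?u \<subseteq> h"
 proof (intro subrelI, elim relcompE)
  fix y w y1 v w1 v2 y2 w2
  assume "(y, w) = (y1, w1)" "(y1, v) \<in> i" "(v, w1) = (v2, w2)" "(v2, y2) \<in> i\<inverse>" "(y2, w2) \<in> h"
  then have *: "(y, v) \<in> i" "(y2, v) \<in> i" "(y2, w) \<in> h" by auto
  have c: "y \<in> carrier Y" "y2 \<in> carrier Y" "v \<in> carrier V" "w \<in> carrier W" using * ri rh by auto
  have k: "(y2 \<ominus>\<^bsub>Y\<^esub> y, \<zero>\<^bsub>V\<^esub>) \<in> i" using ri(7)[OF *(2,1)] c by simp
  show "(y, w) \<in> h"
  proof (rule sat_memI[OF gY gW h c(1,4)])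
   fix s w' assume s: "s \<in> carrier R" "(y \<bullet>\<^bsub>Y\<^esub> s, w') \<in> h"
   have "((y2 \<ominus>\<^bsub>Y\<^esub> y) \<bullet>\<^bsub>Y\<^esub> s, w \<bullet>\<^bsub>W\<^esub> s \<ominus>\<^bsub>W\<^esub> w') \<in> h"
    using rh(7)[OF rh(5)[OF *(3) s(1)] s(2)] c s(1) by (simp add: GY.act_diff_left)
   moreover have "((y2 \<ominus>\<^bsub>Y\<^esub> y) \<bullet>\<^bsub>Y\<^esub> s, \<zero>\<^bsub>V\<^esub>) \<in> i" using ri(5)[OF k s(1)] s(1) by simp
   ultimately show "w \<bullet>\<^bsub>W\<^esub> s \<ominus>\<^bsub>W\<^esub> w' \<in> tor GG W" by (rule kt)
  qed
 qed
 show ?thesis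
 proof (rule ex1I[of _ "cl GG (dsum V W) ?u"])
  show "cl GG (dsum V W) ?u \<in> sat R GG V W \<and> cl GG (dsum Y W) (i O cl GG (dsum V W) ?u) = h"
   by (intro conjI u comp_cl_right_eq[OF gY gV gW i u0 h iu])
 next
  fix u' assume *: "u' \<in> sat R GG V W \<and> cl GG (dsum Y W) (i O u') = h"
  then have u': "u' \<in> sat R GG V W" by simp
  have iu': "i O u' \<subseteq> h" using Cmp_superset[OF Y V W i u'] * by auto
  have "?u \<subseteq> u'"
  proof (intro subrelI)
   fix v w assume "(v, w) \<in> ?u"
   then obtain y where y: "(y, v) \<in> i" "(y, w) \<in> h" by auto
   show "(v, w) \<in> u'"
   proof (rule sat_memI[OF gV gW u' ri(2)[OF y(1)] rh(2)[OF y(2)]])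
    fix s w' assume s: "s \<in> carrier R" "(v \<bullet>\<^bsub>V\<^esub> s, w') \<in> u'"
    then have "(y \<bullet>\<^bsub>Y\<^esub> s, w') \<in> h" using iu' ri(5)[OF y(1) s(1)] by auto
    then show "w \<bullet>\<^bsub>W\<^esub> s \<ominus>\<^bsub>W\<^esub> w' \<in> tor GG W"
     by (rule corrD(4)[OF gY gW H(1) rh(5)[OF y(2) s(1)]])
   qed
  qed
  then show "u' = cl GG (dsum V W) ?u" by (intro cl_eq_sat[OF gV gW u0 u', symmetric])
 qed
qed

lemma sat_cokernels: "has_kernels (op_cat D)"
 unfolding has_kernels_def
proof (intro ballI)
 fix V Y f assume "V \<in> Ob (op_cat D)" "Y \<in> Ob (op_cat D)" "f \<in> Mor (op_cat D) V Y"
 then have V: "V \<in> A" and Y: "Y \<in> A" and f: "f \<in> sat R GG Y V" by auto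
 note gV = A_gm[OF V] and gY = A_gm[OF Y]
 obtain Q q where d: "quotient_data V (Range f) Q q"
  using quotient_exists_Range[OF Y V f] by blast
 note Q = quotient_sat[OF Y V f d]
 let ?c = "sat_of_hom GG V Q q"
 note gQ = A_gm[OF Q(1)]
 interpret GV: gabriel_mod R GG V by (rule gabriel_modI[OF gV])
 interpret GQ: gabriel_mod R GG Q by (rule gabriel_modI[OF gQ])
 interpret q: ghom R V Q q by (rule ghomI[OF gV gQ Q(2)])
 note rf = relD[OF gY gV satD(2)[OF gY gV f]]
 have "is_kernel (op_cat D) V Y f Q ?c"
  unfolding is_kernel_def
 proof (intro conjI ballI impI)
  show "Q \<in> Ob (op_cat D)" "?c \<in> Mor (op_cat D) Q V" using Q by auto
  show "is_zero_mor (op_cat D) Q Y (Cmp (op_cat D) Q V Y f ?c)"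
   unfolding is_zero_mor_op op_cat_simps using zero_comp_iff[OF Y V Q(1) f Q(5)] Q(6) by blast
  fix W h assume "W \<in> Ob (op_cat D)" "h \<in> Mor (op_cat D) W V"
   and z: "is_zero_mor (op_cat D) W Y (Cmp (op_cat D) W V Y f h)"
  then have W: "W \<in> A" and h: "h \<in> sat R GG V W" by auto
  note gW = A_gm[OF W]
  interpret GW: gabriel_mod R GG W by (rule gabriel_modI[OF gW])
  have fh: "f O h \<subseteq> zrel Y W"
   using zero_comp_iff[OF Y V W f h] z unfolding is_zero_mor_op op_cat_simps by blast
  show "\<exists>!u. u \<in> Mor (op_cat D) W Q \<and> Cmp (op_cat D) W Q V ?c u = h"
   unfolding op_cat_simps sat_cat_simps
  proof (rule epi_factor[OF V Q(1) W Q(5) h])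
   fix x assume "x \<in> carrier Q"
   then obtain v where v: "x = q v" "v \<in> carrier V" using Q(3) by auto
   have "(v \<bullet>\<^bsub>V\<^esub> s, x \<bullet>\<^bsub>Q\<^esub> s) \<in> ?c" if "s \<in> carrier R" for s
    using hom_mem_sat[OF gV gQ Q(2), of "v \<bullet>\<^bsub>V\<^esub> s"] v that by (simp add: q.hom_act)
   then show "almost GG (\<lambda>s. x \<bullet>\<^bsub>Q\<^esub> s \<in> Range ?c)" by (intro almost_always) blast
  next
   fix v w assume w: "(v, w) \<in> h" and v: "(v, \<zero>\<^bsub>Q\<^esub>) \<in> ?c"
   then have vc: "v \<in> carrier V" by (simp add: sat_of_hom_def)
   have "q v \<ominus>\<^bsub>Q\<^esub> \<zero>\<^bsub>Q\<^esub> \<in> tor GG Q"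
    by (rule corrD(4)[OF gV gQ satD(1)[OF gV gQ Q(5)] hom_mem_sat[OF gV gQ Q(2) vc] v])
   then show "w \<in> tor GG W"
    using quotient_torsion_mem[OF Y V W f d h fh w] q.hom_closed[OF vc] by simp
  qed
 qed
 then show "\<exists>N i. is_kernel (op_cat D) V Y f N i" by blast
qed

lemma sat_monos: "monos_are_kernels D"
 unfolding monos_are_kernels_def
proof (intro ballI allI impI)
 fix V Y i assume "V \<in> Ob D" "Y \<in> Ob D" and mono: "is_mono D V Y i"
 then have V: "V \<in> A" and Y: "Y \<in> A" and i: "i \<in> sat R GG V Y" by (auto simp: is_mono_def)
 note gV = A_gm[OF V] and gY = A_gm[OF Y]
 interpret GV: gabriel_mod R GG V by (rule gabriel_modI[OF gV])
 interpret GY: gabriel_mod R GG Y by (rule gabriel_modI[OF gY])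
 note I = satD[OF gV gY i] and ri = relD[OF gV gY satD(2)[OF gV gY i]]
 let ?U = "{x. (x, \<zero>\<^bsub>Y\<^esub>) \<in> i}"
 note K = kernel_incl[OF V Y i]
 note gU = A_gm[OF K(1)]
 have inj: "x \<in> tor GG V" if "(x, \<zero>\<^bsub>Y\<^esub>) \<in> i" for x
 proof -
  let ?g = "sat_of_hom GG (sub_mod V ?U) V (\<lambda>x\<in>?U. x)" and ?h = "zrel (sub_mod V ?U) V"
  have h: "?h \<in> sat R GG (sub_mod V ?U) V" by (rule zrel_sat[OF gU gV])
  have "?h O i \<subseteq> zrel (sub_mod V ?U) Y" using I(6) by auto
  then have "Cmp D (sub_mod V ?U) V Y i ?g = Cmp D (sub_mod V ?U) V Y i ?h"
   using Cmp_eq_iff[OF K(1) V Y K(2) i zrel_sat[OF gU gY]]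
    Cmp_eq_iff[OF K(1) V Y h i zrel_sat[OF gU gY]] K(4) by simp
  then have "?g = ?h" using mono K(1,2) h unfolding is_mono_def by simp
  then show ?thesis using K(3)[of x] that by auto
 qed
 obtain Q q where "quotient_data Y (Range i) Q q"
  using quotient_exists_Range[OF V Y i] by blast
 note Q = quotient_sat[OF V Y i this]
 let ?c = "sat_of_hom GG Y Q q"
 note gQ = A_gm[OF Q(1)]
 interpret q: ghom R Y Q q by (rule ghomI[OF gY gQ Q(2)])
 have "is_kernel D Y Q ?c V i"
  unfolding is_kernel_def
 proof (intro conjI ballI impI)
  show "V \<in> Ob D" "i \<in> Mor D V Y" using V i by auto
  show "is_zero_mor D V Q (Cmp D V Y Q ?c i)" using zero_comp_iff[OF V Y Q(1) i Q(5)] Q(6) by blast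
  fix W h assume "W \<in> Ob D" "h \<in> Mor D W Y" and z: "is_zero_mor D W Q (Cmp D W Y Q ?c h)"
  then have W: "W \<in> A" and h: "h \<in> sat R GG W Y" by auto
  note gW = A_gm[OF W]
  have hc: "h O ?c \<subseteq> zrel W Q" using zero_comp_iff[OF W Y Q(1) h Q(5)] z by blast
  show "\<exists>!u. u \<in> Mor D W V \<and> Cmp D W V Y i u = h"
   unfolding sat_cat_simps
  proof (rule mono_factor[OF W V Y i h inj])
   fix w y assume y: "(w, y) \<in> h"
   have yc: "y \<in> carrier Y" by (rule relD(2)[OF gW gY satD(2)[OF gW gY h] y])
   then have "q y \<in> tor GG Q" using hc hom_mem_sat[OF gY gQ Q(2) yc] y by auto
   then have "almost GG (\<lambda>t. q y \<bullet>\<^bsub>Q\<^esub> t = \<zero>\<^bsub>Q\<^esub>)" by (simp add: cl_def)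
   then show "almost GG (\<lambda>t. y \<bullet>\<^bsub>Y\<^esub> t \<in> Range i)"
    by (rule almost_elim) (use Q(4) yc in \<open>simp add: q.hom_act[symmetric]\<close>)
  qed
 qed
 then show "\<exists>Z\<in>Ob D. \<exists>f\<in>Mor D Y Z. is_kernel D Y Z f V i" using Q by (intro bexI[of _ Q] bexI[of _ ?c]) auto
qed

lemma sat_epis: "monos_are_kernels (op_cat D)"
 unfolding monos_are_kernels_def
proof (intro ballI allI impI)
 fix V Y i assume "V \<in> Ob (op_cat D)" "Y \<in> Ob (op_cat D)" and epi: "is_mono (op_cat D) V Y i"
 then have V: "V \<in> A" and Y: "Y \<in> A" and i: "i \<in> sat R GG Y V" by (auto simp: is_mono_def)
 note gV = A_gm[OF V] and gY = A_gm[OF Y]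
 interpret GV: gabriel_mod R GG V by (rule gabriel_modI[OF gV])
 interpret GY: gabriel_mod R GG Y by (rule gabriel_modI[OF gY])
 note I = satD[OF gY gV i] and ri = relD[OF gY gV satD(2)[OF gY gV i]]
 let ?U = "{x. (x, \<zero>\<^bsub>V\<^esub>) \<in> i}"
 let ?f = "sat_of_hom GG (sub_mod Y ?U) Y (\<lambda>x\<in>?U. x)"
 note K = kernel_incl[OF Y V i]
 note gU = A_gm[OF K(1)]
 have dense: "almost GG (\<lambda>s. v \<bullet>\<^bsub>V\<^esub> s \<in> Range i)" if v: "v \<in> carrier V" for v
 proof -
  obtain Q q where "quotient_data V (Range i) Q q"
  using quotient_exists_Range[OF Y V i] by blast
 note Q = quotient_sat[OF Y V i this]
  let ?c = "sat_of_hom GG V Q q"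
  note gQ = A_gm[OF Q(1)]
  have h: "zrel V Q \<in> sat R GG V Q" by (rule zrel_sat[OF gV gQ])
  have "i O zrel V Q \<subseteq> zrel Y Q" using ri(1) by auto
  then have "Cmp D Y V Q ?c i = Cmp D Y V Q (zrel V Q) i"
   using Cmp_eq_iff[OF Y V Q(1) i Q(5) zrel_sat[OF gY gQ]]
    Cmp_eq_iff[OF Y V Q(1) i h zrel_sat[OF gY gQ]] Q(6) by simp
  then have "?c = zrel V Q" using epi Q(1,5) h unfolding is_mono_def by simp
  then have "q v \<in> tor GG Q" using hom_mem_sat[OF gV gQ Q(2) v] by auto
  then have "almost GG (\<lambda>s. q v \<bullet>\<^bsub>Q\<^esub> s = \<zero>\<^bsub>Q\<^esub>)" by (simp add: cl_def)
  then show ?thesis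
  proof (rule almost_elim)
   fix s assume "s \<in> carrier R" "q v \<bullet>\<^bsub>Q\<^esub> s = \<zero>\<^bsub>Q\<^esub>"
   then show "v \<bullet>\<^bsub>V\<^esub> s \<in> Range i"
    using Q(4)[of "v \<bullet>\<^bsub>V\<^esub> s"] v graded_homD(3)[OF Q(2) v, of s] by simp
  qed
 qed
 have "is_kernel (op_cat D) Y (sub_mod Y ?U) ?f V i"
  unfolding is_kernel_def
 proof (intro conjI ballI impI)
  show "V \<in> Ob (op_cat D)" "i \<in> Mor (op_cat D) V Y" using V i by auto
  show "is_zero_mor (op_cat D) V (sub_mod Y ?U) (Cmp (op_cat D) V Y (sub_mod Y ?U) ?f i)"
   unfolding is_zero_mor_op op_cat_simps using zero_comp_iff[OF K(1) Y V K(2) i] K(4) by blast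
  fix W h assume "W \<in> Ob (op_cat D)" "h \<in> Mor (op_cat D) W Y"
   and z: "is_zero_mor (op_cat D) W (sub_mod Y ?U) (Cmp (op_cat D) W Y (sub_mod Y ?U) ?f h)"
  then have W: "W \<in> A" and h: "h \<in> sat R GG Y W" by auto
  note gW = A_gm[OF W]
  interpret GW: gabriel_mod R GG W by (rule gabriel_modI[OF gW])
  have fh: "?f O h \<subseteq> zrel (sub_mod Y ?U) W"
   using zero_comp_iff[OF K(1) Y W K(2) h] z unfolding is_zero_mor_op op_cat_simps by blast
  have kt: "w \<in> tor GG W" if "(y, w) \<in> h" "(y, \<zero>\<^bsub>V\<^esub>) \<in> i" for y w
   using fh K(3)[of y] that by auto
  show "\<exists>!u. u \<in> Mor (op_cat D) W V \<and> Cmp (op_cat D) W V Y i u = h"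
   unfolding op_cat_simps sat_cat_simps by (rule epi_factor[OF Y V W i h dense kt])
 qed
 then show "\<exists>Z\<in>Ob (op_cat D). \<exists>f\<in>Mor (op_cat D) Y Z. is_kernel (op_cat D) Y Z f V i"
  using K by (intro bexI[of _ "sub_mod Y ?U"] bexI[of _ ?f]) auto
qed

theorem sat_abelian: "is_abelian D"
 unfolding is_abelian_def
 by (intro conjI sat_category zero_obj_exists sat_binary_products sat_binary_coproducts sat_kernels
   sat_cokernels sat_monos sat_epis)

end

section \<open>Isomorphisms and equivalences of categories\<close>

text \<open>Being abelian is transported along isomorphisms of categories that are the identity on objects. The
  dual conditions follow because opposite categories are then isomorphic, too.\<close>

locale cat_iso =
 fixes C :: "('o, 'f) category" and D :: "('o, 'g) category" and E :: "'o \<Rightarrow> 'o \<Rightarrow> 'f \<Rightarrow> 'g"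
 assumes D_cat: "is_category D" and Ob_eq: "Ob C = Ob D"
  and E_bij: "V \<in> Ob D ==> Y \<in> Ob D ==> bij_betw (E V Y) (Mor C V Y) (Mor D V Y)"
  and E_Idn: "V \<in> Ob D ==> Idn C V \<in> Mor C V V" "V \<in> Ob D ==> E V V (Idn C V) = Idn D V"
  and E_Cmp: "V \<in> Ob D ==> Y \<in> Ob D ==> Z \<in> Ob D ==> f \<in> Mor C V Y ==> g \<in> Mor C Y Z ==>
    Cmp C V Y Z g f \<in> Mor C V Z"
   "V \<in> Ob D ==> Y \<in> Ob D ==> Z \<in> Ob D ==> f \<in> Mor C V Y ==> g \<in> Mor C Y Z ==>
    E V Z (Cmp C V Y Z g f) = Cmp D V Y Z (E Y Z g) (E V Y f)"
begin

lemma E_closed: "V \<in> Ob D ==> Y \<in> Ob D ==> f \<in> Mor C V Y ==> E V Y f \<in> Mor D V Y"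
 using bij_betwE[OF E_bij] by blast

lemma E_inj: "V \<in> Ob D ==> Y \<in> Ob D ==> f \<in> Mor C V Y ==> g \<in> Mor C V Y ==> E V Y f = E V Y g \<longleftrightarrow> f = g"
 using bij_betw_imp_inj_on[OF E_bij] by (auto dest: inj_onD)

lemma E_eq: "V \<in> Ob D ==> Y \<in> Ob D ==> Z \<in> Ob D ==> f \<in> Mor C V Y ==> g \<in> Mor C Y Z ==> h \<in> Mor C V Z ==>
  Cmp C V Y Z g f = h \<longleftrightarrow> Cmp D V Y Z (E Y Z g) (E V Y f) = E V Z h"
 using E_inj[of V Z "Cmp C V Y Z g f" h] E_Cmp by simp

lemma E_surj: "V \<in> Ob D ==> Y \<in> Ob D ==> g \<in> Mor D V Y ==> \<exists>f. f \<in> Mor C V Y \<and> E V Y f = g"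
proof -
 assume "V \<in> Ob D" "Y \<in> Ob D" "g \<in> Mor D V Y"
 then have "g \<in> E V Y ` Mor C V Y" using bij_betw_imp_surj_on[OF E_bij, of V Y] by simp
 then show ?thesis by auto
qed

lemma E_ball: "V \<in> Ob D ==> Y \<in> Ob D ==> (\<forall>f\<in>Mor C V Y. P (E V Y f)) \<longleftrightarrow> (\<forall>g\<in>Mor D V Y. P g)"
 using E_surj E_closed by metis

lemma E_bex: "V \<in> Ob D ==> Y \<in> Ob D ==> (\<exists>f\<in>Mor C V Y. P (E V Y f)) \<longleftrightarrow> (\<exists>g\<in>Mor D V Y. P g)"
 using E_surj E_closed by metis

lemma E_ex1:
 assumes "V \<in> Ob D" "Y \<in> Ob D" "\<And>f. f \<in> Mor C V Y ==> P f \<longleftrightarrow> Q (E V Y f)"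
 shows "(\<exists>!f. f \<in> Mor C V Y \<and> P f) \<longleftrightarrow> (\<exists>!g. g \<in> Mor D V Y \<and> Q g)"
proof
 assume "\<exists>!f. f \<in> Mor C V Y \<and> P f"
 then obtain f where f: "f \<in> Mor C V Y" "P f" "\<And>f'. f' \<in> Mor C V Y ==> P f' ==> f' = f" by auto
 show "\<exists>!g. g \<in> Mor D V Y \<and> Q g"
 proof (rule ex1I[of _ "E V Y f"])
  show "E V Y f \<in> Mor D V Y \<and> Q (E V Y f)"
   using f(1,2) assms(3)[OF f(1)] E_closed[OF assms(1,2) f(1)] by simp
  fix g assume g: "g \<in> Mor D V Y \<and> Q g"
  then obtain f' where "f' \<in> Mor C V Y" "E V Y f' = g" using E_surj[OF assms(1,2)] by blast
  then show "g = E V Y f" using f(3)[of f'] assms(3)[of f'] g by simp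
 qed
next
 assume "\<exists>!g. g \<in> Mor D V Y \<and> Q g"
 then obtain g where g: "g \<in> Mor D V Y" "Q g" "\<And>g'. g' \<in> Mor D V Y ==> Q g' ==> g' = g" by auto
 then obtain f where f: "f \<in> Mor C V Y" "E V Y f = g" using E_surj[OF assms(1,2)] by blast
 show "\<exists>!f. f \<in> Mor C V Y \<and> P f"
 proof (rule ex1I[of _ f])
  show "f \<in> Mor C V Y \<and> P f" using f g(2) assms(3)[OF f(1)] by simp
  fix f' assume f': "f' \<in> Mor C V Y \<and> P f'"
  then have "E V Y f' = E V Y f"
   using g(3)[OF E_closed[OF assms(1,2)], of f'] assms(3)[of f'] f by simp
  then show "f' = f" using E_inj[OF assms(1,2), of f' f] f f' by simp
 qed
qed

lemma iso_category: "is_category C"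
 unfolding is_category_def Ob_eq
proof (intro conjI ballI)
 fix V Y f assume *: "V \<in> Ob D" "Y \<in> Ob D" "f \<in> Mor C V Y"
 have "Cmp D V V Y (E V Y f) (Idn D V) = E V Y f" "Cmp D V Y Y (Idn D Y) (E V Y f) = E V Y f"
  using D_cat E_closed[OF *] * unfolding is_category_def by auto
 then have e: "E V Y (Cmp C V V Y f (Idn C V)) = E V Y f" "E V Y (Cmp C V Y Y (Idn C Y) f) = E V Y f"
  using * by (simp_all add: E_Cmp E_Idn)
 show "Cmp C V V Y f (Idn C V) = f"
  using E_inj[OF *(1,2) E_Cmp(1)[OF *(1,1,2) E_Idn(1)[OF *(1)] *(3)] *(3)] e by simp
 show "Cmp C V Y Y (Idn C Y) f = f"
  using E_inj[OF *(1,2) E_Cmp(1)[OF *(1,2,2) *(3) E_Idn(1)[OF *(2)]] *(3)] e by simp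
next
 fix W V Y Z f g h assume o: "W \<in> Ob D" "V \<in> Ob D" "Y \<in> Ob D" "Z \<in> Ob D"
  and m: "f \<in> Mor C W V" "g \<in> Mor C V Y" "h \<in> Mor C Y Z"
 have "Cmp D W Y Z (E Y Z h) (Cmp D W V Y (E V Y g) (E W V f)) =
   Cmp D W V Z (Cmp D V Y Z (E Y Z h) (E V Y g)) (E W V f)"
  using D_cat o E_closed m unfolding is_category_def by blast
 then have "E W Z (Cmp C W Y Z h (Cmp C W V Y g f)) = E W Z (Cmp C W V Z (Cmp C V Y Z h g) f)"
  using o m by (simp add: E_Cmp)
 then show "Cmp C W Y Z h (Cmp C W V Y g f) = Cmp C W V Z (Cmp C V Y Z h g) f"
  using o m E_inj[OF o(1,4)] by (simp add: E_Cmp(1))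
qed (use E_Idn E_Cmp in auto)

lemma iso_zero_obj: "is_zero_obj C Z \<longleftrightarrow> is_zero_obj D Z"
proof -
 have "(\<exists>!f. f \<in> Mor C V Y) \<longleftrightarrow> (\<exists>!f. f \<in> Mor D V Y)" if "V \<in> Ob D" "Y \<in> Ob D" for V Y
  using E_ex1[OF that, of "\<lambda>_. True" "\<lambda>_. True"] by simp
 then show ?thesis unfolding is_zero_obj_def Ob_eq by (auto cong: conj_cong)
qed

lemma iso_zero_mor:
 assumes "V \<in> Ob D" "Y \<in> Ob D" "f \<in> Mor C V Y"
 shows "is_zero_mor C V Y f \<longleftrightarrow> is_zero_mor D V Y (E V Y f)"
proof -
 have "(\<exists>g\<in>Mor C V Z. \<exists>h\<in>Mor C Z Y. f = Cmp C V Z Y h g) \<longleftrightarrow>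
   (\<exists>g\<in>Mor D V Z. \<exists>h\<in>Mor D Z Y. E V Y f = Cmp D V Z Y h g)" if Z: "Z \<in> Ob D" for Z
 proof -
  have "f = Cmp C V Z Y h g \<longleftrightarrow> E V Y f = Cmp D V Z Y (E Z Y h) (E V Z g)"
   if "g \<in> Mor C V Z" "h \<in> Mor C Z Y" for g h
   using E_eq[OF assms(1) Z assms(2) that assms(3)] by auto
  then show ?thesis
   unfolding E_bex[OF assms(1) Z, symmetric] E_bex[OF Z assms(2), symmetric] by blast
 qed
 moreover have "Z \<in> Ob D" if "is_zero_obj D Z" for Z using that by (simp add: is_zero_obj_def)
 ultimately show ?thesis unfolding is_zero_mor_def iso_zero_obj by (auto cong: conj_cong)
qed

lemma iso_kernel:
 assumes V: "V \<in> Ob D" "Y \<in> Ob D" "f \<in> Mor C V Y" and N: "N \<in> Ob D" "i \<in> Mor C N V"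
 shows "is_kernel C V Y f N i \<longleftrightarrow> is_kernel D V Y (E V Y f) N (E N V i)"
proof -
 have z: "is_zero_mor C W Y (Cmp C W V Y f h) \<longleftrightarrow> is_zero_mor D W Y (Cmp D W V Y (E V Y f) (E W V h))"
  if "W \<in> Ob D" "h \<in> Mor C W V" for W h
  using iso_zero_mor[OF that(1) V(2) E_Cmp(1)[OF that(1) V(1,2) that(2) V(3)]]
   E_Cmp(2)[OF that(1) V(1,2) that(2) V(3)] by simp
 have u: "(\<exists>!u. u \<in> Mor C W N \<and> Cmp C W N V i u = h) \<longleftrightarrow>
   (\<exists>!u. u \<in> Mor D W N \<and> Cmp D W N V (E N V i) u = E W V h)" if "W \<in> Ob D" "h \<in> Mor C W V" for W h
 proof (rule E_ex1[OF that(1) N(1)])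
  fix f assume f: "f \<in> Mor C W N"
  show "Cmp C W N V i f = h \<longleftrightarrow> Cmp D W N V (E N V i) (E W N f) = E W V h"
   by (rule E_eq[OF that(1) N(1) V(1) f N(2) that(2)])
 qed
 have "(\<forall>h\<in>Mor C W V. is_zero_mor C W Y (Cmp C W V Y f h) \<longrightarrow>
    (\<exists>!u. u \<in> Mor C W N \<and> Cmp C W N V i u = h)) \<longleftrightarrow>
   (\<forall>h\<in>Mor D W V. is_zero_mor D W Y (Cmp D W V Y (E V Y f) h) \<longrightarrow>
    (\<exists>!u. u \<in> Mor D W N \<and> Cmp D W N V (E N V i) u = h))" if W: "W \<in> Ob D" for W
  unfolding E_ball[OF W V(1), symmetric] using z[OF W] u[OF W] by simp
 then show ?thesis
  unfolding is_kernel_def Ob_eq using z[OF N] E_closed[OF N(1) V(1) N(2)] N by simp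
qed

lemma iso_has_kernels: "has_kernels D ==> has_kernels C"
 unfolding has_kernels_def Ob_eq
proof (intro ballI)
 fix V Y f assume k: "\<forall>V\<in>Ob D. \<forall>Y\<in>Ob D. \<forall>f\<in>Mor D V Y. \<exists>N i. is_kernel D V Y f N i"
  and *: "V \<in> Ob D" "Y \<in> Ob D" "f \<in> Mor C V Y"
 then obtain N i where i: "is_kernel D V Y (E V Y f) N i" using E_closed[OF *] by blast
 then have N: "N \<in> Ob D" "i \<in> Mor D N V" by (auto simp: is_kernel_def)
 then obtain i' where "i' \<in> Mor C N V" "E N V i' = i" using E_surj[OF N(1) *(1) N(2)] by blast
 then show "\<exists>N i. is_kernel C V Y f N i" using iso_kernel[OF * N(1), of i'] i by blast
qed

lemma iso_mono:
 assumes "V \<in> Ob D" "Y \<in> Ob D" "is_mono C V Y i" shows "is_mono D V Y (E V Y i)"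
proof -
 have i: "i \<in> Mor C V Y" using assms by (simp add: is_mono_def)
 have "g = h" if W: "W \<in> Ob D" and g: "g \<in> Mor D W V" and h: "h \<in> Mor D W V"
  and e: "Cmp D W V Y (E V Y i) g = Cmp D W V Y (E V Y i) h" for W g h
 proof -
  obtain g' h' where gh: "g' \<in> Mor C W V" "E W V g' = g" "h' \<in> Mor C W V" "E W V h' = h"
   using E_surj[OF W assms(1)] g h by meson
  then have "E W Y (Cmp C W V Y i g') = E W Y (Cmp C W V Y i h')"
   using e E_Cmp(2)[OF W assms(1,2) _ i] by simp
  then have "Cmp C W V Y i g' = Cmp C W V Y i h'"
   using E_inj[OF W assms(2)] E_Cmp(1)[OF W assms(1,2) _ i] gh by simp
  then show "g = h" using assms(3) W gh unfolding is_mono_def Ob_eq by blast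
 qed
 then show ?thesis unfolding is_mono_def using E_closed[OF assms(1,2) i] by blast
qed

lemma iso_monos_are_kernels: "monos_are_kernels D ==> monos_are_kernels C"
 unfolding monos_are_kernels_def Ob_eq
proof (intro ballI allI impI)
 fix V Y i assume k: "\<forall>V\<in>Ob D. \<forall>Y\<in>Ob D. \<forall>i. is_mono D V Y i \<longrightarrow> (\<exists>Z\<in>Ob D. \<exists>f\<in>Mor D Y Z. is_kernel D Y Z f V i)"
  and *: "V \<in> Ob D" "Y \<in> Ob D" "is_mono C V Y i"
 have i: "i \<in> Mor C V Y" using * by (simp add: is_mono_def)
 obtain Z f where Z: "Z \<in> Ob D" "f \<in> Mor D Y Z" "is_kernel D Y Z f V (E V Y i)"
  using k iso_mono[OF *] * by blast
 then obtain f' where f': "f' \<in> Mor C Y Z" "E Y Z f' = f" using E_surj[OF *(2) Z(1,2)] by blast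
 then have "is_kernel C Y Z f' V i" using iso_kernel[OF *(2) Z(1) f'(1) *(1) i] Z(3) by simp
 then show "\<exists>Z\<in>Ob D. \<exists>f\<in>Mor C Y Z. is_kernel C Y Z f V i" using Z(1) f'(1) by blast
qed

lemma iso_products: "has_binary_products D ==> has_binary_products C"
 unfolding has_binary_products_def Ob_eq
proof (intro ballI)
 fix V Y assume *: "V \<in> Ob D" "Y \<in> Ob D" and k: "\<forall>V\<in>Ob D. \<forall>Y\<in>Ob D. \<exists>P\<in>Ob D. \<exists>p\<in>Mor D P V. \<exists>q\<in>Mor D P Y.
   \<forall>W\<in>Ob D. \<forall>f\<in>Mor D W V. \<forall>g\<in>Mor D W Y. \<exists>!u. u \<in> Mor D W P \<and> Cmp D W P V p u = f \<and> Cmp D W P Y q u = g"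
 from bspec[OF bspec[OF k *(1)] *(2)] obtain P p q
  where P: "P \<in> Ob D" "p \<in> Mor D P V" "q \<in> Mor D P Y"
  and u: "\<forall>W\<in>Ob D. \<forall>f\<in>Mor D W V. \<forall>g\<in>Mor D W Y.
   \<exists>!u. u \<in> Mor D W P \<and> Cmp D W P V p u = f \<and> Cmp D W P Y q u = g"
  by (elim bexE) (rule that)
 obtain p' q' where pq: "p' \<in> Mor C P V" "E P V p' = p" "q' \<in> Mor C P Y" "E P Y q' = q"
  using E_surj[OF P(1) *(1) P(2)] E_surj[OF P(1) *(2) P(3)] by blast
 show "\<exists>P\<in>Ob D. \<exists>p\<in>Mor C P V. \<exists>q\<in>Mor C P Y. \<forall>W\<in>Ob D. \<forall>f\<in>Mor C W V. \<forall>g\<in>Mor C W Y.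
   \<exists>!u. u \<in> Mor C W P \<and> Cmp C W P V p u = f \<and> Cmp C W P Y q u = g"
 proof (rule bexI[OF _ P(1)], rule bexI[OF _ pq(1)], rule bexI[OF _ pq(3)], intro ballI)
  fix W f g assume W: "W \<in> Ob D" and f: "f \<in> Mor C W V" and g: "g \<in> Mor C W Y"
  have "(\<exists>!u. u \<in> Mor C W P \<and> (Cmp C W P V p' u = f \<and> Cmp C W P Y q' u = g)) \<longleftrightarrow>
    (\<exists>!u. u \<in> Mor D W P \<and> (Cmp D W P V p u = E W V f \<and> Cmp D W P Y q u = E W Y g))"
  proof (rule E_ex1[OF W P(1)])
   fix u assume u: "u \<in> Mor C W P"
   show "(Cmp C W P V p' u = f \<and> Cmp C W P Y q' u = g) \<longleftrightarrow>
     (Cmp D W P V p (E W P u) = E W V f \<and> Cmp D W P Y q (E W P u) = E W Y g)"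
    using E_eq[OF W P(1) *(1) u pq(1) f] E_eq[OF W P(1) *(2) u pq(3) g] pq by simp
  qed
  then show "\<exists>!u. u \<in> Mor C W P \<and> Cmp C W P V p' u = f \<and> Cmp C W P Y q' u = g"
   using u[rule_format, OF W E_closed[OF W *(1) f] E_closed[OF W *(2) g]] by simp
 qed
qed

end

lemma op_category: "is_category C ==> is_category (op_cat C)"
 unfolding is_category_def op_cat_simps by (intro conjI ballI) (blast | simp)+

lemma (in cat_iso) iso_op: "cat_iso (op_cat C) (op_cat D) (\<lambda>V Y. E Y V)"
 by unfold_locales (auto simp: Ob_eq E_bij E_Idn E_Cmp op_category[OF D_cat])

lemma (in cat_iso) iso_abelian: "is_abelian D ==> is_abelian C"
 unfolding is_abelian_def
 using iso_category iso_zero_obj iso_products iso_has_kernels iso_monos_are_kernels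
  cat_iso.iso_products[OF iso_op] cat_iso.iso_has_kernels[OF iso_op] cat_iso.iso_monos_are_kernels[OF iso_op]
 by blast

text \<open>A quasi-inverse of a fully faithful and essentially surjective functor is obtained by choosing
  preimages of objects and transporting morphisms along the chosen isomorphisms.\<close>

locale category =
 fixes D :: "('p, 'g) category"
 assumes cat: "is_category D"
begin

lemma cIdn: "V \<in> Ob D ==> Idn D V \<in> Mor D V V"
 and cCmp: "V \<in> Ob D ==> Y \<in> Ob D ==> Z \<in> Ob D ==> f \<in> Mor D V Y ==> g \<in> Mor D Y Z ==> Cmp D V Y Z g f \<in> Mor D V Z"
 and cId1: "V \<in> Ob D ==> Y \<in> Ob D ==> f \<in> Mor D V Y ==> Cmp D V V Y f (Idn D V) = f"
 and cId2: "V \<in> Ob D ==> Y \<in> Ob D ==> f \<in> Mor D V Y ==> Cmp D V Y Y (Idn D Y) f = f"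
 and cAssoc: "W \<in> Ob D ==> V \<in> Ob D ==> Y \<in> Ob D ==> Z \<in> Ob D ==> f \<in> Mor D W V ==> g \<in> Mor D V Y ==>
  h \<in> Mor D Y Z ==> Cmp D W V Z (Cmp D V Y Z h g) f = Cmp D W Y Z h (Cmp D W V Y g f)"
 using cat unfolding is_category_def by simp_all

end

lemma fully_faithful_equivalence:
 assumes F: "is_functor C D Fo Fm"
  and bij: "\<And>V Y. V \<in> Ob C ==> Y \<in> Ob C ==> bij_betw (Fm V Y) (Mor C V Y) (Mor D (Fo V) (Fo Y))"
  and eso: "\<And>N. N \<in> Ob D ==> \<exists>M\<in>Ob C. \<exists>f. is_iso D (Fo M) N f"
 shows "is_equivalence C D Fo Fm"
proof -
 have catC: "is_category C" and catD: "is_category D"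
  and FoD: "\<And>V. V \<in> Ob C ==> Fo V \<in> Ob D"
  and FmD: "\<And>V Y f. V \<in> Ob C ==> Y \<in> Ob C ==> f \<in> Mor C V Y ==> Fm V Y f \<in> Mor D (Fo V) (Fo Y)"
  and FmI: "\<And>V. V \<in> Ob C ==> Fm V V (Idn C V) = Idn D (Fo V)"
  and FmC: "\<And>V Y Z f g. V \<in> Ob C ==> Y \<in> Ob C ==> Z \<in> Ob C ==> f \<in> Mor C V Y ==> g \<in> Mor C Y Z ==>
    Fm V Z (Cmp C V Y Z g f) = Cmp D (Fo V) (Fo Y) (Fo Z) (Fm Y Z g) (Fm V Y f)"
  using F unfolding is_functor_def by simp_all
 interpret C: category C by unfold_locales (rule catC)
 interpret D: category D by unfold_locales (rule catD)
 have inj: "f = g" if "V \<in> Ob C" "Y \<in> Ob C" "f \<in> Mor C V Y" "g \<in> Mor C V Y" "Fm V Y f = Fm V Y g" for V Y f g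
  using inj_onD[OF bij_betw_imp_inj_on[OF bij[OF that(1,2)]] that(5) that(3,4)] .
 have "\<forall>N\<in>Ob D. \<exists>M f g. M \<in> Ob C \<and> f \<in> Mor D (Fo M) N \<and> g \<in> Mor D N (Fo M) \<and>
   Cmp D (Fo M) N (Fo M) g f = Idn D (Fo M) \<and> Cmp D N (Fo M) N f g = Idn D N"
  using eso unfolding is_iso_def by metis
 then obtain Go e d where "\<forall>N\<in>Ob D. Go N \<in> Ob C \<and> e N \<in> Mor D (Fo (Go N)) N \<and> d N \<in> Mor D N (Fo (Go N)) \<and>
   Cmp D (Fo (Go N)) N (Fo (Go N)) (d N) (e N) = Idn D (Fo (Go N)) \<and> Cmp D N (Fo (Go N)) N (e N) (d N) = Idn D N"
  by metis
 then have GoC: "Go N \<in> Ob C" and eM: "e N \<in> Mor D (Fo (Go N)) N" and dM: "d N \<in> Mor D N (Fo (Go N))"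
  and de: "Cmp D (Fo (Go N)) N (Fo (Go N)) (d N) (e N) = Idn D (Fo (Go N))"
  and ed: "Cmp D N (Fo (Go N)) N (e N) (d N) = Idn D N" if "N \<in> Ob D" for N
  using that by auto
 have e: "is_iso D (Fo (Go N)) N (e N)" if "N \<in> Ob D" for N
  unfolding is_iso_def using eM[OF that] dM[OF that] de[OF that] ed[OF that] by blast
 note FGo = FoD[OF GoC]
 define pre where "pre V Y = inv_into (Mor C V Y) (Fm V Y)" for V Y
 have pre: "pre V Y g \<in> Mor C V Y" "Fm V Y (pre V Y g) = g"
  if "V \<in> Ob C" "Y \<in> Ob C" "g \<in> Mor D (Fo V) (Fo Y)" for V Y g
  using bij_betw_imp_surj_on[OF bij[OF that(1,2)]] that(3) by (auto simp: pre_def inv_into_into f_inv_into_f)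
 define t where "t N N' g = Cmp D (Fo (Go N)) N' (Fo (Go N')) (d N') (Cmp D (Fo (Go N)) N N' g (e N))" for N N' g
 have tM: "t N N' g \<in> Mor D (Fo (Go N)) (Fo (Go N'))" if "N \<in> Ob D" "N' \<in> Ob D" "g \<in> Mor D N N'" for N N' g
  unfolding t_def by (intro D.cCmp that eM dM FGo)
 have et: "Cmp D (Fo (Go N)) (Fo (Go N')) N' (e N') (t N N' g) = Cmp D (Fo (Go N)) N N' g (e N)"
  if *: "N \<in> Ob D" "N' \<in> Ob D" "g \<in> Mor D N N'" for N N' g
 proof -
  have m: "Cmp D (Fo (Go N)) N N' g (e N) \<in> Mor D (Fo (Go N)) N'" by (intro D.cCmp * eM FGo)
  show ?thesis unfolding t_def
   using D.cAssoc[OF FGo[OF *(1)] *(2) FGo[OF *(2)] *(2) m dM[OF *(2)] eM[OF *(2)]] ed[OF *(2)]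
    D.cId2[OF FGo[OF *(1)] *(2) m] by simp
 qed
 have e_cancel: "f = g" if "N \<in> Ob D" "V \<in> Ob D" "f \<in> Mor D V (Fo (Go N))" "g \<in> Mor D V (Fo (Go N))"
  "Cmp D V (Fo (Go N)) N (e N) f = Cmp D V (Fo (Go N)) N (e N) g" for N V f g
 proof -
  have "Cmp D V (Fo (Go N)) (Fo (Go N)) (Cmp D (Fo (Go N)) N (Fo (Go N)) (d N) (e N)) f =
    Cmp D V (Fo (Go N)) (Fo (Go N)) (Cmp D (Fo (Go N)) N (Fo (Go N)) (d N) (e N)) g"
   using D.cAssoc[OF that(2) FGo[OF that(1)] that(1) FGo[OF that(1)] that(3) eM[OF that(1)] dM[OF that(1)]]
    D.cAssoc[OF that(2) FGo[OF that(1)] that(1) FGo[OF that(1)] that(4) eM[OF that(1)] dM[OF that(1)]]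
    that(5) by simp
  then show ?thesis using de[OF that(1)] D.cId2[OF that(2) FGo[OF that(1)]] that(3,4) by simp
 qed
 define Gm where "Gm N N' g = pre (Go N) (Go N') (t N N' g)" for N N' g
 have GmM: "Gm N N' g \<in> Mor C (Go N) (Go N')" and FGm: "Fm (Go N) (Go N') (Gm N N' g) = t N N' g"
  if "N \<in> Ob D" "N' \<in> Ob D" "g \<in> Mor D N N'" for N N' g
  unfolding Gm_def using pre[OF GoC[OF that(1)] GoC[OF that(2)] tM[OF that]] by auto
 have G: "is_functor D C Go Gm"
  unfolding is_functor_def
 proof (intro conjI ballI catC catD GoC GmM)
  fix V assume V: "V \<in> Ob D"
  note o = GoC[OF V]
  show "Gm V V (Idn D V) = Idn C (Go V)"
  proof (rule inj[OF o o GmM[OF V V D.cIdn[OF V]] C.cIdn[OF o]])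
   show "Fm (Go V) (Go V) (Gm V V (Idn D V)) = Fm (Go V) (Go V) (Idn C (Go V))"
    unfolding FGm[OF V V D.cIdn[OF V]] FmI[OF o] t_def
    using D.cId2[OF FGo[OF V] V eM[OF V]] de[OF V] by simp
  qed
 next
  fix V Y Z f g assume o: "V \<in> Ob D" "Y \<in> Ob D" "Z \<in> Ob D" and f: "f \<in> Mor D V Y" and g: "g \<in> Mor D Y Z"
  note gf = D.cCmp[OF o f g]
  note go = o[THEN GoC] and fo = o[THEN FGo]
  have tgf: "Cmp D (Fo (Go V)) (Fo (Go Y)) (Fo (Go Z)) (t Y Z g) (t V Y f) = t V Z (Cmp D V Y Z g f)"
  proof (rule e_cancel[OF o(3) fo(1) D.cCmp[OF fo tM[OF o(1,2) f] tM[OF o(2,3) g]] tM[OF o(1,3) gf]])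
   have "Cmp D (Fo (Go V)) (Fo (Go Z)) Z (e Z) (Cmp D (Fo (Go V)) (Fo (Go Y)) (Fo (Go Z)) (t Y Z g) (t V Y f)) =
     Cmp D (Fo (Go V)) (Fo (Go Y)) Z (Cmp D (Fo (Go Y)) Y Z g (e Y)) (t V Y f)"
    using D.cAssoc[OF fo o(3) tM[OF o(1,2) f] tM[OF o(2,3) g] eM[OF o(3)]] et[OF o(2,3) g] by simp
   also have "\<dots> = Cmp D (Fo (Go V)) Y Z g (Cmp D (Fo (Go V)) V Y f (e V))"
    using D.cAssoc[OF fo(1,2) o(2,3) tM[OF o(1,2) f] eM[OF o(2)] g] et[OF o(1,2) f] by simp
   also have "\<dots> = Cmp D (Fo (Go V)) (Fo (Go Z)) Z (e Z) (t V Z (Cmp D V Y Z g f))"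
    using D.cAssoc[OF fo(1) o eM[OF o(1)] f g] et[OF o(1,3) gf] by simp
   finally show "Cmp D (Fo (Go V)) (Fo (Go Z)) Z (e Z) (Cmp D (Fo (Go V)) (Fo (Go Y)) (Fo (Go Z)) (t Y Z g) (t V Y f)) =
     Cmp D (Fo (Go V)) (Fo (Go Z)) Z (e Z) (t V Z (Cmp D V Y Z g f))" .
  qed
  show "Gm V Z (Cmp D V Y Z g f) = Cmp C (Go V) (Go Y) (Go Z) (Gm Y Z g) (Gm V Y f)"
   by (rule inj[OF go(1,3) GmM[OF o(1,3) gf] C.cCmp[OF go GmM[OF o(1,2) f] GmM[OF o(2,3) g]]])
     (simp add: FGm[OF o(1,3) gf] FmC[OF go GmM[OF o(1,2) f] GmM[OF o(2,3) g]] FGm[OF o(1,2) f] FGm[OF o(2,3) g] tgf)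
 qed
 have n2: "nat_isomorphic D D (\<lambda>V. Fo (Go V)) (\<lambda>V Y f. Fm (Go V) (Go Y) (Gm V Y f)) (\<lambda>V. V) (\<lambda>V Y f. f)"
  unfolding nat_isomorphic_def by (intro exI[of _ e] conjI ballI) (simp_all add: e FGm et)
 define h where "h V = pre (Go (Fo V)) V (e (Fo V))" for V
 have hM: "h V \<in> Mor C (Go (Fo V)) V" "Fm (Go (Fo V)) V (h V) = e (Fo V)" if "V \<in> Ob C" for V
  unfolding h_def using pre[OF GoC[OF FoD[OF that]] that eM[OF FoD[OF that]]] by auto
 have n1: "nat_isomorphic C C (\<lambda>V. Go (Fo V)) (\<lambda>V Y f. Gm (Fo V) (Fo Y) (Fm V Y f)) (\<lambda>V. V) (\<lambda>V Y f. f)"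
  unfolding nat_isomorphic_def
 proof (intro exI[of _ h] conjI ballI)
  fix V assume V: "V \<in> Ob C"
  note fo = FoD[OF V] and go = GoC[OF FoD[OF V]]
  let ?k = "pre V (Go (Fo V)) (d (Fo V))"
  have k: "?k \<in> Mor C V (Go (Fo V))" "Fm V (Go (Fo V)) ?k = d (Fo V)" using pre[OF V go dM[OF fo]] by auto
  have "Cmp C (Go (Fo V)) V (Go (Fo V)) ?k (h V) = Idn C (Go (Fo V))"
   by (rule inj[OF go go C.cCmp[OF go V go hM(1)[OF V] k(1)] C.cIdn[OF go]])
     (simp add: FmC[OF go V go hM(1)[OF V] k(1)] FmI[OF go] k hM[OF V] de[OF fo])
  moreover have "Cmp C V (Go (Fo V)) V (h V) ?k = Idn C V"
   by (rule inj[OF V V C.cCmp[OF V go V k(1) hM(1)[OF V]] C.cIdn[OF V]])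
     (simp add: FmC[OF V go V k(1) hM(1)[OF V]] FmI[OF V] k hM[OF V] ed[OF fo])
  ultimately show "is_iso C (Go (Fo V)) V (h V)" unfolding is_iso_def using hM(1)[OF V] k(1) by blast
 next
  fix V Y f assume V: "V \<in> Ob C" and Y: "Y \<in> Ob C" and f: "f \<in> Mor C V Y"
  note fV = FoD[OF V] and gV = GoC[OF FoD[OF V]] and fY = FoD[OF Y] and gY = GoC[OF FoD[OF Y]]
  note Ff = FmD[OF V Y f] and Gf = GmM[OF FoD[OF V] FoD[OF Y] FmD[OF V Y f]]
  show "Cmp C (Go (Fo V)) (Go (Fo Y)) Y (h Y) (Gm (Fo V) (Fo Y) (Fm V Y f)) = Cmp C (Go (Fo V)) V Y f (h V)"
   by (rule inj[OF gV Y C.cCmp[OF gV gY Y Gf hM(1)[OF Y]] C.cCmp[OF gV V Y hM(1)[OF V] f]])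
     (simp add: FmC[OF gV gY Y Gf hM(1)[OF Y]] FmC[OF gV V Y hM(1)[OF V] f] hM(2)[OF V] hM(2)[OF Y]
      FGm[OF fV fY Ff] et[OF fV fY Ff])
 qed
 show ?thesis unfolding is_equivalence_def using F G n1 n2 by blast
qed

lemma functor_iso:
 assumes F: "is_functor C D Fo Fm" and o: "V \<in> Ob C" "Y \<in> Ob C" and i: "is_iso C V Y f"
 shows "is_iso D (Fo V) (Fo Y) (Fm V Y f)"
proof -
 obtain g where g: "f \<in> Mor C V Y" "g \<in> Mor C Y V" "Cmp C V Y V g f = Idn C V" "Cmp C Y V Y f g = Idn C Y"
  using i by (auto simp: is_iso_def)
 have "Fm V V (Cmp C V Y V g f) = Cmp D (Fo V) (Fo Y) (Fo V) (Fm Y V g) (Fm V Y f)"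
  "Fm Y Y (Cmp C Y V Y f g) = Cmp D (Fo Y) (Fo V) (Fo Y) (Fm V Y f) (Fm Y V g)"
  "Fm V V (Idn C V) = Idn D (Fo V)" "Fm Y Y (Idn C Y) = Idn D (Fo Y)"
  "Fm V Y f \<in> Mor D (Fo V) (Fo Y)" "Fm Y V g \<in> Mor D (Fo Y) (Fo V)"
  using F o g(1,2) unfolding is_functor_def by auto
 then show ?thesis unfolding is_iso_def using g by auto
qed

section \<open>The Serre quotient is the category of saturated correspondences\<close>

lemma quot_mod_simps [simp]:
 "add (quot_mod M U) = (\<lambda>V Y. V <+>\<^bsub>M\<^esub> Y)" "ring.zero (quot_mod M U) = U"
 "ract (quot_mod M U) = (\<lambda>V s. \<Union>x\<in>V. U +>\<^bsub>M\<^esub> (x \<bullet>\<^bsub>M\<^esub> s))"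
 "mcomp (quot_mod M U) g = (\<lambda>x. U +>\<^bsub>M\<^esub> x) ` mcomp M g"
 by (auto simp: quot_mod_def)

text \<open>The values of a partial homomorphism \<open>U \<rightarrow> N/W\<close> are cosets. Its graph consists of the elements of
  these and determines \<open>U\<close>, \<open>W\<close> and the homomorphism.\<close>

definition graph :: "'m partial_hom \<Rightarrow> ('m \<times> 'm) set" where
 "graph = (\<lambda>(U, W, f). {(x, y). x \<in> U \<and> y \<in> f x})"

definition of_rel :: "('g, 'a, 'm) graded_mod \<Rightarrow> ('m \<times> 'm) set \<Rightarrow> 'm partial_hom" where
 "of_rel M \<Gamma> = (Domain \<Gamma>, {y. (\<zero>\<^bsub>M\<^esub>, y) \<in> \<Gamma>}, \<lambda>x\<in>Domain \<Gamma>. {y. (x, y) \<in> \<Gamma>})"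

locale torsion_class = module_class R GG A
 for R :: "('k, 'g::ab_group_add, 'a) graded_alg" and GG
  and A :: "('g, 'a, 'm) graded_mod set" +
 fixes T :: "('g, 'a, 'm) graded_mod set"
 assumes T_subset: "T \<subseteq> A" and T_iff: "M \<in> A ==> M \<in> T \<longleftrightarrow> carrier M \<subseteq> tor GG M"
begin

lemma quot_iso:
 assumes N: "N \<in> A" and W: "graded_submodule R N W" and d: "quotient_data N W Q q"
 defines "\<theta> \<equiv> \<lambda>V\<in>carrier (quot_mod N W). q (SOME x. x \<in> V)"
 shows "\<theta> \<in> graded_hom R (quot_mod N W) Q" "\<And>x. x \<in> carrier N ==> \<theta> (W +>\<^bsub>N\<^esub> x) = q x"
  "bij_betw \<theta> (carrier (quot_mod N W)) (carrier Q)"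
proof -
 have Q: "Q \<in> A" "q \<in> graded_hom R N Q" "q ` carrier N = carrier Q"
  "\<And>x. x \<in> carrier N ==> q x = \<zero>\<^bsub>Q\<^esub> \<longleftrightarrow> x \<in> W" using d by (auto simp: quotient_data_def)
 interpret N: gmod R N by (rule gmodI[OF A_gm[OF N]])
 interpret q: ghom R N Q q by (rule ghomI[OF A_gm[OF N] A_gm[OF Q(1)] Q(2)])
 note c = N.carrier_quot_mod[of W]
 have qeq: "q x = q y \<longleftrightarrow> x \<ominus>\<^bsub>N\<^esub> y \<in> W" if "x \<in> carrier N" "y \<in> carrier N" for x y
  using that Q(4)[of "x \<ominus>\<^bsub>N\<^esub> y"] q.N.diff_eq_zero[of "q x" "q y"] by (simp add: q.hom_diff q.hom_closed)
 show t: "\<theta> (W +>\<^bsub>N\<^esub> x) = q x" if x: "x \<in> carrier N" for x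
 proof -
  have "(SOME y. y \<in> W +>\<^bsub>N\<^esub> x) \<in> W +>\<^bsub>N\<^esub> x" using N.mem_own_coset[OF W x] by (rule someI)
  then show ?thesis unfolding \<theta>_def c using x N.mem_coset_iff[OF W x] qeq by auto
 qed
 show "\<theta> \<in> graded_hom R (quot_mod N W) Q"
 proof (rule graded_homI)
  show "\<theta> \<in> extensional (carrier (quot_mod N W))" by (simp add: \<theta>_def)
  show "\<theta> x \<in> mcomp Q g" if "x \<in> mcomp (quot_mod N W) g" for g x
   using that by (auto simp: t q.hom_homog N.D_carrier)
 qed (auto simp: c t q.hom_closed N.coset_add[OF W] N.coset_act[OF W] q.hom_add q.hom_act)
 show "bij_betw \<theta> (carrier (quot_mod N W)) (carrier Q)"
  unfolding bij_betw_def
 proof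
  show "inj_on \<theta> (carrier (quot_mod N W))"
  proof (rule inj_onI)
   fix u v assume "u \<in> carrier (quot_mod N W)" "v \<in> carrier (quot_mod N W)" and e: "\<theta> u = \<theta> v"
   then obtain x y where xy: "x \<in> carrier N" "y \<in> carrier N" "u = W +>\<^bsub>N\<^esub> x" "v = W +>\<^bsub>N\<^esub> y"
    unfolding c by auto
   then have "x \<ominus>\<^bsub>N\<^esub> y \<in> W" using e t qeq by simp
   then show "u = v" using N.coset_eq_iff[OF W xy(1,2)] xy by simp
  qed
  show "\<theta> ` carrier (quot_mod N W) = carrier Q" unfolding c Q(3)[symmetric] image_image using t by simp
 qed
qed

lemma torsion_sub_iff:
 assumes "N \<in> A"
 shows "torsion_sub R T N W \<longleftrightarrow> graded_submodule R N W \<and> W \<subseteq> tor GG N"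
 using T_iff[OF A_sub[OF assms]] tor_sub_mod[OF A_gm[OF assms]]
 unfolding torsion_sub_def by auto

text \<open>The class is closed under quotients, so it contains a copy of \<open>M/U\<close>. This is torsion iff \<open>U\<close> is dense
  in \<open>M\<close>.\<close>

lemma cotorsion_sub_iff:
 assumes M: "M \<in> A"
 shows "cotorsion_sub R A T M U \<longleftrightarrow> graded_submodule R M U \<and> carrier M \<subseteq> cl GG M U"
proof (cases "graded_submodule R M U")
 case U: True
 interpret M: gmod R M by (rule gmodI[OF A_gm[OF M]])
 note c = M.carrier_quot_mod[of U]
 have "(\<exists>Q\<in>T. graded_isomorphic R (quot_mod M U) Q) \<longleftrightarrow> carrier M \<subseteq> cl GG M U"
 proof
  assume "\<exists>Q\<in>T. graded_isomorphic R (quot_mod M U) Q"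
  then obtain Q \<theta> where Q: "Q \<in> T" and t: "\<theta> \<in> graded_hom R (quot_mod M U) Q"
   and b: "bij_betw \<theta> (carrier (quot_mod M U)) (carrier Q)"
   by (auto simp: graded_isomorphic_def)
  have QA: "Q \<in> A" and Qt: "carrier Q \<subseteq> tor GG Q" using Q T_subset T_iff by auto
  interpret Q: gmod R Q by (rule gmodI[OF A_gm[OF QA]])
  note h = graded_homD[OF t]
  have 0: "\<theta> U = \<zero>\<^bsub>Q\<^esub>"
  proof -
   have U0: "U \<in> carrier (quot_mod M U)" unfolding c using M.coset_zero[OF U] by (metis M.zero_closed imageI)
   have "U <+>\<^bsub>M\<^esub> U = U" using M.coset_add[OF U M.zero_closed M.zero_closed] M.coset_zero[OF U] by simp
   then have "\<theta> U \<oplus>\<^bsub>Q\<^esub> \<theta> U = \<theta> U" using h(2)[OF U0 U0] by simp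
   then show ?thesis using h(1)[OF U0] by simp
  qed
  show "carrier M \<subseteq> cl GG M U"
  proof
   fix x assume x: "x \<in> carrier M"
   then have xc: "U +>\<^bsub>M\<^esub> x \<in> carrier (quot_mod M U)" unfolding c by auto
   then have "almost GG (\<lambda>s. \<theta> (U +>\<^bsub>M\<^esub> x) \<bullet>\<^bsub>Q\<^esub> s = \<zero>\<^bsub>Q\<^esub>)" using Qt h(1)[OF xc] by (auto simp: cl_def)
   then have "almost GG (\<lambda>s. x \<bullet>\<^bsub>M\<^esub> s \<in> U)"
   proof (rule almost_elim)
    fix s assume s: "s \<in> carrier R" "\<theta> (U +>\<^bsub>M\<^esub> x) \<bullet>\<^bsub>Q\<^esub> s = \<zero>\<^bsub>Q\<^esub>"
    then have "\<theta> (U +>\<^bsub>M\<^esub> (x \<bullet>\<^bsub>M\<^esub> s)) = \<theta> (U +>\<^bsub>M\<^esub> \<zero>\<^bsub>M\<^esub>)"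
     using h(3)[OF xc s(1)] M.coset_act[OF U x s(1)] 0 M.coset_zero[OF U] by simp
    moreover have "U +>\<^bsub>M\<^esub> (x \<bullet>\<^bsub>M\<^esub> s) \<in> carrier (quot_mod M U)" "U +>\<^bsub>M\<^esub> \<zero>\<^bsub>M\<^esub> \<in> carrier (quot_mod M U)"
     unfolding c using x s(1) by auto
    ultimately have "U +>\<^bsub>M\<^esub> (x \<bullet>\<^bsub>M\<^esub> s) = U +>\<^bsub>M\<^esub> \<zero>\<^bsub>M\<^esub>"
     using b by (auto simp: bij_betw_def dest: inj_onD)
    then show "x \<bullet>\<^bsub>M\<^esub> s \<in> U" using M.coset_eq_iff[OF U _ M.zero_closed] x s(1) by simp
   qed
   then show "x \<in> cl GG M U" using x by (simp add: cl_def)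
  qed
 next
  assume dense: "carrier M \<subseteq> cl GG M U"
  obtain Q q where d: "quotient_data M U Q q" using quotient_exists[OF M U] by blast
  then have Q: "Q \<in> A" "q \<in> graded_hom R M Q" "q ` carrier M = carrier Q"
   "\<And>x. x \<in> carrier M ==> q x = \<zero>\<^bsub>Q\<^esub> \<longleftrightarrow> x \<in> U" by (auto simp: quotient_data_def)
  have "carrier Q \<subseteq> tor GG Q"
  proof
   fix z assume z: "z \<in> carrier Q"
   then obtain x where x: "x \<in> carrier M" "z = q x" using Q(3) by auto
   then have "almost GG (\<lambda>s. x \<bullet>\<^bsub>M\<^esub> s \<in> U)" using dense by (auto simp: cl_def)
   then have "almost GG (\<lambda>s. z \<bullet>\<^bsub>Q\<^esub> s = \<zero>\<^bsub>Q\<^esub>)"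
   proof (rule almost_elim)
    fix s assume "s \<in> carrier R" "x \<bullet>\<^bsub>M\<^esub> s \<in> U"
    then show "z \<bullet>\<^bsub>Q\<^esub> s = \<zero>\<^bsub>Q\<^esub>" using Q(4)[of "x \<bullet>\<^bsub>M\<^esub> s"] graded_homD(3)[OF Q(2) x(1), of s] x by simp
   qed
   then show "z \<in> tor GG Q" using z by (simp add: cl_def)
  qed
  then have "Q \<in> T" using T_iff[OF Q(1)] by simp
  then show "\<exists>Q\<in>T. graded_isomorphic R (quot_mod M U) Q"
   using quot_iso(1,3)[OF M U d] unfolding graded_isomorphic_def by blast
 qed
 then show ?thesis unfolding cotorsion_sub_def using A_sub[OF M U] U by simp
qed (simp add: cotorsion_sub_def)

lemma graph_corr:
 assumes M: "M \<in> A" and N: "N \<in> A" and p: "p \<in> partial_homs R A T M N"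
 shows "corr R GG M N (graph p)" "of_rel M (graph p) = p"
proof -
 obtain U W f where pe: "p = (U, W, f)" by (cases p)
 note gM = A_gm[OF M] and gN = A_gm[OF N]
 have U: "graded_submodule R M U" "carrier M \<subseteq> cl GG M U" and W: "graded_submodule R N W" "W \<subseteq> tor GG N"
  and f: "f \<in> graded_hom R (sub_mod M U) (quot_mod N W)"
  using p by (auto simp: partial_homs_def pe cotorsion_sub_iff[OF M] torsion_sub_iff[OF N])
 interpret M: gmod R M by (rule gmodI[OF gM])
 interpret N: gmod R N by (rule gmodI[OF gN])
 obtain Q q where d: "quotient_data N W Q q" using quotient_exists[OF N W(1)] by blast
 then have Q: "Q \<in> A" "q \<in> graded_hom R N Q" "q ` carrier N = carrier Q"
  "\<And>x. x \<in> carrier N ==> q x = \<zero>\<^bsub>Q\<^esub> \<longleftrightarrow> x \<in> W" by (auto simp: quotient_data_def)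
 note gQ = A_gm[OF Q(1)] and gU = M.sub_mod(1)[OF U(1)]
 obtain \<theta> where t: "\<theta> \<in> graded_hom R (quot_mod N W) Q" "\<And>x. x \<in> carrier N ==> \<theta> (W +>\<^bsub>N\<^esub> x) = q x"
  using quot_iso(1,2)[OF N W(1) d] by blast
 define f' where "f' = (\<lambda>x\<in>U. \<theta> (f x))"
 note hf = graded_homD[OF f]
 have f': "f' \<in> graded_hom R (sub_mod M U) Q"
  using compose_hom[OF gU f t(1)] by (simp add: f'_def compose_def)
 interpret q: ghom R N Q q by (rule ghomI[OF gN gQ Q(2)])
 interpret f': ghom R "sub_mod M U" Q f' by (rule ghomI[OF gU gQ f'])
 have mem: "y \<in> f x \<longleftrightarrow> y \<in> carrier N \<and> q y = f' x" if x: "x \<in> U" for x y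
 proof -
  obtain y0 where y0: "y0 \<in> carrier N" "f x = W +>\<^bsub>N\<^esub> y0"
   using hf(1)[of x] x unfolding N.carrier_quot_mod by auto
  have "q y = q y0 \<longleftrightarrow> y \<ominus>\<^bsub>N\<^esub> y0 \<in> W" if "y \<in> carrier N"
   using that y0 Q(4)[of "y \<ominus>\<^bsub>N\<^esub> y0"] q.N.diff_eq_zero[of "q y" "q y0"] by (simp add: q.hom_diff q.hom_closed)
  then show ?thesis using x y0 t(2)[OF y0(1)] N.mem_coset_iff[OF W(1) y0(1)] by (auto simp: f'_def)
 qed
 have gr: "graph p = {(x, y). x \<in> U \<and> y \<in> carrier N \<and> q y = f' x}"
  using mem by (auto simp: graph_def pe)
 have ne: "\<exists>y. y \<in> f x" if "x \<in> U" for x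
 proof -
  have "f' x \<in> q ` carrier N" unfolding Q(3) using f'.hom_closed[of x] that by simp
  then show ?thesis using mem[OF that] by auto
 qed
 have dom: "Domain (graph p) = U" using ne by (auto simp: graph_def pe)
 have hcU: "hcomp (sub_mod M U) (mcomp (sub_mod M U)) g x = M.hc g x" if "x \<in> U" for g x
  using hcomp_sub_mod[OF gM U(1) that] by (simp add: mcomp_sub_mod)
 have g: "graded_submodule R (dsum M N) (graph p)"
 proof (rule relI[OF gM gN])
  fix x y g assume "(x, y) \<in> graph p"
  then have *: "x \<in> U" "y \<in> carrier N" "q y = f' x" by (auto simp: gr)
  then show "(M.hc g x, N.hc g y) \<in> graph p"
   using f'.hom_hc[of x g] hcU[OF *(1)] M.gsD(8)[OF U(1) *(1)] by (auto simp: gr q.hom_hc)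
 qed (use f'.hom_add f'.hom_act f'.hom_zero in \<open>auto simp: gr q.hom_add q.hom_act q.hom_zero M.gsD[OF U(1)]\<close>)
 have 0: "{y. (\<zero>\<^bsub>M\<^esub>, y) \<in> graph p} = W"
  using Q(4) f'.hom_zero M.gsD(3)[OF U(1)] N.gsD(9)[OF W(1)] by (auto simp: gr)
 show "corr R GG M N (graph p)"
  by (rule corrI[OF gM gN g]) (use U W 0 dom in auto)
 have "(\<lambda>x\<in>U. {y. (x, y) \<in> graph p}) = f"
 proof
  fix x show "(\<lambda>x\<in>U. {y. (x, y) \<in> graph p}) x = f x"
   using hf(5) by (cases "x \<in> U") (auto simp: graph_def pe extensional_def)
 qed
 then show "of_rel M (graph p) = p" unfolding of_rel_def dom 0 by (simp add: pe)
qed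

lemma of_rel_partial_hom:
 assumes M: "M \<in> A" and N: "N \<in> A" and c: "corr R GG M N \<Gamma>"
 shows "of_rel M \<Gamma> \<in> partial_homs R A T M N" "graph (of_rel M \<Gamma>) = \<Gamma>"
proof -
 note gM = A_gm[OF M] and gN = A_gm[OF N]
 note C = corrD[OF gM gN c] and r = relD[OF gM gN corrD(1)[OF gM gN c]]
 interpret M: gmod R M by (rule gmodI[OF gM])
 interpret N: gmod R N by (rule gmodI[OF gN])
 show "graph (of_rel M \<Gamma>) = \<Gamma>" by (auto simp: graph_def of_rel_def Domain_iff split: if_splits)
 let ?W = "{y. (\<zero>\<^bsub>M\<^esub>, y) \<in> \<Gamma>}" and ?f = "\<lambda>x\<in>Domain \<Gamma>. {y. (x, y) \<in> \<Gamma>}"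
 have fx: "?f x = ?W +>\<^bsub>N\<^esub> y" if "(x, y) \<in> \<Gamma>" for x y
 proof -
  have "(x, z) \<in> \<Gamma> \<longleftrightarrow> z \<in> carrier N \<and> (\<zero>\<^bsub>M\<^esub>, z \<ominus>\<^bsub>N\<^esub> y) \<in> \<Gamma>" for z
  proof
   assume "(x, z) \<in> \<Gamma>"
   then show "z \<in> carrier N \<and> (\<zero>\<^bsub>M\<^esub>, z \<ominus>\<^bsub>N\<^esub> y) \<in> \<Gamma>" using r(2) r(7)[OF _ that, of x z] r(1)[OF that] by auto
  next
   assume z: "z \<in> carrier N \<and> (\<zero>\<^bsub>M\<^esub>, z \<ominus>\<^bsub>N\<^esub> y) \<in> \<Gamma>"
   then show "(x, z) \<in> \<Gamma>" using r(4)[OF _ that, of "\<zero>\<^bsub>M\<^esub>" "z \<ominus>\<^bsub>N\<^esub> y"] r(1,2)[OF that]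
    by (auto simp: N.diff_add_cancel)
  qed
  then show ?thesis using that N.mem_coset_iff[OF r(11) r(2)[OF that]] by auto
 qed
 have "?f \<in> graded_hom R (sub_mod M (Domain \<Gamma>)) (quot_mod N ?W)"
 proof (rule graded_homI)
  show "?f x \<in> carrier (quot_mod N ?W)" if x: "x \<in> carrier (sub_mod M (Domain \<Gamma>))" for x
  proof -
   obtain y where y: "(x, y) \<in> \<Gamma>" using x by auto
   show ?thesis unfolding N.carrier_quot_mod fx[OF y] using r(2)[OF y] by auto
  qed
  show "?f (x \<oplus>\<^bsub>sub_mod M (Domain \<Gamma>)\<^esub> x') = ?f x \<oplus>\<^bsub>quot_mod N ?W\<^esub> ?f x'"
   if x: "x \<in> carrier (sub_mod M (Domain \<Gamma>))" and x': "x' \<in> carrier (sub_mod M (Domain \<Gamma>))" for x x'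
  proof -
   obtain y y' where y: "(x, y) \<in> \<Gamma>" "(x', y') \<in> \<Gamma>" using x x' by auto
   show ?thesis
    unfolding quot_mod_simps sub_mod_simps fx[OF y(1)] fx[OF y(2)] fx[OF r(4)[OF y]]
    by (rule N.coset_add[OF r(11) r(2)[OF y(1)] r(2)[OF y(2)], symmetric])
  qed
  show "?f (x \<bullet>\<^bsub>sub_mod M (Domain \<Gamma>)\<^esub> s) = ?f x \<bullet>\<^bsub>quot_mod N ?W\<^esub> s"
   if x: "x \<in> carrier (sub_mod M (Domain \<Gamma>))" and s: "s \<in> carrier R" for x s
  proof -
   obtain y where y: "(x, y) \<in> \<Gamma>" using x by auto
   show ?thesis
    unfolding quot_mod_simps sub_mod_simps fx[OF y] fx[OF r(5)[OF y s]]
    by (rule N.coset_act[OF r(11) r(2)[OF y] s, symmetric])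
  qed
  show "?f x \<in> mcomp (quot_mod N ?W) g" if x: "x \<in> mcomp (sub_mod M (Domain \<Gamma>)) g" for x g
  proof -
   obtain y where y: "(x, y) \<in> \<Gamma>" and xg: "x \<in> mcomp M g" using x by auto
   have "(x, N.hc g y) \<in> \<Gamma>" using r(6)[OF y, of g] xg by (simp add: M.hc_homog)
   from fx[OF this] show ?thesis using N.hc_in[OF r(2)[OF y]] by auto
  qed
 qed (auto)
 then show "of_rel M \<Gamma> \<in> partial_homs R A T M N"
  unfolding of_rel_def partial_homs_def
  using c r(8,11) C(3) by (auto simp: cotorsion_sub_iff[OF M] torsion_sub_iff[OF N] corr_def)
qed

lemma comp_of_rel:
 assumes "M \<in> A" "N \<in> A" "P \<in> A" and p: "p \<in> partial_homs R A T M N" and q: "q \<in> partial_homs R A T N P"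
 shows "partial_hom_comp q p = of_rel M (graph p O graph q)"
proof -
 obtain U W f where pe: "p = (U, W, f)" by (cases p)
 obtain V Z g where qe: "q = (V, Z, g)" by (cases q)
 have "of_rel M (graph p) = p" "of_rel N (graph q) = q"
  using graph_corr[OF assms(1,2) p] graph_corr[OF assms(2,3) q] by auto
 then have W: "{y. \<zero>\<^bsub>M\<^esub> \<in> U \<and> y \<in> f \<zero>\<^bsub>M\<^esub>} = W" and ne: "\<And>y. y \<in> V ==> \<exists>z. z \<in> g y"
  by (auto simp: of_rel_def graph_def pe qe)
 have Dm: "Domain (graph p O graph q) = {x \<in> U. f x \<inter> V \<noteq> {}}"
  using ne by (fastforce simp: graph_def pe qe)
 have "{z. (\<zero>\<^bsub>M\<^esub>, z) \<in> graph p O graph q} = \<Union> (g ` (V \<inter> W))"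
  unfolding W[symmetric] by (auto simp: graph_def pe qe)
 moreover have "(\<lambda>x\<in>{x \<in> U. f x \<inter> V \<noteq> {}}. \<Union> (g ` (f x \<inter> V))) =
   (\<lambda>x\<in>{x \<in> U. f x \<inter> V \<noteq> {}}. {z. (x, z) \<in> graph p O graph q})"
  by (rule restrict_ext) (auto simp: graph_def pe qe)
 ultimately show ?thesis unfolding of_rel_def Dm by (simp add: pe qe)
qed

text \<open>The image of \<open>x\<close> under \<open>f\<close> in the quotient by all torsion.\<close>

lemma tor_add_image:
 assumes M: "M \<in> A" and N: "N \<in> A" and p: "(U, W, f) \<in> partial_homs R A T M N" and x: "x \<in> U"
 shows "tor GG N <+>\<^bsub>N\<^esub> f x = {y. (x, y) \<in> cl GG (dsum M N) (graph (U, W, f))}"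
proof -
 note gM = A_gm[OF M] and gN = A_gm[OF N] and c = graph_corr[OF M N p]
 interpret gabriel_mod2 R GG M N by (intro gabriel_mod2I gM gN)
 note S = cl_in_sat[OF gM gN c(1)]
 note s = satD[OF gM gN S(1)] and r = relD[OF gM gN satD(2)[OF gM gN S(1)]]
 have gr: "(x, y) \<in> cl GG (dsum M N) (graph (U, W, f))" if "y \<in> f x" for y
  using S(2) x that by (auto simp: graph_def)
 obtain z where z: "z \<in> f x" using arg_cong[OF c(2), of fst] x by (auto simp: of_rel_def graph_def)
 show ?thesis
 proof (intro equalityI subsetI)
  fix u assume "u \<in> tor GG N <+>\<^bsub>N\<^esub> f x"
  then obtain t y where u: "t \<in> tor GG N" "y \<in> f x" "u = t \<oplus>\<^bsub>N\<^esub> y" unfolding set_add_def' by blast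
  have "t \<in> carrier N" "y \<in> carrier N" using u(1) r(2)[OF gr[OF u(2)]] by (auto simp: cl_def)
  then show "u \<in> {y. (x, y) \<in> cl GG (dsum M N) (graph (U, W, f))}"
   using s(5)[OF gr[OF u(2)], of u] u by (simp add: N.add_diff_cancel)
 next
  fix u assume "u \<in> {y. (x, y) \<in> cl GG (dsum M N) (graph (U, W, f))}"
  then have u: "(x, u) \<in> cl GG (dsum M N) (graph (U, W, f))" by simp
  have "u \<ominus>\<^bsub>N\<^esub> z \<in> tor GG N" by (rule corrD(4)[OF gM gN s(1) u gr[OF z]])
  moreover have "u = (u \<ominus>\<^bsub>N\<^esub> z) \<oplus>\<^bsub>N\<^esub> z" using r(2)[OF u] r(2)[OF gr[OF z]] by (simp add: N.diff_add_cancel)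
  ultimately show "u \<in> tor GG N <+>\<^bsub>N\<^esub> f x" unfolding set_add_def' using z by blast
 qed
qed

text \<open>Equivalence allows restriction to a smaller dense domain and passage to a larger torsion submodule
  of \<open>N\<close>. Neither changes the closure of the graph. Conversely, with all torsion of \<open>N\<close> divided out, partial
  homomorphisms whose graphs have the same closure agree on the intersection of their domains.\<close>

lemma partial_hom_eq_iff:
 assumes M: "M \<in> A" and N: "N \<in> A"
 shows "(p, p') \<in> partial_hom_eq R A T M N \<longleftrightarrow> p \<in> partial_homs R A T M N \<and> p' \<in> partial_homs R A T M N \<and>
  cl GG (dsum M N) (graph p) = cl GG (dsum M N) (graph p')"
proof -
 obtain U1 W1 f1 where pe: "p = (U1, W1, f1)" by (cases p)
 obtain U2 W2 f2 where pe': "p' = (U2, W2, f2)" by (cases p')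
 note gM = A_gm[OF M] and gN = A_gm[OF N]
 interpret gabriel_mod2 R GG M N by (intro gabriel_mod2I gM gN)
 let ?T = "tor GG N" and ?c = "\<lambda>p. cl GG (dsum M N) (graph p)"
 let ?E = "\<exists>U W. cotorsion_sub R A T M U \<and> U \<subseteq> U1 \<inter> U2 \<and> torsion_sub R T N W \<and> W1 \<union> W2 \<subseteq> W \<and>
    (\<forall>x\<in>U. W <+>\<^bsub>N\<^esub> f1 x = W <+>\<^bsub>N\<^esub> f2 x)"
 have iff: "?E \<longleftrightarrow> ?c p = ?c p'" if p: "p \<in> partial_homs R A T M N" and p': "p' \<in> partial_homs R A T M N"
 proof -
  note c = graph_corr(1)[OF M N p] and c' = graph_corr(1)[OF M N p']
  note S = cl_in_sat[OF gM gN c] and S' = cl_in_sat[OF gM gN c']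
  note t = tor_add_image[OF M N p[unfolded pe], folded pe] and t' = tor_add_image[OF M N p'[unfolded pe'], folded pe']
  have U: "graded_submodule R M U1" "carrier M \<subseteq> cl GG M U1" "graded_submodule R M U2" "carrier M \<subseteq> cl GG M U2"
   "W1 \<subseteq> ?T" "W2 \<subseteq> ?T"
   using p p' by (auto simp: partial_homs_def pe pe' cotorsion_sub_iff[OF M] torsion_sub_iff[OF N])
  show ?thesis
  proof
   assume ?E
   then obtain V W where V: "carrier M \<subseteq> cl GG M V" "V \<subseteq> U1 \<inter> U2"
    and W: "graded_submodule R N W" "W \<subseteq> ?T" and e: "\<And>x. x \<in> V ==> W <+>\<^bsub>N\<^esub> f1 x = W <+>\<^bsub>N\<^esub> f2 x"
    by (auto simp: cotorsion_sub_iff[OF M] torsion_sub_iff[OF N])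
   have m: "a \<oplus>\<^bsub>N\<^esub> b \<in> C <+>\<^bsub>N\<^esub> B" if "a \<in> C" "b \<in> B" for a b C B
    unfolding set_add_def' using that by blast
   have mE: "\<exists>a\<in>C. \<exists>b\<in>B. u = a \<oplus>\<^bsub>N\<^esub> b" if "u \<in> C <+>\<^bsub>N\<^esub> B" for u C B
    using that unfolding set_add_def' by blast
   have inc: "?T <+>\<^bsub>N\<^esub> F \<subseteq> ?T <+>\<^bsub>N\<^esub> F'"
    if F: "W <+>\<^bsub>N\<^esub> F = W <+>\<^bsub>N\<^esub> F'" "F \<subseteq> carrier N" "F' \<subseteq> carrier N" for F F'
   proof
    fix u assume "u \<in> ?T <+>\<^bsub>N\<^esub> F"
    from mE[OF this] obtain t y where u: "t \<in> ?T" "y \<in> F" "u = t \<oplus>\<^bsub>N\<^esub> y" by auto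
    have yc: "y \<in> carrier N" using u(2) F(2) by auto
    then have "y \<in> W <+>\<^bsub>N\<^esub> F'" using m[OF N.gsD(3)[OF W(1)] u(2)] F(1) by simp
    from mE[OF this] obtain w y' where w: "w \<in> W" "y' \<in> F'" "y = w \<oplus>\<^bsub>N\<^esub> y'" by auto
    have "t \<in> carrier N" "w \<in> carrier N" "y' \<in> carrier N"
     using N.gsD(9)[OF N.gs_tor u(1)] N.gsD(9)[OF W(1) w(1)] w(2) F(3) by auto
    then have "u = (t \<oplus>\<^bsub>N\<^esub> w) \<oplus>\<^bsub>N\<^esub> y'" using u(3) w(3) by (simp add: N.a_assoc)
    then show "u \<in> ?T <+>\<^bsub>N\<^esub> F'" using m[OF N.gsD(4)[OF N.gs_tor u(1) subsetD[OF W(2) w(1)]] w(2)] by simp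
   qed
   have "?T <+>\<^bsub>N\<^esub> f1 x = ?T <+>\<^bsub>N\<^esub> f2 x" if x: "x \<in> V" for x
   proof -
    have sub: "f1 x \<subseteq> carrier N" "f2 x \<subseteq> carrier N"
     using relD(2)[OF gM gN corrD(1)[OF gM gN c], of x] relD(2)[OF gM gN corrD(1)[OF gM gN c'], of x] x V(2)
     by (auto simp: graph_def pe pe')
    show ?thesis using inc[OF e[OF x] sub] inc[OF e[OF x, symmetric] sub(2,1)] by (rule equalityI)
   qed
   then have eq: "(x, y) \<in> ?c p \<longleftrightarrow> (x, y) \<in> ?c p'" if "x \<in> V" for x y
    using t[of x] t'[of x] that V(2) by blast
   have "graph p' \<subseteq> ?c p"
   proof (intro subrelI)
    fix x y assume xy: "(x, y) \<in> graph p'"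
    note r = relD[OF gM gN corrD(1)[OF gM gN c']]
    have "almost GG (\<lambda>s. x \<bullet>\<^bsub>M\<^esub> s \<in> V)" using V(1) r(1)[OF xy] by (auto simp: cl_def)
    then have "almost GG (\<lambda>s. (x \<bullet>\<^bsub>M\<^esub> s, y \<bullet>\<^bsub>N\<^esub> s) \<in> ?c p)"
     by (rule almost_elim) (use r(5)[OF xy] S'(2) eq in blast)
    then show "(x, y) \<in> ?c p" by (rule satD(3)[OF gM gN S(1) r(1,2)[OF xy]])
   qed
   from cl_eq_sat[OF gM gN c' S(1) this] show "?c p = ?c p'" by simp
  next
   assume e: "?c p = ?c p'"
   have "carrier M \<subseteq> cl GG M (U1 \<inter> U2)"
    using U(2,4) almost_conj by (auto simp: cl_def subset_iff)
   then show ?E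
    using U(5,6) N.gs_tor t t' e M.gs_inter[OF U(1,3)]
    by (intro exI[of _ "U1 \<inter> U2"] exI[of _ ?T]) (auto simp: cotorsion_sub_iff[OF M] torsion_sub_iff[OF N])
  qed
 qed
 have "(p, p') \<in> partial_hom_eq R A T M N \<longleftrightarrow> p \<in> partial_homs R A T M N \<and> p' \<in> partial_homs R A T M N \<and> ?E"
  unfolding partial_hom_eq_def pe pe' by simp
 then show ?thesis using iff by metis
qed

text \<open>All members of a class have the same closed graph; the union makes a choice unnecessary.\<close>

definition class_rel :: "('g, 'a, 'm) graded_mod \<Rightarrow> ('g, 'a, 'm) graded_mod \<Rightarrow> 'm partial_hom set \<Rightarrow> ('m \<times> 'm) set" where
 "class_rel M N \<phi> = (\<Union>p\<in>\<phi>. cl GG (dsum M N) (graph p))"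

abbreviation "cls M N p \<equiv> partial_hom_eq R A T M N `` {p}"

lemma mem_cls:
 assumes "M \<in> A" "N \<in> A" "p \<in> partial_homs R A T M N"
 shows "p' \<in> cls M N p \<longleftrightarrow> p' \<in> partial_homs R A T M N \<and> cl GG (dsum M N) (graph p') = cl GG (dsum M N) (graph p)"
 using partial_hom_eq_iff[OF assms(1,2)] assms(3) by auto

lemma class_rel_cls:
 assumes "M \<in> A" "N \<in> A" "p \<in> partial_homs R A T M N"
 shows "class_rel M N (cls M N p) = cl GG (dsum M N) (graph p)"
proof -
 have "p \<in> cls M N p" using mem_cls[OF assms] assms(3) by simp
 moreover have "cl GG (dsum M N) (graph p') = cl GG (dsum M N) (graph p)" if "p' \<in> cls M N p" for p'
  using mem_cls[OF assms, of p'] that by simp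
 ultimately show ?thesis unfolding class_rel_def by (intro equalityI subsetI) blast+
qed

lemma cls_eq_iff:
 assumes "M \<in> A" "N \<in> A" "p \<in> partial_homs R A T M N" "p' \<in> partial_homs R A T M N"
 shows "cls M N p = cls M N p' \<longleftrightarrow> cl GG (dsum M N) (graph p) = cl GG (dsum M N) (graph p')"
 using mem_cls[OF assms(1-3)] mem_cls[OF assms(1,2,4)] assms(3,4) by blast

lemma hom_partial:
 assumes M: "M \<in> A" and N: "N \<in> A" and f: "f \<in> graded_hom R M N"
 defines "p \<equiv> (carrier M, {\<zero>\<^bsub>N\<^esub>}, \<lambda>x\<in>carrier M. {f x})"
 shows "p \<in> partial_homs R A T M N" "cl GG (dsum M N) (graph p) = sat_of_hom GG M N f"
proof -
 note gM = A_gm[OF M] and gN = A_gm[OF N]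
 interpret gabriel_mod2 R GG M N by (intro gabriel_mod2I gM gN)
 interpret f: ghom R M N f by (rule ghomI[OF gM gN f])
 let ?\<Gamma> = "{(x, y). x \<in> carrier M \<and> y = f x}"
 have g: "graded_submodule R (dsum M N) ?\<Gamma>"
  by (rule relI[OF gM gN]) (auto simp: f.hom_closed f.hom_zero f.hom_add f.hom_act f.hom_hc)
 have Dm: "Domain ?\<Gamma> = carrier M" by auto
 have c: "corr R GG M N ?\<Gamma>"
  by (rule corrI[OF gM gN g]) (use M.cl_superset[OF M.gs_carrier] N.gsD(3)[OF N.gs_tor] Dm f.hom_zero in auto)
 have pe: "p = of_rel M ?\<Gamma>" unfolding p_def of_rel_def Dm by (auto simp: f.hom_zero fun_eq_iff)
 show "p \<in> partial_homs R A T M N" unfolding pe by (rule of_rel_partial_hom[OF M N c])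
 show "cl GG (dsum M N) (graph p) = sat_of_hom GG M N f"
  unfolding pe of_rel_partial_hom(2)[OF M N c]
  by (rule cl_eq_sat[OF gM gN c sat_of_hom[OF gM gN f]]) (use hom_mem_sat[OF gM gN f] in auto)
qed

lemma quot_functor_class:
 assumes "M \<in> A" "N \<in> A" "f \<in> graded_hom R M N"
 shows "quot_functor R A T M N f \<in> Mor (quot_cat R A T) M N"
  "class_rel M N (quot_functor R A T M N f) = sat_of_hom GG M N f"
 using hom_partial[OF assms] class_rel_cls[OF assms(1,2) hom_partial(1)[OF assms]]
 unfolding quot_functor_def quot_cat_def by (auto intro: quotientI)

lemma MorE:
 assumes "\<phi> \<in> Mor (quot_cat R A T) M N"
 obtains p where "p \<in> partial_homs R A T M N" "\<phi> = cls M N p"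
 using assms unfolding quot_cat_def quotient_def by auto

lemma Cmp_quot:
 assumes o: "M \<in> A" "N \<in> A" "P \<in> A" and "\<phi> \<in> Mor (quot_cat R A T) M N" "\<psi> \<in> Mor (quot_cat R A T) N P"
 shows "Cmp (quot_cat R A T) M N P \<psi> \<phi> \<in> Mor (quot_cat R A T) M P"
  "class_rel M P (Cmp (quot_cat R A T) M N P \<psi> \<phi>) = Cmp D M N P (class_rel N P \<psi>) (class_rel M N \<phi>)"
proof -
 note gm = o[THEN A_gm]
 obtain p where p: "p \<in> partial_homs R A T M N" "\<phi> = cls M N p" by (rule MorE[OF assms(4)])
 obtain q where q: "q \<in> partial_homs R A T N P" "\<psi> = cls N P q" by (rule MorE[OF assms(5)])
 have comp: "partial_hom_comp q' p' \<in> partial_homs R A T M P \<and>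
   cl GG (dsum M P) (graph (partial_hom_comp q' p')) =
   cl GG (dsum M P) (cl GG (dsum M N) (graph p') O cl GG (dsum N P) (graph q'))"
  if "p' \<in> partial_homs R A T M N" "q' \<in> partial_homs R A T N P" for p' q'
 proof -
  note c = graph_corr(1)[OF o(1,2) that(1)] and c' = graph_corr(1)[OF o(2,3) that(2)]
  show ?thesis
   unfolding comp_of_rel[OF o that]
   using of_rel_partial_hom[OF o(1,3) corr_comp[OF gm c c']] cl_corr_comp_cl[OF gm c c'] by simp
 qed
 let ?c = "partial_hom_comp q p"
 have c: "partial_hom_comp q' p' \<in> cls M P ?c" if "p' \<in> \<phi>" "q' \<in> \<psi>" for p' q'
  using that comp[OF p(1) q(1)] comp[of p' q'] unfolding p(2) q(2)
  by (simp add: partial_hom_eq_iff[OF o(1,2)] partial_hom_eq_iff[OF o(2,3)] partial_hom_eq_iff[OF o(1,3)])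
 have pq: "p \<in> \<phi>" "q \<in> \<psi>"
  unfolding p(2) q(2) using p(1) q(1) by (simp_all add: partial_hom_eq_iff[OF o(1,2)] partial_hom_eq_iff[OF o(2,3)])
 have "partial_hom_eq R A T M P `` {partial_hom_comp q p | q p. q \<in> \<psi> \<and> p \<in> \<phi>} = cls M P ?c"
 proof (intro equalityI subsetI)
  fix r assume "r \<in> partial_hom_eq R A T M P `` {partial_hom_comp q p | q p. q \<in> \<psi> \<and> p \<in> \<phi>}"
  then obtain q' p' where "q' \<in> \<psi>" "p' \<in> \<phi>" and r: "(partial_hom_comp q' p', r) \<in> partial_hom_eq R A T M P" by auto
  then have "(?c, partial_hom_comp q' p') \<in> partial_hom_eq R A T M P" using c by simp
  then have "(?c, r) \<in> partial_hom_eq R A T M P" using r by (simp add: partial_hom_eq_iff[OF o(1,3)])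
  then show "r \<in> cls M P ?c" by simp
 next
  fix r assume "r \<in> cls M P ?c"
  then show "r \<in> partial_hom_eq R A T M P `` {partial_hom_comp q p | q p. q \<in> \<psi> \<and> p \<in> \<phi>}"
  proof (intro ImageI[of ?c])
   show "?c \<in> {partial_hom_comp q p | q p. q \<in> \<psi> \<and> p \<in> \<phi>}" using pq by blast
  qed simp
 qed
 then have e: "Cmp (quot_cat R A T) M N P \<psi> \<phi> = cls M P (partial_hom_comp q p)" by (simp add: quot_cat_def)
 show "Cmp (quot_cat R A T) M N P \<psi> \<phi> \<in> Mor (quot_cat R A T) M P"
  unfolding e using comp[OF p(1) q(1)] by (auto simp: quot_cat_def intro: quotientI)
 show "class_rel M P (Cmp (quot_cat R A T) M N P \<psi> \<phi>) = Cmp D M N P (class_rel N P \<psi>) (class_rel M N \<phi>)"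
  unfolding e
  using comp[OF p(1) q(1)] class_rel_cls[OF o(1,3), of ?c] class_rel_cls[OF o(1,2) p(1), folded p(2)]
   class_rel_cls[OF o(2,3) q(1), folded q(2)] by simp
qed

lemma class_rel_bij:
 assumes M: "M \<in> A" and N: "N \<in> A"
 shows "bij_betw (class_rel M N) (Mor (quot_cat R A T) M N) (sat R GG M N)"
 unfolding bij_betw_def
proof
 note gM = A_gm[OF M] and gN = A_gm[OF N]
 show "inj_on (class_rel M N) (Mor (quot_cat R A T) M N)"
 proof (rule inj_onI)
  fix \<phi> \<psi> assume "\<phi> \<in> Mor (quot_cat R A T) M N" "\<psi> \<in> Mor (quot_cat R A T) M N" and e: "class_rel M N \<phi> = class_rel M N \<psi>"
  then obtain p q where p: "p \<in> partial_homs R A T M N" "\<phi> = cls M N p" and q: "q \<in> partial_homs R A T M N" "\<psi> = cls M N q"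
   by (elim MorE) auto
  then show "\<phi> = \<psi>" using e cls_eq_iff[OF M N p(1) q(1)] class_rel_cls[OF M N] by simp
 qed
 show "class_rel M N ` Mor (quot_cat R A T) M N = sat R GG M N"
 proof
  show "class_rel M N ` Mor (quot_cat R A T) M N \<subseteq> sat R GG M N"
   using class_rel_cls[OF M N] cl_in_sat(1)[OF gM gN graph_corr(1)[OF M N]] by (auto elim!: MorE)
  show "sat R GG M N \<subseteq> class_rel M N ` Mor (quot_cat R A T) M N"
  proof
   fix \<Gamma> assume \<Gamma>: "\<Gamma> \<in> sat R GG M N"
   note p = of_rel_partial_hom[OF M N satD(1)[OF gM gN \<Gamma>]]
   have "cls M N (of_rel M \<Gamma>) \<in> Mor (quot_cat R A T) M N" using p(1) by (auto simp: quot_cat_def intro: quotientI)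
   moreover have "class_rel M N (cls M N (of_rel M \<Gamma>)) = \<Gamma>"
    using class_rel_cls[OF M N p(1)] p(2) cl_sat[OF \<Gamma> gM gN] by simp
   ultimately show "\<Gamma> \<in> class_rel M N ` Mor (quot_cat R A T) M N" by (metis imageI)
  qed
 qed
qed

lemma quot_cat_iso: "cat_iso (quot_cat R A T) D class_rel"
proof
 show "is_category D" by (rule sat_category)
 show "Ob (quot_cat R A T) = Ob D" by (simp add: quot_cat_def)
 fix V assume V: "V \<in> Ob D"
 then have "Idn (quot_cat R A T) V = quot_functor R A T V V (\<lambda>x\<in>carrier V. x)" by (simp add: quot_cat_def)
 then show "Idn (quot_cat R A T) V \<in> Mor (quot_cat R A T) V V" "class_rel V V (Idn (quot_cat R A T) V) = Idn D V"
  using quot_functor_class[OF _ _ id_hom[OF A_gm], of V] V by simp_all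
qed (use Cmp_quot class_rel_bij in auto)

lemma quot_abelian: "is_abelian (quot_cat R A T)"
 by (rule cat_iso.iso_abelian[OF quot_cat_iso sat_abelian])

lemma mod_cat_category: "is_category (mod_cat R A)"
 unfolding is_category_def
proof (intro conjI ballI)
 fix V assume "V \<in> Ob (mod_cat R A)"
 then show "Idn (mod_cat R A) V \<in> Mor (mod_cat R A) V V" using id_hom[OF A_gm] by (simp add: mod_cat_def)
next
 fix V Y Z f g assume o: "V \<in> Ob (mod_cat R A)" "Y \<in> Ob (mod_cat R A)" "Z \<in> Ob (mod_cat R A)"
  "f \<in> Mor (mod_cat R A) V Y" "g \<in> Mor (mod_cat R A) Y Z"
 then have f: "f \<in> graded_hom R V Y" and g: "g \<in> graded_hom R Y Z" and V: "V \<in> A" by (auto simp: mod_cat_def)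
 then show "Cmp (mod_cat R A) V Y Z g f \<in> Mor (mod_cat R A) V Z"
  using compose_hom[OF A_gm[OF V] f g] by (simp add: mod_cat_def)
next
 fix V Y f assume "f \<in> Mor (mod_cat R A) V Y"
 then have f: "f \<in> graded_hom R V Y" by (simp add: mod_cat_def)
 note e = graded_homD(1,5)[OF f]
 show "Cmp (mod_cat R A) V V Y f (Idn (mod_cat R A) V) = f" "Cmp (mod_cat R A) V Y Y (Idn (mod_cat R A) Y) f = f"
  using e by (auto simp: mod_cat_def compose_def fun_eq_iff extensional_def)
next
 fix W V Y Z f g h assume "f \<in> Mor (mod_cat R A) W V" "g \<in> Mor (mod_cat R A) V Y" "h \<in> Mor (mod_cat R A) Y Z"
 then have "f \<in> graded_hom R W V" by (simp add: mod_cat_def)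
 from graded_homD(1)[OF this]
 show "Cmp (mod_cat R A) W Y Z h (Cmp (mod_cat R A) W V Y g f) = Cmp (mod_cat R A) W V Z (Cmp (mod_cat R A) V Y Z h g) f"
  by (auto simp: mod_cat_def compose_def fun_eq_iff)
qed

lemma quot_functor_functor: "is_functor (mod_cat R A) (quot_cat R A T) (\<lambda>V. V) (quot_functor R A T)"
 unfolding is_functor_def
proof (intro conjI ballI)
 interpret I: cat_iso "quot_cat R A T" D class_rel by (rule quot_cat_iso)
 show "is_category (mod_cat R A)" by (rule mod_cat_category)
 show "is_category (quot_cat R A T)" by (rule I.iso_category)
 show "V \<in> Ob (quot_cat R A T)" if "V \<in> Ob (mod_cat R A)" for V using that by (simp add: mod_cat_def quot_cat_def)
 show "quot_functor R A T V Y f \<in> Mor (quot_cat R A T) V Y"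
  if "V \<in> Ob (mod_cat R A)" "Y \<in> Ob (mod_cat R A)" "f \<in> Mor (mod_cat R A) V Y" for V Y f
  using that quot_functor_class(1) by (simp add: mod_cat_def)
 show "quot_functor R A T V V (Idn (mod_cat R A) V) = Idn (quot_cat R A T) V" if "V \<in> Ob (mod_cat R A)" for V
  by (simp add: mod_cat_def quot_cat_def)
 fix V Y Z f g assume o': "V \<in> Ob (mod_cat R A)" "Y \<in> Ob (mod_cat R A)" "Z \<in> Ob (mod_cat R A)"
  and "f \<in> Mor (mod_cat R A) V Y" "g \<in> Mor (mod_cat R A) Y Z"
 then have o: "V \<in> A" "Y \<in> A" "Z \<in> A" and f: "f \<in> graded_hom R V Y" and g: "g \<in> graded_hom R Y Z"
  by (auto simp: mod_cat_def)
 note gm = o[THEN A_gm]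
 note gf = compose_hom[OF gm(1) f g]
 interpret Z: gabriel_mod R GG Z by (rule gabriel_modI[OF gm(3)])
 interpret g: ghom R Y Z g by (rule ghomI[OF gm(2,3) g])
 have "sat_of_hom GG V Y f O sat_of_hom GG Y Z g \<subseteq> sat_of_hom GG V Z (compose (carrier V) g f)"
 proof (intro subrelI, elim relcompE)
  fix x z x' y z' assume "(x, z) = (x', z')" "(x', y) \<in> sat_of_hom GG V Y f" "(y, z') \<in> sat_of_hom GG Y Z g"
  then have *: "x \<in> carrier V" "y \<in> carrier Y" "y \<ominus>\<^bsub>Y\<^esub> f x \<in> tor GG Y" "z \<in> carrier Z" "z \<ominus>\<^bsub>Z\<^esub> g y \<in> tor GG Z"
   by (auto simp: sat_of_hom_def)
  have fx: "f x \<in> carrier Y" using graded_homD(1)[OF f *(1)] .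
  have "g y \<ominus>\<^bsub>Z\<^esub> g (f x) \<in> tor GG Z" using hom_tor[OF gm(2,3) g *(3)] * fx by (simp add: g.hom_diff)
  then have "z \<ominus>\<^bsub>Z\<^esub> g (f x) \<in> tor GG Z"
   using Z.gs_diff_trans[OF Z.gs_tor *(5)] * fx g.hom_closed by blast
  then show "(x, z) \<in> sat_of_hom GG V Z (compose (carrier V) g f)"
   using * by (simp add: sat_of_hom_def compose_def)
 qed
 then have "Cmp D V Y Z (sat_of_hom GG Y Z g) (sat_of_hom GG V Y f) = sat_of_hom GG V Z (compose (carrier V) g f)"
  using Cmp_eq_iff[OF o sat_of_hom[OF gm(1,2) f] sat_of_hom[OF gm(2,3) g] sat_of_hom[OF gm(1,3) gf]] by simp
 then have "class_rel V Z (quot_functor R A T V Z (compose (carrier V) g f)) =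
   class_rel V Z (Cmp (quot_cat R A T) V Y Z (quot_functor R A T Y Z g) (quot_functor R A T V Y f))"
  using Cmp_quot(2)[OF o quot_functor_class(1)[OF o(1,2) f] quot_functor_class(1)[OF o(2,3) g]]
   quot_functor_class(2)[OF o(1,2) f] quot_functor_class(2)[OF o(2,3) g] quot_functor_class(2)[OF o(1,3) gf] by simp
 then have "quot_functor R A T V Z (compose (carrier V) g f) =
   Cmp (quot_cat R A T) V Y Z (quot_functor R A T Y Z g) (quot_functor R A T V Y f)"
  using I.E_inj[of V Z, OF _ _ quot_functor_class(1)[OF o(1,3) gf]
    Cmp_quot(1)[OF o quot_functor_class(1)[OF o(1,2) f] quot_functor_class(1)[OF o(2,3) g]]] o by simp
 then show "quot_functor R A T V Z (Cmp (mod_cat R A) V Y Z g f) =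
   Cmp (quot_cat R A T) V Y Z (quot_functor R A T Y Z g) (quot_functor R A T V Y f)"
  by (simp add: mod_cat_def)
qed

end

section \<open>The topology of graded right ideals of finite codimension\<close>

lemma graded_algebra_ring:
 assumes "graded_algebra K R" shows "graded_ring R"
 using assms unfolding graded_algebra_def
 by (intro graded_ring.intro graded_ring_axioms.intro) blast+

lemma graded_algebra_vec_act:
 assumes "graded_algebra K R" "field K" shows "vec_act K R (\<lambda>x c. c \<odot>\<^bsub>R\<^esub> x)"
proof -
 interpret K: field K by fact
 interpret R: ring R using assms(1) by (simp add: graded_algebra_def)
 interpret Module.module K R using assms(1) by (simp add: graded_algebra_def)
 show ?thesis
  by unfold_locales (simp_all add: smult_l_distr smult_r_distr smult_assoc1[symmetric] K.m_comm)
qed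

text \<open>\<open>C\<close> is a right noetherian homogeneous subalgebra of \<open>R\<close> such that for every homogeneous \<open>r\<close>, the
  set \<open>r C\<close> lies in a finitely generated left \<open>C\<close>-submodule of \<open>R\<close>. Finite generation is expressed by
  the subgroups that contain the generators.\<close>

locale coefficient_algebra = field K
 for K :: "'k ring" and R :: "('k, 'g::ab_group_add, 'a) graded_alg" (structure) and C :: "'a set" +
 assumes alg: "graded_algebra K R"
  and C_sub: "C \<subseteq> carrier R" "\<one> \<in> C"
  and C_add: "x \<in> C ==> y \<in> C ==> x \<oplus> y \<in> C"
  and C_mult: "x \<in> C ==> y \<in> C ==> x \<otimes> y \<in> C"
  and C_smult: "k \<in> carrier K ==> x \<in> C ==> k \<odot> x \<in> C"
  and C_hc: "x \<in> C ==> hcomp R (acomp R) g x \<in> C"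
  and C_noetherian: "I \<subseteq> C ==> additive_subgroup I R ==> (\<And>x c. x \<in> I ==> c \<in> C ==> x \<otimes> c \<in> I) ==>
   \<exists>B. finite B \<and> B \<subseteq> I \<and> (\<forall>J. additive_subgroup J R \<longrightarrow> (\<forall>x\<in>J. \<forall>c\<in>C. x \<otimes> c \<in> J) \<longrightarrow> B \<subseteq> J \<longrightarrow> I \<subseteq> J)"
  and C_left: "r \<in> acomp R h ==> \<exists>B. finite B \<and> B \<subseteq> carrier R \<and>
   (\<forall>J. additive_subgroup J R \<longrightarrow> (\<forall>c\<in>C. \<forall>b\<in>B. c \<otimes> b \<in> J) \<longrightarrow> (\<forall>c\<in>C. r \<otimes> c \<in> J))"

sublocale coefficient_algebra \<subseteq> A: graded_ring R
 by (rule graded_algebra_ring[OF alg])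

sublocale coefficient_algebra \<subseteq> V: vec_act K R "\<lambda>x c. c \<odot> x"
 by (rule graded_algebra_vec_act[OF alg field_axioms])

context coefficient_algebra
begin

definition cofinite_ideals :: "'a set set" where
 "cofinite_ideals = {J. graded_submodule R (reg R) J \<and> V.fdm (J \<inter> C) C}"

lemma smult_right: "k \<in> carrier K ==> x \<in> carrier R ==> k \<odot> x = x \<otimes> (k \<odot> \<one>)"
 using alg unfolding graded_algebra_def by (metis A.one_closed A.r_one)

lemma smult_mult:
 assumes "k \<in> carrier K" "x \<in> carrier R" "y \<in> carrier R"
 shows "k \<odot> (x \<otimes> y) = (k \<odot> x) \<otimes> y" "k \<odot> (x \<otimes> y) = x \<otimes> (k \<odot> y)"
 using alg assms unfolding graded_algebra_def by blast+

lemma smult_one_closed: "k \<in> carrier K ==> k \<odot> \<one> \<in> carrier R"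
 using V.act_closed by simp

lemma C_zero: "\<zero> \<in> C"
 using C_smult[OF zero_closed C_sub(2)] V.act_zero_right[of "\<one>"] by simp

lemma C_submod: "V.submod C"
 unfolding V.submod_def using C_sub C_zero C_add C_smult by auto

lemma ideal_submod: "graded_submodule R (reg R) J ==> V.submod J"
 unfolding V.submod_def
proof (intro conjI ballI)
 assume "graded_submodule R (reg R) J"
 note G = A.reg.gsD[OF this]
 show "J \<subseteq> carrier R" "\<zero> \<in> J" "\<And>x y. x \<in> J ==> y \<in> J ==> x \<oplus> y \<in> J" using G by auto
 show "k \<odot> x \<in> J" if "x \<in> J" "k \<in> carrier K" for x k
  using G(7)[OF that(1) smult_one_closed[OF that(2)]] G(9)[OF that(1)]
  by (simp add: smult_right[OF that(2), of x])
qed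

lemma submod_Int: "V.submod J ==> V.submod J' ==> V.submod (J \<inter> J')"
 by (auto simp: V.submod_def)

lemma left_mult_linear: "r \<in> carrier R ==> linear_map K R (\<lambda>x c. c \<odot> x) R (\<lambda>x c. c \<odot> x) (\<lambda>s. r \<otimes> s)"
 by unfold_locales (auto simp: A.r_distr smult_mult(2)[symmetric])

lemma right_mult_linear: "r \<in> carrier R ==> linear_map K R (\<lambda>x c. c \<odot> x) R (\<lambda>x c. c \<odot> x) (\<lambda>s. s \<otimes> r)"
 by unfold_locales (auto simp: A.l_distr smult_mult(1)[symmetric])

text \<open>Let \<open>r C \<subseteq> C t\<^sub>1 + \<dots> + C t\<^sub>n\<close>, and let \<open>E\<close> be of finite dimension with \<open>C \<subseteq> J + E\<close>. As \<open>J\<close> is a right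
  ideal, \<open>r C \<subseteq> J + E t\<^sub>1 + \<dots> + E t\<^sub>n\<close>.\<close>

lemma fdm_conductor:
 assumes J: "graded_submodule R (reg R) J" and r: "r \<in> acomp R h" and fin: "V.fdm J C"
 shows "V.fdm ({s \<in> carrier R. r \<otimes> s \<in> J} \<inter> C) C"
proof -
 note rc = A.D_carrier[OF r] and gJ = A.reg.gsD[OF J]
 have Jc: "J \<subseteq> carrier R" using gJ(2) by simp
 interpret L: linear_map K R "\<lambda>x c. c \<odot> x" R "\<lambda>x c. c \<odot> x" "\<lambda>s. r \<otimes> s" by (rule left_mult_linear[OF rc])
 obtain T where T: "finite T" "T \<subseteq> carrier R"
  and Tsub: "\<forall>J. additive_subgroup J R \<longrightarrow> (\<forall>c\<in>C. \<forall>b\<in>T. c \<otimes> b \<in> J) \<longrightarrow> (\<forall>c\<in>C. r \<otimes> c \<in> J)"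
  using C_left[OF r] by blast
 have "V.fdm J ((\<lambda>s. s \<otimes> t) ` C)" if t: "t \<in> T" for t
 proof -
  have tc: "t \<in> carrier R" using t T by auto
  interpret Rt: linear_map K R "\<lambda>x c. c \<odot> x" R "\<lambda>x c. c \<odot> x" "\<lambda>s. s \<otimes> t" by (rule right_mult_linear[OF tc])
  have "(\<lambda>s. s \<otimes> t) ` J \<subseteq> J" using gJ(7) tc by auto
  then show ?thesis using V.fdm_mono[OF Rt.fdm_image[OF fin Jc]] by blast
 qed
 then obtain B where B: "finite B" "B \<subseteq> carrier R" "\<forall>t\<in>T. (\<lambda>s. s \<otimes> t) ` C \<subseteq> V.gen (J \<union> B)"
  using V.fdm_Un[OF T(1), of J "\<lambda>t. (\<lambda>s. s \<otimes> t) ` C"] by blast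
 have "additive_subgroup (V.gen (J \<union> B)) R"
  by (rule V.submod_additive_subgroup[OF V.submod_gen]) (use B Jc in auto)
 then have "(\<lambda>s. r \<otimes> s) ` C \<subseteq> V.gen (J \<union> B)"
  using Tsub[rule_format, of "V.gen (J \<union> B)"] B(3) by blast
 then have "V.fdm J ((\<lambda>s. r \<otimes> s) ` C)" unfolding V.fdm_def using B by blast
 from L.fdm_vimage[OF this C_submod ideal_submod[OF J]]
 show ?thesis using C_sub by (elim V.fdm_mono) auto
qed

text \<open>The right ideal \<open>J \<inter> C\<close> of \<open>C\<close> has finitely many generators \<open>b\<close>, and each \<open>b C\<close> is of finite
  dimension modulo \<open>J'\<close>.\<close>

lemma cofinite_trans:
 assumes J: "J \<in> cofinite_ideals" and J': "graded_submodule R (reg R) J'"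
  and a: "\<And>h a. a \<in> J ==> a \<in> acomp R h ==> {s \<in> carrier R. a \<otimes> s \<in> J'} \<in> cofinite_ideals"
 shows "J' \<in> cofinite_ideals"
proof -
 have gJ: "graded_submodule R (reg R) J" and fJ: "V.fdm (J \<inter> C) C" using J by (auto simp: cofinite_ideals_def)
 note G = A.reg.gsD[OF gJ] and G' = A.reg.gsD[OF J']
 have J'c: "J' \<subseteq> carrier R" using G'(2) by simp
 have sJC: "V.submod (J \<inter> C)" by (rule submod_Int[OF ideal_submod[OF gJ] C_submod])
 have sJ'C: "V.submod (J' \<inter> C)" by (rule submod_Int[OF ideal_submod[OF J'] C_submod])
 obtain B where B: "finite B" "B \<subseteq> J \<inter> C"
  and Bsub: "\<And>I. additive_subgroup I R ==> (\<And>x c. x \<in> I ==> c \<in> C ==> x \<otimes> c \<in> I) ==> B \<subseteq> I ==> J \<inter> C \<subseteq> I"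
 proof -
  have "\<exists>B. finite B \<and> B \<subseteq> J \<inter> C \<and> (\<forall>I. additive_subgroup I R \<longrightarrow> (\<forall>x\<in>I. \<forall>c\<in>C. x \<otimes> c \<in> I) \<longrightarrow> B \<subseteq> I \<longrightarrow> J \<inter> C \<subseteq> I)"
   by (rule C_noetherian) (use G(7) C_mult C_sub V.submod_additive_subgroup[OF sJC] in auto)
  then show ?thesis using that by metis
 qed
 have Bc: "B \<subseteq> carrier R" using B(2) C_sub by auto
 \<comment> \<open>the generators may be taken homogeneous\<close>
 define H where "H = (\<Union>b\<in>B. (\<lambda>g. A.hc g b) ` {g. A.hc g b \<noteq> \<zero>})"
 have H: "finite H" unfolding H_def using B(1) A.finite_support Bc by auto
 have "V.fdm (J' \<inter> C) ((\<lambda>s. x \<otimes> s) ` C)" if x: "x \<in> H" for x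
 proof -
  obtain b g where bg: "b \<in> B" "x = A.hc g b" using x by (auto simp: H_def)
  then have bc: "b \<in> carrier R" "b \<in> J" "b \<in> C" using B Bc by auto
  have xg: "x \<in> acomp R g" "x \<in> J" "x \<in> C"
   using A.hc_in[OF bc(1)] G(8)[OF bc(2), of g] C_hc[OF bc(3)] bg by (auto simp: hcomp_reg)
  have xc: "x \<in> carrier R" using A.D_carrier[OF xg(1)] .
  interpret L: linear_map K R "\<lambda>x c. c \<odot> x" R "\<lambda>x c. c \<odot> x" "\<lambda>s. x \<otimes> s" by (rule left_mult_linear[OF xc])
  have f: "V.fdm ({s \<in> carrier R. x \<otimes> s \<in> J'} \<inter> C) C" using a[OF xg(2,1)] by (simp add: cofinite_ideals_def)
  have "V.fdm ((\<lambda>s. x \<otimes> s) ` ({s \<in> carrier R. x \<otimes> s \<in> J'} \<inter> C)) ((\<lambda>s. x \<otimes> s) ` C)"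
   by (rule L.fdm_image[OF f]) auto
  moreover have "(\<lambda>s. x \<otimes> s) ` ({s \<in> carrier R. x \<otimes> s \<in> J'} \<inter> C) \<subseteq> J' \<inter> C" using C_mult xg(3) by auto
  ultimately show ?thesis using V.fdm_mono by blast
 qed
 then obtain E where E: "finite E" "E \<subseteq> carrier R" "\<forall>x\<in>H. (\<lambda>s. x \<otimes> s) ` C \<subseteq> V.gen (J' \<inter> C \<union> E)"
  using V.fdm_Un[OF H, of "J' \<inter> C" "\<lambda>x. (\<lambda>s. x \<otimes> s) ` C"] by blast
 let ?W = "V.gen (J' \<inter> C \<union> E)"
 note W = V.submodD[OF V.submod_gen, of "J' \<inter> C \<union> E"]
 have WE: "J' \<inter> C \<union> E \<subseteq> carrier R" using E J'c by auto
 let ?I = "{z \<in> carrier R. \<forall>c\<in>C. z \<otimes> c \<in> ?W}"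
 have addI: "additive_subgroup ?I R"
  by (rule additive_subgroupI_closed[OF A.is_abelian_group])
    (use C_sub W[OF WE] in \<open>auto simp: A.l_distr A.l_minus subset_iff\<close>)
 have "J \<inter> C \<subseteq> ?I"
 proof (rule Bsub[OF addI])
  show "x \<otimes> c \<in> ?I" if "x \<in> ?I" "c \<in> C" for x c
   using that C_sub C_mult by (auto simp: A.m_assoc subset_iff)
  show "B \<subseteq> ?I"
  proof
   fix b assume b: "b \<in> B"
   then have bc: "b \<in> carrier R" using Bc by auto
   show "b \<in> ?I"
   proof (rule A.mem_of_hc[OF bc addI])
    fix g
    show "A.hc g b \<in> ?I"
    proof (cases "A.hc g b = \<zero>")
     case True
     then show ?thesis using C_sub W(2)[OF WE] by auto
    next
     case False
     then have "A.hc g b \<in> H" using b by (auto simp: H_def)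
     then show ?thesis using E(3) bc by auto
    qed
   qed
  qed
 qed
 then have "x \<otimes> \<one> \<in> ?W" if "x \<in> J \<inter> C" for x using that C_sub(2) by blast
 then have "J \<inter> C \<subseteq> ?W" using C_sub(1) by (simp add: subset_iff)
 then have "V.fdm (J' \<inter> C) (J \<inter> C)" unfolding V.fdm_def using E by blast
 then have "V.fdm (J' \<inter> C) C" using V.fdm_trans[OF _ fJ] J'c by blast
 then show ?thesis using J' by (simp add: cofinite_ideals_def)
qed

lemma cofinite_gabriel: "gabriel R cofinite_ideals"
proof unfold_locales
 show "graded_submodule R (reg R) J" if "J \<in> cofinite_ideals" for J using that by (simp add: cofinite_ideals_def)
 have "V.fdm (carrier R \<inter> C) C" using V.fdm_refl[of C] C_sub by (simp add: Int_absorb1)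
 then show "carrier R \<in> cofinite_ideals" using A.reg.gs_carrier by (simp add: cofinite_ideals_def)
 show "J' \<in> cofinite_ideals" if "J \<in> cofinite_ideals" "graded_submodule R (reg R) J'" "J \<subseteq> J'" for J J'
  using that V.fdm_mono[of "J \<inter> C" C "J' \<inter> C" C] by (auto simp: cofinite_ideals_def)
 show "J \<inter> J' \<in> cofinite_ideals" if "J \<in> cofinite_ideals" "J' \<in> cofinite_ideals" for J J'
 proof -
  have "V.fdm ((J \<inter> C) \<inter> (J' \<inter> C)) C"
   by (rule V.fdm_inter) (use that submod_Int[OF ideal_submod C_submod] in \<open>auto simp: cofinite_ideals_def\<close>)
  then have "V.fdm (J \<inter> J' \<inter> C) C" by (rule V.fdm_mono) auto
  then show ?thesis using that A.reg.gs_inter by (simp add: cofinite_ideals_def)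
 qed
 show "{s \<in> carrier R. r \<otimes> s \<in> J} \<in> cofinite_ideals" if J: "J \<in> cofinite_ideals" and r: "r \<in> acomp R h" for J r h
 proof -
  have gJ: "graded_submodule R (reg R) J" and "V.fdm J C"
   using J V.fdm_mono[of "J \<inter> C" C J C] by (auto simp: cofinite_ideals_def)
  then show ?thesis using fdm_conductor[OF gJ r] A.reg.gs_conductor[OF gJ, of r h] r
   by (simp add: cofinite_ideals_def)
 qed
 show "J' \<in> cofinite_ideals" if "J \<in> cofinite_ideals" "graded_submodule R (reg R) J'"
  "\<And>h a. a \<in> J ==> a \<in> acomp R h ==> {s \<in> carrier R. a \<otimes> s \<in> J'} \<in> cofinite_ideals" for J J'
  by (rule cofinite_trans[OF that])
qed

lemma module_vec_act:
 assumes "graded_module R M"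
 shows "vec_act K M (\<lambda>y c. y \<bullet>\<^bsub>M\<^esub> (c \<odot> \<one>))"
proof -
 interpret M: gmod R M by (rule A.gmodI[OF assms])
 have 1: "(r \<oplus>\<^bsub>K\<^esub> s) \<odot> \<one> = r \<odot> \<one> \<oplus> s \<odot> \<one>"
  "(r \<otimes>\<^bsub>K\<^esub> s) \<odot> \<one> = (r \<odot> \<one>) \<otimes> (s \<odot> \<one>)" if "r \<in> carrier K" "s \<in> carrier K" for r s
  using that V.act_add_right V.act_mult[of "\<one>" r s] smult_right[of s "r \<odot> \<one>"] smult_one_closed
  by auto
 have 2: "\<one>\<^bsub>K\<^esub> \<odot> \<one> = \<one>" using V.act_one by simp
 show ?thesis
  by unfold_locales (auto simp: 1 2 smult_one_closed M.act_mult M.act_add_right M.act_add_left)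
qed

text \<open>The space \<open>x C\<close> is the quotient of \<open>C\<close> by its intersection with the annihilator of \<open>x\<close>.\<close>

lemma orbit_fin_gen_iff:
 assumes M: "graded_module R M" and x: "x \<in> mcomp M g"
 shows "fin_gen (carrier K) M (\<lambda>c y. y \<bullet>\<^bsub>M\<^esub> (c \<odot> \<one>)) ((\<lambda>s. x \<bullet>\<^bsub>M\<^esub> s) ` C) \<longleftrightarrow>
  {r \<in> carrier R. x \<bullet>\<^bsub>M\<^esub> r \<in> {\<zero>\<^bsub>M\<^esub>}} \<in> cofinite_ideals"
proof -
 interpret M: gmod R M by (rule A.gmodI[OF M])
 interpret W: vec_act K M "\<lambda>y c. y \<bullet>\<^bsub>M\<^esub> (c \<odot> \<one>)" by (rule module_vec_act[OF M])
 have xc: "x \<in> carrier M" using M.D_carrier[OF x] .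
 interpret L: linear_map K R "\<lambda>x c. c \<odot> x" M "\<lambda>y c. y \<bullet>\<^bsub>M\<^esub> (c \<odot> \<one>)" "\<lambda>s. x \<bullet>\<^bsub>M\<^esub> s"
 proof unfold_locales
  show "x \<bullet>\<^bsub>M\<^esub> (r \<odot> s) = x \<bullet>\<^bsub>M\<^esub> s \<bullet>\<^bsub>M\<^esub> (r \<odot> \<one>)" if "s \<in> carrier R" "r \<in> carrier K" for s r
   using smult_right[OF that(2,1)] M.act_mult[OF xc that(1) smult_one_closed[OF that(2)]] by simp
 qed (use xc in \<open>auto simp: M.act_add_right\<close>)
 let ?O = "(\<lambda>s. x \<bullet>\<^bsub>M\<^esub> s) ` C" and ?J = "{r \<in> carrier R. x \<bullet>\<^bsub>M\<^esub> r \<in> {\<zero>\<^bsub>M\<^esub>}}"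
 have O: "W.submod ?O" by (rule L.submod_image[OF C_submod])
 note Oc = W.submodD(1)[OF O]
 have "fin_gen (carrier K) M (\<lambda>c y. y \<bullet>\<^bsub>M\<^esub> (c \<odot> \<one>)) ?O \<longleftrightarrow> V.fdm (?J \<inter> C) C"
 proof
  assume "fin_gen (carrier K) M (\<lambda>c y. y \<bullet>\<^bsub>M\<^esub> (c \<odot> \<one>)) ?O"
  then obtain B where B: "finite B" "B \<subseteq> ?O" "?O = W.gen B" using W.fin_gen_iff[OF Oc] by blast
  then have "?O \<subseteq> W.gen ({\<zero>\<^bsub>M\<^esub>} \<union> B)" using W.gen_mono[of B "{\<zero>\<^bsub>M\<^esub>} \<union> B"] by blast
  moreover have "B \<subseteq> carrier M" using B(2) Oc by blast
  ultimately have "W.fdm {\<zero>\<^bsub>M\<^esub>} ?O" unfolding W.fdm_def using B(1) by blast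
  from L.fdm_vimage[OF this C_submod W.submod_zero] show "V.fdm (?J \<inter> C) C"
   using C_sub by (elim V.fdm_mono) auto
 next
  assume "V.fdm (?J \<inter> C) C"
  then have "W.fdm ((\<lambda>s. x \<bullet>\<^bsub>M\<^esub> s) ` (?J \<inter> C)) ?O" by (rule L.fdm_image) auto
  then have "W.fdm {\<zero>\<^bsub>M\<^esub>} ?O" by (rule W.fdm_mono) auto
  then obtain B where B: "finite B" "B \<subseteq> ?O" "?O \<subseteq> W.gen ({\<zero>\<^bsub>M\<^esub>} \<union> B)"
   using W.fdmE[OF _ O, of "{\<zero>\<^bsub>M\<^esub>}"] by auto
  have Bc: "B \<subseteq> carrier M" using B(2) Oc by blast
  have "W.gen ({\<zero>\<^bsub>M\<^esub>} \<union> B) \<subseteq> W.gen B"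
   by (rule W.gen_least[OF W.submod_gen[OF Bc]])
     (use W.gen_superset W.submodD(2)[OF W.submod_gen[OF Bc]] in auto)
  then have "?O = W.gen B" using B W.gen_least[OF O B(2)] by blast
  then show "fin_gen (carrier K) M (\<lambda>c y. y \<bullet>\<^bsub>M\<^esub> (c \<odot> \<one>)) ?O"
   using W.fin_gen_iff[OF Oc] B by blast
 qed
 then show ?thesis using M.gs_conductor[OF M.gs_zero x] by (simp add: cofinite_ideals_def)
qed

lemma torsion_wrt_iff:
 assumes M: "graded_module R M"
 shows "torsion_wrt K R C M \<longleftrightarrow> carrier M \<subseteq> tor cofinite_ideals M"
proof -
 interpret M: gabriel_mod R cofinite_ideals M
  by (rule gabriel.gabriel_modI[OF cofinite_gabriel M])
 have "torsion_wrt K R C M \<longleftrightarrow> (\<forall>g. \<forall>x\<in>mcomp M g. x \<in> tor cofinite_ideals M)"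
  unfolding torsion_wrt_def using orbit_fin_gen_iff[OF M] M.almost_iff_conductor[OF M.gs_zero] M.D_carrier
  by (simp add: cl_def)
 also have "\<dots> \<longleftrightarrow> carrier M \<subseteq> tor cofinite_ideals M"
  using M.cl_of_hc[OF M.gs_zero] M.hc_in M.D_carrier by blast
 finally show ?thesis .
qed

end

section \<open>Rows of bigraded modules\<close>

lemma (in graded_group) hc_eqI:
 assumes "x \<in> carrier G" "p \<zero> = \<zero>" "\<And>x y. x \<in> carrier G ==> y \<in> carrier G ==> p (x \<oplus> y) = p x \<oplus> p y"
  "\<And>h x. x \<in> D h ==> p x = (if g = h then x else \<zero>)"
 shows "hc g x = p x"
 using assms(1) by (induction rule: homogeneous_induct) (simp_all add: assms(2-4) hc_homog hc_add)

lemma mod_row_simps [simp]: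
 "add (mod_row M i) = add M" "ring.zero (mod_row M i) = ring.zero M" "ract (mod_row M i) = ract M"
 "mcomp (mod_row M i) j = mcomp M (i, j)"
 by (auto simp: mod_row_def)

lemma deg0_simps [simp]:
 "carrier (deg0_alg S) = row S 0" "monoid.mult (deg0_alg S) = monoid.mult S" "one (deg0_alg S) = one S"
 "ring.zero (deg0_alg S) = ring.zero S" "add (deg0_alg S) = add S" "smult (deg0_alg S) = smult S"
 "acomp (deg0_alg S) j = acomp S (0, j)"
 by (auto simp: deg0_alg_def)

lemma row_eq_mod_row: "row S i = carrier (mod_row (reg S) i)"
 by (simp add: row_def mod_row_def sum_of_def finsum_reg)

abbreviation part0 :: "(int \<times> int, 'a, 'm) graded_mod \<Rightarrow> 'm \<Rightarrow> 'm" where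
 "part0 M \<equiv> part M (mcomp M) {g. fst g = 0}"

locale bigraded_mod = gmod S M
 for S :: "('k, int \<times> int, 'a) graded_alg" and M :: "(int \<times> int, 'a, 'm) graded_mod" (structure)
begin

lemma row_carrier: "carrier (mod_row M i) = {x \<in> carrier M. \<forall>g. fst g \<noteq> i \<longrightarrow> hc g x = \<zero>}"
proof -
 have i: "inj (Pair i)" by (auto simp: inj_def)
 have r: "range (Pair i) = {g. fst g = i}" by (auto simp: image_iff)
 have "sum_of M (\<lambda>j. mcomp M (i, j)) = {x \<in> carrier M. \<forall>g. fst g \<noteq> i \<longrightarrow> hc g x = \<zero>}"
  using sum_of_components[OF i] unfolding r by (simp only: mem_Collect_eq)
 then show ?thesis by (simp add: mod_row_def)
qed

lemma row_subset: "carrier (mod_row M i) \<subseteq> carrier M"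
 by (auto simp: row_carrier)

lemma row_least:
 "additive_subgroup V M ==> (\<And>j. mcomp M (i, j) \<subseteq> V) ==> carrier (mod_row M i) \<subseteq> V"
 by (simp add: mod_row_def sum_of_subset[OF abelian_group_axioms])

lemma row_in: "x \<in> carrier (mod_row M i) ==> x \<in> carrier M"
 using row_subset by auto

lemma homog_row: "x \<in> mcomp M (i, j) ==> x \<in> carrier (mod_row M i)"
 by (auto simp: row_carrier hc_homog D_carrier)

lemma row_subgroup: "additive_subgroup (carrier (mod_row M i)) M"
 by (rule additive_subgroupI_closed[OF abelian_group_axioms]) (auto simp: row_carrier hc_add hc_minus)

lemma hc_row: "x \<in> carrier M ==> hc (i, j) x \<in> carrier (mod_row M i)"
 by (rule homog_row[OF hc_in])

lemma part0_row: "x \<in> carrier M ==> part0 M x \<in> carrier (mod_row M 0)"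
 by (auto simp: row_carrier hc_part)

lemma part0_eq: "x \<in> carrier (mod_row M 0) ==> part0 M x = x"
 by (rule part_eq_self) (auto simp: row_carrier)

lemma row_zero: "\<zero> \<in> carrier (mod_row M i)"
 by (simp add: row_carrier)

end

locale bigraded_ring = graded_ring S for S :: "('k, int \<times> int, 'a) graded_alg" (structure)

lemma (in bigraded_ring) row_least:
 "additive_subgroup V S ==> (\<And>j. acomp S (i, j) \<subseteq> V) ==> row S i \<subseteq> V"
 by (simp add: row_def sum_of_subset[OF is_abelian_group])

sublocale bigraded_ring \<subseteq> reg2: bigraded_mod S "reg S" ..

lemma (in bigraded_mod) row_act:
 assumes x: "x \<in> carrier (mod_row M i)" and s: "s \<in> row S k"
 shows "x \<bullet> s \<in> carrier (mod_row M (i + k))"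
proof -
 interpret B: bigraded_ring S ..
 have sc: "s \<in> carrier S" using s B.reg2.row_subset[of k] unfolding row_eq_mod_row by auto
 note A = additive_subgroupD[OF abelian_group_axioms row_subgroup[of "i + k"]]
 have hom: "y \<bullet> s \<in> carrier (mod_row M (i + k))" if y: "y \<in> mcomp M (i, j)" for y j
 proof -
  have yc: "y \<in> carrier M" using D_carrier[OF y] .
  have V: "additive_subgroup {s \<in> carrier S. y \<bullet> s \<in> carrier (mod_row M (i + k))} S"
   by (rule additive_subgroupI_closed[OF R.is_abelian_group])
     (use yc A in \<open>auto simp: act_add_right act_minus_right\<close>)
  have "y \<bullet> t \<in> carrier (mod_row M (i + k))" if "t \<in> acomp S (k, l)" for t l
   using act_homog[OF y that] homog_row[of "y \<bullet> t" "i + k" "j + l"] by simp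
  then show ?thesis using B.row_least[OF V, of k] s R.D_carrier by blast
 qed
 have "additive_subgroup {z \<in> carrier M. z \<bullet> s \<in> carrier (mod_row M (i + k))} M"
  by (rule additive_subgroupI_closed[OF abelian_group_axioms])
    (use sc A in \<open>auto simp: act_add_left act_minus_left\<close>)
 from row_least[OF this, of i] show ?thesis using x hom D_carrier by blast
qed

context bigraded_ring
begin

lemma row_char: "row S i = {x \<in> carrier S. \<forall>g. fst g \<noteq> i \<longrightarrow> hc g x = \<zero>}"
 unfolding row_eq_mod_row reg2.row_carrier by (simp add: hcomp_reg)

lemma row_mult: "x \<in> row S i ==> y \<in> row S k ==> x \<otimes> y \<in> row S (i + k)"
 using reg2.row_act[of x i y k] by (simp add: row_eq_mod_row)

lemma row_sub: "additive_subgroup (row S i) S"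
 by (rule additive_subgroupI_closed[OF is_abelian_group]) (auto simp: row_char hc_add hc_minus)

lemma rowc: "x \<in> row S i ==> x \<in> carrier S"
 by (simp add: row_char)

lemmas rowD = additive_subgroupD[OF is_abelian_group row_sub]

lemma one_row: "\<one> \<in> row S 0"
 using one_homog by (auto simp: row_char hc_homog zero_prod_def)

lemma homog_row_ring: "x \<in> acomp S (i, j) ==> x \<in> row S i"
 by (auto simp: row_char hc_homog D_carrier)

lemma deg0_neg:
 assumes "abelian_group (deg0_alg S)" "x \<in> row S 0" shows "\<ominus>\<^bsub>deg0_alg S\<^esub> x = \<ominus> x"
proof -
 interpret Q: abelian_group "deg0_alg S" by fact
 show ?thesis by (rule Q.minus_equality) (use assms(2) rowD(4) in \<open>auto simp: l_neg rowc\<close>)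
qed

lemma deg0_graded_ring: "graded_ring (deg0_alg S)"
proof -
 have c: "x \<in> row S 0 ==> x \<in> carrier S" for x using rowD(1) by auto
 have Q: "abelian_group (deg0_alg S)"
 proof (rule abelian_groupI)
  show "\<exists>y\<in>carrier (deg0_alg S). y \<oplus>\<^bsub>deg0_alg S\<^esub> x = \<zero>\<^bsub>deg0_alg S\<^esub>" if "x \<in> carrier (deg0_alg S)" for x
   using that c rowD(4) by (intro bexI[of _ "\<ominus> x"]) (auto simp: l_neg)
 qed (auto simp: c a_ac rowD)
 interpret Q: abelian_group "deg0_alg S" by (rule Q)
 have Rng: "ring (deg0_alg S)"
 proof (rule ringI[OF Q])
  show "Group.monoid (deg0_alg S)"
   by (rule monoidI) (use row_mult[of _ 0 _ 0] in \<open>auto simp: c m_assoc one_row\<close>)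
 qed (auto simp: c l_distr r_distr)
 have "direct_sum_decomp (deg0_alg S) (acomp (deg0_alg S))"
 proof (rule direct_sum_decompI_projections[OF Q, where p = "\<lambda>j. hc (0, j)"])
  show "additive_subgroup (acomp (deg0_alg S) g) (deg0_alg S)" for g
   by (rule additive_subgroupI_closed[OF Q])
     (auto simp: D_closed homog_row_ring deg0_neg[OF Q])
  show "finite {g. hc (0, g) x \<noteq> \<zero>\<^bsub>deg0_alg S\<^esub>}" if "x \<in> carrier (deg0_alg S)" for x
   by (rule finite_subset[OF _ finite_imageI[OF finite_support[of x], of snd]])
     (use that c in \<open>auto simp: image_iff\<close>)
  show "x = \<zero>\<^bsub>deg0_alg S\<^esub>" if x: "x \<in> carrier (deg0_alg S)" "\<And>g. hc (0, g) x = \<zero>\<^bsub>deg0_alg S\<^esub>" for x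
  proof -
   have "hc g x = hc g \<zero>" for g
    using x row_char[of 0] by (cases g; cases "fst g = 0") auto
   then show ?thesis using hc_ext[of x \<zero>] x c by simp
  qed
 qed (auto simp: c hc_in hc_add hc_homog)
 then show ?thesis
  using one_homog mult_homog[of _ "(0, _)" _ "(0, _)"]
  by (intro graded_ring.intro Rng graded_ring_axioms.intro) (auto simp: zero_prod_def)
qed

end

sublocale bigraded_ring \<subseteq> R0: graded_ring "deg0_alg S"
 by (rule deg0_graded_ring)

context bigraded_mod
begin

interpretation B: bigraded_ring S ..

lemma mod_row_graded_module: "graded_module (deg0_alg S) (mod_row M i)"
proof -
 have c: "x \<in> carrier (mod_row M i) ==> x \<in> carrier M" for x using row_subset by auto
 have sc: "s \<in> row S 0 ==> s \<in> carrier S" for s using B.rowD(1) by auto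
 note A = additive_subgroupD[OF abelian_group_axioms row_subgroup[of i]]
 have Q: "abelian_group (mod_row M i)"
 proof (rule abelian_groupI)
  show "\<exists>y\<in>carrier (mod_row M i). y \<oplus>\<^bsub>mod_row M i\<^esub> x = \<zero>\<^bsub>mod_row M i\<^esub>" if "x \<in> carrier (mod_row M i)" for x
   using that c A(4) by (intro bexI[of _ "\<ominus> x"]) (auto simp: l_neg)
 qed (auto simp: c a_ac A)
 interpret Q: abelian_group "mod_row M i" by (rule Q)
 have neg: "\<ominus>\<^bsub>mod_row M i\<^esub> x = \<ominus> x" if "x \<in> carrier (mod_row M i)" for x
  by (rule Q.minus_equality) (use that c A(4) in \<open>auto simp: l_neg\<close>)
 have dec: "direct_sum_decomp (mod_row M i) (mcomp (mod_row M i))"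
 proof (rule direct_sum_decompI_projections[OF Q, where p = "\<lambda>j. hc (i, j)"])
  show "additive_subgroup (mcomp (mod_row M i) g) (mod_row M i)" for g
   by (rule additive_subgroupI_closed[OF Q])
     (auto simp: D_closed homog_row neg)
  show "finite {g. hc (i, g) x \<noteq> \<zero>\<^bsub>mod_row M i\<^esub>}" if "x \<in> carrier (mod_row M i)" for x
   by (rule finite_subset[OF _ finite_imageI[OF finite_support[of x], of snd]])
     (use that c in \<open>auto simp: image_iff\<close>)
  show "x = \<zero>\<^bsub>mod_row M i\<^esub>" if x: "x \<in> carrier (mod_row M i)" "\<And>g. hc (i, g) x = \<zero>\<^bsub>mod_row M i\<^esub>" for x
  proof -
   have "hc g x = hc g \<zero>" for g
    using x row_carrier[of i] by (cases g; cases "fst g = i") auto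
   then show ?thesis using hc_ext[of x \<zero>] x c by simp
  qed
 qed (auto simp: c hc_in hc_add hc_homog)
 show ?thesis
  unfolding graded_module_def
  by (intro conjI Q dec ballI allI)
    (use row_act[of _ i _ 0] act_homog[of _ "(i, _)" _ "(0, _)"] in
     \<open>auto simp: c sc act_mult act_add_left act_add_right\<close>)
qed

lemma hcomp_mod_row: "x \<in> carrier (mod_row M i) ==> hcomp (mod_row M i) (mcomp (mod_row M i)) j x = hc (i, j) x"
proof -
 interpret Q: gmod "deg0_alg S" "mod_row M i" by (rule B.R0.gmodI[OF mod_row_graded_module])
 show "x \<in> carrier (mod_row M i) ==> ?thesis"
  by (rule Q.hc_eqI) (auto simp: row_in hc_add hc_homog)
qed

lemma row_gs:
 assumes "gs U" shows "graded_submodule (deg0_alg S) (mod_row M i) (U \<inter> carrier (mod_row M i))"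
proof -
 interpret Q: gmod "deg0_alg S" "mod_row M i" by (rule B.R0.gmodI[OF mod_row_graded_module])
 note A = additive_subgroupD[OF abelian_group_axioms row_subgroup[of i]]
 show ?thesis
 proof (rule Q.gsI)
  show "Q.hc g x \<in> U \<inter> carrier (mod_row M i)" if "x \<in> U \<inter> carrier (mod_row M i)" for x g
   using that gsD(8)[OF assms] hcomp_mod_row[of x i g] hc_row row_subset[of i] by auto
 qed (use gsD[OF assms] A row_act[of _ i _ 0] in \<open>auto simp: B.rowc\<close>)
qed

lemma part0_act:
 assumes z: "z \<in> carrier (mod_row M 0)" and t: "t \<in> carrier S"
 shows "part0 M (z \<bullet> t) = z \<bullet> part S (acomp S) {g. fst g = 0} t"
 using t
proof (induction t rule: R.homogeneous_induct)
 case zero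
 show ?case using row_in[OF z] by simp
next
 case (homog h t)
 obtain k l where h: "h = (k, l)" by (cases h)
 have tc: "t \<in> carrier S" and zc: "z \<in> carrier M" using R.D_carrier[OF homog] z row_subset by auto
 have zt: "z \<bullet> t \<in> carrier (mod_row M k)" using row_act[OF z, of t k] B.homog_row_ring homog h by simp
 show ?case
 proof (cases "k = 0")
  case True
  then show ?thesis using part0_eq zt R.part_homog[OF homog] h by simp
 next
  case False
  have "part0 M (z \<bullet> t) = \<zero>"
   by (rule hc_ext) (use zt False zc tc in \<open>auto simp: hc_part row_carrier\<close>)
  then show ?thesis using False R.part_homog[OF homog] h zc by simp
 qed
next
 case (add s t)
 have zc: "z \<in> carrier M" using z row_subset by auto
 show ?case using add zc by (simp add: act_add_right part_add R.part_add)
qed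

lemma part0_hc:
 assumes z: "z \<in> carrier M" and t: "t \<in> acomp S h"
 shows "part0 M (hc g z \<bullet> t) = (if fst (g + h) = 0 then hc (g + h) (part0 M (z \<bullet> t)) else \<zero>)"
proof -
 have tc: "t \<in> carrier S" using R.D_carrier[OF t] .
 have "hc g z \<bullet> t \<in> mcomp M (g + h)" by (rule act_homog[OF hc_in[OF z] t])
 then show ?thesis using z tc by (simp add: part_homog hc_part hc_act[OF z t])
qed

end

lemma (in bigraded_ring) row_hom:
 assumes M: "graded_module S M" and N: "graded_module S N" and f: "f \<in> graded_hom S M N"
 shows "restrict f (carrier (mod_row M i)) \<in> graded_hom (deg0_alg S) (mod_row M i) (mod_row N i)"
  "f ` carrier M = carrier N ==>
   restrict f (carrier (mod_row M i)) ` carrier (mod_row M i) = carrier (mod_row N i)"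
proof -
 interpret f: ghom S M N f by (rule ghomI[OF M N f])
 interpret BM: bigraded_mod S M by (intro bigraded_mod.intro gmodI M)
 interpret BN: bigraded_mod S N by (intro bigraded_mod.intro gmodI N)
 note G = additive_subgroupD[OF f.M.abelian_group_axioms BM.row_subgroup[of i]]
 have fr: "f x \<in> carrier (mod_row N i)" if "x \<in> carrier (mod_row M i)" for x
  using that unfolding BM.row_carrier BN.row_carrier
  by (auto simp: f.hom_closed f.hom_hc[symmetric] f.hom_zero)
 show "restrict f (carrier (mod_row M i)) \<in> graded_hom (deg0_alg S) (mod_row M i) (mod_row N i)"
 proof (rule graded_homI)
  show "restrict f (carrier (mod_row M i)) (x \<bullet>\<^bsub>mod_row M i\<^esub> s) =
    restrict f (carrier (mod_row M i)) x \<bullet>\<^bsub>mod_row N i\<^esub> s"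
   if x: "x \<in> carrier (mod_row M i)" and s: "s \<in> carrier (deg0_alg S)" for x s
  proof -
   have s0: "s \<in> row S 0" using s by simp
   show ?thesis using BM.row_act[OF x s0] x f.hom_act[OF BM.row_in[OF x] rowc[OF s0]] by simp
  qed
 qed (use fr G(3) BM.row_in f.hom_add f.hom_homog BM.homog_row in auto)
 show "restrict f (carrier (mod_row M i)) ` carrier (mod_row M i) = carrier (mod_row N i)"
  if s: "f ` carrier M = carrier N"
 proof
  show "carrier (mod_row N i) \<subseteq> restrict f (carrier (mod_row M i)) ` carrier (mod_row M i)"
  proof
   fix y assume y: "y \<in> carrier (mod_row N i)"
   have "y \<in> f ` carrier M" unfolding s by (rule BN.row_in[OF y])
   then obtain x where x: "x \<in> carrier M" "f x = y" by auto
   let ?x = "part M (mcomp M) {g. fst g = i} x"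
   have "f ?x = part N (mcomp N) {g. fst g = i} y" using f.hom_part[OF x(1)] x(2) by simp
   also have "\<dots> = y" by (rule f.N.part_eq_self) (use y in \<open>auto simp: BN.row_carrier\<close>)
   finally have "f ?x = y" .
   moreover have "?x \<in> carrier (mod_row M i)" using x(1) by (auto simp: BM.row_carrier f.M.hc_part)
   ultimately show "y \<in> restrict f (carrier (mod_row M i)) ` carrier (mod_row M i)" by (auto simp: image_iff)
  qed
 qed (use fr in auto)
qed

locale bigraded_setting = field K for K :: "'k ring" +
 fixes S :: "('k, int \<times> int, 'a) graded_alg" (structure)
 assumes alg: "graded_algebra K S"
  and dense: "densely_bigraded K S"
  and noetherian: "right_noetherian (deg0_alg S)"
  and left_fin_gen: "\<forall>i. fin_gen (row S 0) S (\<lambda>s x. s \<otimes> x) (row S i)"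
  and right_fin_gen: "\<forall>i. fin_gen (row S 0) S (\<lambda>s x. x \<otimes> s) (row S i)"

sublocale bigraded_setting \<subseteq> S: bigraded_ring S
 by (intro bigraded_ring.intro graded_algebra_ring[OF alg])

context bigraded_setting
begin

abbreviation "R0 \<equiv> deg0_alg S"

lemma deg0_algebra: "graded_algebra K R0"
proof -
 have c: "x \<in> row S 0 ==> x \<in> carrier S" for x using S.rowD(1) by auto
 interpret M: Module.module K S using alg by (simp add: graded_algebra_def)
 have closed: "k \<odot> x \<in> row S 0" if "k \<in> carrier K" "x \<in> row S 0" for k x
 proof -
  have "k \<odot> \<one> \<in> acomp S (0, 0)" using alg that S.one_homog unfolding graded_algebra_def zero_prod_def by blast
  then have "x \<otimes> (k \<odot> \<one>) \<in> row S 0" using S.row_mult[OF that(2) S.homog_row_ring] by simp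
  moreover have "k \<odot> x = x \<otimes> (k \<odot> \<one>)"
   using alg that c unfolding graded_algebra_def by (metis S.one_closed S.r_one)
  ultimately show ?thesis by simp
 qed
 have "Module.module K R0"
  by (rule moduleI)
    (use S.R0.is_abelian_group is_cring in \<open>auto simp: c closed M.smult_l_distr M.smult_r_distr M.smult_assoc1\<close>)
 moreover have "\<forall>c'\<in>carrier K. \<forall>x\<in>carrier R0. \<forall>y\<in>carrier R0.
    c' \<odot>\<^bsub>R0\<^esub> (x \<otimes>\<^bsub>R0\<^esub> y) = (c' \<odot>\<^bsub>R0\<^esub> x) \<otimes>\<^bsub>R0\<^esub> y \<and> c' \<odot>\<^bsub>R0\<^esub> (x \<otimes>\<^bsub>R0\<^esub> y) = x \<otimes>\<^bsub>R0\<^esub> (c' \<odot>\<^bsub>R0\<^esub> y)"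
  using alg c unfolding graded_algebra_def deg0_simps by blast
 moreover have "\<forall>g. \<forall>c\<in>carrier K. \<forall>x\<in>acomp R0 g. c \<odot>\<^bsub>R0\<^esub> x \<in> acomp R0 g"
  using alg unfolding graded_algebra_def by simp
 ultimately show ?thesis
  unfolding graded_algebra_def
  using S.R0.ring_axioms S.R0.decomp_ring S.R0.one_homog S.R0.mult_homog by blast
qed

lemma row_smult: "k \<in> carrier K ==> x \<in> row S 0 ==> k \<odot> x \<in> row S 0"
 using deg0_algebra unfolding graded_algebra_def module_def module_axioms_def by auto

lemma deg0_additive_subgroup:
 assumes "I \<subseteq> row S 0" shows "additive_subgroup I R0 \<longleftrightarrow> additive_subgroup I S"
proof
 assume "additive_subgroup I R0"
 note I = additive_subgroupD[OF S.R0.abelian_group_axioms this]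
 show "additive_subgroup I S"
  by (rule additive_subgroupI_closed[OF S.abelian_group_axioms])
    (use I assms S.rowD(1) S.deg0_neg[OF S.R0.abelian_group_axioms] in \<open>auto simp: subset_iff\<close>)
next
 assume "additive_subgroup I S"
 note I = additive_subgroupD[OF S.abelian_group_axioms this]
 show "additive_subgroup I R0"
  by (rule additive_subgroupI_closed[OF S.R0.abelian_group_axioms])
    (use I assms S.deg0_neg[OF S.R0.abelian_group_axioms] in \<open>auto simp: subset_iff\<close>)
qed

lemma deg0_noetherian:
 assumes I: "I \<subseteq> row S 0" "additive_subgroup I S" "\<And>x c. x \<in> I ==> c \<in> row S 0 ==> x \<otimes> c \<in> I"
 shows "\<exists>B. finite B \<and> B \<subseteq> I \<and>
  (\<forall>J. additive_subgroup J S \<longrightarrow> (\<forall>x\<in>J. \<forall>c\<in>row S 0. x \<otimes> c \<in> J) \<longrightarrow> B \<subseteq> J \<longrightarrow> I \<subseteq> J)"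
proof -
 have "fin_gen (carrier R0) R0 (\<lambda>r x. x \<otimes>\<^bsub>R0\<^esub> r) I"
  using noetherian I deg0_additive_subgroup[OF I(1)] unfolding right_noetherian_def by simp
 then obtain B where B: "finite B" "B \<subseteq> I" "I = span_by (row S 0) R0 (\<lambda>r x. x \<otimes> r) B"
  unfolding fin_gen_def by auto
 have "I \<subseteq> J" if J: "additive_subgroup J S" "\<forall>x\<in>J. \<forall>c\<in>row S 0. x \<otimes> c \<in> J" "B \<subseteq> J" for J
 proof -
  have "additive_subgroup (J \<inter> row S 0) S"
   by (rule additive_subgroupI_closed[OF S.abelian_group_axioms])
     (use additive_subgroupD[OF S.abelian_group_axioms J(1)] S.rowD in auto)
  then have "additive_subgroup (J \<inter> row S 0) R0" using deg0_additive_subgroup[of "J \<inter> row S 0"] by simp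
  then have "span_by (row S 0) R0 (\<lambda>r x. x \<otimes> r) B \<subseteq> J \<inter> row S 0"
   by (rule span_by_subset[OF S.R0.abelian_group_axioms])
     (use J B I(1) S.row_mult[of _ 0 _ 0] in auto)
  then show ?thesis using B by auto
 qed
 then show ?thesis using B by blast
qed

text \<open>For \<open>r\<close> of degree \<open>(i, j)\<close>, the set \<open>r S\<^sub>0\<close> lies in \<open>S\<^sub>i\<close>, which is finitely generated over \<open>S\<^sub>0\<close> from
  the left.\<close>

lemma coefficient_S: "coefficient_algebra K S (row S 0)"
proof unfold_locales
 show "graded_algebra K S" by (rule alg)
 show "\<exists>B. finite B \<and> B \<subseteq> I \<and>
  (\<forall>J. additive_subgroup J S \<longrightarrow> (\<forall>x\<in>J. \<forall>c\<in>row S 0. x \<otimes> c \<in> J) \<longrightarrow> B \<subseteq> J \<longrightarrow> I \<subseteq> J)"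
  if "I \<subseteq> row S 0" "additive_subgroup I S" "\<And>x c. x \<in> I ==> c \<in> row S 0 ==> x \<otimes> c \<in> I" for I
  by (rule deg0_noetherian[OF that])
 show "\<exists>B. finite B \<and> B \<subseteq> carrier S \<and>
   (\<forall>J. additive_subgroup J S \<longrightarrow> (\<forall>c\<in>row S 0. \<forall>b\<in>B. c \<otimes> b \<in> J) \<longrightarrow> (\<forall>c\<in>row S 0. r \<otimes> c \<in> J))"
  if r: "r \<in> acomp S h" for r h
 proof -
  obtain i j where h: "h = (i, j)" by (cases h)
  obtain B where B: "finite B" "B \<subseteq> row S i" "row S i = span_by (row S 0) S (\<lambda>s x. s \<otimes> x) B"
   using left_fin_gen unfolding fin_gen_def by blast
  have "r \<otimes> c \<in> J" if J: "additive_subgroup J S" "\<forall>c\<in>row S 0. \<forall>b\<in>B. c \<otimes> b \<in> J" and c: "c \<in> row S 0" for J c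
  proof -
   have "r \<otimes> c \<in> row S i" using S.row_mult[OF S.homog_row_ring c, of r i j] r h by simp
   moreover have "row S i \<subseteq> J" unfolding B(3) by (rule span_by_subset[OF S.abelian_group_axioms J(1)]) (use J(2) in auto)
   ultimately show ?thesis by auto
  qed
  then show ?thesis using B S.rowD(1) by (intro exI[of _ B]) blast
 qed
 show "S.hc g x \<in> row S 0" if x: "x \<in> row S 0" for x g
 proof (cases "fst g = 0")
  case True
  then have "S.hc g x \<in> acomp S (0, snd g)" using S.hc_in[OF S.rowc[OF x], of g] by (cases g) simp
  then show ?thesis by (rule S.homog_row_ring)
 next
  case False
  then have "S.hc g x = \<zero>" using x S.row_char by blast
  then show ?thesis using S.rowD(2) by simp
 qed
qed (use S.rowD S.one_row S.row_mult[of _ 0 _ 0] row_smult in auto)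

lemma coefficient_R0: "coefficient_algebra K R0 (row S 0)"
proof unfold_locales
 show "graded_algebra K R0" by (rule deg0_algebra)
 show "\<exists>B. finite B \<and> B \<subseteq> I \<and>
  (\<forall>J. additive_subgroup J R0 \<longrightarrow> (\<forall>x\<in>J. \<forall>c\<in>row S 0. x \<otimes>\<^bsub>R0\<^esub> c \<in> J) \<longrightarrow> B \<subseteq> J \<longrightarrow> I \<subseteq> J)"
  if I: "I \<subseteq> row S 0" "additive_subgroup I R0" "\<And>x c. x \<in> I ==> c \<in> row S 0 ==> x \<otimes>\<^bsub>R0\<^esub> c \<in> I" for I
 proof -
  have "\<exists>B. finite B \<and> B \<subseteq> I \<and>
   (\<forall>J. additive_subgroup J S \<longrightarrow> (\<forall>x\<in>J. \<forall>c\<in>row S 0. x \<otimes> c \<in> J) \<longrightarrow> B \<subseteq> J \<longrightarrow> I \<subseteq> J)"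
   by (rule deg0_noetherian) (use I deg0_additive_subgroup[OF I(1)] in auto)
  moreover have "additive_subgroup J S" if "additive_subgroup J R0" for J
   using that deg0_additive_subgroup[of J] additive_subgroupD(1)[OF S.R0.abelian_group_axioms that] by simp
  ultimately show ?thesis by (elim ex_forward) simp
 qed
 show "\<exists>B. finite B \<and> B \<subseteq> carrier R0 \<and>
   (\<forall>J. additive_subgroup J R0 \<longrightarrow> (\<forall>c\<in>row S 0. \<forall>b\<in>B. c \<otimes>\<^bsub>R0\<^esub> b \<in> J) \<longrightarrow> (\<forall>c\<in>row S 0. r \<otimes>\<^bsub>R0\<^esub> c \<in> J))"
  if r: "r \<in> acomp R0 h" for r h
 proof (rule exI[of _ "{\<one>}"], intro conjI allI impI ballI)
  fix J c assume J: "additive_subgroup J R0" "\<forall>c\<in>row S 0. \<forall>b\<in>{\<one>}. c \<otimes>\<^bsub>R0\<^esub> b \<in> J" and c: "c \<in> row S 0"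
  have "r \<otimes> c \<in> row S 0" using S.row_mult[OF S.homog_row_ring c, of r 0 h] r by simp
  then show "r \<otimes>\<^bsub>R0\<^esub> c \<in> J" using J(2) S.rowD(1) by force
 qed (use S.one_row in auto)
 show "hcomp R0 (acomp R0) g x \<in> row S 0" if "x \<in> row S 0" for x g
  using S.R0.hc_closed[of x g] that by simp
qed (use S.rowD S.one_row S.row_mult[of _ 0 _ 0] row_smult in auto)

end

sublocale bigraded_setting \<subseteq> CS: coefficient_algebra K S "row S 0"
 by (rule coefficient_S)

sublocale bigraded_setting \<subseteq> CR: coefficient_algebra K "deg0_alg S" "row S 0"
 by (rule coefficient_R0)

sublocale bigraded_setting \<subseteq> GS: gabriel S CS.cofinite_ideals
 by (rule CS.cofinite_gabriel)

sublocale bigraded_setting \<subseteq> GR: gabriel "deg0_alg S" CR.cofinite_ideals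
 by (rule CR.cofinite_gabriel)

context bigraded_setting
begin

section \<open>Torsion and rows\<close>

abbreviation "GG \<equiv> CS.cofinite_ideals"
abbreviation "G0 \<equiv> CR.cofinite_ideals"

lemma submod_deg0: "W \<subseteq> row S 0 ==> CR.V.submod W \<longleftrightarrow> CS.V.submod W"
 unfolding CR.V.submod_def CS.V.submod_def using S.rowD(1) by (auto simp: additive_subgroup_def subgroup_def)

lemma gen_deg0:
 assumes "B \<subseteq> row S 0" shows "CR.V.gen B = CS.V.gen B"
proof
 have B: "B \<subseteq> carrier S" using assms S.rowD(1) by blast
 have sub: "CS.V.gen B \<subseteq> row S 0" by (rule CS.V.gen_least[OF CS.C_submod assms])
 show "CR.V.gen B \<subseteq> CS.V.gen B"
  by (rule CR.V.gen_least) (use submod_deg0[OF sub] CS.V.submod_gen[OF B] CS.V.gen_superset in auto)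
 have s: "CR.V.submod (CR.V.gen B)" using CR.V.submod_gen[of B] assms by simp
 have "CR.V.gen B \<subseteq> row S 0" using CR.V.submodD(1)[OF s] by simp
 then show "CS.V.gen B \<subseteq> CR.V.gen B"
  using submod_deg0[of "CR.V.gen B"] s by (intro CS.V.gen_least CR.V.gen_superset) simp
qed

lemma fdm_deg0:
 assumes "J \<subseteq> row S 0"
 shows "CR.V.fdm J (row S 0) \<longleftrightarrow> CS.V.fdm J (row S 0)"
proof
 assume "CR.V.fdm J (row S 0)"
 then obtain B where B: "finite B" "B \<subseteq> carrier R0" "row S 0 \<subseteq> CR.V.gen (J \<union> B)"
  unfolding CR.V.fdm_def by (elim exE conjE)
 then have B0: "B \<subseteq> row S 0" unfolding deg0_simps by simp
 then have "J \<union> B \<subseteq> row S 0" using assms by (rule Un_least[rotated])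
 then have "row S 0 \<subseteq> CS.V.gen (J \<union> B)" using B(3) gen_deg0 by metis
 then show "CS.V.fdm J (row S 0)"
  unfolding CS.V.fdm_def using B(1) subset_trans[OF B0 S.rowD(1)] by (intro exI conjI)
next
 assume "CS.V.fdm J (row S 0)"
 then obtain B where B: "finite B" "B \<subseteq> row S 0" "row S 0 \<subseteq> CS.V.gen (J \<union> B)"
  by (rule CS.V.fdmE[OF _ CS.C_submod subset_trans[OF assms S.rowD(1)]])
 then have "J \<union> B \<subseteq> row S 0" using assms by (intro Un_least)
 then have "row S 0 \<subseteq> CR.V.gen (J \<union> B)" using B(3) gen_deg0 by metis
 moreover have "B \<subseteq> carrier R0" using B(2) unfolding deg0_simps .
 ultimately show "CR.V.fdm J (row S 0)" unfolding CR.V.fdm_def using B(1) by (intro exI conjI)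
qed

lemma bmodI: "graded_module S M ==> bigraded_mod S M"
 by (intro bigraded_mod.intro S.gmodI)

text \<open>For elements of \<open>M\<^sub>0\<close>, the topologies of \<open>S\<close> and \<open>S\<^sub>0\<close> agree.\<close>

lemma cl_row:
 assumes M: "graded_module S M" and U: "graded_submodule S M U"
 shows "cl G0 (mod_row M 0) (U \<inter> carrier (mod_row M 0)) = cl GG M U \<inter> carrier (mod_row M 0)"
proof -
 interpret M: gabriel_mod S GG M by (rule GS.gabriel_modI[OF M])
 interpret B: bigraded_mod S M by (rule bmodI[OF M])
 note gM0 = B.mod_row_graded_module[of 0]
 interpret M0: gabriel_mod R0 G0 "mod_row M 0" by (rule GR.gabriel_modI[OF gM0])
 note U0 = B.row_gs[OF U, of 0]
 have hom: "x \<in> cl G0 (mod_row M 0) (U \<inter> carrier (mod_row M 0)) \<longleftrightarrow> x \<in> cl GG M U" if x: "x \<in> mcomp M (0, j)" for x j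
 proof -
  have xr: "x \<in> carrier (mod_row M 0)" using B.homog_row[OF x] .
  have xc: "x \<in> carrier M" using B.row_in[OF xr] .
  let ?J = "{r \<in> carrier S. x \<bullet>\<^bsub>M\<^esub> r \<in> U}" and ?L = "{r \<in> carrier R0. x \<bullet>\<^bsub>mod_row M 0\<^esub> r \<in> U \<inter> carrier (mod_row M 0)}"
  have J: "graded_submodule S (reg S) ?J" by (rule M.gs_conductor[OF U x])
  have J0: "graded_submodule R0 (reg R0) ?L" by (rule M0.gs_conductor[OF U0]) (use x in simp)
  have eq: "?J \<inter> row S 0 = ?L \<inter> row S 0"
   using B.row_act[OF xr, of _ 0] S.rowc by auto
  have "?J \<in> GG \<longleftrightarrow> ?L \<in> G0"
   using J J0 fdm_deg0[of "?L \<inter> row S 0"] eq by (simp add: CS.cofinite_ideals_def CR.cofinite_ideals_def)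
  then show ?thesis
   using M.almost_iff_conductor[OF U x] M0.almost_iff_conductor[OF U0, of x j] x xr xc
   by (simp add: cl_def)
 qed
 show ?thesis
 proof (intro equalityI subsetI)
  fix x assume x: "x \<in> cl G0 (mod_row M 0) (U \<inter> carrier (mod_row M 0))"
  then have xr: "x \<in> carrier (mod_row M 0)" by (simp add: cl_def)
  have xc: "x \<in> carrier M" using B.row_in[OF xr] .
  have "M.hc g x \<in> cl GG M U" for g
  proof (cases "fst g = 0")
   case True
   then have g: "g = (0, snd g)" by (cases g) simp
   have "M.hc (0, snd g) x \<in> cl G0 (mod_row M 0) (U \<inter> carrier (mod_row M 0))"
    using M0.cl_hc[OF U0 x, of "snd g"] B.hcomp_mod_row[OF xr] by simp
   then show ?thesis using hom[OF M.hc_in[OF xc]] g by metis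
  next
   case False
   then have "M.hc g x = \<zero>\<^bsub>M\<^esub>" using xr unfolding B.row_carrier mem_Collect_eq by blast
   then show ?thesis using M.gsD(3)[OF M.gs_cl[OF U]] by simp
  qed
  then show "x \<in> cl GG M U \<inter> carrier (mod_row M 0)" using M.cl_of_hc[OF U xc] xr by simp
 next
  fix x assume x: "x \<in> cl GG M U \<inter> carrier (mod_row M 0)"
  then have xr: "x \<in> carrier (mod_row M 0)" by simp
  have xc: "x \<in> carrier M" using B.row_in[OF xr] .
  show "x \<in> cl G0 (mod_row M 0) (U \<inter> carrier (mod_row M 0))"
  proof (rule M0.cl_of_hc[OF U0 xr])
   fix j show "M0.hc j x \<in> cl G0 (mod_row M 0) (U \<inter> carrier (mod_row M 0))"
    unfolding B.hcomp_mod_row[OF xr] using hom[OF M.hc_in[OF xc]] M.cl_hc[OF U] x by auto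
  qed
 qed
qed

lemma tor_row: "graded_module S M ==> tor G0 (mod_row M 0) = tor GG M \<inter> carrier (mod_row M 0)"
proof -
 assume M: "graded_module S M"
 interpret B: bigraded_mod S M by (rule bmodI[OF M])
 have "{\<zero>\<^bsub>M\<^esub>} \<inter> carrier (mod_row M 0) = {\<zero>\<^bsub>M\<^esub>}" using B.row_zero by auto
 then show ?thesis using cl_row[OF M B.gs_zero] by simp
qed

text \<open>The right ideal generated by \<open>S\<^sub>n\<close> is open: it contains \<open>S\<^sub>n S\<^sub>-\<^sub>n\<close>, which has finite codimension
  in \<open>S\<^sub>0\<close> by density.\<close>

lemma ideal_containing_row:
 assumes J: "graded_submodule S (reg S) J" and sub: "row S n \<subseteq> J"
 shows "J \<in> GG"
proof -
 let ?W = "span_by (row S n) S (\<lambda>x y. x \<otimes> y) (row S (0 - n))"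
 note G = S.reg.gsD[OF J]
 obtain B where B: "finite B" "B \<subseteq> row S 0" "row S 0 = ?W <+>\<^bsub>S\<^esub> span_by (carrier K) S (\<lambda>c x. c \<odot> x) B"
  using spec[OF spec[OF dense[unfolded densely_bigraded_def], of 0], of n, unfolded fin_codim_def]
  by (elim exE conjE)
 have Bc: "B \<subseteq> carrier S" using B(2) S.rowD(1) by blast
 have JC: "CS.V.submod (J \<inter> row S 0)" by (rule CS.submod_Int[OF CS.ideal_submod[OF J] CS.C_submod])
 have "x \<otimes> y \<in> J \<inter> row S 0" if "x \<in> row S n" "y \<in> row S (0 - n)" for x y
  using G(7)[of x y] S.row_mult[OF that] that sub S.rowc by auto
 then have W: "?W \<subseteq> J \<inter> row S 0"
  by (rule span_by_subset[OF S.abelian_group_axioms CS.V.submod_additive_subgroup[OF JC]])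
 have "row S 0 \<subseteq> (J \<inter> row S 0) <+>\<^bsub>S\<^esub> CS.V.gen B"
  using B(3) CS.V.span_by_eq_gen[OF B(1) Bc] W unfolding set_add_def' by auto
 then have "row S 0 \<subseteq> CS.V.gen ((J \<inter> row S 0) \<union> B)" using CS.V.set_add_gen[OF JC Bc] by simp
 then show ?thesis using J B(1) Bc by (auto simp: CS.cofinite_ideals_def CS.V.fdm_def)
qed

text \<open>Hence an element is close to \<open>U\<close> as soon as the row \<open>0\<close> parts of all its multiples are.\<close>

lemma cl_if_part0:
 assumes M: "graded_module S M" and U: "graded_submodule S M U" and z: "z \<in> carrier M"
  and p: "\<And>t. t \<in> carrier S ==> part0 M (z \<bullet>\<^bsub>M\<^esub> t) \<in> cl GG M U"
 shows "z \<in> cl GG M U"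
proof -
 interpret M: gabriel_mod S GG M by (rule GS.gabriel_modI[OF M])
 interpret B: bigraded_mod S M by (rule bmodI[OF M])
 note C = M.gs_cl[OF U]
 show ?thesis
 proof (rule M.cl_of_hc[OF U z])
  fix g
  let ?J = "{r \<in> carrier S. M.hc g z \<bullet>\<^bsub>M\<^esub> r \<in> cl GG M U}"
  have J: "graded_submodule S (reg S) ?J" by (rule M.gs_conductor[OF C M.hc_in[OF z]])
  have hom: "t \<in> ?J" if t: "t \<in> acomp S h" "fst (g + h) = 0" for t h
  proof -
   have tc: "t \<in> carrier S" using S.D_carrier[OF t(1)] .
   have "M.hc g z \<bullet>\<^bsub>M\<^esub> t \<in> carrier (mod_row M 0)"
    using M.act_homog[OF M.hc_in[OF z] t(1), of g] t(2) B.homog_row by (metis prod.collapse)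
   then have "M.hc g z \<bullet>\<^bsub>M\<^esub> t = M.hc (g + h) (part0 M (z \<bullet>\<^bsub>M\<^esub> t))"
    using B.part0_hc[OF z t(1), of g] B.part0_eq t(2) by simp
   then show ?thesis using M.cl_hc[OF U p[OF tc]] tc by simp
  qed
  have "row S (- fst g) \<subseteq> ?J"
  proof
   fix t assume t: "t \<in> row S (- fst g)"
   have tc: "t \<in> carrier S" using S.rowc[OF t] .
   show "t \<in> ?J"
   proof (rule S.mem_of_hc[OF tc])
    show "additive_subgroup ?J S" by (rule CS.V.submod_additive_subgroup[OF CS.ideal_submod[OF J]])
    show "S.hc h t \<in> ?J" for h
    proof (cases "fst h = - fst g")
     case True
     then show ?thesis using hom[OF S.hc_in[OF tc]] by simp
    next
     case False
     then have "S.hc h t = \<zero>" using t unfolding S.row_char mem_Collect_eq by blast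
     then show ?thesis using S.reg.gsD(3)[OF J] by simp
    qed
   qed
  qed
  then have "?J \<in> GG" by (rule ideal_containing_row[OF J])
  then have "almost GG (\<lambda>s. M.hc g z \<bullet>\<^bsub>M\<^esub> s \<in> cl GG M U)" unfolding almost_def by (rule bexI[rotated]) simp
  then show "M.hc g z \<in> cl GG M U" by (rule M.almost_cl[OF U M.hc_closed[OF z]])
 qed
qed

text \<open>The largest graded \<open>S\<close>-submodule with prescribed row \<open>0\<close>.\<close>

definition extend :: "(int \<times> int, 'a, 'n) graded_mod \<Rightarrow> 'n set \<Rightarrow> 'n set" where
 "extend M U = {z \<in> carrier M. \<forall>t\<in>carrier S. part0 M (z \<bullet>\<^bsub>M\<^esub> t) \<in> U}"

lemma extend_gs:
 assumes M: "graded_module S M" and U: "graded_submodule R0 (mod_row M 0) U"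
 shows "graded_submodule S M (extend M U)" "extend M U \<inter> carrier (mod_row M 0) = U"
proof -
 interpret B: bigraded_mod S M by (rule bmodI[OF M])
 interpret M0: gmod R0 "mod_row M 0" by (rule S.R0.gmodI[OF B.mod_row_graded_module])
 note G = M0.gsD[OF U, simplified]
 have Uc: "x \<in> carrier M" if "x \<in> U" for x using G(9)[OF that] B.row_in by auto
 have add: "additive_subgroup U M"
  by (rule additive_subgroupI_closed[OF B.abelian_group_axioms])
    (use G(3,4,7) Uc B.act_minus_right[of _ "\<one>"] S.rowD(4)[OF S.one_row] in \<open>auto, metis B.act_one S.one_closed\<close>)
 show "B.gs (extend M U)"
 proof (rule B.gsI)
  show "extend M U \<subseteq> carrier M" by (auto simp: extend_def)
  show "\<zero>\<^bsub>M\<^esub> \<in> extend M U" using G(3) by (simp add: extend_def)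
  show "x \<oplus>\<^bsub>M\<^esub> y \<in> extend M U" if "x \<in> extend M U" "y \<in> extend M U" for x y
   using that G(4) by (simp add: extend_def B.act_add_left B.part_add)
  show "x \<bullet>\<^bsub>M\<^esub> r \<in> extend M U" if "x \<in> extend M U" "r \<in> carrier S" for x r
   using that by (simp add: extend_def B.act_mult[symmetric])
  show "B.hc g z \<in> extend M U" if z: "z \<in> extend M U" for z g
  proof -
   have zc: "z \<in> carrier M" using z by (simp add: extend_def)
   have "part0 M (B.hc g z \<bullet>\<^bsub>M\<^esub> t) \<in> U" if t: "t \<in> carrier S" for t
    using t
   proof (induction t rule: S.homogeneous_induct)
    case zero
    then show ?case using zc G(3) by simp
   next
    case (homog h t)
    have tc: "t \<in> carrier S" using S.D_carrier[OF homog] .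
    have p: "part0 M (z \<bullet>\<^bsub>M\<^esub> t) \<in> U" using z tc by (simp add: extend_def)
    show ?case
    proof (cases "fst (g + h) = 0")
     case True
     then have "g + h = (0, snd (g + h))" by (metis prod.collapse)
     then have "B.hc (g + h) (part0 M (z \<bullet>\<^bsub>M\<^esub> t)) \<in> U"
      using G(8)[OF p, of "snd (g + h)"] B.hcomp_mod_row[OF B.part0_row, of "z \<bullet>\<^bsub>M\<^esub> t"] zc tc by simp
     then show ?thesis using B.part0_hc[OF zc homog, of g] True by simp
    next
     case False
     then show ?thesis using B.part0_hc[OF zc homog, of g] G(3) by simp
    qed
   next
    case (add s t)
    then show ?case using zc G(4) by (simp add: B.act_add_right B.part_add)
   qed
   then show ?thesis using zc by (simp add: extend_def)
  qed
 qed
 show "extend M U \<inter> carrier (mod_row M 0) = U"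
 proof (intro equalityI subsetI)
  fix z assume z: "z \<in> extend M U \<inter> carrier (mod_row M 0)"
  then have "part0 M (z \<bullet>\<^bsub>M\<^esub> \<one>) \<in> U" unfolding extend_def using S.one_closed by blast
  then show "z \<in> U" using z B.part0_eq[of z] B.act_one[OF B.row_in, of z 0] by simp
 next
  fix z assume z: "z \<in> U"
  then have zr: "z \<in> carrier (mod_row M 0)" using G(9) by simp
  have "part0 M (z \<bullet>\<^bsub>M\<^esub> t) \<in> U" if t: "t \<in> carrier S" for t
  proof -
   have "part S (acomp S) {g. fst g = 0} t \<in> row S 0" using t by (auto simp: S.row_char S.hc_part)
   then show ?thesis using B.part0_act[OF zr t] G(7)[OF z] by simp
  qed
  then show "z \<in> extend M U \<inter> carrier (mod_row M 0)" using zr B.row_in by (simp add: extend_def)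
 qed
qed

lemma extend_closed:
 assumes M: "graded_module S M" and U: "graded_submodule R0 (mod_row M 0) U"
  and s: "cl G0 (mod_row M 0) U \<subseteq> U"
 shows "cl GG M (extend M U) \<subseteq> extend M U"
proof
 interpret M: gabriel_mod S GG M by (rule GS.gabriel_modI[OF M])
 interpret B: bigraded_mod S M by (rule bmodI[OF M])
 note E = extend_gs[OF M U]
 fix z assume z: "z \<in> cl GG M (extend M U)"
 have "part0 M (z \<bullet>\<^bsub>M\<^esub> t) \<in> U" if t: "t \<in> carrier S" for t
 proof -
  have "part0 M (z \<bullet>\<^bsub>M\<^esub> t) \<in> cl GG M (extend M U)" by (rule M.cl_part[OF E(1) M.cl_act[OF E(1) z t]])
  moreover have "part0 M (z \<bullet>\<^bsub>M\<^esub> t) \<in> carrier (mod_row M 0)"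
   using B.part0_row[of "z \<bullet>\<^bsub>M\<^esub> t"] z t by (simp add: cl_def)
  ultimately show ?thesis using cl_row[OF M E(1)] E(2) s by auto
 qed
 then show "z \<in> extend M U" using z by (simp add: cl_def extend_def)
qed

lemma mod_row_dsum:
 assumes M: "graded_module S M" and N: "graded_module S N"
 shows "mod_row (dsum M N) i = dsum (mod_row M i) (mod_row N i)"
proof -
 interpret gmod2 S M N by (intro gmod2.intro S.gmodI assms)
 interpret BM: bigraded_mod S M by (rule bmodI[OF M])
 interpret BN: bigraded_mod S N by (rule bmodI[OF N])
 interpret BP: bigraded_mod S "dsum M N" by (rule bmodI[OF dsum_graded_module])
 have "carrier (mod_row (dsum M N) i) = carrier (mod_row M i) \<times> carrier (mod_row N i)"
  unfolding BM.row_carrier BN.row_carrier BP.row_carrier using hc_dsum by auto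
 moreover have "monoid.mult (mod_row (dsum M N) i) = undefined" "one (mod_row (dsum M N) i) = undefined"
  by (simp_all add: mod_row_def dsum_def)
 ultimately show ?thesis
  by (intro graded_mod.equality) (auto simp: dsum_def mod_row_def[of "dsum M N", unfolded dsum_def])
qed

lemma part0_dsum:
 assumes M: "graded_module S M" and N: "graded_module S N" and "x \<in> carrier M" "y \<in> carrier N"
 shows "part0 (dsum M N) (x, y) = (part0 M x, part0 N y)"
proof -
 interpret gmod2 S M N by (intro gmod2.intro S.gmodI M N)
 have c: "(x, y) \<in> carrier (dsum M N)" using assms by simp
 show ?thesis
 proof (rule P.hc_ext)
  show "P.hc g (part0 (dsum M N) (x, y)) = P.hc g (part0 M x, part0 N y)" for g
   using P.hc_part[OF c, of g "{g. fst g = 0}"] hc_dsum[OF c, of g] hc_dsum[of "(part0 M x, part0 N y)" g]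
    M.hc_part[OF assms(3), of g "{g. fst g = 0}"] N.hc_part[OF assms(4), of g "{g. fst g = 0}"] assms(3,4)
   by simp
 qed (use c P.part_closed[OF c] in auto)
qed

section \<open>Correspondences and rows\<close>

definition row_rel :: "(int \<times> int, 'a, 'n) graded_mod \<Rightarrow> (int \<times> int, 'a, 'p) graded_mod \<Rightarrow>
  ('n \<times> 'p) set \<Rightarrow> ('n \<times> 'p) set" where
 "row_rel M N \<Gamma> = \<Gamma> \<inter> (carrier (mod_row M 0) \<times> carrier (mod_row N 0))"

text \<open>With \<open>(x, y)\<close> a graded submodule contains the pair of the row \<open>0\<close> parts of \<open>x\<close> and \<open>y\<close>. Hence the row
  of a correspondence is defined wherever the correspondence is defined in row \<open>0\<close>.\<close>

lemma sat_row_rel: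
 assumes M: "graded_module S M" and N: "graded_module S N" and \<Gamma>: "\<Gamma> \<in> sat S GG M N"
 shows "row_rel M N \<Gamma> \<in> sat R0 G0 (mod_row M 0) (mod_row N 0)"
proof -
 interpret gabriel_mod2 S GG M N by (rule GS.gabriel_mod2I[OF M N])
 interpret BM: bigraded_mod S M by (rule bmodI[OF M])
 interpret BN: bigraded_mod S N by (rule bmodI[OF N])
 interpret BP: bigraded_mod S "dsum M N" by (rule bmodI[OF dsum_graded_module])
 note s = GS.satD[OF M N \<Gamma>] and r = GS.relD[OF M N GS.satD(2)[OF M N \<Gamma>]]
 note rd = mod_row_dsum[OF M N, of 0]
 have eq: "row_rel M N \<Gamma> = \<Gamma> \<inter> carrier (mod_row (dsum M N) 0)" by (simp add: row_rel_def rd)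
 show ?thesis
 proof (rule GR.satI[OF BM.mod_row_graded_module BN.mod_row_graded_module])
  show "graded_submodule R0 (dsum (mod_row M 0) (mod_row N 0)) (row_rel M N \<Gamma>)"
   using BP.row_gs[OF s(2), of 0] by (simp add: eq rd)
  show "x \<in> cl G0 (mod_row M 0) (Domain (row_rel M N \<Gamma>))" if x: "x \<in> carrier (mod_row M 0)" for x
  proof -
   have "Domain \<Gamma> \<inter> carrier (mod_row M 0) \<subseteq> Domain (row_rel M N \<Gamma>)"
   proof
    fix u assume "u \<in> Domain \<Gamma> \<inter> carrier (mod_row M 0)"
    then obtain y where y: "(u, y) \<in> \<Gamma>" "u \<in> carrier (mod_row M 0)" by auto
    have "part0 (dsum M N) (u, y) \<in> \<Gamma>" by (rule P.gs_part[OF s(2) y(1)])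
    moreover have "part0 (dsum M N) (u, y) = (u, part0 N y)"
     using part0_dsum[OF M N r(1,2)[OF y(1)]] BM.part0_eq[OF y(2)] by simp
    ultimately show "u \<in> Domain (row_rel M N \<Gamma>)"
     using y(2) BN.part0_row[OF r(2)[OF y(1)]] by (auto simp: row_rel_def)
   qed
   moreover have "x \<in> cl G0 (mod_row M 0) (Domain \<Gamma> \<inter> carrier (mod_row M 0))"
    using cl_row[OF M r(8)] x BM.row_in[OF x] s(1) by (auto simp: corr_def)
   ultimately show ?thesis
    using gabriel_mod.cl_mono[OF GR.gabriel_modI[OF BM.mod_row_graded_module]] by blast
  qed
  show "y \<in> tor G0 (mod_row N 0)" if "(\<zero>\<^bsub>mod_row M 0\<^esub>, y) \<in> row_rel M N \<Gamma>" for y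
   using that GS.corrD(3)[OF M N s(1), of y] tor_row[OF N] by (auto simp: row_rel_def)
  fix x y assume *: "x \<in> carrier (mod_row M 0)" "y \<in> carrier (mod_row N 0)"
   "almost G0 (\<lambda>s. (x \<bullet>\<^bsub>mod_row M 0\<^esub> s, y \<bullet>\<^bsub>mod_row N 0\<^esub> s) \<in> row_rel M N \<Gamma>)"
  then have "(x, y) \<in> cl G0 (mod_row (dsum M N) 0) (\<Gamma> \<inter> carrier (mod_row (dsum M N) 0))"
   by (simp add: cl_def rd eq[symmetric] del: eq) (simp add: row_rel_def)
  then have "(x, y) \<in> cl GG (dsum M N) \<Gamma>" using cl_row[OF dsum_graded_module s(2)] by simp
  then show "(x, y) \<in> row_rel M N \<Gamma>" using \<Gamma> * by (auto simp: sat_def row_rel_def)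
 qed
qed

text \<open>A correspondence between rows \<open>0\<close> extends uniquely: closed correspondences of \<open>S\<close>-modules are
  recovered from the row \<open>0\<close> parts of multiples of their elements.\<close>

lemma row_rel_bij:
 assumes M: "graded_module S M" and N: "graded_module S N"
 shows "bij_betw (row_rel M N) (sat S GG M N) (sat R0 G0 (mod_row M 0) (mod_row N 0))"
proof -
 interpret gabriel_mod2 S GG M N by (rule GS.gabriel_mod2I[OF M N])
 interpret BM: bigraded_mod S M by (rule bmodI[OF M])
 interpret BN: bigraded_mod S N by (rule bmodI[OF N])
 interpret BP: bigraded_mod S "dsum M N" by (rule bmodI[OF dsum_graded_module])
 note gM0 = BM.mod_row_graded_module[of 0] and gN0 = BN.mod_row_graded_module[of 0]
 note rd = mod_row_dsum[OF M N, of 0]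
 have eq: "row_rel M N \<Gamma> = \<Gamma> \<inter> carrier (mod_row (dsum M N) 0)" for \<Gamma> by (simp add: row_rel_def rd)
 have ext: "extend (dsum M N) \<Delta> \<in> sat S GG M N \<and> row_rel M N (extend (dsum M N) \<Delta>) = \<Delta>"
  if \<Delta>: "\<Delta> \<in> sat R0 G0 (mod_row M 0) (mod_row N 0)" for \<Delta>
 proof -
  note d = GR.satD[OF gM0 gN0 \<Delta>]
  have gd: "graded_submodule R0 (mod_row (dsum M N) 0) \<Delta>" using d(2) by (simp add: rd)
  note E = extend_gs[OF dsum_graded_module gd]
  let ?E = "extend (dsum M N) \<Delta>"
  have r: "row_rel M N ?E = \<Delta>" using E(2) by (simp add: eq)
  have cE: "cl GG (dsum M N) ?E \<subseteq> ?E"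
   by (rule extend_closed[OF dsum_graded_module gd]) (use \<Delta> in \<open>simp add: sat_def rd\<close>)
  note rE = GS.relD[OF M N E(1)]
  have dom: "x \<in> cl GG M (Domain ?E)" if x: "x \<in> carrier M" for x
  proof (rule cl_if_part0[OF M rE(8) x])
   fix t assume t: "t \<in> carrier S"
   have p: "part0 M (x \<bullet>\<^bsub>M\<^esub> t) \<in> carrier (mod_row M 0)" using BM.part0_row x t by simp
   have "Domain \<Delta> \<subseteq> Domain ?E \<inter> carrier (mod_row M 0)" using r by (auto simp: row_rel_def)
   moreover have "part0 M (x \<bullet>\<^bsub>M\<^esub> t) \<in> cl G0 (mod_row M 0) (Domain \<Delta>)" using d(1) p by (auto simp: corr_def)
   ultimately have "part0 M (x \<bullet>\<^bsub>M\<^esub> t) \<in> cl G0 (mod_row M 0) (Domain ?E \<inter> carrier (mod_row M 0))"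
    by (auto simp: cl_def elim!: GR.almost_elim)
   then show "part0 M (x \<bullet>\<^bsub>M\<^esub> t) \<in> cl GG M (Domain ?E)" using cl_row[OF M rE(8)] by simp
  qed
  have zero: "y \<in> tor GG N" if y: "(\<zero>\<^bsub>M\<^esub>, y) \<in> ?E" for y
  proof (rule cl_if_part0[OF N N.gs_zero rE(2)[OF y]])
   fix t assume t: "t \<in> carrier S"
   have yc: "y \<in> carrier N" using rE(2)[OF y] .
   have "(\<zero>\<^bsub>M\<^esub>, y) \<bullet>\<^bsub>dsum M N\<^esub> t \<in> ?E" by (rule P.gsD(7)[OF E(1) y t])
   then have "part0 (dsum M N) (\<zero>\<^bsub>M\<^esub>, y \<bullet>\<^bsub>N\<^esub> t) \<in> ?E" using P.gs_part[OF E(1)] t by simp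
   moreover have "part0 (dsum M N) (\<zero>\<^bsub>M\<^esub>, y \<bullet>\<^bsub>N\<^esub> t) = (\<zero>\<^bsub>M\<^esub>, part0 N (y \<bullet>\<^bsub>N\<^esub> t))"
    using part0_dsum[OF M N] yc t by simp
   ultimately have "(\<zero>\<^bsub>M\<^esub>, part0 N (y \<bullet>\<^bsub>N\<^esub> t)) \<in> \<Delta>"
    using r BN.part0_row[of "y \<bullet>\<^bsub>N\<^esub> t"] yc t BM.row_zero by (auto simp: row_rel_def)
   then have "part0 N (y \<bullet>\<^bsub>N\<^esub> t) \<in> tor G0 (mod_row N 0)" using GR.corrD(3)[OF gM0 gN0 d(1)] by simp
   then show "part0 N (y \<bullet>\<^bsub>N\<^esub> t) \<in> tor GG N" using tor_row[OF N] by simp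
  qed
  have "corr S GG M N ?E" by (rule GS.corrI[OF M N E(1) dom zero])
  then show ?thesis using cE r by (simp add: sat_def)
 qed
 have sub: "\<Gamma> \<subseteq> extend (dsum M N) (row_rel M N \<Gamma>)" if \<Gamma>: "\<Gamma> \<in> sat S GG M N" for \<Gamma>
 proof
  fix p assume p: "p \<in> \<Gamma>"
  note s = GS.satD(2)[OF M N \<Gamma>]
  have pc: "p \<in> carrier (dsum M N)" using P.gsD(9)[OF s p] .
  have "part0 (dsum M N) (p \<bullet>\<^bsub>dsum M N\<^esub> t) \<in> row_rel M N \<Gamma>" if t: "t \<in> carrier S" for t
   unfolding eq using P.gs_part[OF s P.gsD(7)[OF s p t]] BP.part0_row[OF P.act_closed[OF pc t]] by blast
  then show "p \<in> extend (dsum M N) (row_rel M N \<Gamma>)" unfolding extend_def using pc by blast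
 qed
 show ?thesis
  unfolding bij_betw_def
 proof
  show "inj_on (row_rel M N) (sat S GG M N)"
  proof (rule inj_onI)
   fix \<Gamma> \<Gamma>' assume *: "\<Gamma> \<in> sat S GG M N" "\<Gamma>' \<in> sat S GG M N" "row_rel M N \<Gamma> = row_rel M N \<Gamma>'"
   have "\<Gamma> = extend (dsum M N) (row_rel M N \<Gamma>)"
    by (rule GS.sat_eqI[OF M N *(1) _ sub[OF *(1)]]) (use ext[OF sat_row_rel[OF M N *(1)]] in simp)
   moreover have "\<Gamma>' = extend (dsum M N) (row_rel M N \<Gamma>')"
    by (rule GS.sat_eqI[OF M N *(2) _ sub[OF *(2)]]) (use ext[OF sat_row_rel[OF M N *(2)]] in simp)
   ultimately show "\<Gamma> = \<Gamma>'" using *(3) by simp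
  qed
  show "row_rel M N ` sat S GG M N = sat R0 G0 (mod_row M 0) (mod_row N 0)"
  proof (intro equalityI subsetI)
   fix \<Delta> assume "\<Delta> \<in> row_rel M N ` sat S GG M N"
   then show "\<Delta> \<in> sat R0 G0 (mod_row M 0) (mod_row N 0)" using sat_row_rel[OF M N] by auto
  next
   fix \<Delta> assume "\<Delta> \<in> sat R0 G0 (mod_row M 0) (mod_row N 0)"
   from ext[OF this] show "\<Delta> \<in> row_rel M N ` sat S GG M N" by (metis imageI)
  qed
 qed
qed

lemma row_rel_hom:
 assumes M: "graded_module S M" and N: "graded_module S N" and f: "f \<in> graded_hom S M N"
 shows "mor_row0 M N f \<in> graded_hom R0 (mod_row M 0) (mod_row N 0)"
  "row_rel M N (sat_of_hom GG M N f) = sat_of_hom G0 (mod_row M 0) (mod_row N 0) (mor_row0 M N f)"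
proof -
 interpret BM: bigraded_mod S M by (rule bmodI[OF M])
 interpret BN: bigraded_mod S N by (rule bmodI[OF N])
 note gM0 = BM.mod_row_graded_module[of 0] and gN0 = BN.mod_row_graded_module[of 0]
 show h: "mor_row0 M N f \<in> graded_hom R0 (mod_row M 0) (mod_row N 0)"
  unfolding mor_row0_def by (rule S.row_hom(1)[OF M N f])
 have fr: "f x \<in> carrier (mod_row N 0)" if "x \<in> carrier (mod_row M 0)" for x
  using graded_homD(1)[OF h that] that by (simp add: mor_row0_def)
 note s = sat_row_rel[OF M N GS.sat_of_hom[OF M N f]]
 have "sat_of_hom G0 (mod_row M 0) (mod_row N 0) (mor_row0 M N f) \<subseteq> row_rel M N (sat_of_hom GG M N f)"
 proof (intro subrelI)
  fix x y assume "(x, y) \<in> sat_of_hom G0 (mod_row M 0) (mod_row N 0) (mor_row0 M N f)"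
  then have *: "x \<in> carrier (mod_row M 0)" "y \<in> carrier (mod_row N 0)" "y \<ominus>\<^bsub>mod_row N 0\<^esub> f x \<in> tor G0 (mod_row N 0)"
   by (auto simp: sat_of_hom_def mor_row0_def)
  have "(x, f x) \<in> row_rel M N (sat_of_hom GG M N f)"
   using GS.hom_mem_sat[OF M N f BM.row_in[OF *(1)]] fr[OF *(1)] *(1) by (simp add: row_rel_def)
  from GR.satD(5)[OF gM0 gN0 s this *(2,3)] show "(x, y) \<in> row_rel M N (sat_of_hom GG M N f)" .
 qed
 then show "row_rel M N (sat_of_hom GG M N f) = sat_of_hom G0 (mod_row M 0) (mod_row N 0) (mor_row0 M N f)"
  using GR.sat_eqI[OF gM0 gN0 GR.sat_of_hom[OF gM0 gN0 h] s] by simp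
qed

text \<open>The bijection between closed correspondences respects composition: the composite of two rows is
  contained in the row of the composite, and inclusion implies equality after closure.\<close>

theorem row_induces_equivalence:
 fixes A :: "(int \<times> int, 'a, 'm) graded_mod set"
 assumes TA: "torsion_class S GG A T" and TB: "torsion_class R0 G0 B T0"
  and AB: "\<And>M. M \<in> A ==> mod_row M 0 \<in> B"
  and eso: "\<And>N. N \<in> B ==> \<exists>M\<in>A. \<exists>\<theta>. is_iso (mod_cat R0 B) (mod_row M 0) N \<theta>"
 shows "induces_abelian_equivalence (mod_cat S A) (mod_cat R0 B) (\<lambda>M. mod_row M 0) mor_row0
  (quot_cat S A T) (quot_functor S A T) (quot_cat R0 B T0) (quot_functor R0 B T0)"
proof -
 interpret TA: torsion_class S GG A T by (rule TA)
 interpret TB: torsion_class R0 G0 B T0 by (rule TB)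
 interpret EA: cat_iso "quot_cat S A T" "sat_cat S GG A" TA.class_rel by (rule TA.quot_cat_iso)
 interpret EB: cat_iso "quot_cat R0 B T0" "sat_cat R0 G0 B" TB.class_rel by (rule TB.quot_cat_iso)
 let ?QA = "quot_cat S A T" and ?QB = "quot_cat R0 B T0"
 let ?z = "\<lambda>M :: (int \<times> int, 'a, 'm) graded_mod. mod_row M 0"
 have ObA: "Ob ?QA = A" "Ob (mod_cat S A) = A" and ObB: "Ob ?QB = B" "Ob (mod_cat R0 B) = B"
  by (auto simp: quot_cat_def mod_cat_def)
 define \<Phi> where "\<Phi> V Y \<phi> = inv_into (Mor ?QB (?z V) (?z Y)) (TB.class_rel (?z V) (?z Y))
   (row_rel V Y (TA.class_rel V Y \<phi>))" for V Y \<phi>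
 have bij: "bij_betw (\<Phi> V Y) (Mor ?QA V Y) (Mor ?QB (?z V) (?z Y))" if "V \<in> A" "Y \<in> A" for V Y
 proof -
  have "bij_betw (inv_into (Mor ?QB (?z V) (?z Y)) (TB.class_rel (?z V) (?z Y)) \<circ> (row_rel V Y \<circ> TA.class_rel V Y))
    (Mor ?QA V Y) (Mor ?QB (?z V) (?z Y))"
   by (rule bij_betw_trans[OF bij_betw_trans[OF TA.class_rel_bij[OF that] row_rel_bij[OF TA.A_gm TA.A_gm]]
      bij_betw_inv_into[OF TB.class_rel_bij[OF AB AB]]]) (use that in auto)
  moreover have "inv_into (Mor ?QB (?z V) (?z Y)) (TB.class_rel (?z V) (?z Y)) \<circ> (row_rel V Y \<circ> TA.class_rel V Y) = \<Phi> V Y"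
   by (simp add: \<Phi>_def fun_eq_iff)
  ultimately show ?thesis by simp
 qed
 have E\<Phi>: "TB.class_rel (?z V) (?z Y) (\<Phi> V Y \<phi>) = row_rel V Y (TA.class_rel V Y \<phi>)"
  if o: "V \<in> A" "Y \<in> A" and \<phi>: "\<phi> \<in> Mor ?QA V Y" for V Y \<phi>
 proof -
  have "TA.class_rel V Y \<phi> \<in> sat S GG V Y" using bij_betwE[OF TA.class_rel_bij[OF o]] \<phi> by blast
  then have "row_rel V Y (TA.class_rel V Y \<phi>) \<in> sat R0 G0 (?z V) (?z Y)"
   by (rule sat_row_rel[OF TA.A_gm[OF o(1)] TA.A_gm[OF o(2)]])
  then show ?thesis unfolding \<Phi>_def
   using bij_betw_inv_into_right[OF TB.class_rel_bij[OF AB[OF o(1)] AB[OF o(2)]]] by blast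
 qed
 have \<Phi>M: "\<Phi> V Y \<phi> \<in> Mor ?QB (?z V) (?z Y)" if "V \<in> A" "Y \<in> A" "\<phi> \<in> Mor ?QA V Y" for V Y \<phi>
  using bij_betwE[OF bij[OF that(1,2)]] that(3) by blast
 have inj: "\<psi> = \<psi>'" if "V \<in> B" "Y \<in> B" "\<psi> \<in> Mor ?QB V Y" "\<psi>' \<in> Mor ?QB V Y"
  "TB.class_rel V Y \<psi> = TB.class_rel V Y \<psi>'" for V Y \<psi> \<psi>'
  using EB.E_inj[of V Y \<psi> \<psi>'] that by simp
 have compat: "\<Phi> V Y (quot_functor S A T V Y f) = quot_functor R0 B T0 (?z V) (?z Y) (mor_row0 V Y f)"
  if o: "V \<in> A" "Y \<in> A" and f: "f \<in> graded_hom S V Y" for V Y f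
 proof (rule inj[OF AB[OF o(1)] AB[OF o(2)]])
  note g = TA.A_gm[OF o(1)] TA.A_gm[OF o(2)]
  note qf = TA.quot_functor_class[OF o f] and h = row_rel_hom[OF g f]
  note qh = TB.quot_functor_class[OF AB[OF o(1)] AB[OF o(2)] h(1)]
  show "\<Phi> V Y (quot_functor S A T V Y f) \<in> Mor ?QB (?z V) (?z Y)" by (rule \<Phi>M[OF o qf(1)])
  show "quot_functor R0 B T0 (?z V) (?z Y) (mor_row0 V Y f) \<in> Mor ?QB (?z V) (?z Y)" by (rule qh(1))
  show "TB.class_rel (?z V) (?z Y) (\<Phi> V Y (quot_functor S A T V Y f)) =
    TB.class_rel (?z V) (?z Y) (quot_functor R0 B T0 (?z V) (?z Y) (mor_row0 V Y f))"
   using E\<Phi>[OF o qf(1)] qf(2) h(2) qh(2) by simp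
 qed
 have id_row: "mor_row0 V V (\<lambda>x\<in>carrier V. x) = (\<lambda>x\<in>carrier (?z V). x)" if "V \<in> A" for V
 proof -
  interpret BV: bigraded_mod S V by (rule bmodI[OF TA.A_gm[OF that]])
  show ?thesis using BV.row_in by (auto simp: mor_row0_def)
 qed
 have functor0: "is_functor (mod_cat S A) (mod_cat R0 B) ?z mor_row0"
  unfolding is_functor_def
 proof (intro conjI ballI TA.mod_cat_category TB.mod_cat_category)
  show "?z V \<in> Ob (mod_cat R0 B)" if "V \<in> Ob (mod_cat S A)" for V using AB that by (simp add: mod_cat_def)
  show "mor_row0 V Y f \<in> Mor (mod_cat R0 B) (?z V) (?z Y)"
   if "V \<in> Ob (mod_cat S A)" "Y \<in> Ob (mod_cat S A)" "f \<in> Mor (mod_cat S A) V Y" for V Y f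
   using row_rel_hom(1)[OF TA.A_gm TA.A_gm] that by (simp add: mod_cat_def)
  show "mor_row0 V V (Idn (mod_cat S A) V) = Idn (mod_cat R0 B) (?z V)" if "V \<in> Ob (mod_cat S A)" for V
   using id_row that by (simp add: mod_cat_def)
  fix V Y Z f g assume "V \<in> Ob (mod_cat S A)" "Y \<in> Ob (mod_cat S A)" "Z \<in> Ob (mod_cat S A)"
   "f \<in> Mor (mod_cat S A) V Y" "g \<in> Mor (mod_cat S A) Y Z"
  then have V: "V \<in> A" and Y: "Y \<in> A" and f: "f \<in> graded_hom S V Y" by (auto simp: mod_cat_def)
  interpret BV: bigraded_mod S V by (rule bmodI[OF TA.A_gm[OF V]])
  note h = graded_homD(1)[OF row_rel_hom(1)[OF TA.A_gm[OF V] TA.A_gm[OF Y] f]]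
  show "mor_row0 V Z (Cmp (mod_cat S A) V Y Z g f) =
    Cmp (mod_cat R0 B) (?z V) (?z Y) (?z Z) (mor_row0 Y Z g) (mor_row0 V Y f)"
   using h BV.row_in by (auto simp: mod_cat_def mor_row0_def compose_def fun_eq_iff)
 qed
 have functorQ: "is_functor ?QA ?QB ?z \<Phi>"
  unfolding is_functor_def ObA ObB
 proof (intro conjI ballI EA.iso_category EB.iso_category AB \<Phi>M)
  fix V assume V: "V \<in> A"
  show "\<Phi> V V (Idn ?QA V) = Idn ?QB (?z V)"
   using compat[OF V V GS.id_hom[OF TA.A_gm[OF V]]] id_row[OF V] by (simp add: quot_cat_def)
 next
  fix V Y Z f g assume o: "V \<in> A" "Y \<in> A" "Z \<in> A" and f: "f \<in> Mor ?QA V Y" and g: "g \<in> Mor ?QA Y Z"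
  note gm = TA.A_gm[OF o(1)] TA.A_gm[OF o(2)] TA.A_gm[OF o(3)]
  note ob = AB[OF o(1)] AB[OF o(2)] AB[OF o(3)]
  let ?f = "TA.class_rel V Y f" and ?g = "TA.class_rel Y Z g"
  have fs: "?f \<in> sat S GG V Y" and gs: "?g \<in> sat S GG Y Z"
   using bij_betwE[OF TA.class_rel_bij] o f g by blast+
  note gf = TA.Cmp_quot[OF o f g]
  note cs = GS.comp_in_sat[OF gm fs gs]
  note r = sat_row_rel[OF gm(1,2) fs] sat_row_rel[OF gm(2,3) gs] sat_row_rel[OF gm(1,3) cs(1)]
  have "row_rel V Y ?f O row_rel Y Z ?g \<subseteq> row_rel V Z (cl GG (dsum V Z) (?f O ?g))"
   using cs(2) by (auto simp: row_rel_def)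
  then have c: "cl G0 (dsum (?z V) (?z Z)) (row_rel V Y ?f O row_rel Y Z ?g) = row_rel V Z (cl GG (dsum V Z) (?f O ?g))"
   using GR.comp_eq_iff[OF TB.A_gm[OF ob(1)] TB.A_gm[OF ob(2)] TB.A_gm[OF ob(3)] r] by simp
  note C = TB.Cmp_quot[OF ob \<Phi>M[OF o(1,2) f] \<Phi>M[OF o(2,3) g]]
  show "\<Phi> V Z (Cmp ?QA V Y Z g f) = Cmp ?QB (?z V) (?z Y) (?z Z) (\<Phi> Y Z g) (\<Phi> V Y f)"
  proof (rule inj[OF ob(1,3) \<Phi>M[OF o(1,3) gf(1)] C(1)])
   show "TB.class_rel (?z V) (?z Z) (\<Phi> V Z (Cmp ?QA V Y Z g f)) =
     TB.class_rel (?z V) (?z Z) (Cmp ?QB (?z V) (?z Y) (?z Z) (\<Phi> Y Z g) (\<Phi> V Y f))"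
    unfolding E\<Phi>[OF o(1,3) gf(1)] C(2) E\<Phi>[OF o(1,2) f] E\<Phi>[OF o(2,3) g] gf(2) using c by simp
  qed
 qed
 have "is_equivalence ?QA ?QB ?z \<Phi>"
 proof (rule fully_faithful_equivalence[OF functorQ])
  show "bij_betw (\<Phi> V Y) (Mor ?QA V Y) (Mor ?QB (?z V) (?z Y))" if "V \<in> Ob ?QA" "Y \<in> Ob ?QA" for V Y
   using bij that ObA by simp
  fix N assume "N \<in> Ob ?QB"
  then obtain M \<theta> where M: "M \<in> A" "is_iso (mod_cat R0 B) (?z M) N \<theta>" using eso ObB by blast
  have "is_iso ?QB (?z M) N (quot_functor R0 B T0 (?z M) N \<theta>)"
   by (rule functor_iso[OF TB.quot_functor_functor _ _ M(2)]) (use AB[OF M(1)] \<open>N \<in> Ob ?QB\<close> ObB in auto)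
  then show "\<exists>M\<in>Ob ?QA. \<exists>f. is_iso ?QB (?z M) N f" using M(1) ObA by blast
 qed
 then show ?thesis
  unfolding induces_abelian_equivalence_def
  using functor0 TA.quot_functor_functor TB.quot_functor_functor TA.quot_abelian TB.quot_abelian compat
  by (auto simp: mod_cat_def intro!: exI[of _ \<Phi>])
qed

end

section \<open>Extending graded modules over the row of degree zero\<close>

lemma sum_of_add:
 assumes G: "abelian_group G" and D: "\<And>g. additive_subgroup (D g) G"
  and "x \<in> sum_of G D" "y \<in> sum_of G D"
 shows "x \<oplus>\<^bsub>G\<^esub> y \<in> sum_of G D"
proof -
 interpret abelian_group G by fact
 note A = additive_subgroupD[OF G D]
 obtain J u where u: "finite J" "u \<in> Pi J D" "x = (\<Oplus>\<^bsub>G\<^esub>g\<in>J. u g)" using assms(3) by (auto simp: sum_of_def)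
 obtain L v where v: "finite L" "v \<in> Pi L D" "y = (\<Oplus>\<^bsub>G\<^esub>g\<in>L. v g)" using assms(4) by (auto simp: sum_of_def)
 let ?u = "\<lambda>g. if g \<in> J then u g else \<zero>\<^bsub>G\<^esub>" and ?v = "\<lambda>g. if g \<in> L then v g else \<zero>\<^bsub>G\<^esub>"
 have uD: "?u g \<in> D g" and vD: "?v g \<in> D g" for g using u(2) v(2) A(2) by auto
 have c: "?u g \<in> carrier G" "?v g \<in> carrier G" for g using uD[of g] vD[of g] A(1)[of g] by auto
 have x: "x = (\<Oplus>\<^bsub>G\<^esub>g\<in>J \<union> L. ?u g)"
  unfolding u(3) by (rule add.finprod_mono_neutral_cong_left[folded finsum_def]) (use u(1) v(1) c in \<open>auto split: if_splits\<close>)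
 have y: "y = (\<Oplus>\<^bsub>G\<^esub>g\<in>J \<union> L. ?v g)"
  unfolding v(3) by (rule add.finprod_mono_neutral_cong_left[folded finsum_def]) (use u(1) v(1) c in \<open>auto split: if_splits\<close>)
 have "x \<oplus>\<^bsub>G\<^esub> y = (\<Oplus>\<^bsub>G\<^esub>g\<in>J \<union> L. ?u g \<oplus>\<^bsub>G\<^esub> ?v g)"
  unfolding x y by (rule finsum_addf[symmetric]) (use c in auto)
 moreover have "(\<lambda>g. ?u g \<oplus>\<^bsub>G\<^esub> ?v g) \<in> Pi (J \<union> L) D" using A(3)[OF uD vD] by blast
 ultimately show ?thesis unfolding sum_of_def using u(1) v(1)
  by (intro CollectI exI[of _ "J \<union> L"] exI[of _ "\<lambda>g. ?u g \<oplus>\<^bsub>G\<^esub> ?v g"]) simp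
qed

lemma sum_of_superset:
 assumes "abelian_group G" "x \<in> D g" "x \<in> carrier G" shows "x \<in> sum_of G D"
proof -
 interpret abelian_group G by fact
 show ?thesis unfolding sum_of_def
  by (intro CollectI exI[of _ "{g}"] exI[of _ "\<lambda>_. x"]) (use assms in \<open>simp add: finsum_insert\<close>)
qed

locale coefficient_module = bigraded_ring S for S (structure) +
 fixes N :: "(int, 'a, 'm) graded_mod"
 assumes N_gm: "graded_module (deg0_alg S) N"

sublocale coefficient_module \<subseteq> N: gmod "deg0_alg S" N
 by (rule R0.gmodI[OF N_gm])

context coefficient_module
begin

abbreviation "p0 \<equiv> part S (acomp S) {g. fst g = 0}"

lemma p0_row: "x \<in> row S i ==> p0 x = (if i = 0 then x else \<zero>)"
 by (rule hc_ext) (auto simp: hc_part row_char)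

lemma p0_in: "x \<in> carrier S ==> p0 x \<in> row S 0"
 by (auto simp: row_char hc_part)

lemma p0_left:
 assumes c: "c \<in> row S 0" and t: "t \<in> carrier S" shows "p0 (c \<otimes> t) = c \<otimes> p0 t"
 using t
proof (induction rule: homogeneous_induct)
 case (homog g y)
 then have y: "y \<in> row S (fst g)" using homog_row_ring[of y "fst g" "snd g"] by simp
 show ?case using p0_row[OF y] p0_row[OF row_mult[OF c y]] rowc[OF c] by simp
qed (use rowc[OF c] in \<open>simp_all add: r_distr part_add\<close>)

lemma p0_right:
 assumes c: "c \<in> row S 0" and t: "t \<in> carrier S" shows "p0 (t \<otimes> c) = p0 t \<otimes> c"
 using t
proof (induction rule: homogeneous_induct)
 case (homog g y)
 then have y: "y \<in> row S (fst g)" using homog_row_ring[of y "fst g" "snd g"] by simp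
 show ?case using p0_row[OF y] p0_row[OF row_mult[OF y c]] rowc[OF c] by simp
qed (use rowc[OF c] in \<open>simp_all add: l_distr part_add\<close>)

lemma N_act:
 "n \<in> carrier N ==> c \<in> row S 0 ==> n \<bullet>\<^bsub>N\<^esub> c \<in> carrier N"
 "n \<in> carrier N ==> n \<bullet>\<^bsub>N\<^esub> \<one> = n"
 "n \<in> carrier N ==> c \<in> row S 0 ==> d \<in> row S 0 ==> n \<bullet>\<^bsub>N\<^esub> (c \<otimes> d) = n \<bullet>\<^bsub>N\<^esub> c \<bullet>\<^bsub>N\<^esub> d"
 "n \<in> carrier N ==> c \<in> row S 0 ==> d \<in> row S 0 ==> n \<bullet>\<^bsub>N\<^esub> (c \<oplus> d) = n \<bullet>\<^bsub>N\<^esub> c \<oplus>\<^bsub>N\<^esub> n \<bullet>\<^bsub>N\<^esub> d"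
 "n \<in> carrier N ==> m \<in> carrier N ==> c \<in> row S 0 ==> (n \<oplus>\<^bsub>N\<^esub> m) \<bullet>\<^bsub>N\<^esub> c = n \<bullet>\<^bsub>N\<^esub> c \<oplus>\<^bsub>N\<^esub> m \<bullet>\<^bsub>N\<^esub> c"
 "n \<in> carrier N ==> n \<bullet>\<^bsub>N\<^esub> \<zero> = \<zero>\<^bsub>N\<^esub>"
 "c \<in> row S 0 ==> \<zero>\<^bsub>N\<^esub> \<bullet>\<^bsub>N\<^esub> c = \<zero>\<^bsub>N\<^esub>"
 "n \<in> carrier N ==> c \<in> row S 0 ==> (\<ominus>\<^bsub>N\<^esub> n) \<bullet>\<^bsub>N\<^esub> c = \<ominus>\<^bsub>N\<^esub> (n \<bullet>\<^bsub>N\<^esub> c)"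
 "n \<in> mcomp N a ==> c \<in> acomp S (0, b) ==> n \<bullet>\<^bsub>N\<^esub> c \<in> mcomp N (a + b)"
 using N.act_closed[of n c] N.act_one[of n] N.act_mult[of n c d] N.act_add_right[of n c d]
  N.act_add_left[of n m c] N.act_zero_right[of n] N.act_zero_left[of c] N.act_minus_left[of n c]
  N.act_homog[of n a c b]
 unfolding deg0_simps by blast+

text \<open>The image of \<open>n \<otimes> s\<close> under the natural map from \<open>N \<otimes> S\<close> to \<open>Hom(S, N)\<close>, the tensor product and
  the homomorphisms being over \<open>S\<^sub>0\<close>.\<close>

definition tensor :: "'m \<Rightarrow> 'a \<Rightarrow> 'a \<Rightarrow> 'm" where
 "tensor n s = (\<lambda>t\<in>carrier S. n \<bullet>\<^bsub>N\<^esub> p0 (s \<otimes> t))"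

text \<open>Elements of this image are functions, so that equality needs no tensor relations, and the
  rows of the image are finitely generated if \<open>N\<close> is, which is not clear for all of \<open>Hom(S, N)\<close>.\<close>

inductive_set tensors :: "('a \<Rightarrow> 'm) set" where
 zero: "(\<lambda>t\<in>carrier S. \<zero>\<^bsub>N\<^esub>) \<in> tensors"
| add: "f \<in> tensors ==> n \<in> carrier N ==> s \<in> carrier S ==>
  (\<lambda>t\<in>carrier S. f t \<oplus>\<^bsub>N\<^esub> tensor n s t) \<in> tensors"

text \<open>Components are formed as for homomorphisms of graded modules, with \<open>N\<close> in row \<open>0\<close>.\<close>

definition induced :: "(int \<times> int, 'a, 'a \<Rightarrow> 'm) graded_mod" where
 "induced = \<lparr>carrier = tensors, monoid.mult = undefined, one = undefined,
   ring.zero = (\<lambda>t\<in>carrier S. \<zero>\<^bsub>N\<^esub>), add = (\<lambda>f g. \<lambda>t\<in>carrier S. f t \<oplus>\<^bsub>N\<^esub> g t),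
   ract = (\<lambda>f r. \<lambda>t\<in>carrier S. f (r \<otimes> t)),
   mcomp = (\<lambda>g. {f \<in> tensors. \<forall>h. \<forall>t\<in>acomp S h.
    f t \<in> (if fst (g + h) = 0 then mcomp N (snd (g + h)) else {\<zero>\<^bsub>N\<^esub>})})\<rparr>"

lemma induced_simps [simp]:
 "carrier induced = tensors" "\<zero>\<^bsub>induced\<^esub> = (\<lambda>t\<in>carrier S. \<zero>\<^bsub>N\<^esub>)"
 "f \<oplus>\<^bsub>induced\<^esub> g = (\<lambda>t\<in>carrier S. f t \<oplus>\<^bsub>N\<^esub> g t)" "f \<bullet>\<^bsub>induced\<^esub> r = (\<lambda>t\<in>carrier S. f (r \<otimes> t))"
 by (simp_all add: induced_def)

lemma tensor_app: "t \<in> carrier S ==> tensor n s t = n \<bullet>\<^bsub>N\<^esub> p0 (s \<otimes> t)"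
 by (simp add: tensor_def)

lemma tensor_closed: "n \<in> carrier N ==> s \<in> carrier S ==> t \<in> carrier S ==> tensor n s t \<in> carrier N"
 by (simp add: tensor_app N_act p0_in)

lemma tensorsD:
 assumes "f \<in> tensors"
 shows tensors_ext: "f \<in> extensional (carrier S)"
  and tensors_closed: "\<And>t. t \<in> carrier S ==> f t \<in> carrier N"
  and tensors_add: "\<And>t u. t \<in> carrier S ==> u \<in> carrier S ==> f (t \<oplus> u) = f t \<oplus>\<^bsub>N\<^esub> f u"
  and tensors_act: "\<And>t c. t \<in> carrier S ==> c \<in> row S 0 ==> f (t \<otimes> c) = f t \<bullet>\<^bsub>N\<^esub> c"
 using assms
proof (induction)
 case zero
 { case 1 show ?case by (rule restrict_extensional) next
  case 2 then show ?case by simp next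
  case 3 then show ?case by simp next
  case 4 then show ?case using rowc[of _ 0] by (simp add: N_act) }
next
 case (add f n s)
 { case 1 show ?case by (rule restrict_extensional) next
  case 2 then show ?case using add by (simp add: tensor_closed) next
  case (3 t u)
  have "tensor n s (t \<oplus> u) = tensor n s t \<oplus>\<^bsub>N\<^esub> tensor n s u"
   using 3 add.hyps(2,3) by (simp add: tensor_app r_distr part_add N_act p0_in)
  then show ?case using 3 add tensor_closed[OF add.hyps(2,3)] by (simp add: N.add.m_ac) next
  case (4 t c)
  have "tensor n s (t \<otimes> c) = tensor n s t \<bullet>\<^bsub>N\<^esub> c"
   using 4 add.hyps(2,3) rowc[OF 4(2)] by (simp add: tensor_app m_assoc[symmetric] p0_right p0_in N_act)
  then show ?case using 4 add tensor_closed[OF add.hyps(2,3)] rowc[OF 4(2)] by (simp add: N_act) }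
qed

lemma tensors_eqI: "f \<in> tensors ==> g \<in> tensors ==> (\<And>t. t \<in> carrier S ==> f t = g t) ==> f = g"
 by (rule extensionalityI[OF tensors_ext tensors_ext])

lemma tensor_in: assumes "n \<in> carrier N" "s \<in> carrier S" shows "tensor n s \<in> tensors"
proof -
 have "(\<lambda>t\<in>carrier S. (\<lambda>t\<in>carrier S. \<zero>\<^bsub>N\<^esub>) t \<oplus>\<^bsub>N\<^esub> tensor n s t) = tensor n s"
  by (rule extensionalityI[of _ "carrier S"]) (use assms tensor_closed in \<open>auto simp: tensor_def\<close>)
 then show ?thesis using tensors.add[OF tensors.zero assms] by simp
qed

lemma tensors_plus:
 assumes f: "f \<in> tensors" and g: "g \<in> tensors"
 shows "(\<lambda>t\<in>carrier S. f t \<oplus>\<^bsub>N\<^esub> g t) \<in> tensors"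
 using g
proof induction
 case zero
 have eq: "(\<lambda>t\<in>carrier S. f t \<oplus>\<^bsub>N\<^esub> (\<lambda>t\<in>carrier S. \<zero>\<^bsub>N\<^esub>) t) = f"
  by (rule extensionalityI[of _ "carrier S"]) (use tensorsD(1,2)[OF f] in auto)
 show ?case by (rule back_subst[of "\<lambda>f. f \<in> tensors", OF f eq[symmetric]])
next
 case (add g n s)
 have eq: "(\<lambda>t\<in>carrier S. f t \<oplus>\<^bsub>N\<^esub> (\<lambda>t\<in>carrier S. g t \<oplus>\<^bsub>N\<^esub> tensor n s t) t) =
   (\<lambda>t\<in>carrier S. (\<lambda>t\<in>carrier S. f t \<oplus>\<^bsub>N\<^esub> g t) t \<oplus>\<^bsub>N\<^esub> tensor n s t)"
  by (rule extensionalityI[of _ "carrier S"])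
    (use tensorsD(2)[OF f] tensorsD(2)[OF add(1)] tensor_closed[OF add(2,3)] in \<open>auto simp: N.a_assoc\<close>)
 show ?case by (rule back_subst[of "\<lambda>f. f \<in> tensors", OF tensors.add[OF add(4,2,3)] eq[symmetric]])
qed

lemma tensors_uminus:
 assumes f: "f \<in> tensors" shows "(\<lambda>t\<in>carrier S. \<ominus>\<^bsub>N\<^esub> f t) \<in> tensors"
 using f
proof induction
 case zero
 have eq: "(\<lambda>t\<in>carrier S. \<ominus>\<^bsub>N\<^esub> (\<lambda>t\<in>carrier S. \<zero>\<^bsub>N\<^esub>) t) = (\<lambda>t\<in>carrier S. \<zero>\<^bsub>N\<^esub>)"
  by (rule extensionalityI[of _ "carrier S"]) auto
 show ?case by (rule back_subst[of "\<lambda>f. f \<in> tensors", OF tensors.zero eq[symmetric]])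
next
 case (add f n s)
 have eq: "(\<lambda>t\<in>carrier S. \<ominus>\<^bsub>N\<^esub> (\<lambda>t\<in>carrier S. f t \<oplus>\<^bsub>N\<^esub> tensor n s t) t) =
   (\<lambda>t\<in>carrier S. (\<lambda>t\<in>carrier S. \<ominus>\<^bsub>N\<^esub> f t) t \<oplus>\<^bsub>N\<^esub> tensor (\<ominus>\<^bsub>N\<^esub> n) s t)"
  by (rule extensionalityI[of _ "carrier S"])
    (use tensorsD(2)[OF add(1)] add(2,3) in \<open>auto simp: tensor_app p0_in N_act N.minus_add\<close>)
 show ?case
  by (rule back_subst[of "\<lambda>f. f \<in> tensors", OF tensors.add[OF add(4) N.a_inv_closed[OF add(2)] add(3)] eq[symmetric]])
qed

lemma tensor_act: "n \<in> carrier N ==> s \<in> carrier S ==> r \<in> carrier S ==>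
  tensor n s \<bullet>\<^bsub>induced\<^esub> r = tensor n (s \<otimes> r)"
 by (rule extensionalityI[of _ "carrier S"]) (auto simp: tensor_def m_assoc)

lemma tensors_ract:
 assumes f: "f \<in> tensors" and r: "r \<in> carrier S" shows "(\<lambda>t\<in>carrier S. f (r \<otimes> t)) \<in> tensors"
 using f
proof induction
 case zero
 have eq: "(\<lambda>t\<in>carrier S. (\<lambda>t\<in>carrier S. \<zero>\<^bsub>N\<^esub>) (r \<otimes> t)) = (\<lambda>t\<in>carrier S. \<zero>\<^bsub>N\<^esub>)"
  by (rule extensionalityI[of _ "carrier S"]) (use r in auto)
 show ?case by (rule back_subst[of "\<lambda>f. f \<in> tensors", OF tensors.zero eq[symmetric]])
next
 case (add f n s)
 have eq: "(\<lambda>t\<in>carrier S. (\<lambda>t\<in>carrier S. f t \<oplus>\<^bsub>N\<^esub> tensor n s t) (r \<otimes> t)) =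
   (\<lambda>t\<in>carrier S. (\<lambda>t\<in>carrier S. f (r \<otimes> t)) t \<oplus>\<^bsub>N\<^esub> tensor n (s \<otimes> r) t)"
  by (rule extensionalityI[of _ "carrier S"]) (use r add(2,3) in \<open>auto simp: tensor_app m_assoc\<close>)
 show ?case
  by (rule back_subst[of "\<lambda>f. f \<in> tensors", OF tensors.add[OF add(4) add(2) m_closed[OF add(3) r]] eq[symmetric]])
qed

lemma tensor_add:
 "n \<in> carrier N ==> s \<in> carrier S ==> r \<in> carrier S ==> tensor n (s \<oplus> r) = tensor n s \<oplus>\<^bsub>induced\<^esub> tensor n r"
 "n \<in> carrier N ==> m \<in> carrier N ==> s \<in> carrier S ==>
  tensor (n \<oplus>\<^bsub>N\<^esub> m) s = tensor n s \<oplus>\<^bsub>induced\<^esub> tensor m s"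
 "n \<in> carrier N ==> tensor n \<zero> = \<zero>\<^bsub>induced\<^esub>"
 "s \<in> carrier S ==> tensor \<zero>\<^bsub>N\<^esub> s = \<zero>\<^bsub>induced\<^esub>"
 "n \<in> carrier N ==> c \<in> row S 0 ==> s \<in> carrier S ==> tensor (n \<bullet>\<^bsub>N\<^esub> c) s = tensor n (c \<otimes> s)"
 by (auto intro!: extensionalityI[of _ "carrier S"]
   simp: tensor_def l_distr part_add p0_in N_act rowc m_assoc p0_left)

lemma induced_abelian_group: "abelian_group induced"
proof (rule abelian_groupI)
 show "x \<oplus>\<^bsub>induced\<^esub> y \<in> carrier induced" if "x \<in> carrier induced" "y \<in> carrier induced" for x y
  using that tensors_plus by simp
 show "\<zero>\<^bsub>induced\<^esub> \<in> carrier induced" using tensors.zero by simp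
 show "x \<oplus>\<^bsub>induced\<^esub> y \<oplus>\<^bsub>induced\<^esub> z = x \<oplus>\<^bsub>induced\<^esub> (y \<oplus>\<^bsub>induced\<^esub> z)"
  if "x \<in> carrier induced" "y \<in> carrier induced" "z \<in> carrier induced" for x y z
  using that by (auto simp: fun_eq_iff restrict_def N.a_assoc tensors_closed)
 show "x \<oplus>\<^bsub>induced\<^esub> y = y \<oplus>\<^bsub>induced\<^esub> x" if "x \<in> carrier induced" "y \<in> carrier induced" for x y
  using that by (auto simp: fun_eq_iff restrict_def N.a_comm tensors_closed)
 show "\<zero>\<^bsub>induced\<^esub> \<oplus>\<^bsub>induced\<^esub> x = x" if "x \<in> carrier induced" for x
  using that tensors_ext[of x] by (auto simp: fun_eq_iff restrict_def tensors_closed extensional_def)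
 show "\<exists>y\<in>carrier induced. y \<oplus>\<^bsub>induced\<^esub> x = \<zero>\<^bsub>induced\<^esub>" if "x \<in> carrier induced" for x
  using that tensors_uminus[of x]
  by (intro bexI[of _ "\<lambda>t\<in>carrier S. \<ominus>\<^bsub>N\<^esub> x t"]) (auto simp: fun_eq_iff restrict_def N.l_neg tensors_closed)
qed

lemma induced_mcomp: "f \<in> mcomp induced g \<longleftrightarrow> f \<in> tensors \<and> (\<forall>h. \<forall>t\<in>acomp S h.
  f t \<in> (if fst (g + h) = 0 then mcomp N (snd (g + h)) else {\<zero>\<^bsub>N\<^esub>}))"
 by (simp add: induced_def)

lemma induced_uminus: "f \<in> tensors ==> \<ominus>\<^bsub>induced\<^esub> f = (\<lambda>t\<in>carrier S. \<ominus>\<^bsub>N\<^esub> f t)"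
proof -
 interpret I: abelian_group induced by (rule induced_abelian_group)
 assume f: "f \<in> tensors"
 show ?thesis
  by (rule I.minus_equality) (use f tensors_uminus[OF f] in \<open>auto simp: fun_eq_iff restrict_def N.l_neg tensors_closed\<close>)
qed

lemma induced_mcomp_subgroup: "additive_subgroup (mcomp induced g) induced"
proof -
 define W where "W h = (if fst (g + h) = 0 then mcomp N (snd (g + h)) else {\<zero>\<^bsub>N\<^esub>})" for h
 have "additive_subgroup (W h) N" for h
  using N.D_subgroup N.gsD(1)[OF N.gs_zero] by (simp add: W_def)
 note C = additive_subgroupD[OF N.abelian_group_axioms this]
 have m: "mcomp induced g = {f \<in> tensors. \<forall>h. \<forall>t\<in>acomp S h. f t \<in> W h}"
  by (simp add: induced_def W_def)
 show ?thesis
  unfolding m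
  by (rule additive_subgroupI_closed[OF induced_abelian_group])
    (use C(2-4) in \<open>auto simp: tensors.zero tensors_plus induced_uminus tensors_uminus D_carrier\<close>)
qed

lemma tensor_homog:
 assumes n: "n \<in> mcomp N a" and s: "s \<in> acomp S (i, b)"
 shows "tensor n s \<in> mcomp induced (i, a + b)"
 unfolding induced_mcomp
proof (intro conjI allI ballI)
 show "tensor n s \<in> tensors" by (rule tensor_in[OF N.D_carrier[OF n] D_carrier[OF s]])
 fix h t assume t: "t \<in> acomp S h"
 have st: "s \<otimes> t \<in> acomp S ((i, b) + h)" by (rule mult_homog[OF s t])
 show "tensor n s t \<in> (if fst ((i, a + b) + h) = 0 then mcomp N (snd ((i, a + b) + h)) else {\<zero>\<^bsub>N\<^esub>})"
 proof (cases "fst ((i, b) + h) = 0")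
  case True
  then have "(i, b) + h = (0, b + snd h)" by (cases h) simp
  then have "n \<bullet>\<^bsub>N\<^esub> (s \<otimes> t) \<in> mcomp N (a + (b + snd h))" using N_act(9)[OF n] st by simp
  then show ?thesis using True st D_carrier[OF t] by (cases h) (simp add: tensor_app part_homog add.assoc)
 next
  case False
  then show ?thesis using st D_carrier[OF t] N.D_carrier[OF n]
   by (cases h) (simp add: tensor_app part_homog N_act)
 qed
qed

lemma tensors_homogeneous_induct [consumes 1, case_names zero tensor plus]:
 assumes "f \<in> tensors" and zero: "P \<zero>\<^bsub>induced\<^esub>"
  and homog: "\<And>n s a i b. n \<in> mcomp N a ==> s \<in> acomp S (i, b) ==> P (tensor n s)"
  and plus: "\<And>f g. f \<in> tensors ==> g \<in> tensors ==> P f ==> P g ==> P (f \<oplus>\<^bsub>induced\<^esub> g)"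
 shows "P f"
proof -
 have 1: "P (tensor n s)" if n: "n \<in> mcomp N a" and s: "s \<in> carrier S" for n s a
  using s
 proof (induction rule: homogeneous_induct)
  case zero
  show ?case unfolding tensor_add(3)[OF N.D_carrier[OF n]] by (rule assms(2))
 next
  case (homog g s)
  then show ?case using assms(3)[OF n, of s "fst g" "snd g"] by simp
 next
  case (add s r)
  show ?case
   unfolding tensor_add(1)[OF N.D_carrier[OF n] add(1,2)]
   by (rule plus[OF tensor_in[OF N.D_carrier[OF n] add(1)] tensor_in[OF N.D_carrier[OF n] add(2)] add(3,4)])
 qed
 have 2: "P (tensor n s)" if n: "n \<in> carrier N" and s: "s \<in> carrier S" for n s
  using n
 proof (induction rule: N.homogeneous_induct)
  case zero
  show ?case unfolding tensor_add(4)[OF s] by (rule assms(2))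
 next
  case (homog g n)
  then show ?case using 1[OF homog s] by simp
 next
  case (add n m)
  show ?case
   unfolding tensor_add(2)[OF add(1,2) s] by (rule plus[OF tensor_in[OF add(1) s] tensor_in[OF add(2) s] add(3,4)])
 qed
 from assms(1) show ?thesis
 proof induction
  case zero
  show ?case using assms(2) unfolding induced_simps .
 next
  case (add f n s)
  show ?case
   using plus[OF add(1) tensor_in[OF add(2,3)] add(4) 2[OF add(2,3)]] unfolding induced_simps .
 qed
qed

lemma induced_decomp: "direct_sum_decomp induced (mcomp induced)"
proof (rule direct_sum_decompI_independent[OF induced_abelian_group induced_mcomp_subgroup])
 interpret I: abelian_group induced by (rule induced_abelian_group)
 show "\<exists>J u. finite J \<and> u \<in> Pi J (mcomp induced) \<and> f = (\<Oplus>\<^bsub>induced\<^esub>g\<in>J. u g)" if "f \<in> carrier induced" for f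
 proof -
  have "f \<in> tensors" using that by simp
  then have "f \<in> sum_of induced (mcomp induced)"
  proof (induction rule: tensors_homogeneous_induct)
   case zero
   show ?case
    by (rule sum_of_superset[OF induced_abelian_group, of _ "mcomp induced" 0, OF
      additive_subgroupD(2)[OF induced_abelian_group induced_mcomp_subgroup]]) (rule I.zero_closed)
  next
   case (tensor n s a i b)
   show ?case by (rule sum_of_superset[where D = "mcomp induced", OF induced_abelian_group tensor_homog[OF tensor]])
    (use tensor_in N.D_carrier[OF tensor(1)] D_carrier[OF tensor(2)] in simp)
  next
   case (plus f g)
   show ?case by (rule sum_of_add[OF induced_abelian_group induced_mcomp_subgroup plus(3,4)])
  qed
  then show ?thesis unfolding sum_of_def by blast
 qed
 show "u g = \<zero>\<^bsub>induced\<^esub>"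
  if J: "finite J" and u: "\<And>g. u g \<in> mcomp induced g" and sum: "(\<Oplus>\<^bsub>induced\<^esub>g\<in>J. u g) = \<zero>\<^bsub>induced\<^esub>" and g: "g \<in> J"
  for J u g
 proof -
  have ut: "u h \<in> tensors" for h using u[of h] by (simp add: induced_mcomp)
  have hom: "u g t = \<zero>\<^bsub>N\<^esub>" if t: "t \<in> acomp S h" for t h
  proof (cases "fst (g + h) = 0")
   case False
   then show ?thesis using u[of g] t unfolding induced_mcomp by (metis singletonD)
  next
   case True
   have tc: "t \<in> carrier S" using D_carrier[OF t] .
   let ?h = "N.hc (snd (g + h))"
   have "(\<Oplus>\<^bsub>induced\<^esub>g\<in>J. u g) t = (\<Oplus>\<^bsub>N\<^esub>g\<in>J. u g t)"
    by (rule finsum_additive[OF induced_abelian_group N.abelian_group_axioms, where h = "\<lambda>f. f t"])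
      (use tc ut tensors_closed in auto)
   then have z: "(\<Oplus>\<^bsub>N\<^esub>g\<in>J. u g t) = \<zero>\<^bsub>N\<^esub>" using sum tc by simp
   have each: "?h (u g' t) = (if g = g' then u g' t else \<zero>\<^bsub>N\<^esub>)" for g'
   proof (cases "fst (g' + h) = 0")
    case True2: True
    then have "u g' t \<in> mcomp N (snd (g' + h))" using u[of g'] t unfolding induced_mcomp by metis
    then show ?thesis using True True2 by (simp add: N.hc_homog prod_eq_iff)
   next
    case False
    then have "u g' t = \<zero>\<^bsub>N\<^esub>" using u[of g'] t unfolding induced_mcomp by (metis singletonD)
    then show ?thesis using False True by auto
   qed
   have "(\<Oplus>\<^bsub>N\<^esub>g'\<in>J. if g = g' then u g' t else \<zero>\<^bsub>N\<^esub>) = (\<Oplus>\<^bsub>N\<^esub>g'\<in>J. ?h (u g' t))"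
    by (rule N.finsum_cong') (use each ut tc tensors_closed in auto)
   also have "\<dots> = ?h (\<Oplus>\<^bsub>N\<^esub>g'\<in>J. u g' t)"
    by (rule finsum_additive[OF N.abelian_group_axioms N.abelian_group_axioms, symmetric])
      (use ut tc tensors_closed in \<open>auto simp: N.hc_add\<close>)
   also have "\<dots> = \<zero>\<^bsub>N\<^esub>" using z by simp
   finally show ?thesis
    using N.finsum_singleton[OF g J, of "\<lambda>g'. u g' t"] ut tc tensors_closed by auto
  qed
  have "u g t = \<zero>\<^bsub>N\<^esub>" if "t \<in> carrier S" for t
   using that
  proof (induction rule: homogeneous_induct)
   case zero
   show ?case using hom[of \<zero>] D_closed(2) by blast
  next
   case (homog h t)
   then show ?case by (rule hom)
  next
   case (add t r)
   then show ?case using tensors_add[OF ut] by simp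
  qed
  then show ?thesis using tensors_eqI[OF ut tensors.zero] by simp
 qed
qed

lemma induced_graded_module: "graded_module S induced"
 unfolding graded_module_def
proof (intro conjI ballI allI induced_abelian_group induced_decomp)
 fix x assume x: "x \<in> carrier induced"
 show "x \<bullet>\<^bsub>induced\<^esub> \<one> = x"
  by (rule extensionalityI[of _ "carrier S"]) (use x tensors_ext in auto)
 fix s assume s: "s \<in> carrier S"
 show "x \<bullet>\<^bsub>induced\<^esub> s \<in> carrier induced" using x s tensors_ract by simp
 fix t assume t: "t \<in> carrier S"
 show "x \<bullet>\<^bsub>induced\<^esub> (s \<otimes> t) = x \<bullet>\<^bsub>induced\<^esub> s \<bullet>\<^bsub>induced\<^esub> t"
  by (rule extensionalityI[of _ "carrier S"]) (use s t in \<open>auto simp: m_assoc\<close>)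
 show "x \<bullet>\<^bsub>induced\<^esub> (s \<oplus> t) = x \<bullet>\<^bsub>induced\<^esub> s \<oplus>\<^bsub>induced\<^esub> x \<bullet>\<^bsub>induced\<^esub> t"
  by (rule extensionalityI[of _ "carrier S"]) (use x s t in \<open>auto simp: l_distr tensors_add\<close>)
next
 fix x y s assume "x \<in> carrier induced" "y \<in> carrier induced" "s \<in> carrier S"
 then show "(x \<oplus>\<^bsub>induced\<^esub> y) \<bullet>\<^bsub>induced\<^esub> s = x \<bullet>\<^bsub>induced\<^esub> s \<oplus>\<^bsub>induced\<^esub> y \<bullet>\<^bsub>induced\<^esub> s"
  by (intro extensionalityI[of _ "carrier S"]) auto
next
 fix g h x s assume x: "x \<in> mcomp induced g" and s: "s \<in> acomp S h"
 show "x \<bullet>\<^bsub>induced\<^esub> s \<in> mcomp induced (g + h)"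
  unfolding induced_mcomp
 proof (intro conjI allI ballI)
  show "x \<bullet>\<^bsub>induced\<^esub> s \<in> tensors" using x tensors_ract[of x s] D_carrier[OF s] by (simp add: induced_mcomp)
  fix k t assume t: "t \<in> acomp S k"
  have "s \<otimes> t \<in> acomp S (h + k)" by (rule mult_homog[OF s t])
  then have "x (s \<otimes> t) \<in> (if fst (g + (h + k)) = 0 then mcomp N (snd (g + (h + k))) else {\<zero>\<^bsub>N\<^esub>})"
   using x unfolding induced_mcomp by blast
  then show "(x \<bullet>\<^bsub>induced\<^esub> s) t \<in> (if fst (g + h + k) = 0 then mcomp N (snd (g + h + k)) else {\<zero>\<^bsub>N\<^esub>})"
   using D_carrier[OF t] by (auto simp: add.assoc split: if_splits)
 qed
qed

end

sublocale coefficient_module \<subseteq> I: bigraded_mod S induced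
 by (intro bigraded_mod.intro gmodI induced_graded_module)

context coefficient_module
begin

lemma tensor_row:
 assumes n: "n \<in> carrier N" and s: "s \<in> row S i"
 shows "tensor n s \<in> carrier (mod_row induced i)"
proof -
 note G = additive_subgroupD[OF I.abelian_group_axioms I.row_subgroup[of i]]
 have hom: "tensor n t \<in> carrier (mod_row induced i)" if t: "t \<in> acomp S (i, b)" for t b
  using n
 proof (induction rule: N.homogeneous_induct)
  case zero
  show ?case unfolding tensor_add(4)[OF D_carrier[OF t]] by (rule G(2))
 next
  case (homog a n)
  show ?case by (rule I.homog_row[OF tensor_homog[OF homog t]])
 next
  case (add n m)
  show ?case unfolding tensor_add(2)[OF add(1,2) D_carrier[OF t]] by (rule G(3)[OF add(3,4)])
 qed
 have sc: "s \<in> carrier S" using rowc[OF s] .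
 have V: "additive_subgroup {s \<in> carrier S. tensor n s \<in> carrier (mod_row induced i)} S"
 proof (rule additive_subgroupI_closed[OF is_abelian_group])
  have m: "tensor n (\<ominus> x) = \<ominus>\<^bsub>induced\<^esub> tensor n x" if "x \<in> carrier S" for x
   by (rule additive_map_minus[OF is_abelian_group I.abelian_group_axioms])
     (use n that tensor_in tensor_add(1) in auto)
  show "\<ominus> x \<in> {s \<in> carrier S. tensor n s \<in> carrier (mod_row induced i)}"
   if "x \<in> {s \<in> carrier S. tensor n s \<in> carrier (mod_row induced i)}" for x
   using that G(4) m by auto
 qed (use n G(2,3) tensor_add(1,3) in auto)
 from row_least[OF V, of i] show ?thesis using s hom D_carrier by blast
qed

lemma row_support:
 assumes f: "f \<in> carrier (mod_row induced 0)" and t: "t \<in> row S i" "i \<noteq> 0"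
 shows "f t = \<zero>\<^bsub>N\<^esub>"
proof -
 have hom: "f t = \<zero>\<^bsub>N\<^esub>" if f: "f \<in> mcomp induced (0, j)" for f j
 proof -
  have ft: "f \<in> tensors" using f by (simp add: induced_mcomp)
  have tc: "t \<in> carrier S" using rowc[OF t(1)] .
  have V: "additive_subgroup {t \<in> carrier S. f t = \<zero>\<^bsub>N\<^esub>} S"
  proof (rule additive_subgroupI_closed[OF is_abelian_group])
   have "f (\<ominus> x) = \<ominus>\<^bsub>N\<^esub> f x" if "x \<in> carrier S" for x
    by (rule additive_map_minus[OF is_abelian_group N.abelian_group_axioms])
      (use that tensorsD(2,3)[OF ft] in auto)
   then show "\<ominus> x \<in> {t \<in> carrier S. f t = \<zero>\<^bsub>N\<^esub>}" if "x \<in> {t \<in> carrier S. f t = \<zero>\<^bsub>N\<^esub>}" for x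
    using that by auto
   have "f \<zero> = \<zero>\<^bsub>N\<^esub>"
    by (rule additive_map_zero[OF is_abelian_group N.abelian_group_axioms])
      (use tensorsD(2,3)[OF ft] in auto)
   then show "\<zero> \<in> {t \<in> carrier S. f t = \<zero>\<^bsub>N\<^esub>}" by simp
  qed (use tensorsD(3)[OF ft] in auto)
  have "f r = \<zero>\<^bsub>N\<^esub>" if r: "r \<in> acomp S (i, l)" for r l
   using f r t(2) unfolding induced_mcomp by (metis (no_types) add_0 fst_add fst_conv singletonD)
  then show ?thesis using row_least[OF V, of i] t(1) D_carrier by blast
 qed
 have tc: "t \<in> carrier S" using rowc[OF t(1)] .
 have V: "additive_subgroup {f \<in> tensors. f t = \<zero>\<^bsub>N\<^esub>} induced"
  by (rule additive_subgroupI_closed[OF I.abelian_group_axioms])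
    (use tc tensors_plus tensors.zero tensors_uminus in \<open>auto simp: induced_uminus\<close>)
 have "mcomp induced (0, j) \<subseteq> {f \<in> tensors. f t = \<zero>\<^bsub>N\<^esub>}" for j
  using hom[of _ j] induced_mcomp[of _ "(0, j)"] by blast
 from subsetD[OF I.row_least[OF V this] f] show ?thesis by blast
qed

text \<open>An element of row \<open>0\<close> vanishes on the other rows of \<open>S\<close>, so its value \<open>n\<close> at \<open>1\<close> determines it: it
  is \<open>n \<otimes> 1\<close>.\<close>

lemma row0_iso:
 defines "\<theta> \<equiv> \<lambda>f\<in>carrier (mod_row induced 0). f \<one>"
 shows "\<theta> \<in> graded_hom (deg0_alg S) (mod_row induced 0) N"
  "bij_betw \<theta> (carrier (mod_row induced 0)) (carrier N)"
proof -
 have t: "f \<in> tensors" if "f \<in> carrier (mod_row induced 0)" for f using I.row_in[OF that] by simp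
 have th: "\<theta> f = f \<one>" if "f \<in> carrier (mod_row induced 0)" for f using that by (simp add: \<theta>_def)
 note G = additive_subgroupD[OF I.abelian_group_axioms I.row_subgroup[of 0]]
 show "\<theta> \<in> graded_hom (deg0_alg S) (mod_row induced 0) N"
 proof (rule graded_homI)
  show "\<theta> f \<in> carrier N" if "f \<in> carrier (mod_row induced 0)" for f using th[OF that] t[OF that] tensors_closed by simp
  show "\<theta> (f \<oplus>\<^bsub>mod_row induced 0\<^esub> g) = \<theta> f \<oplus>\<^bsub>N\<^esub> \<theta> g"
   if "f \<in> carrier (mod_row induced 0)" "g \<in> carrier (mod_row induced 0)" for f g
   using th[OF G(3)[OF that]] th[OF that(1)] th[OF that(2)] by simp
  show "\<theta> (f \<bullet>\<^bsub>mod_row induced 0\<^esub> c) = \<theta> f \<bullet>\<^bsub>N\<^esub> c"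
   if f: "f \<in> carrier (mod_row induced 0)" and c: "c \<in> carrier (deg0_alg S)" for f c
  proof -
   have c0: "c \<in> row S 0" using c by simp
   have "f \<bullet>\<^bsub>induced\<^esub> c \<in> carrier (mod_row induced 0)" using I.row_act[OF f c0] by simp
   from th[OF this] show ?thesis
    using th[OF f] tensors_act[OF t[OF f] one_closed c0] rowc[OF c0] by simp
  qed
  show "\<theta> f \<in> mcomp N j" if f: "f \<in> mcomp (mod_row induced 0) j" for f j
  proof -
   have f': "f \<in> mcomp induced (0, j)" using f by simp
   then have "f \<one> \<in> (if fst ((0::int, j) + 0) = 0 then mcomp N (snd ((0::int, j) + 0)) else {\<zero>\<^bsub>N\<^esub>})"
    using one_homog unfolding induced_mcomp by blast
   then show ?thesis using th[OF I.homog_row[OF f']] by simp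
  qed
  show "\<theta> \<in> extensional (carrier (mod_row induced 0))" by (simp add: \<theta>_def)
 qed
 show "bij_betw \<theta> (carrier (mod_row induced 0)) (carrier N)"
 proof (rule bij_betw_byWitness[where f' = "\<lambda>n. tensor n \<one>"])
  show "\<forall>n\<in>carrier N. \<theta> (tensor n \<one>) = n"
   using th[OF tensor_row[OF _ one_row]] p0_row[OF one_row] by (simp add: tensor_app N_act)
  show "\<theta> ` carrier (mod_row induced 0) \<subseteq> carrier N" using th t tensors_closed by auto
  show "(\<lambda>n. tensor n \<one>) ` carrier N \<subseteq> carrier (mod_row induced 0)" using tensor_row[OF _ one_row] by auto
  show "\<forall>f\<in>carrier (mod_row induced 0). tensor (\<theta> f) \<one> = f"
  proof
   fix f assume f: "f \<in> carrier (mod_row induced 0)"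
   note ft = t[OF f]
   have c: "f \<one> \<in> carrier N" using tensors_closed[OF ft] by simp
   have "tensor (f \<one>) \<one> t = f t" if "t \<in> carrier S" for t
    using that
   proof (induction rule: homogeneous_induct)
    case zero
    have "f \<zero> = \<zero>\<^bsub>N\<^esub>"
     by (rule additive_map_zero[OF is_abelian_group N.abelian_group_axioms])
       (use tensorsD(2,3)[OF ft] in auto)
    then show ?case using c by (simp add: tensor_app N_act)
   next
    case (homog g t)
    then have t: "t \<in> row S (fst g)" using homog_row_ring[of t "fst g" "snd g"] by simp
    show ?case
     using p0_row[OF t] rowc[OF t] row_support[OF f t] c tensors_act[OF ft one_closed, of t] t
     by (auto simp: tensor_app N_act)
   next
    case (add t u)
    then show ?case using tensors_add[OF tensor_in[OF c one_closed] add(1,2)] tensors_add[OF ft add(1,2)] by simp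
   qed
   then show "tensor (\<theta> f) \<one> = f" using tensors_eqI[OF tensor_in[OF c one_closed] ft] th[OF f] by simp
  qed
 qed
qed

text \<open>Generators are the \<open>n \<otimes> s\<close> for generators \<open>n\<close> of \<open>N\<close> and \<open>s\<close> of \<open>S\<^sub>i\<close>: in \<open>n c \<otimes> s = n \<otimes> c s\<close> the element
  \<open>c s\<close> of \<open>S\<^sub>i\<close> is a combination of generators.\<close>

lemma induced_row_fin_gen:
 assumes N_fg: "fg_module (deg0_alg S) N"
  and S_fg: "fin_gen (row S 0) S (\<lambda>s x. x \<otimes> s) (row S i)"
 shows "fg_module (deg0_alg S) (mod_row induced i)"
proof -
 interpret Q: gmod "deg0_alg S" "mod_row induced i" by (rule R0.gmodI[OF I.mod_row_graded_module])
 obtain E where E: "finite E" "E \<subseteq> carrier N" "carrier N = span_by (carrier (deg0_alg S)) N (\<lambda>s x. x \<bullet>\<^bsub>N\<^esub> s) E"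
  using N_fg unfolding fg_module_def fin_gen_def by (elim exE conjE)
 obtain B where B: "finite B" "B \<subseteq> row S i" "row S i = span_by (row S 0) S (\<lambda>s x. x \<otimes> s) B"
  using S_fg unfolding fin_gen_def by (elim exE conjE)
 let ?T = "(\<lambda>(n, t). tensor n t) ` (E \<times> B)"
 have T: "finite ?T" "?T \<subseteq> carrier (mod_row induced i)" using E(1,2) B(1,2) by (auto intro!: tensor_row)
 define V where "V = Q.gen ?T"
 have sV: "Q.submod V" unfolding V_def by (rule Q.submod_gen[OF T(2)])
 note vD = Q.submodD[OF sV, unfolded mod_row_simps deg0_simps]
 have Vminus: "\<ominus>\<^bsub>induced\<^esub> f \<in> V" if "f \<in> V" for f
 proof -
  have "f \<bullet>\<^bsub>induced\<^esub> (\<ominus> \<one>) = \<ominus>\<^bsub>induced\<^esub> f"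
   using I.act_minus_right[of f \<one>] I.act_one[of f] I.row_in[OF subsetD[OF vD(1) that]] by (simp del: induced_simps)
  then show ?thesis using vD(4)[OF that rowD(4)[OF one_row]] by (simp del: induced_simps)
 qed
 have gens: "tensor n s \<in> V" if n: "n \<in> E" and s: "s \<in> row S i" for n s
 proof -
  have nc: "n \<in> carrier N" using n E by auto
  have W: "additive_subgroup {s \<in> carrier S. tensor n s \<in> V} S"
  proof (rule additive_subgroupI_closed[OF is_abelian_group])
   have m: "tensor n (\<ominus> x) = \<ominus>\<^bsub>induced\<^esub> tensor n x" if "x \<in> carrier S" for x
    by (rule additive_map_minus[OF is_abelian_group I.abelian_group_axioms])
      (use nc that tensor_in tensor_add(1) in auto)
   show "\<ominus> x \<in> {s \<in> carrier S. tensor n s \<in> V}" if "x \<in> {s \<in> carrier S. tensor n s \<in> V}" for x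
    using that Vminus m by auto
  qed (use nc vD(2,3) tensor_add(1,3) in auto)
  have "span_by (row S 0) S (\<lambda>s x. x \<otimes> s) B \<subseteq> {s \<in> carrier S. tensor n s \<in> V}"
  proof (rule span_by_subset[OF is_abelian_group W])
   fix c b assume c: "c \<in> row S 0" and b: "b \<in> B"
   have bc: "b \<in> carrier S" using b B(2) rowc by blast
   have "tensor n b \<in> V" using Q.gen_superset[of ?T] n b unfolding V_def by auto
   then have "tensor n b \<bullet>\<^bsub>induced\<^esub> c \<in> V" using vD(4) c by blast
   then show "b \<otimes> c \<in> {s \<in> carrier S. tensor n s \<in> V}"
    using tensor_act[OF nc bc rowc[OF c]] bc rowc[OF c] by simp
  qed
  then show ?thesis using s B(3) by blast
 qed
 have W: "additive_subgroup {n \<in> carrier N. \<forall>s\<in>row S i. tensor n s \<in> V} N"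
 proof (rule additive_subgroupI_closed[OF N.abelian_group_axioms])
  have m: "tensor (\<ominus>\<^bsub>N\<^esub> x) s = \<ominus>\<^bsub>induced\<^esub> tensor x s" if "x \<in> carrier N" "s \<in> carrier S" for x s
   by (rule additive_map_minus[OF N.abelian_group_axioms I.abelian_group_axioms, where h = "\<lambda>n. tensor n s"])
     (use that tensor_in tensor_add(2) in auto)
  show "\<ominus>\<^bsub>N\<^esub> x \<in> {n \<in> carrier N. \<forall>s\<in>row S i. tensor n s \<in> V}"
   if "x \<in> {n \<in> carrier N. \<forall>s\<in>row S i. tensor n s \<in> V}" for x
   using that Vminus m rowc by auto
 qed (use vD(2,3) tensor_add(2,4) rowc in auto)
 have "span_by (carrier (deg0_alg S)) N (\<lambda>s x. x \<bullet>\<^bsub>N\<^esub> s) E \<subseteq> {n \<in> carrier N. \<forall>s\<in>row S i. tensor n s \<in> V}"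
 proof (rule span_by_subset[OF N.abelian_group_axioms W])
  fix c n assume c: "c \<in> carrier (deg0_alg S)" and n: "n \<in> E"
  have c0: "c \<in> row S 0" using c by simp
  have nc: "n \<in> carrier N" using n E by auto
  have "tensor (n \<bullet>\<^bsub>N\<^esub> c) s \<in> V" if s: "s \<in> row S i" for s
   unfolding tensor_add(5)[OF nc c0 rowc[OF s]] using gens[OF n] row_mult[OF c0 s] by simp
  then show "n \<bullet>\<^bsub>N\<^esub> c \<in> {n \<in> carrier N. \<forall>s\<in>row S i. tensor n s \<in> V}" using N_act(1)[OF nc c0] by simp
 qed
 then have all: "tensor n s \<in> V" if "n \<in> carrier N" "s \<in> row S i" for n s using that E(3) by blast
 let ?p = "part induced (mcomp induced) {g. fst g = i}"
 have part: "?p f \<in> V" if "f \<in> tensors" for f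
  using that
 proof (induction rule: tensors_homogeneous_induct)
  case zero
  show ?case using vD(2) by (simp del: induced_simps)
 next
  case (tensor n s a k b)
  show ?case
   using I.part_homog[OF tensor_homog[OF tensor], of "{g. fst g = i}"] all[OF N.D_carrier[OF tensor(1)], of s]
    homog_row_ring[OF tensor(2)] vD(2) by (auto simp del: induced_simps)
 next
  case (plus f g)
  have "?p (f \<oplus>\<^bsub>induced\<^esub> g) = ?p f \<oplus>\<^bsub>induced\<^esub> ?p g" by (rule I.part_add) (use plus in auto)
  then show ?case using vD(3)[OF plus(3,4)] by (simp del: induced_simps)
 qed
 have "carrier (mod_row induced i) \<subseteq> V"
 proof
  fix f assume f: "f \<in> carrier (mod_row induced i)"
  have "?p f = f" by (rule I.part_eq_self) (use f in \<open>auto simp: I.row_carrier\<close>)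
  then show "f \<in> V" using part[of f] I.row_in[OF f] by simp
 qed
 then have "carrier (mod_row induced i) = V" using vD(1) by (rule equalityI)
 then show ?thesis unfolding fg_module_def using Q.fin_gen_iff[OF subset_refl] T V_def by blast
qed

end

section \<open>Closure properties of finitely generated modules\<close>

lemma fin_gen_restricted_carrier:
 assumes "abelian_group G" "abelian_group H" "carrier H \<subseteq> carrier G" "add H = add G"
  and sc: "\<And>c b. c \<in> C ==> b \<in> V ==> sc c b \<in> carrier H"
 shows "fin_gen C H sc V \<longleftrightarrow> fin_gen C G sc V"
proof -
 have "span_by C H sc B = span_by C G sc B" if B: "B \<subseteq> V" for B
 proof -
  have eq: "(\<Oplus>\<^bsub>H\<^esub>b\<in>T. sc (c b) b) = (\<Oplus>\<^bsub>G\<^esub>b\<in>T. sc (c b) b)" if "T \<subseteq> B" "c \<in> T \<rightarrow> C" for T c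
   by (rule finsum_restricted_carrier[OF assms(1-4)]) (use that B in \<open>auto intro!: sc\<close>)
  show ?thesis
  proof (intro equalityI subsetI)
   fix x assume "x \<in> span_by C H sc B"
   then obtain T c where T: "finite T" "T \<subseteq> B" "c \<in> T \<rightarrow> C" and x: "x = (\<Oplus>\<^bsub>H\<^esub>b\<in>T. sc (c b) b)"
    by (auto simp: span_by_def)
   show "x \<in> span_by C G sc B" unfolding span_by_def x eq[OF T(2,3)] using T by blast
  next
   fix x assume "x \<in> span_by C G sc B"
   then obtain T c where T: "finite T" "T \<subseteq> B" "c \<in> T \<rightarrow> C" and x: "x = (\<Oplus>\<^bsub>G\<^esub>b\<in>T. sc (c b) b)"
    by (auto simp: span_by_def)
   show "x \<in> span_by C H sc B" unfolding span_by_def x eq[OF T(2,3), symmetric] using T by blast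
  qed
 qed
 then show ?thesis unfolding fin_gen_def by (intro ex_cong1 conj_cong refl) simp
qed

lemma (in gmod) fg_sub_mod:
 assumes "right_noetherian R" "fg_module R M" "gs U" shows "fg_module R (sub_mod M U)"
proof -
 have "fin_gen (carrier R) M (\<lambda>r x. x \<bullet> r) U"
  by (rule noetherian_submodule_fin_gen[OF assms(1) gsD(10)[OF assms(3)] submod_carrier gsD(2)[OF assms(3)]
     assms(2)[unfolded fg_module_def]])
 moreover have "abelian_group (sub_mod M U)" using sub_mod(1)[OF assms(3)] by (simp add: graded_module_def)
 ultimately show ?thesis
  using fin_gen_restricted_carrier[of M "sub_mod M U" "carrier R" U "\<lambda>r x. x \<bullet> r"] gsD(2,7)[OF assms(3)]
   abelian_group_axioms
  by (simp add: fg_module_def)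
qed

lemma (in ghom) fg_image:
 assumes "fg_module R M" "f ` carrier M = carrier N" shows "fg_module R N"
proof -
 obtain B where B: "finite B" "B \<subseteq> carrier M" "carrier M = M.gen B"
  using assms(1) unfolding fg_module_def M.fin_gen_iff[OF subset_refl] by (elim exE conjE)
 have fB: "f ` B \<subseteq> carrier N" using B(2) hom_closed by auto
 note V = N.submodD[OF N.submod_gen[OF fB]]
 have "M.submod {x \<in> carrier M. f x \<in> N.gen (f ` B)}"
  unfolding M.submod_def using V(2-4) by (auto simp: hom_zero hom_add hom_act)
 then have "M.gen B \<subseteq> {x \<in> carrier M. f x \<in> N.gen (f ` B)}"
  by (rule M.gen_least) (use B(2) N.gen_superset[of "f ` B"] in auto)
 then have "f x \<in> N.gen (f ` B)" if "x \<in> carrier M" for x using that B(3) by auto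
 then have "f ` carrier M \<subseteq> N.gen (f ` B)" by (rule image_subsetI)
 then have "carrier N \<subseteq> N.gen (f ` B)" unfolding assms(2) .
 then have "carrier N = N.gen (f ` B)" using V(1) by (rule equalityI)
 then show ?thesis unfolding fg_module_def N.fin_gen_iff[OF subset_refl] using B(1) fB by blast
qed

lemma (in gmod2) fg_dsum:
 assumes "fg_module R M" "fg_module R N" shows "fg_module R (dsum M N)"
proof -
 obtain B where B: "finite B" "B \<subseteq> carrier M" "carrier M = M.gen B"
  using assms(1) unfolding fg_module_def M.fin_gen_iff[OF subset_refl] by (elim exE conjE)
 obtain E where E: "finite E" "E \<subseteq> carrier N" "carrier N = N.gen E"
  using assms(2) unfolding fg_module_def N.fin_gen_iff[OF subset_refl] by (elim exE conjE)
 let ?T = "(\<lambda>x. (x, \<zero>\<^bsub>N\<^esub>)) ` B \<union> (\<lambda>y. (\<zero>\<^bsub>M\<^esub>, y)) ` E"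
 have T: "finite ?T" "?T \<subseteq> carrier (dsum M N)" using B(1,2) E(1,2) by auto
 define V where "V = P.gen ?T"
 have sup: "?T \<subseteq> V" unfolding V_def by (rule P.gen_superset)
 have "P.submod V" unfolding V_def by (rule P.submod_gen[OF T(2)])
 note v = P.submodD[OF this]
 have "M.submod {x \<in> carrier M. (x, \<zero>\<^bsub>N\<^esub>) \<in> V}"
  unfolding M.submod_def using v(2) v(3)[of "(_, \<zero>\<^bsub>N\<^esub>)" "(_, \<zero>\<^bsub>N\<^esub>)"] v(4)[of "(_, \<zero>\<^bsub>N\<^esub>)"] by auto
 then have "M.gen B \<subseteq> {x \<in> carrier M. (x, \<zero>\<^bsub>N\<^esub>) \<in> V}" by (rule M.gen_least) (use B(2) sup in auto)
 then have 1: "(x, \<zero>\<^bsub>N\<^esub>) \<in> V" if "x \<in> carrier M" for x using that B(3) by blast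
 have "N.submod {y \<in> carrier N. (\<zero>\<^bsub>M\<^esub>, y) \<in> V}"
  unfolding N.submod_def using v(2) v(3)[of "(\<zero>\<^bsub>M\<^esub>, _)" "(\<zero>\<^bsub>M\<^esub>, _)"] v(4)[of "(\<zero>\<^bsub>M\<^esub>, _)"] by auto
 then have "N.gen E \<subseteq> {y \<in> carrier N. (\<zero>\<^bsub>M\<^esub>, y) \<in> V}" by (rule N.gen_least) (use E(2) sup in auto)
 then have 2: "(\<zero>\<^bsub>M\<^esub>, y) \<in> V" if "y \<in> carrier N" for y using that E(3) by blast
 have "carrier (dsum M N) \<subseteq> V"
  using v(3)[OF 1 2] by auto
 then have "carrier (dsum M N) = V" using v(1) by (rule equalityI)
 then show ?thesis unfolding fg_module_def P.fin_gen_iff[OF subset_refl] using T V_def by blast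
qed

lemma fg_zero: assumes "abelian_group M" "carrier M = {\<zero>\<^bsub>M\<^esub>}" shows "fg_module R M"
proof -
 interpret abelian_group M by fact
 show ?thesis unfolding fg_module_def fin_gen_def
  by (intro exI[of _ "{}"]) (auto simp: span_by_def assms(2))
qed

section \<open>Classes of modules\<close>

definition zero_module :: "'m \<Rightarrow> ('g, 'a, 'm) graded_mod" where
 "zero_module z = \<lparr>carrier = {z}, monoid.mult = undefined, one = undefined, ring.zero = z,
   add = (\<lambda>_ _. z), ract = (\<lambda>_ _. z), mcomp = (\<lambda>_. {z})\<rparr>"

lemma zero_module: "graded_module R (zero_module z)"
proof -
 have G: "abelian_group (zero_module z)" by (rule abelian_groupI) (auto simp: zero_module_def)
 interpret G: abelian_group "zero_module z" by (rule G)
 have z: "\<ominus>\<^bsub>zero_module z\<^esub> z = z" using G.zero_minus_zero by (simp add: zero_module_def)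
 have "direct_sum_decomp (zero_module z) (mcomp (zero_module z))"
 proof (rule direct_sum_decompI_projections[OF G, where p = "\<lambda>_ _. z"])
  show "additive_subgroup (mcomp (zero_module z) g) (zero_module z)" for g
   by (rule additive_subgroupI_closed[OF G]) (auto simp: zero_module_def z[unfolded zero_module_def])
 qed (auto simp: zero_module_def)
 then show ?thesis unfolding graded_module_def using G by (auto simp: zero_module_def)
qed

lemma (in gmod) img_mod_inj:
 assumes "inj_on q (carrier M)"
 shows "graded_module R (img_mod q M)" "restrict q (carrier M) \<in> graded_hom R M (img_mod q M)"
  "restrict q (carrier M) ` carrier M = carrier (img_mod q M)"
proof -
 have "q x = q y \<longleftrightarrow> x \<ominus> y \<in> {\<zero>}" if "x \<in> carrier M" "y \<in> carrier M" for x y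
  using diff_eq_zero[OF that] inj_on_eq_iff[OF assms that] by simp
 from img_mod[OF gs_zero this] show "graded_module R (img_mod q M)"
  "restrict q (carrier M) \<in> graded_hom R M (img_mod q M)"
  "restrict q (carrier M) ` carrier M = carrier (img_mod q M)" by blast+
qed

text \<open>A pairing function moves the direct sum of two modules into the universe.\<close>

lemma (in gabriel) module_classI:
 fixes P :: "('g, 'a, 'm) graded_mod \<Rightarrow> bool"
 assumes pairing: "\<And>M N :: ('g, 'a, 'm) graded_mod. graded_module R M ==> graded_module R N ==>
   \<exists>j :: 'm \<times> 'm \<Rightarrow> 'm. inj_on j (carrier M \<times> carrier N)"
  and zero: "\<And>z. P (zero_module z)"
  and sub: "\<And>M U. graded_module R M ==> P M ==> graded_submodule R M U ==> P (sub_mod M U)"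
  and image: "\<And>M N f. graded_module R M ==> P M ==> graded_module R N ==> f \<in> graded_hom R M N ==>
   f ` carrier M = carrier N ==> P N"
  and sum: "\<And>M N Q f. graded_module R M ==> P M ==> graded_module R N ==> P N ==> graded_module R Q ==>
   f \<in> graded_hom R (dsum M N) Q ==> f ` carrier (dsum M N) = carrier Q ==> P Q"
 shows "module_class R GG {M. graded_module R M \<and> P M}"
proof (intro module_class.intro gabriel_axioms module_class_axioms.intro)
 show "{M. graded_module R M \<and> P M} \<noteq> {}" using zero[of undefined] zero_module[of R undefined] by auto
 show "sub_mod M U \<in> {M. graded_module R M \<and> P M}"
  if "M \<in> {M. graded_module R M \<and> P M}" "graded_submodule R M U" for M U
  using that sub[of M U] gmod.sub_mod(1)[OF gmodI] by auto
 show "N \<in> {M. graded_module R M \<and> P M}"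
  if "M \<in> {M. graded_module R M \<and> P M}" "graded_module R N" "f \<in> graded_hom R M N" "f ` carrier M = carrier N"
  for M N f
  using that image[of M N f] by auto
 show "\<exists>j :: 'm \<times> 'm \<Rightarrow> 'm. inj_on j (carrier M \<times> carrier N) \<and> img_mod j (dsum M N) \<in> {M. graded_module R M \<and> P M}"
  if M: "M \<in> {M. graded_module R M \<and> P M}" and N: "N \<in> {M. graded_module R M \<and> P M}" for M N
 proof -
  have gM: "graded_module R M" "P M" and gN: "graded_module R N" "P N" using M N by auto
  obtain j :: "'m \<times> 'm \<Rightarrow> 'm" where j: "inj_on j (carrier M \<times> carrier N)" using pairing[OF gM(1) gN(1)] by blast
  interpret gmod2 R M N by (intro gmod2.intro gmodI gM gN)
  have j': "inj_on j (carrier (dsum M N))" using j by simp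
  note I = P.img_mod_inj[OF j']
  show ?thesis using sum[OF gM gN I] I(1) j by auto
 qed
qed auto

lemma (in gabriel) torsion_classI:
 assumes "module_class R GG {M. graded_module R M \<and> P M}"
  and "\<And>M. graded_module R M ==> Q M \<longleftrightarrow> carrier M \<subseteq> tor GG M"
 shows "torsion_class R GG {M. graded_module R M \<and> P M} {M \<in> {M. graded_module R M \<and> P M}. Q M}"
 by (intro torsion_class.intro torsion_class_axioms.intro assms(1)) (use assms(2) in auto)

lemma (in bigraded_mod) mod_row_sub_mod:
 assumes U: "gs U"
 shows "mod_row (sub_mod M U) i = sub_mod (mod_row M i) (U \<inter> carrier (mod_row M i))"
proof -
 interpret Q: bigraded_mod S "sub_mod M U" by (intro bigraded_mod.intro R.gmodI sub_mod(1)[OF U])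
 interpret i: ghom S "sub_mod M U" M "restrict (\<lambda>x. x) U" by (rule R.ghomI[OF sub_mod(1)[OF U] gm sub_mod(2)[OF U]])
 have "Q.hc g x = hc g x" if "x \<in> U" for x g
  using i.hom_hc[of x g] Q.hc_closed[of x g] that by simp
 then have c: "carrier (mod_row (sub_mod M U) i) = U \<inter> carrier (mod_row M i)"
  unfolding Q.row_carrier row_carrier using gsD(9)[OF U] by auto
 show ?thesis
  by (rule graded_mod.equality)
    (use c homog_row in \<open>auto simp: fun_eq_iff, auto simp: mod_row_def sub_mod_def\<close>)
qed

section \<open>Isomorphisms of graded modules\<close>

lemma (in graded_ring) inverse_hom:
 assumes M: "graded_module R M" and N: "graded_module R N" and f: "f \<in> graded_hom R M N"
  and b: "bij_betw f (carrier M) (carrier N)"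
 shows "restrict (inv_into (carrier M) f) (carrier N) \<in> graded_hom R N M"
proof -
 interpret f: ghom R M N f by (rule ghomI[OF M N f])
 let ?g = "inv_into (carrier M) f"
 have gc: "?g y \<in> carrier M" and fg: "f (?g y) = y" if "y \<in> carrier N" for y
  using that bij_betw_imp_surj_on[OF b] by (auto intro: inv_into_into f_inv_into_f)
 have gf: "?g (f x) = x" if "x \<in> carrier M" for x by (rule inv_into_f_f[OF bij_betw_imp_inj_on[OF b] that])
 show ?thesis
 proof (rule graded_homI)
  show "restrict ?g (carrier N) (x \<oplus>\<^bsub>N\<^esub> y) = restrict ?g (carrier N) x \<oplus>\<^bsub>M\<^esub> restrict ?g (carrier N) y"
   if "x \<in> carrier N" "y \<in> carrier N" for x y
   using that gf[of "?g x \<oplus>\<^bsub>M\<^esub> ?g y"] gc fg by (simp add: f.hom_add)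
  show "restrict ?g (carrier N) (x \<bullet>\<^bsub>N\<^esub> s) = restrict ?g (carrier N) x \<bullet>\<^bsub>M\<^esub> s"
   if "x \<in> carrier N" "s \<in> carrier R" for x s
   using that gf[of "?g x \<bullet>\<^bsub>M\<^esub> s"] gc fg by (simp add: f.hom_act)
  show "restrict ?g (carrier N) y \<in> mcomp M g" if y: "y \<in> mcomp N g" for y g
  proof -
   have yc: "y \<in> carrier N" using f.N.D_carrier[OF y] .
   have "f (f.M.hc g (?g y)) = y" using f.hom_hc[OF gc[OF yc]] fg[OF yc] f.N.hc_homog[OF y] by simp
   then have "f.M.hc g (?g y) = ?g y" using gf[of "f.M.hc g (?g y)"] gc[OF yc] by simp
   then show ?thesis using f.M.hc_in[OF gc[OF yc], of g] yc by simp
  qed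
 qed (use gc in auto)
qed

lemma (in graded_ring) is_isoI:
 assumes M: "graded_module R M" and N: "graded_module R N" and f: "f \<in> graded_hom R M N"
  and b: "bij_betw f (carrier M) (carrier N)"
 shows "is_iso (mod_cat R B) M N f"
 unfolding is_iso_def mod_cat_def category.simps
proof (intro conjI bexI)
 show "restrict (inv_into (carrier M) f) (carrier N) \<in> graded_hom R N M" by (rule inverse_hom[OF assms])
 show "compose (carrier M) (restrict (inv_into (carrier M) f) (carrier N)) f = (\<lambda>x\<in>carrier M. x)"
  by (rule restrict_ext[THEN trans[OF compose_def]])
    (use b graded_homD(1)[OF f] in \<open>auto simp: bij_betw_def\<close>)
 show "compose (carrier N) f (restrict (inv_into (carrier M) f) (carrier N)) = (\<lambda>x\<in>carrier N. x)"
  by (rule restrict_ext[THEN trans[OF compose_def]])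
    (use b in \<open>auto simp: bij_betw_def f_inv_into_f\<close>)
qed (rule f)

section \<open>Room in the universe\<close>

lemma infinite_pairing:
 assumes "infinite (UNIV :: 'm set)" shows "\<exists>p :: 'm \<times> 'm \<Rightarrow> 'm. inj p"
proof -
 have "|UNIV \<times> UNIV :: ('m \<times> 'm) set| =o |UNIV :: 'm set|" by (rule card_of_Times_same_infinite[OF assms])
 then show ?thesis using card_of_ordIso[of "UNIV \<times> UNIV :: ('m \<times> 'm) set" "UNIV :: 'm set"]
  by (auto simp: bij_betw_def)
qed

lemma infinite_list_coding:
 assumes "infinite (UNIV :: 'm set)" shows "\<exists>c :: 'm list \<Rightarrow> 'm. inj c"
proof -
 obtain p :: "'m \<times> 'm \<Rightarrow> 'm" where p: "inj p" using infinite_pairing[OF assms] by blast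
 obtain z :: "nat \<Rightarrow> 'm" where z: "inj z" using infinite_countable_subset[OF assms] by blast
 define fold where "fold xs = foldr (\<lambda>x y. p (x, y)) xs (z 0)" for xs
 have len: "fold xs = fold ys ==> xs = ys" if "length xs = length ys" for xs ys
  using that by (induction xs ys rule: list_induct2) (auto simp: fold_def dest!: injD[OF p])
 have "inj (\<lambda>xs. p (z (length xs), fold xs))"
 proof (rule injI)
  fix xs ys assume "p (z (length xs), fold xs) = p (z (length ys), fold ys)"
  then have "z (length xs) = z (length ys)" "fold xs = fold ys" using injD[OF p] by blast+
  then show "xs = ys" using len injD[OF z] by blast
 qed
 then show ?thesis by blast
qed

text \<open>A sum of tensors is coded by the list of the pairs \<open>(n, s)\<close> that occur in it.\<close>

lemma (in coefficient_module) tensors_coding: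
 fixes e :: "'a \<Rightarrow> 'm"
 assumes "infinite (UNIV :: 'm set)" and e: "inj_on e (carrier S)"
 shows "\<exists>j :: ('a \<Rightarrow> 'm) \<Rightarrow> 'm. inj_on j tensors"
proof -
 define val where "val xs = foldr (\<lambda>(n, s) f. \<lambda>t\<in>carrier S. f t \<oplus>\<^bsub>N\<^esub> tensor n s t) xs
  (\<lambda>t\<in>carrier S. \<zero>\<^bsub>N\<^esub>)" for xs
 have "\<exists>xs. set xs \<subseteq> UNIV \<times> carrier S \<and> val xs = f" if "f \<in> tensors" for f
  using that
 proof induction
  case zero
  show ?case by (intro exI[of _ "[]"]) (simp add: val_def)
 next
  case (add f n s)
  then obtain xs where "set xs \<subseteq> UNIV \<times> carrier S" "val xs = f" by blast
  then show ?case using add(3) by (intro exI[of _ "(n, s) # xs"]) (simp add: val_def)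
 qed
 then obtain rep where rep: "\<And>f. f \<in> tensors ==> set (rep f) \<subseteq> UNIV \<times> carrier S \<and> val (rep f) = f" by metis
 obtain p :: "'m \<times> 'm \<Rightarrow> 'm" where p: "inj p" using infinite_pairing[OF assms(1)] by blast
 obtain c :: "'m list \<Rightarrow> 'm" where c: "inj c" using infinite_list_coding[OF assms(1)] by blast
 have m: "inj_on (\<lambda>(n, s). p (n, e s)) (UNIV \<times> carrier S)"
  by (auto simp: inj_on_def inj_eq[OF p] inj_on_eq_iff[OF e])
 have "inj_on (\<lambda>f. c (map (\<lambda>(n, s). p (n, e s)) (rep f))) tensors"
 proof (rule inj_onI)
  fix f g assume f: "f \<in> tensors" and g: "g \<in> tensors"
   and "c (map (\<lambda>(n, s). p (n, e s)) (rep f)) = c (map (\<lambda>(n, s). p (n, e s)) (rep g))"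
  then have "map (\<lambda>(n, s). p (n, e s)) (rep f) = map (\<lambda>(n, s). p (n, e s)) (rep g)" using injD[OF c] by blast
  then have "rep f = rep g"
   using map_inj_on[of "\<lambda>(n, s). p (n, e s)" "rep f" "rep g"] inj_on_subset[OF m] rep[OF f] rep[OF g] by blast
  then show "f = g" using rep[OF f] rep[OF g] by metis
 qed
 then show ?thesis by blast
qed

lemma graded_module_over_zero_ring:
 assumes "graded_ring R" "\<one>\<^bsub>R\<^esub> = \<zero>\<^bsub>R\<^esub>" "graded_module R M" shows "carrier M = {\<zero>\<^bsub>M\<^esub>}"
proof -
 interpret M: gmod R M by (rule graded_ring.gmodI[OF assms(1,3)])
 have "x = \<zero>\<^bsub>M\<^esub>" if "x \<in> carrier M" for x
  using M.act_one[OF that] M.act_zero_right[OF that] assms(2) by simp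
 then show ?thesis by auto
qed

context bigraded_setting
begin

text \<open>In characteristic \<open>0\<close> the multiples of \<open>1\<close> are distinct unless \<open>1 = 0\<close>.\<close>

lemma trivial_or_infinite:
 assumes char0: "\<forall>n::nat. n > 0 \<longrightarrow> [n] \<cdot>\<^bsub>K\<^esub> \<one>\<^bsub>K\<^esub> \<noteq> \<zero>\<^bsub>K\<^esub>"
 shows "\<one> = \<zero> \<or> infinite (carrier S)"
proof (rule disjCI)
 assume "\<not> infinite (carrier S)"
 then have fin: "finite (carrier S)" by simp
 interpret A: Module.module K S using alg by (simp add: graded_algebra_def)
 let ?u = "\<lambda>n::nat. [n] \<cdot>\<^bsub>K\<^esub> \<one>\<^bsub>K\<^esub>"
 have u: "?u n \<in> carrier K" for n by simp
 have "\<not> inj (\<lambda>n. ?u n \<odot> \<one>)"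
  using finite_subset[OF _ fin, of "range (\<lambda>n. ?u n \<odot> \<one>)"] u finite_imageD[of "\<lambda>n. ?u n \<odot> \<one>" UNIV]
   A.smult_closed by auto
 then obtain k l where kl: "?u k \<odot> \<one> = ?u l \<odot> \<one>" "k < l"
  unfolding inj_def by (metis nat_neq_iff)
 have "?u l = ?u k \<oplus>\<^bsub>K\<^esub> ?u (l - k)"
  using add.nat_pow_mult[of "\<one>\<^bsub>K\<^esub>" k "l - k"] kl(2) by simp
 then have "?u k \<odot> \<one> = ?u k \<odot> \<one> \<oplus> ?u (l - k) \<odot> \<one>"
  using kl(1) A.smult_l_distr[OF u u S.one_closed] by simp
 then have z: "?u (l - k) \<odot> \<one> = \<zero>"
  using S.add.l_cancel_one'[of "?u k \<odot> \<one>" "?u (l - k) \<odot> \<one>"] A.smult_closed[OF u S.one_closed] by simp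
 have "?u (l - k) \<in> Units K" using char0 kl(2) u by (simp add: field_Units)
 then have i: "inv\<^bsub>K\<^esub> ?u (l - k) \<in> carrier K" "inv\<^bsub>K\<^esub> ?u (l - k) \<otimes>\<^bsub>K\<^esub> ?u (l - k) = \<one>\<^bsub>K\<^esub>" by auto
 have "\<one> = (inv\<^bsub>K\<^esub> ?u (l - k) \<otimes>\<^bsub>K\<^esub> ?u (l - k)) \<odot> \<one>" using i(2) A.smult_one by simp
 also have "\<dots> = \<zero>" using A.smult_assoc1[OF i(1) u S.one_closed] z i(1) A.smult_r_null by simp
 finally show "\<one> = \<zero>" .
qed

lemma universe_cases:
 fixes e :: "'a \<Rightarrow> 'm"
 assumes "\<forall>n::nat. n > 0 \<longrightarrow> [n] \<cdot>\<^bsub>K\<^esub> \<one>\<^bsub>K\<^esub> \<noteq> \<zero>\<^bsub>K\<^esub>" and e: "inj_on e (carrier S)"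
 shows "\<one> = \<zero> \<or> infinite (UNIV :: 'm set)"
 using trivial_or_infinite[OF assms(1)] finite_imageD[OF _ e] finite_subset[OF subset_UNIV] by blast

text \<open>Over the zero ring a pair of modules has only one pair of elements.\<close>

lemma modules_pairing:
 fixes M N :: "('g::ab_group_add, 'a, 'm) graded_mod" and R :: "('k, 'g, 'a) graded_alg"
 assumes "\<one> = \<zero> \<or> infinite (UNIV :: 'm set)"
  and R: "graded_ring R" "\<one>\<^bsub>R\<^esub> = \<one>" "\<zero>\<^bsub>R\<^esub> = \<zero>"
  and M: "graded_module R M" and N: "graded_module R N"
 shows "\<exists>j :: 'm \<times> 'm \<Rightarrow> 'm. inj_on j (carrier M \<times> carrier N)"
proof (cases "infinite (UNIV :: 'm set)")
 case True
 then obtain p :: "'m \<times> 'm \<Rightarrow> 'm" where "inj p" using infinite_pairing by blast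
 then show ?thesis using inj_on_subset[OF _ subset_UNIV] by blast
next
 case False
 then have "\<one>\<^bsub>R\<^esub> = \<zero>\<^bsub>R\<^esub>" using assms(1) R(2,3) by simp
 then show ?thesis
  using graded_module_over_zero_ring[OF R(1) _ M] graded_module_over_zero_ring[OF R(1) _ N] by simp
qed

section \<open>The four module categories\<close>

lemma torsion_classes:
 assumes U: "\<one> = \<zero> \<or> infinite (UNIV :: 'm set)"
 shows "torsion_class S GG (GrMod S :: (int \<times> int, 'a, 'm) graded_mod set) (BiLTors K S)"
  "torsion_class R0 G0 (GrMod R0 :: (int, 'a, 'm) graded_mod set) (Tors K R0)"
  "torsion_class S GG (lbigrmod S :: (int \<times> int, 'a, 'm) graded_mod set) (lbiltors K S)"
  "torsion_class R0 G0 (grmod R0 :: (int, 'a, 'm) graded_mod set) (tors K R0)"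
proof -
 note pS = modules_pairing[OF U S.graded_ring_axioms refl refl]
 note pR = modules_pairing[OF U S.deg0_graded_ring deg0_simps(3,4)]
 have "module_class S GG {M :: (int \<times> int, 'a, 'm) graded_mod. graded_module S M \<and> True}"
  by (rule GS.module_classI) (use pS in auto)
 from GS.torsion_classI[OF this CS.torsion_wrt_iff]
 show "torsion_class S GG (GrMod S :: (int \<times> int, 'a, 'm) graded_mod set) (BiLTors K S)"
  by (simp add: GrMod_def BiLTors_def)
 have "module_class R0 G0 {M :: (int, 'a, 'm) graded_mod. graded_module R0 M \<and> True}"
  by (rule GR.module_classI) (use pR in auto)
 from GR.torsion_classI[OF this CR.torsion_wrt_iff]
 show "torsion_class R0 G0 (GrMod R0 :: (int, 'a, 'm) graded_mod set) (Tors K R0)"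
  by (simp add: GrMod_def Tors_def)
 have "module_class R0 G0 {M :: (int, 'a, 'm) graded_mod. graded_module R0 M \<and> fg_module R0 M}"
 proof (rule GR.module_classI)
  fix M N Q :: "(int, 'a, 'm) graded_mod" and W and f :: "'m \<Rightarrow> 'm" and h :: "'m \<times> 'm \<Rightarrow> 'm" and z :: 'm
  show "fg_module R0 (zero_module z :: (int, 'a, 'm) graded_mod)"
   by (rule fg_zero) (use zero_module[of R0 z] in \<open>auto simp: graded_module_def zero_module_def\<close>)
  assume M: "graded_module R0 M" "fg_module R0 M"
  show "fg_module R0 (sub_mod M W)" if "graded_submodule R0 M W"
   by (rule gmod.fg_sub_mod[OF S.R0.gmodI[OF M(1)] noetherian M(2) that])
  show "fg_module R0 N" if "graded_module R0 N" "f \<in> graded_hom R0 M N" "f ` carrier M = carrier N"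
   by (rule ghom.fg_image[OF S.R0.ghomI[OF M(1) that(1,2)] M(2) that(3)])
  assume N: "graded_module R0 N" "fg_module R0 N"
  interpret D: gmod2 R0 M N by (intro gmod2.intro S.R0.gmodI M N)
  show "fg_module R0 Q" if "graded_module R0 Q" "h \<in> graded_hom R0 (dsum M N) Q"
   "h ` carrier (dsum M N) = carrier Q"
   by (rule ghom.fg_image[OF S.R0.ghomI[OF D.dsum_graded_module that(1,2)] D.fg_dsum[OF M(2) N(2)] that(3)])
 qed (rule pR)
 from GR.torsion_classI[OF this CR.torsion_wrt_iff]
 show "torsion_class R0 G0 (grmod R0 :: (int, 'a, 'm) graded_mod set) (tors K R0)"
  by (simp add: GrMod_def grmod_def tors_def)
 have "module_class S GG {M :: (int \<times> int, 'a, 'm) graded_mod. graded_module S M \<and>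
   (\<forall>i. fg_module R0 (mod_row M i))}"
 proof (rule GS.module_classI)
  fix M N Q :: "(int \<times> int, 'a, 'm) graded_mod" and W and f :: "'m \<Rightarrow> 'm" and h :: "'m \<times> 'm \<Rightarrow> 'm" and z :: 'm
  show "\<forall>i. fg_module R0 (mod_row (zero_module z :: (int \<times> int, 'a, 'm) graded_mod) i)"
  proof
   fix i
   interpret Z: bigraded_mod S "zero_module z :: (int \<times> int, 'a, 'm) graded_mod" by (rule bmodI[OF zero_module])
   have "carrier (mod_row (zero_module z :: (int \<times> int, 'a, 'm) graded_mod) i) \<subseteq> {z}"
    using Z.row_subset[of i] by (simp add: zero_module_def)
   moreover have "z \<in> carrier (mod_row (zero_module z :: (int \<times> int, 'a, 'm) graded_mod) i)"
    using Z.row_zero[of i] by (simp add: zero_module_def)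
   moreover have "\<zero>\<^bsub>zero_module z :: (int \<times> int, 'a, 'm) graded_mod\<^esub> = z" by (simp add: zero_module_def)
   ultimately show "fg_module R0 (mod_row (zero_module z :: (int \<times> int, 'a, 'm) graded_mod) i)"
    by (intro fg_zero) (use Z.mod_row_graded_module[of i] in \<open>auto simp: graded_module_def\<close>)
  qed
  assume M: "graded_module S M" "\<forall>i. fg_module R0 (mod_row M i)"
  interpret BM: bigraded_mod S M by (rule bmodI[OF M(1)])
  note gMi = BM.mod_row_graded_module
  show "\<forall>i. fg_module R0 (mod_row (sub_mod M W) i)" if W: "graded_submodule S M W"
   unfolding BM.mod_row_sub_mod[OF W]
   using gmod.fg_sub_mod[OF S.R0.gmodI[OF gMi] noetherian _ BM.row_gs[OF W]] M(2) by blast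
  show "\<forall>i. fg_module R0 (mod_row N i)"
   if "graded_module S N" "f \<in> graded_hom S M N" "f ` carrier M = carrier N"
  proof
   fix i
   interpret BN: bigraded_mod S N by (rule bmodI[OF that(1)])
   note h = S.row_hom[OF M(1) that(1,2), of i]
   show "fg_module R0 (mod_row N i)"
    by (rule ghom.fg_image[OF S.R0.ghomI[OF gMi BN.mod_row_graded_module h(1)] M(2)[rule_format] h(2)[OF that(3)]])
  qed
  assume N: "graded_module S N" "\<forall>i. fg_module R0 (mod_row N i)"
  interpret BN: bigraded_mod S N by (rule bmodI[OF N(1)])
  show "\<forall>i. fg_module R0 (mod_row Q i)"
   if "graded_module S Q" "h \<in> graded_hom S (dsum M N) Q" "h ` carrier (dsum M N) = carrier Q"
  proof
   fix i
   interpret D: gmod2 S M N by (intro gmod2.intro S.gmodI M(1) N(1))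
   interpret BQ: bigraded_mod S Q by (rule bmodI[OF that(1)])
   interpret BD: bigraded_mod S "dsum M N" by (rule bmodI[OF D.dsum_graded_module])
   interpret DR: gmod2 R0 "mod_row M i" "mod_row N i"
    by (intro gmod2.intro S.R0.gmodI gMi BN.mod_row_graded_module)
   have fg: "fg_module R0 (mod_row (dsum M N) i)"
    unfolding mod_row_dsum[OF M(1) N(1)] by (rule DR.fg_dsum[OF M(2)[rule_format] N(2)[rule_format]])
   note h = S.row_hom[OF D.dsum_graded_module that(1,2), of i]
   show "fg_module R0 (mod_row Q i)"
    by (rule ghom.fg_image[OF S.R0.ghomI[OF BD.mod_row_graded_module BQ.mod_row_graded_module h(1)] fg h(2)[OF that(3)]])
  qed
 qed (rule pS)
 from GS.torsion_classI[OF this CS.torsion_wrt_iff]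
 show "torsion_class S GG (lbigrmod S :: (int \<times> int, 'a, 'm) graded_mod set) (lbiltors K S)"
  by (simp add: GrMod_def lbigrmod_def lbiltors_def)
qed

text \<open>The induced module consists of functions; a coding of these moves it into the universe.\<close>

lemma row0_essentially_surjective:
 fixes e :: "'a \<Rightarrow> 'm" and N :: "(int, 'a, 'm) graded_mod"
 assumes U: "\<one> = \<zero> \<or> infinite (UNIV :: 'm set)"
  and e: "inj_on e (carrier S)" and N: "graded_module R0 N"
 shows "\<exists>M :: (int \<times> int, 'a, 'm) graded_mod. graded_module S M \<and>
  (fg_module R0 N \<longrightarrow> (\<forall>i. fg_module R0 (mod_row M i))) \<and>
  (\<forall>B. \<exists>\<theta>. is_iso (mod_cat R0 B) (mod_row M 0) N \<theta>)"
proof -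
 interpret T: coefficient_module S N
  by (intro coefficient_module.intro S.bigraded_ring_axioms coefficient_module_axioms.intro N)
 have "\<exists>j :: ('a \<Rightarrow> 'm) \<Rightarrow> 'm. inj_on j T.tensors"
 proof (cases "infinite (UNIV :: 'm set)")
  case True
  then show ?thesis by (rule T.tensors_coding[OF _ e])
 next
  case False
  then have "carrier N = {\<zero>\<^bsub>N\<^esub>}"
   using U graded_module_over_zero_ring[OF S.deg0_graded_ring _ N] by simp
  then have "f = g" if "f \<in> T.tensors" "g \<in> T.tensors" for f g
   using T.tensors_eqI[OF that] T.tensors_closed[OF that(1)] T.tensors_closed[OF that(2)] by simp
  then show ?thesis by (intro exI inj_onI)
 qed
 then obtain j :: "('a \<Rightarrow> 'm) \<Rightarrow> 'm" where "inj_on j T.tensors" by blast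
 then have j: "inj_on j (carrier T.induced)" by simp
 let ?M = "img_mod j T.induced" and ?j = "restrict j (carrier T.induced)"
 note I = T.I.img_mod_inj[OF j]
 interpret BM: bigraded_mod S ?M by (rule bmodI[OF I(1)])
 note r = S.row_hom[OF T.induced_graded_module I(1,2)]
 note gr = T.I.mod_row_graded_module BM.mod_row_graded_module
 have "fg_module R0 (mod_row ?M i)" if "fg_module R0 N" for i
  by (rule ghom.fg_image[OF S.R0.ghomI[OF gr r(1)] T.induced_row_fin_gen[OF that right_fin_gen[rule_format]] r(2)[OF I(3)]])
 moreover have "\<exists>\<theta>. is_iso (mod_cat R0 B) (mod_row ?M 0) N \<theta>" for B
 proof -
  let ?C = "carrier (mod_row T.induced 0)" and ?D = "carrier (mod_row ?M 0)"
  let ?r = "restrict ?j ?C"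
  have "inj_on ?r ?C"
   using inj_on_subset[OF j T.I.row_subset[of 0]] T.I.row_in[of _ 0] by (auto simp: inj_on_def)
  then have b: "bij_betw ?r ?C ?D" using r(2)[OF I(3), of 0] by (simp only: bij_betw_def)
  let ?s = "restrict (inv_into ?C ?r) ?D"
  have s: "?s \<in> graded_hom R0 (mod_row ?M 0) (mod_row T.induced 0)"
   by (rule S.R0.inverse_hom[OF gr r(1) b])
  have sb: "bij_betw ?s ?D ?C"
   using bij_betw_inv_into[OF b] by (rule bij_betw_cong[THEN iffD1, rotated]) simp
  let ?\<theta> = "compose ?D (\<lambda>f\<in>?C. f \<one>) ?s"
  have "?\<theta> \<in> graded_hom R0 (mod_row ?M 0) N"
   by (rule S.R0.compose_hom[OF gr(2) s T.row0_iso(1)])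
  moreover have "bij_betw ?\<theta> ?D (carrier N)"
   by (rule bij_betw_compose[OF sb T.row0_iso(2)])
  ultimately show ?thesis using S.R0.is_isoI[OF gr(2) N] by blast
 qed
 ultimately show ?thesis using I(1) by blast
qed

end

theorem theorem4p10:
  fixes K :: "'k ring"
    and S :: "('k, int \<times> int, 'a) graded_alg"
    and e :: "'a \<Rightarrow> 'm"
  assumes "algebraically_closed K"
    and "\<forall>n::nat. n > 0 \<longrightarrow> [n] \<cdot>\<^bsub>K\<^esub> \<one>\<^bsub>K\<^esub> \<noteq> \<zero>\<^bsub>K\<^esub>"
    and "graded_algebra K S"
    and "densely_bigraded K S"
    and "right_noetherian (deg0_alg S)" and "left_noetherian (deg0_alg S)"
    and "\<forall>i. fin_gen (row S 0) S (\<lambda>s x. s \<otimes>\<^bsub>S\<^esub> x) (row S i)"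
    and "\<forall>i. fin_gen (row S 0) S (\<lambda>s x. x \<otimes>\<^bsub>S\<^esub> s) (row S i)"
    and universe: "inj_on e (carrier S)"
  shows
    "induces_abelian_equivalence
       (mod_cat S (BiGrMod S)) (mod_cat (deg0_alg S) (GrMod (deg0_alg S)))
       (\<lambda>M :: (int \<times> int, 'a, 'm) graded_mod. mod_row M 0) mor_row0
       (quot_cat S (BiGrMod S) (BiLTors K S)) (quot_functor S (BiGrMod S) (BiLTors K S))
       (quot_cat (deg0_alg S) (GrMod (deg0_alg S)) (Tors K (deg0_alg S)))
       (quot_functor (deg0_alg S) (GrMod (deg0_alg S)) (Tors K (deg0_alg S)))
     \<and> induces_abelian_equivalence
       (mod_cat S (lbigrmod S)) (mod_cat (deg0_alg S) (grmod (deg0_alg S)))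
       (\<lambda>M :: (int \<times> int, 'a, 'm) graded_mod. mod_row M 0) mor_row0
       (quot_cat S (lbigrmod S) (lbiltors K S)) (quot_functor S (lbigrmod S) (lbiltors K S))
       (quot_cat (deg0_alg S) (grmod (deg0_alg S)) (tors K (deg0_alg S)))
       (quot_functor (deg0_alg S) (grmod (deg0_alg S)) (tors K (deg0_alg S)))"
proof -
 have "field K" using assms(1) by (simp add: algebraically_closed_def)
 then interpret bigraded_setting K S
  by (intro bigraded_setting.intro bigraded_setting_axioms.intro assms)
 note U = universe_cases[OF assms(2) universe]
 note C = torsion_classes[OF U]
 have row: "graded_module R0 (mod_row M 0)" if "graded_module S M" for M :: "(int \<times> int, 'a, 'm) graded_mod"
  by (rule bigraded_mod.mod_row_graded_module[OF bmodI[OF that]])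
 show ?thesis
 proof (intro conjI row_induces_equivalence C)
  show "mod_row M 0 \<in> GrMod R0" if "M \<in> BiGrMod S" for M :: "(int \<times> int, 'a, 'm) graded_mod"
   using that row by (simp add: GrMod_def)
  show "mod_row M 0 \<in> grmod R0" if "M \<in> lbigrmod S" for M :: "(int \<times> int, 'a, 'm) graded_mod"
   using that row by (simp add: GrMod_def grmod_def lbigrmod_def)
  show "\<exists>M\<in>BiGrMod S. \<exists>\<theta>. is_iso (mod_cat R0 (GrMod R0)) (mod_row M 0) N \<theta>"
   if "N \<in> GrMod R0" for N :: "(int, 'a, 'm) graded_mod"
   using row0_essentially_surjective[OF U universe, of N] that by (auto simp: GrMod_def)
  show "\<exists>M\<in>lbigrmod S. \<exists>\<theta>. is_iso (mod_cat R0 (grmod R0)) (mod_row M 0) N \<theta>"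
   if "N \<in> grmod R0" for N :: "(int, 'a, 'm) graded_mod"
   using row0_essentially_surjective[OF U universe, of N] that by (auto simp: GrMod_def grmod_def lbigrmod_def)
 qed
qed

end
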